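(* The OCHA operad $\mathcal{OC}_\infty$ is non-formal, i.e. it is not connected to its homology operad $H_*(\mathcal{OC}_\infty)$ (with zero differential) by a zig-zag of quasi-isomorphisms of differential graded $2$-colored operads.
   Context: Work over a field $\mathbf k$ of characteristic $0$; dg vector spaces are lower graded with differential of degree $-1$; $(sV)_n=V_{n-1}$; $(V^* )_n=(V_{-n})^*$. Colors are $\mathfrak c$ (closed) and $\mathfrak o$ (open). A $2$-colored operad has components $\mathcal P(n,m;x)$ ($n$ closed inputs, $m$ open inputs, output $x$) with $S_n\times S_m$-action, compositions and units. $\mathcal{SC}$: $\mathcal{SC}(n,0;\mathfrak c)$ is the space of configurations of $n\ge1$ numbered disjoint little disks in the unit disk; $\mathcal{SC}(n,m;\mathfrak c)=\emptyset$ for $m\ge1$; for $n+m\ge1$, $\mathcal{SC}(n,m;\mathfrak o)$ is the space of configurations of $2n+m$ disjoint little disks in the unit disk invariant under complex conjugation, with exactly $m$ numbered (open) disks fixed by conjugation and $n$ conjugate pairs of numbered (closed) disks. Composition is gluing (with the conjugate configuration glued into the conjugate closed disk). $H_0(\mathcal{SC})$ is its degree $0$ homology with coefficients in $\mathbf k$; its algebras are triples $(C,A,f)$ with $C$ commutative associative, $A$ associative (both non-unital), $f:C\to A$ an algebra morphism with central image. $\mathcal{OC}_\infty=\Omega\big((\Lambda H_0(\mathcal{SC}))^*\big)$, where $\Lambda V(k)=s^{1-k}V(k)\otimes\mathrm{sgn}_k$ ($k$ the total number of inputs) and $\Omega(C)$ is the cobar construction, i.e. the free operad on $s^{-1}\overline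 C$ with differential the derivation induced by the cooperad structure of $C$. As a graded operad $\mathcal{OC}_\infty$ is free on corollae $\mathfrak l_n$ ($n\ge2$ closed inputs, closed output, degree $n-2$) and $\mathfrak n_{p,q}$ ($p$ closed and $q$ open inputs, $2p+q\ge2$, open output, degree $p+q-2$), the symmetric groups acting by relabelling and multiplication by the signature. *)

theory Defs
  imports
    "HOL-Analysis.Analysis"
    "HOL-Algebra.Module"
    "HOL-Algebra.AbelCoset"
    "HOL-Combinatorics.Permutations"
    "HOL-Library.Poly_Mapping"
begin

section \<open>Vector spaces\<close>

text \<open>
  Vector spaces over the field \<open>'k\<close> are modules in the sense of HOL-Algebra over
  \<open>field_ring\<close>; the ring fields \<open>mult\<close> and \<open>one\<close> of a module record play no role.
\<close>

definition field_ring :: "'k::field ring" where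
  "field_ring = \<lparr>carrier = UNIV, monoid.mult = (*), one = 1, zero = 0, add = (+)\<rparr>"

definition linear_maps ::
  "('k::field, 'a) module \<Rightarrow> ('k, 'b) module \<Rightarrow> ('a \<Rightarrow> 'b) set" where
  "linear_maps V W = {f \<in> carrier V \<rightarrow> carrier W.
     (\<forall>v\<in>carrier V. \<forall>w\<in>carrier V. f (v \<oplus>\<^bsub>V\<^esub> w) = f v \<oplus>\<^bsub>W\<^esub> f w) \<and>
     (\<forall>c. \<forall>v\<in>carrier V. f (c \<odot>\<^bsub>V\<^esub> v) = c \<odot>\<^bsub>W\<^esub> f v)}"

text \<open>
  The quotient \<open>V/W\<close>, with cosets as elements.  A map \<open>f\<close> into \<open>V\<close> which respects the
  relevant subspaces sends a coset (or a product of cosets) \<open>X\<close> to the coset \<open>W + f(X)\<close>.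
\<close>

definition coset_map ::
  "('k, 'b) module \<Rightarrow> 'b set \<Rightarrow> ('a \<Rightarrow> 'b) \<Rightarrow> 'a set \<Rightarrow> 'b set" where
  "coset_map V W f X = W <+>\<^bsub>V\<^esub> (f ` X)"

definition quotient_module ::
  "('k, 'a) module \<Rightarrow> 'a set \<Rightarrow> ('k, 'a set) module" where
  "quotient_module V W =
    \<lparr>carrier = a_rcosets\<^bsub>V\<^esub> W, monoid.mult = undefined, one = undefined,
     zero = W, add = (\<lambda>X Y. X <+>\<^bsub>V\<^esub> Y),
     smult = (\<lambda>c. coset_map V W (smult V c))\<rparr>"

text \<open>Formal linear combinations.\<close>

definition scal :: "'k::field \<Rightarrow> ('b \<Rightarrow>\<^sub>0 'k) \<Rightarrow> ('b \<Rightarrow>\<^sub>0 'k)" where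
  "scal c f = Poly_Mapping.map ((*) c) f"

abbreviation basis_vec :: "'b \<Rightarrow> ('b \<Rightarrow>\<^sub>0 'k::field)" where
  "basis_vec x \<equiv> Poly_Mapping.single x 1"

definition lin_ext ::
  "('b \<Rightarrow> ('c \<Rightarrow>\<^sub>0 'k::field)) \<Rightarrow> ('b \<Rightarrow>\<^sub>0 'k) \<Rightarrow> ('c \<Rightarrow>\<^sub>0 'k)" where
  "lin_ext g f = (\<Sum>x\<in>Poly_Mapping.keys f. scal (Poly_Mapping.lookup f x) (g x))"

definition bilin_ext ::
  "('b \<Rightarrow> 'c \<Rightarrow> 'd) \<Rightarrow> ('b \<Rightarrow>\<^sub>0 'k::field) \<times> ('c \<Rightarrow>\<^sub>0 'k) \<Rightarrow> ('d \<Rightarrow>\<^sub>0 'k)" where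
  "bilin_ext g = (\<lambda>(f, f'). lin_ext (\<lambda>x. lin_ext (\<lambda>y. basis_vec (g x y)) f') f)"

definition span_of :: "('b \<Rightarrow>\<^sub>0 'k::field) set \<Rightarrow> ('b \<Rightarrow>\<^sub>0 'k) set" where
  "span_of = Modules.module.span scal"

definition free_module :: "'b set \<Rightarrow> ('k::field, 'b \<Rightarrow>\<^sub>0 'k) module" where
  "free_module X =
    \<lparr>carrier = {f. Poly_Mapping.keys f \<subseteq> X}, monoid.mult = undefined, one = undefined,
     zero = 0, add = (+), smult = scal\<rparr>"

definition dual_module :: "('k::field, 'a) module \<Rightarrow> ('k, 'a \<Rightarrow> 'k) module" where
  "dual_module V =
    \<lparr>carrier = {f \<in> extensional (carrier V).
       (\<forall>v\<in>carrier V. \<forall>w\<in>carrier V. f (v \<oplus>\<^bsub>V\<^esub> w) = f v + f w) \<and>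
       (\<forall>c. \<forall>v\<in>carrier V. f (c \<odot>\<^bsub>V\<^esub> v) = c * f v)},
     monoid.mult = undefined, one = undefined,
     zero = (\<lambda>v\<in>carrier V. 0), add = (\<lambda>f g. \<lambda>v\<in>carrier V. f v + g v),
     smult = (\<lambda>c f. \<lambda>v\<in>carrier V. c * f v)\<rparr>"

definition ksign :: "int \<Rightarrow> 'k::field" where
  "ksign n = (if even n then 1 else - 1)"


section \<open>Two-coloured operads\<close>

datatype colour = Closed | Open

type_synonym arity = "colour \<Rightarrow> nat"

text \<open>
  The index \<open>Idx a x d\<close> stands for the degree \<open>d\<close> part of \<open>P(n,m;x)\<close>, where
  \<open>n = a Closed\<close> and \<open>m = a Open\<close>.  The inputs of colour \<open>y\<close> are numbered
  \<open>0, \<dots>, a y - 1\<close>.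
\<close>

datatype idx = Idx (ar: arity) (out: colour) (deg: int)

definition shift :: "int \<Rightarrow> idx \<Rightarrow> idx" where
  "shift n s = Idx (ar s) (out s) (deg s + n)"

definition unit_ar :: "colour \<Rightarrow> arity" where
  "unit_ar x = (\<lambda>y. if y = x then 1 else 0)"

definition unit_idx :: "colour \<Rightarrow> idx" where
  "unit_idx x = Idx (unit_ar x) x 0"

definition comp_ar :: "arity \<Rightarrow> colour \<Rightarrow> arity \<Rightarrow> arity" where
  "comp_ar a x b = (\<lambda>y. a y + b y - (if y = x then 1 else 0))"

definition comp_idx :: "idx \<Rightarrow> idx \<Rightarrow> idx" where
  "comp_idx s t = Idx (comp_ar (ar s) (out t) (ar t)) (out s) (deg s + deg t)"

definition perms :: "arity \<Rightarrow> (colour \<Rightarrow> nat \<Rightarrow> nat) set" where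
  "perms a = {\<sigma>. \<forall>y. \<sigma> y permutes {..<a y}}"

text \<open>
  Numbering of the inputs of a partial composition \<open>p \<circ>\<^sub>i q\<close>, where \<open>q\<close> (of arity
  \<open>b\<close>) is inserted into the \<open>i\<close>-th input of colour \<open>x\<close> of \<open>p\<close> (of arity \<open>a\<close>).
  Among the inputs of colour \<open>x\<close>, those of \<open>q\<close> take the place of the input \<open>i\<close>; among
  the inputs of the other colour, those of \<open>q\<close> come after those of \<open>p\<close>.
  The input \<open>(y,j)\<close> of \<open>p\<close> becomes \<open>(y, lab_out x i b y j)\<close>, the input \<open>(y,j)\<close> of \<open>q\<close>
  becomes \<open>(y, lab_in x i a y j)\<close>.
\<close>

definition lab_out :: "colour \<Rightarrow> nat \<Rightarrow> arity \<Rightarrow> colour \<Rightarrow> nat \<Rightarrow> nat" where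
  "lab_out x i b y j = (if y = x \<and> i < j then j + b y - 1 else j)"

definition lab_in :: "colour \<Rightarrow> nat \<Rightarrow> arity \<Rightarrow> colour \<Rightarrow> nat \<Rightarrow> nat" where
  "lab_in x i a y j = (if y = x then i + j else a y + j)"

text \<open>
  The permutations by which the two sides of the equivariance, sequential and parallel
  associativity axioms differ.  Each of the following predicates says that \<open>\<pi>\<close> takes the
  number of every free input in one composite to its number in the other composite:
  of \<open>p \<circ>\<^sub>i q\<close> and \<open>\<sigma>p \<circ>\<^bsub>\<sigma>i\<^esub> \<tau>q\<close>;
  of \<open>p \<circ>\<^sub>i (q \<circ>\<^sub>j r)\<close> and \<open>(p \<circ>\<^sub>i q) \<circ>\<^bsub>j'\<^esub> r\<close>;
  of \<open>(p \<circ>\<^sub>j r) \<circ>\<^bsub>i'\<^esub> q\<close> and \<open>(p \<circ>\<^sub>i q) \<circ>\<^bsub>j'\<^esub> r\<close>.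
\<close>

definition equivariance_perm ::
  "arity \<Rightarrow> colour \<Rightarrow> nat \<Rightarrow> arity \<Rightarrow> (colour \<Rightarrow> nat \<Rightarrow> nat) \<Rightarrow> (colour \<Rightarrow> nat \<Rightarrow> nat) \<Rightarrow>
   (colour \<Rightarrow> nat \<Rightarrow> nat) \<Rightarrow> bool" where
  "equivariance_perm a x i b \<sigma> \<tau> \<pi> \<longleftrightarrow> \<pi> \<in> perms (comp_ar a x b) \<and>
     (\<forall>y j. j < a y \<longrightarrow> (y, j) \<noteq> (x, i) \<longrightarrow>
        \<pi> y (lab_out x i b y j) = lab_out x (\<sigma> x i) b y (\<sigma> y j)) \<and>
     (\<forall>y j. j < b y \<longrightarrow>
        \<pi> y (lab_in x i a y j) = lab_in x (\<sigma> x i) a y (\<tau> y j))"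

definition sequential_perm ::
  "arity \<Rightarrow> colour \<Rightarrow> nat \<Rightarrow> arity \<Rightarrow> colour \<Rightarrow> nat \<Rightarrow> arity \<Rightarrow>
   (colour \<Rightarrow> nat \<Rightarrow> nat) \<Rightarrow> bool" where
  "sequential_perm a x i b y j c \<pi> \<longleftrightarrow>
    (let ab = comp_ar a x b; bc = comp_ar b y c; j' = lab_in x i a y j in
     \<pi> \<in> perms (comp_ar ab y c) \<and>
     (\<forall>w l. l < a w \<longrightarrow> (w, l) \<noteq> (x, i) \<longrightarrow>
        \<pi> w (lab_out x i bc w l) = lab_out y j' c w (lab_out x i b w l)) \<and>
     (\<forall>w l. l < b w \<longrightarrow> (w, l) \<noteq> (y, j) \<longrightarrow>
        \<pi> w (lab_in x i a w (lab_out y j c w l)) = lab_out y j' c w (lab_in x i a w l)) \<and>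
     (\<forall>w l. l < c w \<longrightarrow>
        \<pi> w (lab_in x i a w (lab_in y j b w l)) = lab_in y j' ab w l))"

definition parallel_perm ::
  "arity \<Rightarrow> colour \<Rightarrow> nat \<Rightarrow> arity \<Rightarrow> colour \<Rightarrow> nat \<Rightarrow> arity \<Rightarrow>
   (colour \<Rightarrow> nat \<Rightarrow> nat) \<Rightarrow> bool" where
  "parallel_perm a x i b y j c \<pi> \<longleftrightarrow>
    (let ab = comp_ar a x b; ac = comp_ar a y c;
         i' = lab_out y j c x i; j' = lab_out x i b y j in
     \<pi> \<in> perms (comp_ar ab y c) \<and>
     (\<forall>w l. l < a w \<longrightarrow> (w, l) \<noteq> (x, i) \<longrightarrow> (w, l) \<noteq> (y, j) \<longrightarrow>
        \<pi> w (lab_out x i' b w (lab_out y j c w l)) = lab_out y j' c w (lab_out x i b w l)) \<and>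
     (\<forall>w l. l < b w \<longrightarrow>
        \<pi> w (lab_in x i' ac w l) = lab_out y j' c w (lab_in x i a w l)) \<and>
     (\<forall>w l. l < c w \<longrightarrow>
        \<pi> w (lab_out x i' b w (lab_in y j a w l)) = lab_in y j' ab w l))"

record ('k, 'a) collection_data =
  component :: "idx \<Rightarrow> ('k, 'a) module"
  act :: "idx \<Rightarrow> (colour \<Rightarrow> nat \<Rightarrow> nat) \<Rightarrow> 'a \<Rightarrow> 'a"

text \<open>
  \<open>pcomp P s i t p q\<close> is the partial composition of \<open>p\<close>, of index \<open>s\<close>, with \<open>q\<close>, of
  index \<open>t\<close>, at the \<open>i\<close>-th input of \<open>p\<close> of colour \<open>out t\<close>.  The group action is a left
  action: \<open>act P s \<sigma>\<close> renumbers the input \<open>(y,j)\<close> as \<open>(y, \<sigma> y j)\<close>.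
\<close>

record ('k, 'a) operad_data = "('k, 'a) collection_data" +
  unit_op :: "colour \<Rightarrow> 'a"
  pcomp :: "idx \<Rightarrow> nat \<Rightarrow> idx \<Rightarrow> 'a \<Rightarrow> 'a \<Rightarrow> 'a"

record ('k, 'a) dg_operad_data = "('k, 'a) operad_data" +
  diff :: "idx \<Rightarrow> 'a \<Rightarrow> 'a"

locale graded_operad =
  fixes P :: "('k::field, 'a, 'z) operad_data_scheme"
  assumes vector_space: "module field_ring (component P s)"
    and act_linear: "\<sigma> \<in> perms (ar s) \<Longrightarrow>
      act P s \<sigma> \<in> linear_maps (component P s) (component P s)"
    and act_id: "p \<in> carrier (component P s) \<Longrightarrow> act P s (\<lambda>y. id) p = p"
    and act_act: "\<sigma> \<in> perms (ar s) \<Longrightarrow> \<tau> \<in> perms (ar s) \<Longrightarrow> p \<in> carrier (component P s) \<Longrightarrow>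
      act P s \<sigma> (act P s \<tau> p) = act P s (\<lambda>y. \<sigma> y \<circ> \<tau> y) p"
    and unit_closed: "unit_op P x \<in> carrier (component P (unit_idx x))"
    and pcomp_linear_left: "i < ar s (out t) \<Longrightarrow> q \<in> carrier (component P t) \<Longrightarrow>
      (\<lambda>p. pcomp P s i t p q) \<in> linear_maps (component P s) (component P (comp_idx s t))"
    and pcomp_linear_right: "i < ar s (out t) \<Longrightarrow> p \<in> carrier (component P s) \<Longrightarrow>
      pcomp P s i t p \<in> linear_maps (component P t) (component P (comp_idx s t))"
    and unit_left: "p \<in> carrier (component P s) \<Longrightarrow>
      pcomp P (unit_idx (out s)) 0 s (unit_op P (out s)) p = p"
    and unit_right: "p \<in> carrier (component P s) \<Longrightarrow> i < ar s x \<Longrightarrow>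
      pcomp P s i (unit_idx x) p (unit_op P x) = p"
    and equivariance: "p \<in> carrier (component P s) \<Longrightarrow> q \<in> carrier (component P t) \<Longrightarrow>
      i < ar s (out t) \<Longrightarrow> \<sigma> \<in> perms (ar s) \<Longrightarrow> \<tau> \<in> perms (ar t) \<Longrightarrow>
      equivariance_perm (ar s) (out t) i (ar t) \<sigma> \<tau> \<pi> \<Longrightarrow>
      pcomp P s (\<sigma> (out t) i) t (act P s \<sigma> p) (act P t \<tau> q) =
      act P (comp_idx s t) \<pi> (pcomp P s i t p q)"
    and sequential_assoc: "p \<in> carrier (component P s) \<Longrightarrow> q \<in> carrier (component P t) \<Longrightarrow>
      r \<in> carrier (component P u) \<Longrightarrow> i < ar s (out t) \<Longrightarrow> j < ar t (out u) \<Longrightarrow>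
      sequential_perm (ar s) (out t) i (ar t) (out u) j (ar u) \<pi> \<Longrightarrow>
      pcomp P (comp_idx s t) (lab_in (out t) i (ar s) (out u) j) u (pcomp P s i t p q) r =
      act P (comp_idx (comp_idx s t) u) \<pi> (pcomp P s i (comp_idx t u) p (pcomp P t j u q r))"
    and parallel_assoc: "p \<in> carrier (component P s) \<Longrightarrow> q \<in> carrier (component P t) \<Longrightarrow>
      r \<in> carrier (component P u) \<Longrightarrow> i < ar s (out t) \<Longrightarrow> j < ar s (out u) \<Longrightarrow>
      (out t, i) \<noteq> (out u, j) \<Longrightarrow>
      parallel_perm (ar s) (out t) i (ar t) (out u) j (ar u) \<pi> \<Longrightarrow>
      pcomp P (comp_idx s t) (lab_out (out t) i (ar t) (out u) j) u (pcomp P s i t p q) r =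
      ksign (deg t * deg u) \<odot>\<^bsub>component P (comp_idx (comp_idx s t) u)\<^esub>
        act P (comp_idx (comp_idx s t) u) \<pi>
          (pcomp P (comp_idx s u) (lab_out (out u) j (ar u) (out t) i) t (pcomp P s j u p r) q)"

locale dg_operad = graded_operad P
  for P :: "('k::field, 'a, 'z) dg_operad_data_scheme" +
  assumes diff_linear:
      "diff P s \<in> linear_maps (component P s) (component P (shift (- 1) s))"
    and diff_diff: "p \<in> carrier (component P s) \<Longrightarrow>
      diff P (shift (- 1) s) (diff P s p) = \<zero>\<^bsub>component P (shift (- 2) s)\<^esub>"
    and diff_act: "\<sigma> \<in> perms (ar s) \<Longrightarrow> p \<in> carrier (component P s) \<Longrightarrow>
      diff P s (act P s \<sigma> p) = act P (shift (- 1) s) \<sigma> (diff P s p)"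
    and diff_unit: "diff P (unit_idx x) (unit_op P x) =
      \<zero>\<^bsub>component P (shift (- 1) (unit_idx x))\<^esub>"
    and leibniz: "p \<in> carrier (component P s) \<Longrightarrow> q \<in> carrier (component P t) \<Longrightarrow>
      i < ar s (out t) \<Longrightarrow>
      diff P (comp_idx s t) (pcomp P s i t p q) =
      pcomp P (shift (- 1) s) i t (diff P s p) q
      \<oplus>\<^bsub>component P (shift (- 1) (comp_idx s t))\<^esub>
      ksign (deg s) \<odot>\<^bsub>component P (shift (- 1) (comp_idx s t))\<^esub>
        pcomp P s i (shift (- 1) t) p (diff P t q)"


section \<open>Homology, quasi-isomorphisms and zig-zags\<close>

definition cycles :: "('k, 'a) dg_operad_data \<Rightarrow> idx \<Rightarrow> ('k, 'a) module" where
  "cycles P s = (component P s)\<lparr>carrier :=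
     {p \<in> carrier (component P s). diff P s p = \<zero>\<^bsub>component P (shift (- 1) s)\<^esub>}\<rparr>"

definition boundaries :: "('k, 'a) dg_operad_data \<Rightarrow> idx \<Rightarrow> 'a set" where
  "boundaries P s = diff P (shift 1 s) ` carrier (component P (shift 1 s))"

definition homology_operad ::
  "('k, 'a) dg_operad_data \<Rightarrow> ('k, 'a set) dg_operad_data" where
  "homology_operad P =
    \<lparr>component = (\<lambda>s. quotient_module (cycles P s) (boundaries P s)),
     act = (\<lambda>s \<sigma>. coset_map (component P s) (boundaries P s) (act P s \<sigma>)),
     unit_op = (\<lambda>x. boundaries P (unit_idx x) +>\<^bsub>component P (unit_idx x)\<^esub> unit_op P x),
     pcomp = (\<lambda>s i t X Y. coset_map (component P (comp_idx s t)) (boundaries P (comp_idx s t))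
       (\<lambda>(p, q). pcomp P s i t p q) (X \<times> Y)),
     diff = (\<lambda>s X. boundaries P (shift (- 1) s))\<rparr>"

definition dg_operad_morphism ::
  "('k::field, 'a) dg_operad_data \<Rightarrow> ('k, 'b) dg_operad_data \<Rightarrow> (idx \<Rightarrow> 'a \<Rightarrow> 'b) \<Rightarrow> bool"
  where
  "dg_operad_morphism P Q f \<longleftrightarrow>
     (\<forall>s. f s \<in> linear_maps (component P s) (component Q s)) \<and>
     (\<forall>s. \<forall>\<sigma>\<in>perms (ar s). \<forall>p\<in>carrier (component P s).
        f s (act P s \<sigma> p) = act Q s \<sigma> (f s p)) \<and>
     (\<forall>x. f (unit_idx x) (unit_op P x) = unit_op Q x) \<and>
     (\<forall>s t i. \<forall>p\<in>carrier (component P s). \<forall>q\<in>carrier (component P t).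
        i < ar s (out t) \<longrightarrow>
        f (comp_idx s t) (pcomp P s i t p q) = pcomp Q s i t (f s p) (f t q)) \<and>
     (\<forall>s. \<forall>p\<in>carrier (component P s).
        f (shift (- 1) s) (diff P s p) = diff Q s (f s p))"

definition quasi_isomorphism ::
  "('k::field, 'a) dg_operad_data \<Rightarrow> ('k, 'b) dg_operad_data \<Rightarrow> (idx \<Rightarrow> 'a \<Rightarrow> 'b) \<Rightarrow> bool"
  where
  "quasi_isomorphism P Q f \<longleftrightarrow> dg_operad_morphism P Q f \<and>
     (\<forall>s. bij_betw (coset_map (component Q s) (boundaries Q s) (f s))
        (carrier (component (homology_operad P) s))
        (carrier (component (homology_operad Q) s)))"

definition quasi_iso_step ::
  "('k::field, 'a) dg_operad_data \<Rightarrow> ('k, 'b) dg_operad_data \<Rightarrow> bool" where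
  "quasi_iso_step P Q \<longleftrightarrow> (\<exists>f. quasi_isomorphism P Q f) \<or> (\<exists>f. quasi_isomorphism Q P f)"

text \<open>
  A zig-zag \<open>P, X\<^sub>1, \<dots>, X\<^sub>r, Q\<close> with \<open>r \<ge> 1\<close>, in which the intermediate dg operads have
  their elements in the type \<open>'x\<close>.  Adding identity morphisms gives \<open>r \<ge> 1\<close>, and any
  finite number of dg operads can be transported to a common type (for instance the sum
  of their types).  Hence, \<open>'x\<close> being arbitrary, a zig-zag exists in the usual sense if and
  only if one exists for some choice of \<open>'x\<close>.
\<close>

definition zigzag ::
  "'x itself \<Rightarrow> ('k::field, 'a) dg_operad_data \<Rightarrow> ('k, 'b) dg_operad_data \<Rightarrow> bool" where
  "zigzag TYPE('x) P Q \<longleftrightarrow>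
    (\<exists>X Y :: ('k, 'x) dg_operad_data.
       dg_operad X \<and> dg_operad Y \<and> quasi_iso_step P X \<and>
       equivclp (\<lambda>X Y. dg_operad X \<and> dg_operad Y \<and> (\<exists>f. quasi_isomorphism X Y f)) X Y \<and>
       quasi_iso_step Y Q)"

definition formal_via :: "'x itself \<Rightarrow> ('k::field, 'a) dg_operad_data \<Rightarrow> bool" where
  "formal_via TYPE('x) P \<longleftrightarrow> zigzag TYPE('x) P (homology_operad P)"


section \<open>The Swiss-cheese operad and its degree 0 homology\<close>

text \<open>
  A little disk is given by its centre and radius.  A configuration is a numbered family of
  disks, indexed by the inputs and equal to \<open>(0, 0)\<close> at all other places.  Disks are open, so
  that the unit disk itself is the identity of each colour.
\<close>

type_synonym config = "colour \<Rightarrow> nat \<Rightarrow> complex \<times> real"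

definition disk :: "complex \<times> real \<Rightarrow> complex set" where
  "disk D = ball (fst D) (snd D)"

definition conj_disk :: "complex \<times> real \<Rightarrow> complex \<times> real" where
  "conj_disk D = (cnj (fst D), snd D)"

definition little_disks :: "arity \<Rightarrow> config set" where
  "little_disks a = {D.
     (\<forall>y j. j < a y \<longrightarrow> snd (D y j) > 0 \<and> disk (D y j) \<subseteq> ball 0 1) \<and>
     (\<forall>y j. \<not> j < a y \<longrightarrow> D y j = (0, 0)) \<and>
     (\<forall>y j y' j'. j < a y \<longrightarrow> j' < a y' \<longrightarrow> (y, j) \<noteq> (y', j') \<longrightarrow>
        disk (D y j) \<inter> disk (D y' j') = {})}"

text \<open>
  For open output, the conjugation invariant family consists of the open disks
  \<open>D Open j\<close>, which are fixed by conjugation, and of the conjugate pairs formed by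
  \<open>D Closed j\<close> and its conjugate.  A pair is represented by its member in the upper half
  plane; this is also the member into which a closed configuration is glued, while the
  conjugate configuration goes into the conjugate disk.
\<close>

fun SC :: "arity \<Rightarrow> colour \<Rightarrow> config set" where
  "SC a Closed = {D \<in> little_disks a. a Closed \<ge> 1 \<and> a Open = 0}"
| "SC a Open = {D \<in> little_disks a. a Closed + a Open \<ge> 1 \<and>
     (\<forall>j<a Open. conj_disk (D Open j) = D Open j) \<and>
     (\<forall>j<a Closed. Im (fst (D Closed j)) > 0) \<and>
     (\<forall>j<a Closed. \<forall>y. \<forall>l<a y.
        disk (conj_disk (D Closed j)) \<inter> disk (D y l) = {})}"

definition SC_unit :: "colour \<Rightarrow> config" where
  "SC_unit x = (\<lambda>y j. if y = x \<and> j = 0 then (0, 1) else (0, 0))"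

definition SC_act :: "(colour \<Rightarrow> nat \<Rightarrow> nat) \<Rightarrow> config \<Rightarrow> config" where
  "SC_act \<sigma> D = (\<lambda>y j. D y (inv_into UNIV (\<sigma> y) j))"

definition rescale :: "complex \<times> real \<Rightarrow> complex \<times> real \<Rightarrow> complex \<times> real" where
  "rescale D E = (fst D + of_real (snd D) * fst E, snd D * snd E)"

definition SC_glue ::
  "arity \<Rightarrow> colour \<Rightarrow> nat \<Rightarrow> arity \<Rightarrow> config \<Rightarrow> config \<Rightarrow> config" where
  "SC_glue a x i b D E = (\<lambda>y l.
     if y = x then
       (if l < i then D y l
        else if l < i + b y then rescale (D x i) (E y (l - i))
        else D y (l + 1 - b y))
     else
       (if l < a y then D y l
        else if l < a y + b y then rescale (D x i) (E y (l - a y))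
        else (0, 0)))"

text \<open>
  Degree 0 singular homology of a space \<open>X\<close> of configurations: the 0-chains modulo the
  boundaries \<open>\<gamma>(1) - \<gamma>(0)\<close> of the singular 1-simplices \<open>\<gamma>\<close>.
\<close>

definition boundaries0 :: "config set \<Rightarrow> (config \<Rightarrow>\<^sub>0 'k::field) set" where
  "boundaries0 X = span_of {basis_vec (pathfinish g) - basis_vec (pathstart g) | g.
     path g \<and> path_image g \<subseteq> X}"

definition SC_points :: "idx \<Rightarrow> config set" where
  "SC_points s = (if deg s = 0 then SC (ar s) (out s) else {})"

definition H0_SC :: "('k::field, (config \<Rightarrow>\<^sub>0 'k) set) operad_data" where
  "H0_SC =
    \<lparr>component = (\<lambda>s. quotient_module (free_module (SC_points s)) (boundaries0 (SC_points s))),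
     act = (\<lambda>s \<sigma>. coset_map (free_module (SC_points s)) (boundaries0 (SC_points s))
       (lin_ext (\<lambda>D. basis_vec (SC_act \<sigma> D)))),
     unit_op = (\<lambda>x. boundaries0 (SC_points (unit_idx x))
       +>\<^bsub>free_module (SC_points (unit_idx x))\<^esub> basis_vec (SC_unit x)),
     pcomp = (\<lambda>s i t X Y. coset_map (free_module (SC_points (comp_idx s t)))
       (boundaries0 (SC_points (comp_idx s t)))
       (bilin_ext (SC_glue (ar s) (out t) i (ar t))) (X \<times> Y))\<rparr>"


section \<open>Operadic suspension and linear dual\<close>

definition total :: "idx \<Rightarrow> int" where
  "total s = int (ar s Closed) + int (ar s Open)"

text \<open>
  The operad structure of \<open>\<Lambda>\<close>: let \<open>e\<^sub>k\<close> be the generator of \<open>s\<^bsup>1-k\<^esup> sgn\<^sub>k\<close>, thought of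
  as the operation taking \<open>k\<close> copies of a degree 1 element to one, so that
  \<open>e\<^sub>k \<circ>\<^sub>i e\<^sub>l = (-1)\<^bsup>i(l-1)\<^esup> e\<^bsub>k+l-1\<^esub>\<close> when \<open>i\<close> inputs precede the one used.  Inputs are
  ordered with the closed ones first.  The further summand in each line of
  \<open>insertion_parity\<close> is the parity of the permutation which separates the colours after
  inserting the inputs of \<open>q\<close>.  The sign \<open>|p| |e\<^sub>l|\<close> in \<open>suspension\<close> comes from
  \<open>(e\<^sub>k \<otimes> p) \<circ>\<^sub>i (e\<^sub>l \<otimes> q)\<close>.
\<close>

fun insertion_parity :: "arity \<Rightarrow> colour \<Rightarrow> nat \<Rightarrow> arity \<Rightarrow> int" where
  "insertion_parity a Closed i b =
     int i * (int (b Closed) + int (b Open) - 1)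
     + int (b Open) * (int (a Closed) - 1 - int i + int (a Open))"
| "insertion_parity a Open i b =
     (int (a Closed) + int i) * (int (b Closed) + int (b Open) - 1)
     + int (b Closed) * int i"

definition susp_idx :: "idx \<Rightarrow> idx" where
  "susp_idx s = shift (total s - 1) s"

definition suspension :: "('k::field, 'a) operad_data \<Rightarrow> ('k, 'a) operad_data" where
  "suspension P =
    \<lparr>component = (\<lambda>s. component P (susp_idx s)),
     act = (\<lambda>s \<sigma> p. of_int (sign (\<sigma> Closed) * sign (\<sigma> Open))
       \<odot>\<^bsub>component P (susp_idx s)\<^esub> act P (susp_idx s) \<sigma> p),
     unit_op = unit_op P,
     pcomp = (\<lambda>s i t p q.
       ksign (insertion_parity (ar s) (out t) i (ar t) + deg (susp_idx s) * (1 - total t))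
       \<odot>\<^bsub>component P (comp_idx (susp_idx s) (susp_idx t))\<^esub>
         pcomp P (susp_idx s) i (susp_idx t) p q)\<rparr>"

text \<open>
  A graded cooperad: \<open>decomp C s i t c\<close> is a representative, as a formal sum of pairs, of the
  component in \<open>C s \<otimes> C t\<close> of the infinitesimal decomposition of \<open>c\<close>, for the
  two-vertex tree in which the vertex with decoration in \<open>C t\<close> sits at the \<open>i\<close>-th input of
  colour \<open>out t\<close> of the other one and inputs are numbered as in \<open>pcomp\<close>.
\<close>

record (overloaded) ('k, 'a) cooperad_data = "('k, 'a) collection_data" +
  decomp :: "idx \<Rightarrow> nat \<Rightarrow> idx \<Rightarrow> 'a \<Rightarrow> ('a \<times> 'a \<Rightarrow>\<^sub>0 'k)"

definition neg_idx :: "idx \<Rightarrow> idx" where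
  "neg_idx s = Idx (ar s) (out s) (- deg s)"

text \<open>
  The dual of an operad with finite-dimensional components.  The decomposition is the
  transpose of the composition, using \<open>(V \<otimes> W)\<^sup>* = V\<^sup>* \<otimes> W\<^sup>*\<close> with
  \<open>(g \<otimes> h)(p \<otimes> q) = (-1)\<^bsup>|h||p|\<^esup> g(p) h(q)\<close>.
\<close>

definition dual_cooperad ::
  "('k::field, 'a) operad_data \<Rightarrow> ('k, 'a \<Rightarrow> 'k) cooperad_data" where
  "dual_cooperad P =
    \<lparr>component = (\<lambda>s. dual_module (component P (neg_idx s))),
     act = (\<lambda>s \<sigma> f. \<lambda>p\<in>carrier (component P (neg_idx s)).
       f (act P (neg_idx s) (\<lambda>y. inv_into UNIV (\<sigma> y)) p)),
     decomp = (\<lambda>s i t f. SOME w.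
       Poly_Mapping.keys w \<subseteq> carrier (dual_module (component P (neg_idx s)))
         \<times> carrier (dual_module (component P (neg_idx t))) \<and>
       (\<forall>p\<in>carrier (component P (neg_idx s)). \<forall>q\<in>carrier (component P (neg_idx t)).
         (\<Sum>(g, h)\<in>Poly_Mapping.keys w.
            Poly_Mapping.lookup w (g, h) * (ksign (deg t * deg s) * g p * h q)) =
         f (pcomp P (neg_idx s) i (neg_idx t) p q)))\<rparr>"


section \<open>Free operads\<close>

text \<open>
  The free graded operad on a collection \<open>E\<close> is constructed as formal linear combinations of
  well-formed expressions in the operad operations, modulo the consequences of the operad
  axioms and of the linear structure and the group action of \<open>E\<close>.
\<close>

datatype 'e expr =
    Id colour
  | Gen idx 'e
  | Act "colour \<Rightarrow> nat \<Rightarrow> nat" "'e expr"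
  | Comp "'e expr" nat "'e expr"

primrec idx_of :: "'e expr \<Rightarrow> idx" where
  "idx_of (Id x) = unit_idx x"
| "idx_of (Gen s e) = s"
| "idx_of (Act \<sigma> t) = idx_of t"
| "idx_of (Comp t i u) = comp_idx (idx_of t) (idx_of u)"

primrec wf_expr :: "('k, 'e, 'z) collection_data_scheme \<Rightarrow> 'e expr \<Rightarrow> bool" where
  "wf_expr E (Id x) \<longleftrightarrow> True"
| "wf_expr E (Gen s e) \<longleftrightarrow> e \<in> carrier (component E s)"
| "wf_expr E (Act \<sigma> t) \<longleftrightarrow> wf_expr E t \<and> \<sigma> \<in> perms (ar (idx_of t))"
| "wf_expr E (Comp t i u) \<longleftrightarrow>
     wf_expr E t \<and> wf_expr E u \<and> i < ar (idx_of t) (out (idx_of u))"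

definition exprs :: "('k, 'e, 'z) collection_data_scheme \<Rightarrow> idx \<Rightarrow> 'e expr set" where
  "exprs E s = {t. wf_expr E t \<and> idx_of t = s}"

inductive relator ::
  "('k::field, 'e, 'z) collection_data_scheme \<Rightarrow> idx \<Rightarrow> ('e expr \<Rightarrow>\<^sub>0 'k) \<Rightarrow> bool"
  for E :: "('k::field, 'e, 'z) collection_data_scheme" where
  gen_add: "e \<in> carrier (component E s) \<Longrightarrow> e' \<in> carrier (component E s) \<Longrightarrow>
    relator E s (basis_vec (Gen s (e \<oplus>\<^bsub>component E s\<^esub> e'))
      - (basis_vec (Gen s e) + basis_vec (Gen s e')))"
| gen_smult: "e \<in> carrier (component E s) \<Longrightarrow>
    relator E s (basis_vec (Gen s (c \<odot>\<^bsub>component E s\<^esub> e)) - scal c (basis_vec (Gen s e)))"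
| gen_act: "e \<in> carrier (component E s) \<Longrightarrow> \<sigma> \<in> perms (ar s) \<Longrightarrow>
    relator E s (basis_vec (Gen s (act E s \<sigma> e)) - basis_vec (Act \<sigma> (Gen s e)))"
| act_id: "t \<in> exprs E s \<Longrightarrow>
    relator E s (basis_vec (Act (\<lambda>y. id) t) - basis_vec t)"
| act_act: "t \<in> exprs E s \<Longrightarrow> \<sigma> \<in> perms (ar s) \<Longrightarrow> \<tau> \<in> perms (ar s) \<Longrightarrow>
    relator E s (basis_vec (Act \<sigma> (Act \<tau> t)) - basis_vec (Act (\<lambda>y. \<sigma> y \<circ> \<tau> y) t))"
| unit_left: "t \<in> exprs E s \<Longrightarrow>
    relator E s (basis_vec (Comp (Id (out s)) 0 t) - basis_vec t)"
| unit_right: "t \<in> exprs E s \<Longrightarrow> i < ar s x \<Longrightarrow>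
    relator E s (basis_vec (Comp t i (Id x)) - basis_vec t)"
| equivariance: "t \<in> exprs E s \<Longrightarrow> u \<in> exprs E s' \<Longrightarrow> i < ar s (out s') \<Longrightarrow>
    \<sigma> \<in> perms (ar s) \<Longrightarrow> \<tau> \<in> perms (ar s') \<Longrightarrow>
    equivariance_perm (ar s) (out s') i (ar s') \<sigma> \<tau> \<pi> \<Longrightarrow>
    relator E (comp_idx s s')
      (basis_vec (Comp (Act \<sigma> t) (\<sigma> (out s') i) (Act \<tau> u)) - basis_vec (Act \<pi> (Comp t i u)))"
| sequential_assoc: "t \<in> exprs E s \<Longrightarrow> u \<in> exprs E s' \<Longrightarrow> v \<in> exprs E s'' \<Longrightarrow>
    i < ar s (out s') \<Longrightarrow> j < ar s' (out s'') \<Longrightarrow>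
    sequential_perm (ar s) (out s') i (ar s') (out s'') j (ar s'') \<pi> \<Longrightarrow>
    relator E (comp_idx (comp_idx s s') s'')
      (basis_vec (Comp (Comp t i u) (lab_in (out s') i (ar s) (out s'') j) v)
       - basis_vec (Act \<pi> (Comp t i (Comp u j v))))"
| parallel_assoc: "t \<in> exprs E s \<Longrightarrow> u \<in> exprs E s' \<Longrightarrow> v \<in> exprs E s'' \<Longrightarrow>
    i < ar s (out s') \<Longrightarrow> j < ar s (out s'') \<Longrightarrow> (out s', i) \<noteq> (out s'', j) \<Longrightarrow>
    parallel_perm (ar s) (out s') i (ar s') (out s'') j (ar s'') \<pi> \<Longrightarrow>
    relator E (comp_idx (comp_idx s s') s'')
      (basis_vec (Comp (Comp t i u) (lab_out (out s') i (ar s') (out s'') j) v)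
       - scal (ksign (deg s' * deg s''))
           (basis_vec (Act \<pi> (Comp (Comp t j v) (lab_out (out s'') j (ar s'') (out s') i) u))))"
| cong_act: "relator E s r \<Longrightarrow> \<sigma> \<in> perms (ar s) \<Longrightarrow>
    relator E s (lin_ext (\<lambda>t. basis_vec (Act \<sigma> t)) r)"
| cong_comp_left: "relator E s r \<Longrightarrow> u \<in> exprs E s' \<Longrightarrow> i < ar s (out s') \<Longrightarrow>
    relator E (comp_idx s s') (lin_ext (\<lambda>t. basis_vec (Comp t i u)) r)"
| cong_comp_right: "t \<in> exprs E s \<Longrightarrow> relator E s' r \<Longrightarrow> i < ar s (out s') \<Longrightarrow>
    relator E (comp_idx s s') (lin_ext (\<lambda>u. basis_vec (Comp t i u)) r)"

definition relations ::
  "('k::field, 'e, 'z) collection_data_scheme \<Rightarrow> idx \<Rightarrow> ('e expr \<Rightarrow>\<^sub>0 'k) set" where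
  "relations E s = span_of {r. relator E s r}"

definition free_operad ::
  "('k::field, 'e) collection_data \<Rightarrow> ('k, ('e expr \<Rightarrow>\<^sub>0 'k) set) operad_data" where
  "free_operad E =
    \<lparr>component = (\<lambda>s. quotient_module (free_module (exprs E s)) (relations E s)),
     act = (\<lambda>s \<sigma>. coset_map (free_module (exprs E s)) (relations E s)
       (lin_ext (\<lambda>t. basis_vec (Act \<sigma> t)))),
     unit_op = (\<lambda>x. relations E (unit_idx x)
       +>\<^bsub>free_module (exprs E (unit_idx x))\<^esub> basis_vec (Id x)),
     pcomp = (\<lambda>s i t X Y. coset_map (free_module (exprs E (comp_idx s t)))
       (relations E (comp_idx s t)) (bilin_ext (\<lambda>p q. Comp p i q)) (X \<times> Y))\<rparr>"


section \<open>The cobar construction\<close>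

text \<open>
  The coaugmentation coideal of a cooperad whose components of identity arity, \<open>C(1,0;c)\<close> and
  \<open>C(0,1;o)\<close>, are spanned by the coaugmentation.
\<close>

definition coaug_coideal ::
  "('k, 'a, 'z) collection_data_scheme \<Rightarrow> ('k, 'a) collection_data" where
  "coaug_coideal C =
    \<lparr>component = (\<lambda>s. if ar s = unit_ar (out s)
       then (component C s)\<lparr>carrier := {\<zero>\<^bsub>component C s\<^esub>}\<rparr> else component C s),
     act = act C\<rparr>"

definition desuspend :: "('k, 'a) collection_data \<Rightarrow> ('k, 'a) collection_data" where
  "desuspend E =
    \<lparr>component = (\<lambda>s. component E (shift 1 s)), act = (\<lambda>s. act E (shift 1 s))\<rparr>"

text \<open>
  Two-vertex trees with inputs numbered by the arity of \<open>u\<close>: \<open>S y\<close> is the set of inputs of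
  colour \<open>y\<close> attached to the upper vertex, of index \<open>t\<close>; the remaining inputs and, as last
  input of its colour, the internal edge are attached to the lower vertex, of index \<open>s\<close>.  Trees
  which contribute only zero because one of the decorations vanishes are left out.
\<close>

definition two_vertex_trees ::
  "('k, 'a, 'z) collection_data_scheme \<Rightarrow> idx \<Rightarrow> ((colour \<Rightarrow> nat set) \<times> idx \<times> idx) set"
  where
  "two_vertex_trees C u = {(S, s, t).
     (\<forall>y. S y \<subseteq> {..<ar u y}) \<and>
     ar t = (\<lambda>y. card (S y)) \<and>
     ar s = (\<lambda>y. ar u y - card (S y) + (if y = out t then 1 else 0)) \<and>
     out s = out u \<and> deg s + deg t = deg u \<and>
     carrier (component (coaug_coideal C) s) \<noteq> {\<zero>\<^bsub>component (coaug_coideal C) s\<^esub>} \<and>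
     carrier (component (coaug_coideal C) t) \<noteq> {\<zero>\<^bsub>component (coaug_coideal C) t\<^esub>}}"

text \<open>
  In the composite of such a tree, the inputs of each colour of the lower vertex come first,
  followed by those of the upper vertex.
\<close>

definition unshuffle :: "arity \<Rightarrow> (colour \<Rightarrow> nat set) \<Rightarrow> colour \<Rightarrow> nat \<Rightarrow> nat" where
  "unshuffle a S y j = (if j < a y
     then (sorted_list_of_set ({..<a y} - S y) @ sorted_list_of_set (S y)) ! j else j)"

text \<open>
  On a generator \<open>s\<^sup>-\<^sup>1 c\<close> the differential is the sum, over all two-vertex trees, of
  \<open>(-1)\<^bsup>|c'|\<^esup> s\<^sup>-\<^sup>1 c' \<circ> s\<^sup>-\<^sup>1 c''\<close>, where \<open>\<Sum> c' \<otimes> c''\<close> is the decomposition of \<open>c\<close>.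
\<close>

definition cobar_gen ::
  "('k::field, 'a) cooperad_data \<Rightarrow> idx \<Rightarrow> 'a \<Rightarrow> ('a expr \<Rightarrow>\<^sub>0 'k)" where
  "cobar_gen C u c = (\<Sum>(S, s, t)\<in>two_vertex_trees C u.
     let \<pi> = unshuffle (ar u) S; i = ar s (out t) - 1 in
     lin_ext (\<lambda>(c', c''). scal (ksign (deg s))
        (basis_vec (Act \<pi> (Comp (Gen (shift (- 1) s) c') i (Gen (shift (- 1) t) c'')))))
       (decomp C s i t (act C u (\<lambda>y. inv_into UNIV (\<pi> y)) c)))"

primrec cobar_diff ::
  "('k::field, 'a) cooperad_data \<Rightarrow> 'a expr \<Rightarrow> ('a expr \<Rightarrow>\<^sub>0 'k)" where
  "cobar_diff C (Id x) = 0"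
| "cobar_diff C (Gen s c) = cobar_gen C (shift 1 s) c"
| "cobar_diff C (Act \<sigma> t) = lin_ext (\<lambda>t'. basis_vec (Act \<sigma> t')) (cobar_diff C t)"
| "cobar_diff C (Comp t i u) =
     lin_ext (\<lambda>t'. basis_vec (Comp t' i u)) (cobar_diff C t)
     + scal (ksign (deg (idx_of t))) (lin_ext (\<lambda>u'. basis_vec (Comp t i u')) (cobar_diff C u))"

definition cobar ::
  "('k::field, 'a) cooperad_data \<Rightarrow> ('k, ('a expr \<Rightarrow>\<^sub>0 'k) set) dg_operad_data" where
  "cobar C =
    (let E = desuspend (coaug_coideal C); F = free_operad E in
     \<lparr>component = component F, act = act F, unit_op = unit_op F, pcomp = pcomp F,
      diff = (\<lambda>s. coset_map (free_module (exprs E (shift (- 1) s)))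
        (relations E (shift (- 1) s)) (lin_ext (cobar_diff C)))\<rparr>)"

definition OC_infinity ::
  "('k::field, (((config \<Rightarrow>\<^sub>0 'k) set \<Rightarrow> 'k) expr \<Rightarrow>\<^sub>0 'k) set) dg_operad_data" where
  "OC_infinity = cobar (dual_cooperad (suspension H0_SC))"

end

theory Submission
  imports Defs
begin

text \<open>
  The obstruction to formality is a Massey product.  Let \<open>\<eta>\<close> be a cycle with one closed input and open output, of
  degree \<open>-1\<close>, and \<open>\<mu>\<close> a cycle of degree \<open>0\<close> with two open inputs, and let \<open>h\<close> bound \<open>\<mu>(\<eta>(c), a) - \<mu>(a, \<eta>(c))\<close>.
  Then the alternation of \<open>h \<circ> \<eta>\<close> in its two closed inputs is a cycle.  The existence of such a triple for which
  this cycle is not a boundary is invariant under quasi-isomorphisms.  It holds in the OCHA operad with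
  \<open>\<eta> = n\<^bsub>1,0\<^esub>\<close>, \<open>\<mu> = n\<^bsub>0,2\<^esub>\<close>, \<open>h = - n\<^bsub>1,1\<^esub>\<close>: the only boundaries of this arity and degree are the multiples of
  \<open>d n\<^bsub>2,0\<^esub>\<close>, in which the composite of \<open>\<eta>\<close> with \<open>l\<^sub>2\<close> occurs as well.  It fails in the homology operad, because the
  differential is injective on the multiples of \<open>n\<^bsub>1,1\<^esub>\<close>, so that \<open>h\<close> has to be \<open>0\<close> there.

  The argument involves only operations with at most two inputs, but the cobar differential is well formed only if the
  spaces of configurations have finitely many components in all arities.  A configuration can be deformed until its
  disks are separated by their real parts, and the configurations with a given order of the real parts form a convex set.
\<close>

section \<open>Vector spaces and their quotients\<close>

text \<open>Only the intermediate objects of a zig-zag are known to be dg operads; for the cobar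
  construction and its homology the axioms are checked nowhere. The two ends of a zig-zag are
  therefore treated separately, in both directions of the arrow, from a short list of facts in the
  arities (1,0), (0,2), (1,1) and (2,0). To compute there, expressions are evaluated in an explicit
  model with fifteen basis trees. Evaluation kills every relator because the model satisfies the
  operad axioms; rewriting to normal form shows that in low arity it kills nothing else.
  Well-definedness of the differential and the vanishing of its square are then read off from the
  model. A bound on the arity of an expression does not bound the arities of the generators in it:
  the zero vectors of the components of arity 0 are generators too, and grafting them onto a
  generator of large arity lowers the number of inputs. This is why the dual cooperad has to be
  controlled in every arity.\<close>

lemma cring_field_ring: "cring (field_ring :: 'k::field ring)"
  by (unfold_locales) (auto simp: field_ring_def algebra_simps Units_def intro: exI[of _ "- x" for x])

lemma field_ring_simps [simp]:
  "carrier field_ring = UNIV" "x \<otimes>\<^bsub>field_ring\<^esub> y = x * y" "\<one>\<^bsub>field_ring\<^esub> = 1"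
  "\<zero>\<^bsub>field_ring\<^esub> = 0" "x \<oplus>\<^bsub>field_ring\<^esub> y = x + y"
  by (auto simp: field_ring_def)

lemma field_ring_minus [simp]: "\<ominus>\<^bsub>field_ring\<^esub> (x :: 'k::field) = - x"
proof -
  interpret cring "field_ring :: 'k ring" by (rule cring_field_ring)
  show ?thesis by (rule minus_equality) auto
qed

abbreviation vs :: "('k::field, 'a, 'z) module_scheme \<Rightarrow> bool" where
  "vs V \<equiv> module field_ring V"

lemma vs_abelian_group: "vs V \<Longrightarrow> abelian_group V"
  by (rule module.axioms(2))

lemma linear_mapsI:
  assumes "\<And>v. v \<in> carrier V \<Longrightarrow> f v \<in> carrier W"
    and "\<And>v w. v \<in> carrier V \<Longrightarrow> w \<in> carrier V \<Longrightarrow> f (v \<oplus>\<^bsub>V\<^esub> w) = f v \<oplus>\<^bsub>W\<^esub> f w"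
    and "\<And>c v. v \<in> carrier V \<Longrightarrow> f (c \<odot>\<^bsub>V\<^esub> v) = c \<odot>\<^bsub>W\<^esub> f v"
  shows "f \<in> linear_maps V W"
  using assms by (auto simp: linear_maps_def)

lemma linear_mapsD:
  assumes "f \<in> linear_maps V W"
  shows linear_maps_closed: "v \<in> carrier V \<Longrightarrow> f v \<in> carrier W"
    and linear_maps_add: "v \<in> carrier V \<Longrightarrow> w \<in> carrier V \<Longrightarrow> f (v \<oplus>\<^bsub>V\<^esub> w) = f v \<oplus>\<^bsub>W\<^esub> f w"
    and linear_maps_smult: "v \<in> carrier V \<Longrightarrow> f (c \<odot>\<^bsub>V\<^esub> v) = c \<odot>\<^bsub>W\<^esub> f v"
  using assms by (auto simp: linear_maps_def)

context
  fixes V W f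
  assumes V: "vs V" and W: "vs W" and f: "f \<in> linear_maps V W"
begin

interpretation V: module field_ring V by (rule V)
interpretation W: module field_ring W by (rule W)

lemma linear_maps_zero: "f \<zero>\<^bsub>V\<^esub> = \<zero>\<^bsub>W\<^esub>"
  using linear_maps_smult[OF f, of "\<zero>\<^bsub>V\<^esub>" 0] linear_maps_closed[OF f, of "\<zero>\<^bsub>V\<^esub>"]
    V.smult_l_null[of "\<zero>\<^bsub>V\<^esub>"] W.smult_l_null[of "f \<zero>\<^bsub>V\<^esub>"] by simp

lemma linear_maps_uminus: "v \<in> carrier V \<Longrightarrow> f (\<ominus>\<^bsub>V\<^esub> v) = \<ominus>\<^bsub>W\<^esub> f v"
  using linear_maps_smult[OF f, of v "-1"] linear_maps_closed[OF f, of v]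
    V.smult_l_minus[of 1 v] W.smult_l_minus[of 1 "f v"] V.smult_one[of v] W.smult_one[of "f v"]
  by simp

lemma linear_maps_minus:
  "v \<in> carrier V \<Longrightarrow> w \<in> carrier V \<Longrightarrow> f (v \<ominus>\<^bsub>V\<^esub> w) = f v \<ominus>\<^bsub>W\<^esub> f w"
  by (simp add: a_minus_def linear_maps_add[OF f] linear_maps_uminus)

end

lemma a_r_coset_alt: "H +>\<^bsub>G\<^esub> a = (\<lambda>h. h \<oplus>\<^bsub>G\<^esub> a) ` H"
  by (auto simp: a_r_coset_def r_coset_def)

lemma set_add_alt: "H <+>\<^bsub>G\<^esub> K = {h \<oplus>\<^bsub>G\<^esub> k | h k. h \<in> H \<and> k \<in> K}"
  by (auto simp: set_add_defs)

lemma a_rcosets_alt: "a_rcosets\<^bsub>G\<^esub> H = (\<lambda>a. H +>\<^bsub>G\<^esub> a) ` carrier G"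
  by (auto simp: A_RCOSETS_defs a_r_coset_defs)

definition subspace_of :: "'a set \<Rightarrow> ('k::field, 'a, 'z) module_scheme \<Rightarrow> bool" where
  "subspace_of W V \<longleftrightarrow> W \<subseteq> carrier V \<and> \<zero>\<^bsub>V\<^esub> \<in> W \<and> (\<forall>v\<in>W. \<forall>w\<in>W. v \<oplus>\<^bsub>V\<^esub> w \<in> W) \<and>
     (\<forall>c. \<forall>v\<in>W. c \<odot>\<^bsub>V\<^esub> v \<in> W)"

lemma subspace_ofD:
  assumes "subspace_of W V"
  shows "w \<in> W \<Longrightarrow> w \<in> carrier V" "\<zero>\<^bsub>V\<^esub> \<in> W" "v \<in> W \<Longrightarrow> w \<in> W \<Longrightarrow> v \<oplus>\<^bsub>V\<^esub> w \<in> W"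
    "w \<in> W \<Longrightarrow> c \<odot>\<^bsub>V\<^esub> w \<in> W"
  using assms by (auto simp: subspace_of_def)

text \<open>The scalars fill their whole type, so the membership conditions on scalars disappear
  from the module rules.\<close>

locale vspace =
  fixes V :: "('k::field, 'a) module"
  assumes V: "vs V"
begin

sublocale module field_ring V by (rule V)

lemma smult_simps [simp]:
  "v \<in> carrier V \<Longrightarrow> 1 \<odot>\<^bsub>V\<^esub> v = v" "v \<in> carrier V \<Longrightarrow> c \<odot>\<^bsub>V\<^esub> v \<in> carrier V"
  "v \<in> carrier V \<Longrightarrow> 0 \<odot>\<^bsub>V\<^esub> v = \<zero>\<^bsub>V\<^esub>"
  using smult_one[of v] smult_closed[of c v] smult_l_null[of v] by auto

lemma smult_add_left: "v \<in> carrier V \<Longrightarrow> (a + b) \<odot>\<^bsub>V\<^esub> v = a \<odot>\<^bsub>V\<^esub> v \<oplus>\<^bsub>V\<^esub> b \<odot>\<^bsub>V\<^esub> v"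
  and smult_add_right: "v \<in> carrier V \<Longrightarrow> w \<in> carrier V \<Longrightarrow>
    a \<odot>\<^bsub>V\<^esub> (v \<oplus>\<^bsub>V\<^esub> w) = a \<odot>\<^bsub>V\<^esub> v \<oplus>\<^bsub>V\<^esub> a \<odot>\<^bsub>V\<^esub> w"
  and smult_smult: "v \<in> carrier V \<Longrightarrow> a \<odot>\<^bsub>V\<^esub> (b \<odot>\<^bsub>V\<^esub> v) = (a * b) \<odot>\<^bsub>V\<^esub> v"
  using smult_l_distr[of a b v] smult_r_distr[of a v w] smult_assoc1[of a b v] by auto

lemma smult_minus_right:
  "v \<in> carrier V \<Longrightarrow> w \<in> carrier V \<Longrightarrow> a \<odot>\<^bsub>V\<^esub> (v \<ominus>\<^bsub>V\<^esub> w) = a \<odot>\<^bsub>V\<^esub> v \<ominus>\<^bsub>V\<^esub> a \<odot>\<^bsub>V\<^esub> w"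
  using smult_r_minus[of a w] by (simp add: a_minus_def smult_add_right)

lemma smult_minus_one: "v \<in> carrier V \<Longrightarrow> (- 1) \<odot>\<^bsub>V\<^esub> v = \<ominus>\<^bsub>V\<^esub> v"
  using smult_l_minus[of 1 v] by simp

lemma smult_zero_right [simp]: "a \<odot>\<^bsub>V\<^esub> \<zero>\<^bsub>V\<^esub> = \<zero>\<^bsub>V\<^esub>"
  using smult_r_null[of a] by simp

end

locale quotient_space = vspace V for V :: "('k::field, 'a) module" +
  fixes W
  assumes W: "subspace_of W V"
begin

abbreviation cl where "cl v \<equiv> W +>\<^bsub>V\<^esub> v"

lemma W_uminus: "w \<in> W \<Longrightarrow> \<ominus>\<^bsub>V\<^esub> w \<in> W"
  using subspace_ofD(1)[OF W, of w] subspace_ofD(4)[OF W, of w "- 1"] smult_l_minus[of 1 w] by simp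

lemma mem_cl_iff: "v \<in> carrier V \<Longrightarrow> u \<in> cl v \<longleftrightarrow> u \<in> carrier V \<and> u \<ominus>\<^bsub>V\<^esub> v \<in> W"
proof
  assume v: "v \<in> carrier V" and "u \<in> cl v"
  then obtain w where w: "w \<in> W" "u = w \<oplus>\<^bsub>V\<^esub> v" by (auto simp: a_r_coset_alt)
  moreover have "w \<oplus>\<^bsub>V\<^esub> v \<ominus>\<^bsub>V\<^esub> v = w"
    using v subspace_ofD(1)[OF W w(1)] by (simp add: a_minus_def a_assoc r_neg)
  ultimately show "u \<in> carrier V \<and> u \<ominus>\<^bsub>V\<^esub> v \<in> W" using v subspace_ofD(1)[OF W] by auto
next
  assume v: "v \<in> carrier V" and u: "u \<in> carrier V \<and> u \<ominus>\<^bsub>V\<^esub> v \<in> W"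
  then have "(u \<ominus>\<^bsub>V\<^esub> v) \<oplus>\<^bsub>V\<^esub> v = u" by (simp add: a_minus_def a_assoc l_neg)
  then show "u \<in> cl v" using u by (force simp: a_r_coset_alt)
qed

lemma cl_eq_iff: 
  assumes u: "u \<in> carrier V" and v: "v \<in> carrier V" 
  shows "cl u = cl v \<longleftrightarrow> u \<ominus>\<^bsub>V\<^esub> v \<in> W"
proof
  assume "cl u = cl v"
  moreover have "u \<in> cl u" using mem_cl_iff[OF u] u subspace_ofD(2)[OF W] by (simp add: a_minus_def r_neg)
  ultimately show "u \<ominus>\<^bsub>V\<^esub> v \<in> W" using mem_cl_iff[OF v] by blast
next
  assume w: "u \<ominus>\<^bsub>V\<^esub> v \<in> W"
  have sym: "\<ominus>\<^bsub>V\<^esub> (u \<ominus>\<^bsub>V\<^esub> v) = v \<ominus>\<^bsub>V\<^esub> u"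
    using u v by (simp add: a_minus_def minus_add a_comm)
  have eq: "(x \<ominus>\<^bsub>V\<^esub> u) \<oplus>\<^bsub>V\<^esub> (u \<ominus>\<^bsub>V\<^esub> v) = x \<ominus>\<^bsub>V\<^esub> v" 
           "(x \<ominus>\<^bsub>V\<^esub> v) \<oplus>\<^bsub>V\<^esub> \<ominus>\<^bsub>V\<^esub> (u \<ominus>\<^bsub>V\<^esub> v) = x \<ominus>\<^bsub>V\<^esub> u" if "x \<in> carrier V" for x
    using u v that unfolding sym by (simp_all add: a_minus_def a_assoc r_neg2 r_neg1)
  show "cl u = cl v"
    using mem_cl_iff[OF u] mem_cl_iff[OF v] eq subspace_ofD(3)[OF W _ w]
      subspace_ofD(3)[OF W _ W_uminus[OF w]] by (metis subsetI subset_antisym)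
qed

lemma cl_eq_zero_iff: 
  assumes u: "u \<in> carrier V"
  shows "cl u = cl \<zero>\<^bsub>V\<^esub> \<longleftrightarrow> u \<in> W"
proof -
  have "\<ominus>\<^bsub>V\<^esub> \<zero>\<^bsub>V\<^esub> = \<zero>\<^bsub>V\<^esub>" by (rule minus_equality) auto
  then have "u \<ominus>\<^bsub>V\<^esub> \<zero>\<^bsub>V\<^esub> = u" by (simp only: a_minus_def r_zero[OF u])
  then show ?thesis using cl_eq_iff[OF u zero_closed] by simp
qed

lemma cl_I: "w \<in> W \<Longrightarrow> u = w \<oplus>\<^bsub>V\<^esub> v \<Longrightarrow> u \<in> cl v"
  by (auto simp: a_r_coset_alt)

lemma cl_E: 
  assumes "u \<in> cl v" obtains w where "w \<in> W" "u = w \<oplus>\<^bsub>V\<^esub> v"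
  using assms by (auto simp: a_r_coset_alt)

lemma cl_add: 
  assumes u: "u \<in> carrier V" and v: "v \<in> carrier V" 
  shows "cl u <+>\<^bsub>V\<^esub> cl v = cl (u \<oplus>\<^bsub>V\<^esub> v)"
proof (intro equalityI subsetI)
  fix x assume "x \<in> cl u <+>\<^bsub>V\<^esub> cl v"
  then obtain y z where y: "y \<in> cl u" and z: "z \<in> cl v" and x: "x = y \<oplus>\<^bsub>V\<^esub> z"
    unfolding set_add_alt by blast
  obtain w where w: "w \<in> W" "y = w \<oplus>\<^bsub>V\<^esub> u" using y by (rule cl_E)
  obtain w' where w': "w' \<in> W" "z = w' \<oplus>\<^bsub>V\<^esub> v" using z by (rule cl_E)
  have "x = (w \<oplus>\<^bsub>V\<^esub> w') \<oplus>\<^bsub>V\<^esub> (u \<oplus>\<^bsub>V\<^esub> v)" 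
    using w w' u v subspace_ofD(1)[OF W] unfolding x by (simp add: a_ac)
  with subspace_ofD(3)[OF W w(1) w'(1)] show "x \<in> cl (u \<oplus>\<^bsub>V\<^esub> v)" by (rule cl_I)
next
  fix x assume "x \<in> cl (u \<oplus>\<^bsub>V\<^esub> v)"
  then obtain w where w: "w \<in> W" "x = w \<oplus>\<^bsub>V\<^esub> (u \<oplus>\<^bsub>V\<^esub> v)" by (rule cl_E)
  have "x = (w \<oplus>\<^bsub>V\<^esub> u) \<oplus>\<^bsub>V\<^esub> (\<zero>\<^bsub>V\<^esub> \<oplus>\<^bsub>V\<^esub> v)"
    using w u v subspace_ofD(1)[OF W] by (simp add: a_ac)
  moreover have "w \<oplus>\<^bsub>V\<^esub> u \<in> cl u" "\<zero>\<^bsub>V\<^esub> \<oplus>\<^bsub>V\<^esub> v \<in> cl v" 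
    using cl_I[OF w(1) refl] cl_I[OF subspace_ofD(2)[OF W] refl] by auto
  ultimately show "x \<in> cl u <+>\<^bsub>V\<^esub> cl v" unfolding set_add_alt by blast
qed

text \<open>\<open>coset_map\<close> adds \<open>W\<close> to the image of the whole coset; since
  \<open>f\<close> takes \<open>W'\<close> into \<open>W\<close>, representatives other than
  \<open>u\<close> contribute nothing new.\<close>

lemma coset_map_cl:
  assumes U: "module field_ring U" "subspace_of W' U" and f: "f \<in> linear_maps U V" "f ` W' \<subseteq> W"
    and u: "u \<in> carrier U"
  shows "coset_map V W f (W' +>\<^bsub>U\<^esub> u) = cl (f u)"
proof -
  have fu: "f u \<in> carrier V" using linear_maps_closed[OF f(1) u] .
  interpret U: module field_ring U by (rule U)
  show ?thesis
  proof (intro equalityI subsetI)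
    fix x assume "x \<in> coset_map V W f (W' +>\<^bsub>U\<^esub> u)"
    then obtain w w' where w: "w \<in> W" "w' \<in> W'" and x: "x = w \<oplus>\<^bsub>V\<^esub> f (w' \<oplus>\<^bsub>U\<^esub> u)" 
      unfolding coset_map_def set_add_alt a_r_coset_alt by blast
    have w': "f w' \<in> W" "w' \<in> carrier U" using w f U subspace_ofD(1)[OF U(2)] by auto
    then have "x = (w \<oplus>\<^bsub>V\<^esub> f w') \<oplus>\<^bsub>V\<^esub> f u"
      using w u fu subspace_ofD(1)[OF W] by (simp add: x linear_maps_add[OF f(1)] a_ac)
    with subspace_ofD(3)[OF W w(1) w'(1)] show "x \<in> cl (f u)" by (rule cl_I)
  next
    fix x assume "x \<in> cl (f u)"
    then obtain w where w: "w \<in> W" "x = w \<oplus>\<^bsub>V\<^esub> f u" by (rule cl_E)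
    then have "x = w \<oplus>\<^bsub>V\<^esub> f (\<zero>\<^bsub>U\<^esub> \<oplus>\<^bsub>U\<^esub> u)" using u by simp
    with w(1) subspace_ofD(2)[OF U(2)] show "x \<in> coset_map V W f (W' +>\<^bsub>U\<^esub> u)" 
      unfolding coset_map_def set_add_alt a_r_coset_alt by blast
  qed
qed

lemma smult_linear: "smult V c \<in> linear_maps V V"
  by (rule linear_mapsI) (auto simp: smult_add_right smult_smult mult.commute)

lemma carrier_quotient: "carrier (quotient_module V W) = cl ` carrier V"
  by (simp add: quotient_module_def a_rcosets_alt)

lemma zero_quotient: "\<zero>\<^bsub>quotient_module V W\<^esub> = cl \<zero>\<^bsub>V\<^esub>"
  using subspace_ofD(1)[OF W] by (auto simp: quotient_module_def a_r_coset_alt)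

lemma add_quotient:
  "u \<in> carrier V \<Longrightarrow> v \<in> carrier V \<Longrightarrow> cl u \<oplus>\<^bsub>quotient_module V W\<^esub> cl v = cl (u \<oplus>\<^bsub>V\<^esub> v)"
  by (simp add: quotient_module_def cl_add)

lemma smult_quotient:
  "v \<in> carrier V \<Longrightarrow> c \<odot>\<^bsub>quotient_module V W\<^esub> cl v = cl (c \<odot>\<^bsub>V\<^esub> v)"
  using coset_map_cl[OF V W smult_linear, of c v] subspace_ofD(4)[OF W]
  by (auto simp: quotient_module_def)

lemma vs_quotient: "vs (quotient_module V W)"
proof (rule moduleI)
  show "cring (field_ring :: 'k ring)" by (rule cring_field_ring)
  show "abelian_group (quotient_module V W)"
  proof (rule abelian_groupI)
    fix x assume "x \<in> carrier (quotient_module V W)"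
    then obtain v where "v \<in> carrier V" "x = cl v" by (auto simp: carrier_quotient)
    then have "cl (\<ominus>\<^bsub>V\<^esub> v) \<in> carrier (quotient_module V W)"
      "cl (\<ominus>\<^bsub>V\<^esub> v) \<oplus>\<^bsub>quotient_module V W\<^esub> x = \<zero>\<^bsub>quotient_module V W\<^esub>"
      by (auto simp: carrier_quotient add_quotient zero_quotient l_neg)
    then show "\<exists>y\<in>carrier (quotient_module V W). y \<oplus>\<^bsub>quotient_module V W\<^esub> x = \<zero>\<^bsub>quotient_module V W\<^esub>"
      by blast
  qed (auto simp: carrier_quotient add_quotient zero_quotient a_ac)
qed (auto simp: carrier_quotient add_quotient zero_quotient smult_quotient smult_add_left smult_add_right smult_smult)

end

section \<open>Quasi-isomorphisms\<close>

lemma shift_simps [simp]: "shift 0 s = s" "shift m (shift n s) = shift (n + m) s"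
  "ar (shift n s) = ar s" "out (shift n s) = out s" "deg (shift n s) = deg s + n"
  by (auto simp: shift_def)

text \<open>Just enough of the dg axioms to speak of homology at one index. It can be verified in
  low arity for objects that are not known to be dg operads.\<close>

definition complex_at :: "('k::field, 'a) dg_operad_data \<Rightarrow> idx \<Rightarrow> bool" where
  "complex_at P s \<longleftrightarrow> (\<forall>n. vs (component P (shift n s))) \<and>
     diff P (shift 1 s) \<in> linear_maps (component P (shift 1 s)) (component P s) \<and>
     diff P s \<in> linear_maps (component P s) (component P (shift (- 1) s)) \<and>
     (\<forall>p\<in>carrier (component P (shift 1 s)). diff P s (diff P (shift 1 s) p) = \<zero>\<^bsub>component P (shift (- 1) s)\<^esub>)"

lemma complex_atD:
  assumes "complex_at P s"
  shows "vs (component P (shift n s))" "vs (component P s)"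
    "diff P (shift 1 s) \<in> linear_maps (component P (shift 1 s)) (component P s)"
    "diff P s \<in> linear_maps (component P s) (component P (shift (- 1) s))"
    "p \<in> carrier (component P (shift 1 s)) \<Longrightarrow> diff P s (diff P (shift 1 s) p) = \<zero>\<^bsub>component P (shift (- 1) s)\<^esub>"
  using assms unfolding complex_at_def by (auto dest: spec[of _ 0])

definition cycle :: "('k::field, 'a) dg_operad_data \<Rightarrow> idx \<Rightarrow> 'a \<Rightarrow> bool" where
  "cycle P s p \<longleftrightarrow> p \<in> carrier (component P s) \<and> diff P s p = \<zero>\<^bsub>component P (shift (- 1) s)\<^esub>"

lemma vs_cycles:
  assumes "complex_at P s"
  shows "vs (cycles P s)"
proof -
  interpret C: module field_ring "component P s" using complex_atD(2)[OF assms] .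
  interpret D: module field_ring "component P (shift (- 1) s)" using complex_atD(1)[OF assms] .
  note l = complex_atD(4)[OF assms]
  have Ccl: "c \<odot>\<^bsub>component P s\<^esub> v \<in> carrier (component P s)" if "v \<in> carrier (component P s)" for c v
    using C.smult_closed[of c v] that by simp
  show ?thesis unfolding cycles_def
  proof (intro moduleI cring_field_ring abelian_groupI)
    fix x assume x: "x \<in> carrier (component P s\<lparr>carrier := {p \<in> carrier (component P s). diff P s p = \<zero>\<^bsub>component P (shift (- 1) s)\<^esub>}\<rparr>)"
    then have "\<ominus>\<^bsub>component P s\<^esub> x \<in> carrier (component P s)"
      "diff P s (\<ominus>\<^bsub>component P s\<^esub> x) = \<zero>\<^bsub>component P (shift (- 1) s)\<^esub>"
      using linear_maps_uminus[OF complex_atD(2)[OF assms] complex_atD(1)[OF assms] l, of x] by auto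
    then show "\<exists>y\<in>carrier (component P s\<lparr>carrier := {p \<in> carrier (component P s). diff P s p = \<zero>\<^bsub>component P (shift (- 1) s)\<^esub>}\<rparr>).
      y \<oplus>\<^bsub>component P s\<lparr>carrier := {p \<in> carrier (component P s). diff P s p = \<zero>\<^bsub>component P (shift (- 1) s)\<^esub>}\<rparr>\<^esub> x =
      \<zero>\<^bsub>component P s\<lparr>carrier := {p \<in> carrier (component P s). diff P s p = \<zero>\<^bsub>component P (shift (- 1) s)\<^esub>}\<rparr>\<^esub>"
      using x C.l_neg by auto
  qed (use C.smult_l_distr C.smult_r_distr C.smult_assoc1 C.smult_one D.smult_r_null in \<open>auto simp: C.a_ac linear_maps_add[OF l] linear_maps_smult[OF l] Ccl
     linear_maps_zero[OF complex_atD(2)[OF assms] complex_atD(1)[OF assms] l]\<close>)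
qed

text \<open>Both ambient spaces occur: homology is defined as a quotient of the cycles, while
  classes are compared as cosets in the whole component.\<close>

lemma boundaries_subspace:
  assumes "complex_at P s"
  shows "subspace_of (boundaries P s) (component P s)" "subspace_of (boundaries P s) (cycles P s)"
proof -
  note l = complex_atD(3)[OF assms]
  interpret C: module field_ring "component P (shift 1 s)" using complex_atD(1)[OF assms] .
  have z: "\<zero>\<^bsub>component P s\<^esub> \<in> diff P (shift 1 s) ` carrier (component P (shift 1 s))"
    using linear_maps_zero[OF complex_atD(1)[OF assms] complex_atD(2)[OF assms] l] C.zero_closed by (metis image_eqI)
  have sm: "c \<odot>\<^bsub>component P (shift 1 s)\<^esub> p \<in> carrier (component P (shift 1 s))"
    if "p \<in> carrier (component P (shift 1 s))" for c p
    using that C.smult_closed[of c p] by simp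
  have 1: "diff P (shift 1 s) v \<oplus>\<^bsub>component P s\<^esub> diff P (shift 1 s) w \<in> diff P (shift 1 s) ` carrier (component P (shift 1 s))"
    if "v \<in> carrier (component P (shift 1 s))" "w \<in> carrier (component P (shift 1 s))" for v w
    using linear_maps_add[OF l that] that by (metis C.add.m_closed image_eqI)
  have 2: "c \<odot>\<^bsub>component P s\<^esub> diff P (shift 1 s) v \<in> diff P (shift 1 s) ` carrier (component P (shift 1 s))"
    if "v \<in> carrier (component P (shift 1 s))" for v c
    using linear_maps_smult[OF l that] that sm by (metis image_eqI)
  show "subspace_of (boundaries P s) (component P s)" "subspace_of (boundaries P s) (cycles P s)"
    using z 1 2 complex_atD(5)[OF assms] linear_maps_closed[OF l]
    by (auto simp: subspace_of_def boundaries_def cycles_def)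
qed

lemma boundariesE:
  assumes "b \<in> boundaries P s"
  obtains c where "c \<in> carrier (component P (shift 1 s))" "b = diff P (shift 1 s) c"
  using assms by (auto simp: boundaries_def)

abbreviation (input) hcls where "hcls P s p \<equiv> boundaries P s +>\<^bsub>component P s\<^esub> p"

text \<open>Cycles carry the addition of the component, so cosets formed in either of them
  coincide.\<close>

lemma carrier_homology:
  "carrier (component (homology_operad P) s) = {hcls P s p | p. cycle P s p}"
  by (auto simp: homology_operad_def quotient_module_def a_rcosets_alt cycles_def cycle_def a_r_coset_alt)

locale quasi_iso_at =
  fixes P :: "('k::field, 'a) dg_operad_data" and Q :: "('k, 'b) dg_operad_data" and f s
  assumes qi: "quasi_isomorphism P Q f" and P: "complex_at P s" and Q: "complex_at Q s"
begin

lemma dg_morphism: "dg_operad_morphism P Q f"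
  using qi by (simp add: quasi_isomorphism_def)

lemma linear: "f t \<in> linear_maps (component P t) (component Q t)"
  using dg_morphism by (simp add: dg_operad_morphism_def)

lemma f_diff: "p \<in> carrier (component P t) \<Longrightarrow> f (shift (- 1) t) (diff P t p) = diff Q t (f t p)"
  using dg_morphism by (simp add: dg_operad_morphism_def)

lemma f_diff': "p \<in> carrier (component P (shift 1 s)) \<Longrightarrow> f s (diff P (shift 1 s) p) = diff Q (shift 1 s) (f (shift 1 s) p)"
  using f_diff[of p "shift 1 s"] by simp

sublocale BP: quotient_space "component P s" "boundaries P s"
  by (rule quotient_space.intro[OF vspace.intro quotient_space_axioms.intro, OF complex_atD(2)[OF P] boundaries_subspace(1)[OF P]])

sublocale BQ: quotient_space "component Q s" "boundaries Q s"
  by (rule quotient_space.intro[OF vspace.intro quotient_space_axioms.intro, OF complex_atD(2)[OF Q] boundaries_subspace(1)[OF Q]])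

lemma coset_map_hcls:
  "p \<in> carrier (component P s) \<Longrightarrow>
     coset_map (component Q s) (boundaries Q s) (f s) (hcls P s p) = hcls Q s (f s p)"
  by (rule BQ.coset_map_cl[OF BP.V BP.W linear])
    (use f_diff' linear_maps_closed[OF linear] in \<open>auto simp: boundaries_def\<close>)

lemma bij: "bij_betw (coset_map (component Q s) (boundaries Q s) (f s))
   {hcls P s p | p. cycle P s p} {hcls Q s q | q. cycle Q s q}"
  using qi unfolding quasi_isomorphism_def carrier_homology by blast

lemma homology_surj:
  assumes q: "cycle Q s q"
  obtains p c where "cycle P s p" "c \<in> carrier (component Q (shift 1 s))"
    "f s p = q \<oplus>\<^bsub>component Q s\<^esub> diff Q (shift 1 s) c"
proof -
  have "hcls Q s q \<in> coset_map (component Q s) (boundaries Q s) (f s) ` {hcls P s p | p. cycle P s p}"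
    using bij q unfolding bij_betw_def by blast
  then obtain p where p: "cycle P s p" "hcls Q s q = hcls Q s (f s p)"
    using coset_map_hcls by (auto simp: cycle_def)
  have fp: "f s p \<in> carrier (component Q s)" using p linear_maps_closed[OF linear] by (auto simp: cycle_def)
  have q': "q \<in> carrier (component Q s)" using q by (auto simp: cycle_def)
  have "f s p \<ominus>\<^bsub>component Q s\<^esub> q \<in> boundaries Q s"
    using BQ.cl_eq_iff[OF fp q'] p by simp
  then obtain c where c: "c \<in> carrier (component Q (shift 1 s))" "f s p \<ominus>\<^bsub>component Q s\<^esub> q = diff Q (shift 1 s) c"
    by (rule boundariesE)
  have "f s p = q \<oplus>\<^bsub>component Q s\<^esub> diff Q (shift 1 s) c"
    unfolding c(2)[symmetric] using fp q' by (simp add: a_minus_def BQ.a_lcomm[of q] BQ.r_neg)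
  then show thesis using that p c by blast
qed

lemma homology_inj:
  assumes p: "cycle P s p" and b: "f s p \<in> boundaries Q s"
  shows "p \<in> boundaries P s"
proof -
  let ?z = "\<zero>\<^bsub>component P s\<^esub>"
  have z: "cycle P s ?z"
    using linear_maps_zero[OF BP.V _ complex_atD(4)[OF P]] complex_atD(1)[OF P] by (auto simp: cycle_def)
  have fz: "f s ?z = \<zero>\<^bsub>component Q s\<^esub>" by (rule linear_maps_zero[OF BP.V BQ.V linear])
  have p': "p \<in> carrier (component P s)" using p by (auto simp: cycle_def)
  have "hcls Q s (f s p) = hcls Q s (f s ?z)"
    unfolding fz using BQ.cl_eq_zero_iff[OF linear_maps_closed[OF linear p']] b by simp
  then have "coset_map (component Q s) (boundaries Q s) (f s) (hcls P s p) =
      coset_map (component Q s) (boundaries Q s) (f s) (hcls P s ?z)"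
    by (simp add: coset_map_hcls p')
  \<comment> \<open>Injectivity on homology is applied to the classes of the two cycles
    \<open>p\<close> and zero.\<close>
  then have "hcls P s p = hcls P s ?z"
    using bij p z unfolding bij_betw_def inj_on_def by blast
  then show ?thesis using BP.cl_eq_zero_iff[OF p'] by simp
qed

end

text \<open>The differential is constantly the zero coset; the only work is that the quotients of
  cycles by boundaries are vector spaces, in all degrees of this arity.\<close>

lemma complex_at_homology:
  assumes "\<And>n. complex_at P (shift n s)"
  shows "complex_at (homology_operad P) s"
proof -
  have vs: "vs (component (homology_operad P) (shift n s))" 
    and z: "\<zero>\<^bsub>component (homology_operad P) (shift n s)\<^esub> = boundaries P (shift n s)" 
    and d: "diff (homology_operad P) (shift n s) = (\<lambda>_. boundaries P (shift (n-1) s))" for n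
  proof -
    interpret quotient_space "cycles P (shift n s)" "boundaries P (shift n s)"
      by (rule quotient_space.intro[OF vspace.intro quotient_space_axioms.intro, OF vs_cycles[OF assms] boundaries_subspace(2)[OF assms]])
    show "vs (component (homology_operad P) (shift n s))" 
      using vs_quotient by (simp add: homology_operad_def)
    show "\<zero>\<^bsub>component (homology_operad P) (shift n s)\<^esub> = boundaries P (shift n s)" 
      by (simp add: homology_operad_def quotient_module_def)
    show "diff (homology_operad P) (shift n s) = (\<lambda>_. boundaries P (shift (n-1) s))"
      by (simp add: homology_operad_def fun_eq_iff)
  qed
  have lin: "diff (homology_operad P) (shift n s) \<in> 
      linear_maps (component (homology_operad P) (shift n s)) (component (homology_operad P) (shift (n-1) s))" for n
  proof -
    interpret module field_ring "component (homology_operad P) (shift (n-1) s)" by (rule vs)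
    show ?thesis unfolding d z[symmetric] by (rule linear_mapsI) (use smult_r_null in auto)
  qed
  show ?thesis unfolding complex_at_def using vs lin[of 0] lin[of 1] z[of "-1"] d[of 0] by auto
qed

lemma dg_operad_complex_at: 
  fixes P :: "('k::field, 'a) dg_operad_data"
  assumes "dg_operad P"
  shows "complex_at P s"
proof -
  interpret dg_operad P by (rule assms)
  show ?thesis unfolding complex_at_def
    using vector_space diff_linear[of "shift 1 s"] diff_linear[of s] diff_diff[of _ "shift 1 s"] by simp
qed

declare One_nat_def [simp del]

section \<open>The Massey product\<close>

definition arr :: "nat \<Rightarrow> nat \<Rightarrow> arity" where
  "arr n m = (\<lambda>y. case y of Closed \<Rightarrow> n | Open \<Rightarrow> m)"

lemma arr_simps [simp]: "arr n m Closed = n" "arr n m Open = m"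
  by (auto simp: arr_def)

lemma arity_eq_iff: "a = b \<longleftrightarrow> a Closed = b Closed \<and> a Open = b Open" for a b :: "colour \<Rightarrow> 'x"
  by (metis (full_types) colour.exhaust ext)

lemma all_colour: "(\<forall>y. Q y) \<longleftrightarrow> Q Closed \<and> Q Open"
  by (metis (full_types) colour.exhaust)

lemma arr_eq_iff [simp]: "arr n m = arr n' m' \<longleftrightarrow> n = n' \<and> m = m'"
  by (simp add: arity_eq_iff)

definition ix :: "nat \<Rightarrow> nat \<Rightarrow> int \<Rightarrow> idx" where
  "ix n m d = Idx (arr n m) Open d"

lemma ix_simps [simp]: "ar (ix n m d) = arr n m" "out (ix n m d) = Open" "deg (ix n m d) = d"
  "shift e (ix n m d) = ix n m (d + e)"
  by (auto simp: ix_def shift_def)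

lemma comp_ix: "m > 0 \<Longrightarrow> comp_idx (ix n m d) (ix n' m' d') = ix (n + n') (m + m' - 1) (d + d')"
  by (auto simp: ix_def comp_idx_def comp_ar_def arity_eq_iff)

lemma comp_ix_simps [simp]: 
  "comp_idx (ix 0 2 m) (ix 1 0 d) = ix 1 1 (m + d)" "comp_idx (ix 1 1 m) (ix 1 0 d) = ix 2 0 (m + d)"
  by (auto simp: comp_ix) (auto simp: One_nat_def)

definition cswap :: "colour \<Rightarrow> nat \<Rightarrow> nat" where
  "cswap = (\<lambda>y. if y = Closed then Transposition.transpose 0 1 else id)"

lemma cswap_simps [simp]: "cswap Closed = Transposition.transpose 0 1" "cswap Open = id"
  by (auto simp: cswap_def)

lemma permutes_transpose_01: "Transposition.transpose 0 1 permutes {..<2::nat}"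
  by (rule permutes_swap_id) auto

lemma cswap_perms [simp]: "cswap \<in> perms (arr 2 m)"
  using permutes_transpose_01 by (auto simp: perms_def all_colour permutes_id)

lemma cswap_cswap: "(\<lambda>y. cswap y \<circ> cswap y) = (\<lambda>y. id)"
  by (auto simp: cswap_def)

text \<open>
  The operation \<open>\<mu>(q(c), a) - \<mu>(a, q(c))\<close> with one closed input \<open>c\<close> and one open input \<open>a\<close>.
\<close>

definition commdiff :: "('k::field, 'a) dg_operad_data \<Rightarrow> int \<Rightarrow> int \<Rightarrow> 'a \<Rightarrow> 'a \<Rightarrow> 'a" where
  "commdiff P m d \<mu> q =
    pcomp P (ix 0 2 m) 0 (ix 1 0 d) \<mu> q \<ominus>\<^bsub>component P (ix 1 1 (m + d))\<^esub> pcomp P (ix 0 2 m) 1 (ix 1 0 d) \<mu> q"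

text \<open>The closed input of \<open>p\<close> keeps the number 0 and that of \<open>r\<close>
  receives the number 1; this ordering is behind the exchange of inputs in
  \<open>plug_commdiff\<close>.\<close>

definition plug :: "('k::field, 'a) dg_operad_data \<Rightarrow> int \<Rightarrow> int \<Rightarrow> 'a \<Rightarrow> 'a \<Rightarrow> 'a" where
  "plug P m d p r = pcomp P (ix 1 1 m) 0 (ix 1 0 d) p r"

definition alternation :: "('k::field, 'a) dg_operad_data \<Rightarrow> int \<Rightarrow> 'a \<Rightarrow> 'a" where
  "alternation P d y = y \<ominus>\<^bsub>component P (ix 2 0 d)\<^esub> act P (ix 2 0 d) cswap y"

definition massey_system :: "('k::field, 'a) dg_operad_data \<Rightarrow> 'a \<Rightarrow> 'a \<Rightarrow> 'a \<Rightarrow> bool" where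
  "massey_system P \<eta> \<mu> h \<longleftrightarrow> cycle P (ix 1 0 (- 1)) \<eta> \<and> cycle P (ix 0 2 0) \<mu> \<and>
     h \<in> carrier (component P (ix 1 1 0)) \<and> diff P (ix 1 1 0) h = commdiff P 0 (- 1) \<mu> \<eta>"

text \<open>The class depends on \<open>h\<close>, which may be altered by any cycle. Asking for one
  good triple, instead of dividing by this indeterminacy, gives a property that is transported by
  transporting a triple.\<close>

definition massey_nontrivial :: "('k::field, 'a) dg_operad_data \<Rightarrow> bool" where
  "massey_nontrivial P \<longleftrightarrow> (\<exists>\<eta> \<mu> h. massey_system P \<eta> \<mu> h \<and>
     alternation P (- 1) (plug P 0 (- 1) h \<eta>) \<notin> boundaries P (ix 2 0 (- 1)))"

section \<open>Identities of the Massey product in a dg operad\<close>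

lemma (in vspace) minus_combination:
  assumes "x \<in> carrier V" "x' \<in> carrier V" "y \<in> carrier V" "y' \<in> carrier V"
  shows "(x \<oplus>\<^bsub>V\<^esub> c \<odot>\<^bsub>V\<^esub> y) \<ominus>\<^bsub>V\<^esub> (x' \<oplus>\<^bsub>V\<^esub> c \<odot>\<^bsub>V\<^esub> y') =
    (x \<ominus>\<^bsub>V\<^esub> x') \<oplus>\<^bsub>V\<^esub> c \<odot>\<^bsub>V\<^esub> (y \<ominus>\<^bsub>V\<^esub> y')"
  using assms by (simp add: smult_minus_right) (simp add: a_minus_def minus_add a_ac)

lemma linear_maps_compose:
  assumes "f \<in> linear_maps U V" "g \<in> linear_maps V W"
  shows "(\<lambda>x. g (f x)) \<in> linear_maps U W"
  using assms by (intro linear_mapsI) (auto simp: linear_mapsD)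

lemma linear_maps_difference:
  assumes W: "vs W" and f: "f \<in> linear_maps V W" and g: "g \<in> linear_maps V W"
  shows "(\<lambda>x. f x \<ominus>\<^bsub>W\<^esub> g x) \<in> linear_maps V W"
proof -
  interpret vspace W by (rule vspace.intro[OF W])
  show ?thesis
    by (rule linear_mapsI) (auto simp: linear_maps_closed[OF f] linear_maps_closed[OF g] linear_maps_add[OF f]
      linear_maps_add[OF g] linear_maps_smult[OF f] linear_maps_smult[OF g] smult_minus_right, 
      auto simp: linear_maps_closed[OF f] linear_maps_closed[OF g] a_minus_def minus_add a_ac)
qed

lemma linear_maps_id: "(\<lambda>x. x) \<in> linear_maps V V"
  by (auto simp: linear_maps_def)

text \<open>The same axioms without a record extension, which is the type on which
  \<open>boundaries\<close> and \<open>massey_system\<close> are defined.\<close>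

locale dg_operad' = dg_operad P for P :: "('k::field, 'a) dg_operad_data"
begin

abbreviation Cmp ("\<C>") where "\<C> n m d \<equiv> component P (ix n m d)"

lemma vsC: "vs (\<C> n m d)" by (rule vector_space)

lemma complex_at_P: "complex_at P s"
  by (rule dg_operad_complex_at) unfold_locales

lemma ins_linear:
  assumes "j < 2"
  shows "q \<in> carrier (\<C> 1 0 d) \<Longrightarrow> (\<lambda>\<mu>. pcomp P (ix 0 2 m) j (ix 1 0 d) \<mu> q) \<in> linear_maps (\<C> 0 2 m) (\<C> 1 1 (m + d))"
    and "\<mu> \<in> carrier (\<C> 0 2 m) \<Longrightarrow> pcomp P (ix 0 2 m) j (ix 1 0 d) \<mu> \<in> linear_maps (\<C> 1 0 d) (\<C> 1 1 (m + d))"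
  using pcomp_linear_left[of j "ix 0 2 m" "ix 1 0 d" q] pcomp_linear_right[of j "ix 0 2 m" "ix 1 0 d" \<mu>] assms
  by auto

lemma plug_linear:
  shows plug_left: "r \<in> carrier (\<C> 1 0 d) \<Longrightarrow> (\<lambda>p. plug P m d p r) \<in> linear_maps (\<C> 1 1 m) (\<C> 2 0 (m + d))"
    and plug_right: "p \<in> carrier (\<C> 1 1 m) \<Longrightarrow> plug P m d p \<in> linear_maps (\<C> 1 0 d) (\<C> 2 0 (m + d))"
  using pcomp_linear_left[of 0 "ix 1 1 m" "ix 1 0 d" r] pcomp_linear_right[of 0 "ix 1 1 m" "ix 1 0 d" p]
  by (auto simp: plug_def[abs_def])

lemma commdiff_left: "q \<in> carrier (\<C> 1 0 d) \<Longrightarrow> (\<lambda>\<mu>. commdiff P m d \<mu> q) \<in> linear_maps (\<C> 0 2 m) (\<C> 1 1 (m + d))"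
  and commdiff_right: "\<mu> \<in> carrier (\<C> 0 2 m) \<Longrightarrow> commdiff P m d \<mu> \<in> linear_maps (\<C> 1 0 d) (\<C> 1 1 (m + d))"
  using linear_maps_difference[OF vsC ins_linear(1)[of 0 q d m] ins_linear(1)[of 1 q d m]]
    linear_maps_difference[OF vsC ins_linear(2)[of 0 \<mu> m d] ins_linear(2)[of 1 \<mu> m d]]
  by (auto simp: commdiff_def[abs_def])

lemma alternation_linear: "alternation P d \<in> linear_maps (\<C> 2 0 d) (\<C> 2 0 d)"
  unfolding alternation_def[abs_def]
  by (intro linear_maps_difference vsC linear_maps_id) (rule act_linear, simp)

lemma diff_lin: "diff P (ix n m d) \<in> linear_maps (\<C> n m d) (\<C> n m (d - 1))"
  using diff_linear[of "ix n m d"] by simp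

lemma diff_alternation:
  assumes "y \<in> carrier (\<C> 2 0 d)"
  shows "diff P (ix 2 0 d) (alternation P d y) = alternation P (d - 1) (diff P (ix 2 0 d) y)"
proof -
  have "act P (ix 2 0 d) cswap y \<in> carrier (\<C> 2 0 d)"
    using linear_maps_closed[OF act_linear[of cswap "ix 2 0 d"]] assms by simp
  then show ?thesis using linear_maps_minus[OF vsC vsC diff_lin] assms diff_act[of cswap "ix 2 0 d" y]
    by (simp add: alternation_def)
qed

lemma diff_plug:
  assumes "p \<in> carrier (\<C> 1 1 m)" "r \<in> carrier (\<C> 1 0 d)"
  shows "diff P (ix 2 0 (m + d)) (plug P m d p r) =
    plug P (m - 1) d (diff P (ix 1 1 m) p) r \<oplus>\<^bsub>\<C> 2 0 (m + d - 1)\<^esub>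
    ksign m \<odot>\<^bsub>\<C> 2 0 (m + d - 1)\<^esub> plug P m (d - 1) p (diff P (ix 1 0 d) r)"
  using leibniz[of p "ix 1 1 m" r "ix 1 0 d" 0] assms by (simp add: plug_def)

lemma diff_commdiff:
  assumes \<mu>: "\<mu> \<in> carrier (\<C> 0 2 m)" and q: "q \<in> carrier (\<C> 1 0 d)"
  shows "diff P (ix 1 1 (m + d)) (commdiff P m d \<mu> q) =
    commdiff P (m - 1) d (diff P (ix 0 2 m) \<mu>) q \<oplus>\<^bsub>\<C> 1 1 (m + d - 1)\<^esub>
    ksign m \<odot>\<^bsub>\<C> 1 1 (m + d - 1)\<^esub> commdiff P m (d - 1) \<mu> (diff P (ix 1 0 d) q)"
proof -
  interpret vspace "\<C> 1 1 (m + d - 1)" by (rule vspace.intro[OF vsC])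
  have d\<mu>: "diff P (ix 0 2 m) \<mu> \<in> carrier (\<C> 0 2 (m - 1))" and dq: "diff P (ix 1 0 d) q \<in> carrier (\<C> 1 0 (d - 1))"
    using linear_maps_closed[OF diff_lin] assms by auto
  define X where "X j = pcomp P (ix 0 2 (m-1)) j (ix 1 0 d) (diff P (ix 0 2 m) \<mu>) q" for j
  define Y where "Y j = pcomp P (ix 0 2 m) j (ix 1 0 (d-1)) \<mu> (diff P (ix 1 0 d) q)" for j
  have eq: "m - 1 + d = m + d - 1" "m + (d - 1) = m + d - 1" by auto
  have cl: "X j \<in> carrier (\<C> 1 1 (m + d - 1))" "Y j \<in> carrier (\<C> 1 1 (m + d - 1))" if "j < 2" for j
    using linear_maps_closed[OF ins_linear(1)[OF that q, of "m-1"] d\<mu>] 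
      linear_maps_closed[OF ins_linear(2)[OF that \<mu>, of "d-1"] dq] unfolding X_def Y_def eq by auto
  have L: "diff P (ix 1 1 (m + d)) (pcomp P (ix 0 2 m) j (ix 1 0 d) \<mu> q) = 
     X j \<oplus>\<^bsub>\<C> 1 1 (m + d - 1)\<^esub> ksign m \<odot>\<^bsub>\<C> 1 1 (m + d - 1)\<^esub> Y j" if "j < 2" for j
    using leibniz[OF \<mu> q, of j] that by (simp add: X_def Y_def)
  have C: "pcomp P (ix 0 2 m) j (ix 1 0 d) \<mu> q \<in> carrier (\<C> 1 1 (m + d))" if "j < 2" for j
    using linear_maps_closed[OF ins_linear(1)[OF that q] \<mu>] .
  have "diff P (ix 1 1 (m + d)) (commdiff P m d \<mu> q) =
     (X 0 \<oplus>\<^bsub>\<C> 1 1 (m + d - 1)\<^esub> ksign m \<odot>\<^bsub>\<C> 1 1 (m + d - 1)\<^esub> Y 0) \<ominus>\<^bsub>\<C> 1 1 (m + d - 1)\<^esub>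
     (X 1 \<oplus>\<^bsub>\<C> 1 1 (m + d - 1)\<^esub> ksign m \<odot>\<^bsub>\<C> 1 1 (m + d - 1)\<^esub> Y 1)"
    using linear_maps_minus[OF vsC vsC diff_lin C[of 0] C[of 1]] L[of 0] L[of 1] by (simp add: commdiff_def)
  also have "\<dots> = (X 0 \<ominus>\<^bsub>\<C> 1 1 (m + d - 1)\<^esub> X 1) \<oplus>\<^bsub>\<C> 1 1 (m + d - 1)\<^esub>
     ksign m \<odot>\<^bsub>\<C> 1 1 (m + d - 1)\<^esub> (Y 0 \<ominus>\<^bsub>\<C> 1 1 (m + d - 1)\<^esub> Y 1)"
    using cl[of 0] cl[of 1] by (intro minus_combination) auto
  finally show ?thesis by (simp add: commdiff_def X_def Y_def eq)
qed

text \<open>Parallel associativity turns the second term of the commutator into \<open>cswap\<close>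
  applied to the first term with \<open>q\<close> and \<open>r\<close> exchanged, up to the Koszul
  sign. The alternation changes sign under \<open>cswap\<close>, so the difference becomes a graded
  symmetric sum in \<open>q\<close> and \<open>r\<close>.\<close>

lemma plug_commdiff:
  assumes \<mu>: "\<mu> \<in> carrier (\<C> 0 2 m)" and q: "q \<in> carrier (\<C> 1 0 d)" and r: "r \<in> carrier (\<C> 1 0 e)"
  defines "M \<equiv> \<lambda>d e q r. plug P (m + d) e (pcomp P (ix 0 2 m) 0 (ix 1 0 d) \<mu> q) r"
  shows "alternation P (m + d + e) (plug P (m + d) e (commdiff P m d \<mu> q) r) =
    alternation P (m + d + e) (M d e q r) \<oplus>\<^bsub>\<C> 2 0 (m + d + e)\<^esub>
    ksign (d * e) \<odot>\<^bsub>\<C> 2 0 (m + d + e)\<^esub> alternation P (m + d + e) (M e d r q)"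
    and "M d e q r \<in> carrier (\<C> 2 0 (m + d + e))"
proof -
  let ?V = "\<C> 2 0 (m + d + e)" and ?\<tau> = "act P (ix 2 0 (m + d + e)) cswap"
  interpret vspace ?V by (rule vspace.intro[OF vsC])
  \<comment> \<open>The operation inserted last contributes the closed input with number 1, so
    reversing the order of the two insertions exchanges the closed inputs.\<close>
  have pp: "parallel_perm (arr 0 2) Open 1 (arr 1 0) Open 0 (arr 1 0) cswap"
    by (auto simp: parallel_perm_def Let_def lab_out_def lab_in_def comp_ar_def perms_def all_colour
       permutes_id permutes_transpose_01 less_2_cases_iff)
  have eq: "m + e + d = m + d + e" by simp
  have ins: "pcomp P (ix 0 2 m) j (ix 1 0 d) \<mu> q \<in> carrier (\<C> 1 1 (m + d))" if "j < 2" for j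
    using linear_maps_closed[OF ins_linear(1)[OF that q] \<mu>] .
  have ins': "pcomp P (ix 0 2 m) j (ix 1 0 e) \<mu> r \<in> carrier (\<C> 1 1 (m + e))" if "j < 2" for j
    using linear_maps_closed[OF ins_linear(1)[OF that r] \<mu>] .
  show Mc: "M d e q r \<in> carrier ?V"
    using linear_maps_closed[OF plug_left[OF r] ins[of 0]] by (simp add: M_def)
  have Mc': "M e d r q \<in> carrier ?V"
    using linear_maps_closed[OF plug_left[OF q] ins'[of 0]] by (simp add: M_def eq)
  have \<tau>: "?\<tau> \<in> linear_maps ?V ?V" using act_linear[of cswap "ix 2 0 (m + d + e)"] by simp
  have "plug P (m + d) e (pcomp P (ix 0 2 m) 1 (ix 1 0 d) \<mu> q) r = ksign (d * e) \<odot>\<^bsub>?V\<^esub> ?\<tau> (M e d r q)"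
    using parallel_assoc[OF \<mu> q r, of 1 0 cswap] pp by (simp add: plug_def lab_out_def M_def)
  then have "plug P (m + d) e (commdiff P m d \<mu> q) r = M d e q r \<ominus>\<^bsub>?V\<^esub> ksign (d * e) \<odot>\<^bsub>?V\<^esub> ?\<tau> (M e d r q)"
    using linear_maps_minus[OF vsC vsC plug_left[OF r] ins ins, of 0 1] by (simp add: commdiff_def M_def)
  moreover have "alternation P (m + d + e) (ksign (d * e) \<odot>\<^bsub>?V\<^esub> ?\<tau> (M e d r q)) =
     \<ominus>\<^bsub>?V\<^esub> (ksign (d * e) \<odot>\<^bsub>?V\<^esub> alternation P (m + d + e) (M e d r q))"
  proof -
    have "alternation P (m + d + e) (?\<tau> (M e d r q)) = ?\<tau> (M e d r q) \<ominus>\<^bsub>?V\<^esub> M e d r q"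
      using act_act[of cswap "ix 2 0 (m + d + e)" cswap] act_id[of _ "ix 2 0 (m + d + e)"] Mc' 
      by (simp add: alternation_def cswap_cswap)
    also have "\<dots> = \<ominus>\<^bsub>?V\<^esub> alternation P (m + d + e) (M e d r q)"
      using Mc' linear_maps_closed[OF \<tau> Mc'] by (simp add: alternation_def a_minus_def minus_add a_comm)
    finally show ?thesis
      using linear_maps_smult[OF alternation_linear linear_maps_closed[OF \<tau> Mc']] 
        smult_r_minus[of "ksign (d*e)"] linear_maps_closed[OF alternation_linear Mc'] by simp
  qed
  ultimately show "alternation P (m + d + e) (plug P (m + d) e (commdiff P m d \<mu> q) r) =
    alternation P (m + d + e) (M d e q r) \<oplus>\<^bsub>?V\<^esub> ksign (d * e) \<odot>\<^bsub>?V\<^esub> alternation P (m + d + e) (M e d r q)"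
    using linear_maps_minus[OF vsC vsC alternation_linear Mc, of "ksign (d * e) \<odot>\<^bsub>?V\<^esub> ?\<tau> (M e d r q)"]
      linear_maps_closed[OF \<tau> Mc'] linear_maps_closed[OF alternation_linear Mc'] 
      linear_maps_closed[OF alternation_linear Mc] by (simp add: a_minus_def)
qed

text \<open>For equal arguments of odd degree the two terms of \<open>plug_commdiff\<close> agree
  and carry opposite signs.\<close>

lemma comm_self:
  assumes "\<mu> \<in> carrier (\<C> 0 2 m)" "q \<in> carrier (\<C> 1 0 d)" "odd d"
  shows "alternation P (m + d + d) (plug P (m + d) d (commdiff P m d \<mu> q) q) = \<zero>\<^bsub>\<C> 2 0 (m + d + d)\<^esub>"
proof -
  interpret vspace "\<C> 2 0 (m + d + d)" by (rule vspace.intro[OF vsC])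
  have k: "ksign (d * d) = (- 1 :: 'k)" using assms(3) by (simp add: ksign_def)
  show ?thesis unfolding plug_commdiff(1)[OF assms(1,2,2)] k
    using linear_maps_closed[OF alternation_linear plug_commdiff(2)[OF assms(1,2,2)]]
    by (simp only: smult_minus_one r_neg)
qed

text \<open>When the Koszul sign is trivial, the sum in \<open>plug_commdiff\<close> is symmetric in
  its two arguments.\<close>

lemma comm_sym:
  assumes "\<mu> \<in> carrier (\<C> 0 2 m)" "q \<in> carrier (\<C> 1 0 d)" "r \<in> carrier (\<C> 1 0 e)" "even (d * e)"
  shows "alternation P (m + d + e) (plug P (m + d) e (commdiff P m d \<mu> q) r) = 
    alternation P (m + e + d) (plug P (m + e) d (commdiff P m e \<mu> r) q)"
proof -
  interpret vspace "\<C> 2 0 (m + d + e)" by (rule vspace.intro[OF vsC])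
  have eq: "m + e + d = m + d + e" by simp
  show ?thesis using plug_commdiff[OF assms(1,2,3)] plug_commdiff[OF assms(1,3,2)] assms(4) 
      linear_maps_closed[OF alternation_linear]
    unfolding eq by (simp add: ksign_def mult.commute a_comm)
qed

text \<open>The boundary of \<open>h\<close> composed with \<open>\<eta>\<close> is the commutator
  composed with \<open>\<eta>\<close>, and \<open>comm_self\<close> kills its alternation because
  \<open>\<eta>\<close> has odd degree.\<close>

lemma cycle_alternation_plug:
  assumes "massey_system P \<eta> \<mu> h"
  shows "cycle P (ix 2 0 (- 1)) (alternation P (- 1) (plug P 0 (- 1) h \<eta>))"
proof -
  have \<eta>: "\<eta> \<in> carrier (\<C> 1 0 (- 1))" "diff P (ix 1 0 (- 1)) \<eta> = \<zero>\<^bsub>\<C> 1 0 (- 2)\<^esub>"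
    and \<mu>: "\<mu> \<in> carrier (\<C> 0 2 0)" and h: "h \<in> carrier (\<C> 1 1 0)" "diff P (ix 1 1 0) h = commdiff P 0 (- 1) \<mu> \<eta>"
    using assms by (auto simp: massey_system_def cycle_def)
  have c: "plug P 0 (- 1) h \<eta> \<in> carrier (\<C> 2 0 (- 1))"
    using linear_maps_closed[OF plug_left[OF \<eta>(1)] h(1)] by simp
  interpret vspace "\<C> 2 0 (- 2)" by (rule vspace.intro[OF vsC])
  have dh: "commdiff P 0 (- 1) \<mu> \<eta> \<in> carrier (\<C> 1 1 (- 1))" 
    using linear_maps_closed[OF commdiff_left[OF \<eta>(1)] \<mu>] by simp
  have "diff P (ix 2 0 (- 1)) (plug P 0 (- 1) h \<eta>) = plug P (- 1) (- 1) (commdiff P 0 (- 1) \<mu> \<eta>) \<eta>"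
    using diff_plug[OF h(1) \<eta>(1)] linear_maps_zero[OF vsC vsC plug_right[OF h(1), of "- 2"]] 
      linear_maps_closed[OF plug_left[OF \<eta>(1)] dh] by (simp add: \<eta> h)
  then show ?thesis
    using diff_alternation[OF c] comm_self[OF \<mu> \<eta>(1)] linear_maps_closed[OF alternation_linear c] by (simp add: cycle_def)
qed

text \<open>The correction of \<open>h\<close> is again a commutator with \<open>\<eta>\<close>, so
  its contribution to the product vanishes by \<open>comm_self\<close>.\<close>

lemma massey_change_mu:
  assumes M: "massey_system P \<eta> \<mu> h" and b: "b \<in> carrier (\<C> 0 2 1)"
  defines "\<mu>' \<equiv> \<mu> \<oplus>\<^bsub>\<C> 0 2 0\<^esub> diff P (ix 0 2 1) b"
  defines "h' \<equiv> h \<oplus>\<^bsub>\<C> 1 1 0\<^esub> commdiff P 1 (- 1) b \<eta>"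
  shows "massey_system P \<eta> \<mu>' h'" "alternation P (- 1) (plug P 0 (- 1) h' \<eta>) = alternation P (- 1) (plug P 0 (- 1) h \<eta>)"
proof -
  have \<eta>: "\<eta> \<in> carrier (\<C> 1 0 (- 1))" "diff P (ix 1 0 (- 1)) \<eta> = \<zero>\<^bsub>\<C> 1 0 (- 2)\<^esub>"
    and \<mu>: "\<mu> \<in> carrier (\<C> 0 2 0)" "diff P (ix 0 2 0) \<mu> = \<zero>\<^bsub>\<C> 0 2 (- 1)\<^esub>" 
    and h: "h \<in> carrier (\<C> 1 1 0)" "diff P (ix 1 1 0) h = commdiff P 0 (- 1) \<mu> \<eta>"
    using M by (auto simp: massey_system_def cycle_def)
  interpret V02: vspace "\<C> 0 2 0" by (rule vspace.intro[OF vsC])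
  interpret V02': vspace "\<C> 0 2 (- 1)" by (rule vspace.intro[OF vsC])
  interpret V11: vspace "\<C> 1 1 0" by (rule vspace.intro[OF vsC])
  interpret V11': vspace "\<C> 1 1 (- 1)" by (rule vspace.intro[OF vsC])
  interpret V20: vspace "\<C> 2 0 (- 1)" by (rule vspace.intro[OF vsC])
  have db: "diff P (ix 0 2 1) b \<in> carrier (\<C> 0 2 0)" using linear_maps_closed[OF diff_lin b] by simp
  have ddb: "diff P (ix 0 2 0) (diff P (ix 0 2 1) b) = \<zero>\<^bsub>\<C> 0 2 (- 1)\<^esub>" using diff_diff[OF b] by simp
  have \<mu>': "cycle P (ix 0 2 0) \<mu>'"
    using linear_maps_add[OF diff_lin \<mu>(1) db] \<mu> db ddb by (simp add: cycle_def \<mu>'_def)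
  have k: "commdiff P 1 (- 1) b \<eta> \<in> carrier (\<C> 1 1 0)"
    using linear_maps_closed[OF commdiff_left[OF \<eta>(1)] b] by simp
  have c: "commdiff P 0 (- 1) (diff P (ix 0 2 1) b) \<eta> \<in> carrier (\<C> 1 1 (- 1))"
    using linear_maps_closed[OF commdiff_left[OF \<eta>(1)] db] by simp
  have "diff P (ix 1 1 0) (commdiff P 1 (- 1) b \<eta>) = commdiff P 0 (- 1) (diff P (ix 0 2 1) b) \<eta>"
    using diff_commdiff[OF b \<eta>(1)] linear_maps_zero[OF vsC vsC commdiff_right[OF b, of "- 2"]] c 
    by (simp add: \<eta>)
  then have "diff P (ix 1 1 0) h' = commdiff P 0 (- 1) \<mu>' \<eta>"
    using linear_maps_add[OF diff_lin h(1) k] linear_maps_add[OF commdiff_left[OF \<eta>(1)] \<mu>(1) db]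
    by (simp add: h'_def \<mu>'_def h)
  then show "massey_system P \<eta> \<mu>' h'" using \<mu>' M k h by (simp add: massey_system_def h'_def)
  have p: "plug P 0 (- 1) h \<eta> \<in> carrier (\<C> 2 0 (- 1))" "plug P 0 (- 1) (commdiff P 1 (- 1) b \<eta>) \<eta> \<in> carrier (\<C> 2 0 (- 1))"
    using linear_maps_closed[OF plug_left[OF \<eta>(1)] h(1)] linear_maps_closed[OF plug_left[OF \<eta>(1)] k] by auto
  show "alternation P (- 1) (plug P 0 (- 1) h' \<eta>) = alternation P (- 1) (plug P 0 (- 1) h \<eta>)"
    using linear_maps_add[OF plug_left[OF \<eta>(1)] h(1) k] linear_maps_add[OF alternation_linear p] comm_self[OF b \<eta>(1)]
      linear_maps_closed[OF alternation_linear p(1)] by (simp add: h'_def)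
qed

text \<open>Expanding the new product gives the old one, two terms linear in \<open>a\<close> and
  one quadratic in \<open>a\<close>. The linear terms together form a boundary, and so does the
  quadratic one.\<close>

lemma massey_change_eta:
  assumes M: "massey_system P \<eta> \<mu> h" and a: "a \<in> carrier (\<C> 1 0 0)"
  defines "\<eta>' \<equiv> \<eta> \<oplus>\<^bsub>\<C> 1 0 (- 1)\<^esub> diff P (ix 1 0 0) a"
  defines "h' \<equiv> h \<oplus>\<^bsub>\<C> 1 1 0\<^esub> commdiff P 0 0 \<mu> a"
  obtains w where "massey_system P \<eta>' \<mu> h'" "w \<in> carrier (\<C> 2 0 0)"
    "alternation P (- 1) (plug P 0 (- 1) h' \<eta>') =
      alternation P (- 1) (plug P 0 (- 1) h \<eta>) \<oplus>\<^bsub>\<C> 2 0 (- 1)\<^esub> diff P (ix 2 0 0) w"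
proof -
  have \<eta>: "\<eta> \<in> carrier (\<C> 1 0 (- 1))" "diff P (ix 1 0 (- 1)) \<eta> = \<zero>\<^bsub>\<C> 1 0 (- 2)\<^esub>"
    and \<mu>: "\<mu> \<in> carrier (\<C> 0 2 0)" "diff P (ix 0 2 0) \<mu> = \<zero>\<^bsub>\<C> 0 2 (- 1)\<^esub>" 
    and h: "h \<in> carrier (\<C> 1 1 0)" "diff P (ix 1 1 0) h = commdiff P 0 (- 1) \<mu> \<eta>"
    using M by (auto simp: massey_system_def cycle_def)
  interpret V10: vspace "\<C> 1 0 (- 1)" by (rule vspace.intro[OF vsC])
  interpret V10': vspace "\<C> 1 0 (- 2)" by (rule vspace.intro[OF vsC])
  interpret V11: vspace "\<C> 1 1 0" by (rule vspace.intro[OF vsC])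
  interpret V11': vspace "\<C> 1 1 (- 1)" by (rule vspace.intro[OF vsC])
  interpret V20: vspace "\<C> 2 0 (- 1)" by (rule vspace.intro[OF vsC])
  interpret V20': vspace "\<C> 2 0 0" by (rule vspace.intro[OF vsC])
  let ?da = "diff P (ix 1 0 0) a" and ?k = "commdiff P 0 0 \<mu> a" and ?i = "pcomp P (ix 0 2 0) 0 (ix 1 0 0) \<mu> a"
  let ?S = "alternation P (- 1)" and ?T = "plug P 0 (- 1)"
  have da: "?da \<in> carrier (\<C> 1 0 (- 1))" using linear_maps_closed[OF diff_lin a] by simp
  have dda: "diff P (ix 1 0 (- 1)) ?da = \<zero>\<^bsub>\<C> 1 0 (- 2)\<^esub>" using diff_diff[OF a] by simp
  have \<eta>': "cycle P (ix 1 0 (- 1)) \<eta>'"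
    using linear_maps_add[OF diff_lin \<eta>(1) da] \<eta> da dda by (simp add: cycle_def \<eta>'_def)
  have k: "?k \<in> carrier (\<C> 1 1 0)" using linear_maps_closed[OF commdiff_left[OF a] \<mu>(1)] by simp
  have c: "commdiff P 0 (- 1) \<mu> ?da \<in> carrier (\<C> 1 1 (- 1))"
    using linear_maps_closed[OF commdiff_left[OF da] \<mu>(1)] by simp
  have dk: "diff P (ix 1 1 0) ?k = commdiff P 0 (- 1) \<mu> ?da"
    using diff_commdiff[OF \<mu>(1) a] linear_maps_zero[OF vsC vsC commdiff_left[OF a, of "- 1"]] c 
    by (simp add: \<mu> ksign_def)
  then have "diff P (ix 1 1 0) h' = commdiff P 0 (- 1) \<mu> \<eta>'"
    using linear_maps_add[OF diff_lin h(1) k] linear_maps_add[OF commdiff_right[OF \<mu>(1)] \<eta>(1) da]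
    by (simp add: h'_def \<eta>'_def h)
  then have M': "massey_system P \<eta>' \<mu> h'" using \<eta>' M k h by (simp add: massey_system_def h'_def)
  have i: "?i \<in> carrier (\<C> 1 1 0)" "pcomp P (ix 0 2 0) 0 (ix 1 0 (- 1)) \<mu> ?da \<in> carrier (\<C> 1 1 (- 1))"
    using linear_maps_closed[OF ins_linear(1)[OF _ a] \<mu>(1), of 0] linear_maps_closed[OF ins_linear(1)[OF _ da] \<mu>(1), of 0] by auto
  have di: "diff P (ix 1 1 0) ?i = pcomp P (ix 0 2 0) 0 (ix 1 0 (- 1)) \<mu> ?da"
    using leibniz[OF \<mu>(1) a, of 0] linear_maps_zero[OF vsC vsC ins_linear(1)[OF _ a, of 0 "- 1"]] i(2)
    by (simp add: \<mu> ksign_def)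
  \<comment> \<open>\<open>w1\<close> will bound the two terms linear in \<open>a\<close>, and
    \<open>w2\<close> the quadratic one.\<close>
  define w1 where "w1 = alternation P 0 (plug P 0 0 h a)"
  define w2 where "w2 = alternation P 0 (plug P 0 0 ?i a)"
  have pc: "plug P 0 0 p a \<in> carrier (\<C> 2 0 0)" if "p \<in> carrier (\<C> 1 1 0)" for p
    using linear_maps_closed[OF plug_left[OF a] that] by simp
  have pc': "plug P (- 1) 0 p a \<in> carrier (\<C> 2 0 (- 1))" if "p \<in> carrier (\<C> 1 1 (- 1))" for p
    using linear_maps_closed[OF plug_left[OF a] that] by simp
  have tc: "?T p r \<in> carrier (\<C> 2 0 (- 1))" if "p \<in> carrier (\<C> 1 1 0)" "r \<in> carrier (\<C> 1 0 (- 1))" for p r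
    using linear_maps_closed[OF plug_left[OF that(2)] that(1)] by simp
  have Sc: "?S p \<in> carrier (\<C> 2 0 (- 1))" if "p \<in> carrier (\<C> 2 0 (- 1))" for p
    using linear_maps_closed[OF alternation_linear that] .
  have w: "w1 \<in> carrier (\<C> 2 0 0)" "w2 \<in> carrier (\<C> 2 0 0)"
    unfolding w1_def w2_def using linear_maps_closed[OF alternation_linear pc] h i by auto
  have dh: "commdiff P 0 (- 1) \<mu> \<eta> \<in> carrier (\<C> 1 1 (- 1))"
    using linear_maps_closed[OF commdiff_left[OF \<eta>(1)] \<mu>(1)] by simp
  have dS: "diff P (ix 2 0 0) (alternation P 0 (plug P 0 0 p a)) = ?S (plug P (- 1) 0 (diff P (ix 1 1 0) p) a) \<oplus>\<^bsub>\<C> 2 0 (- 1)\<^esub> ?S (?T p ?da)"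
    if p: "p \<in> carrier (\<C> 1 1 0)" for p
  proof -
    have "diff P (ix 1 1 0) p \<in> carrier (\<C> 1 1 (- 1))" using linear_maps_closed[OF diff_lin p] by simp
    then show ?thesis
      using diff_alternation[OF pc[OF p]] diff_plug[OF p a] linear_maps_add[OF alternation_linear pc' tc[OF p da]] tc[OF p da]
      by (simp add: ksign_def)
  qed
  \<comment> \<open>\<open>\<eta>\<close> has odd and \<open>a\<close> even degree, so they may be
    exchanged in the alternated commutator.\<close>
  have 1: "?S (plug P (- 1) 0 (commdiff P 0 (- 1) \<mu> \<eta>) a) = ?S (?T ?k \<eta>)"
    using comm_sym[OF \<mu>(1) \<eta>(1) a] by simp
  \<comment> \<open>Evaluated at \<open>a\<close> and its boundary, the symmetric sum of
    \<open>plug_commdiff\<close> consists of the two Leibniz terms of \<open>w2\<close>.\<close>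
  have 2: "?S (?T ?k ?da) = diff P (ix 2 0 0) w2"
    using dS[OF i(1)] plug_commdiff(1)[OF \<mu>(1) a da] Sc[OF tc[OF i(1) da]] Sc[OF pc'[OF i(2)]] 
    by (simp add: ksign_def w2_def di V20.a_comm)
  have dw1: "diff P (ix 2 0 0) w1 = ?S (?T ?k \<eta>) \<oplus>\<^bsub>\<C> 2 0 (- 1)\<^esub> ?S (?T h ?da)"
    unfolding w1_def dS[OF h(1)] h(2) 1 ..
  have T: "?T h' \<eta>' = (?T h \<eta> \<oplus>\<^bsub>\<C> 2 0 (- 1)\<^esub> ?T ?k \<eta>) \<oplus>\<^bsub>\<C> 2 0 (- 1)\<^esub> (?T h ?da \<oplus>\<^bsub>\<C> 2 0 (- 1)\<^esub> ?T ?k ?da)"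
    unfolding h'_def \<eta>'_def
    using linear_maps_add[OF plug_right \<eta>(1) da, of "h \<oplus>\<^bsub>\<C> 1 1 0\<^esub> ?k" 0] h(1) k
      linear_maps_add[OF plug_left[OF \<eta>(1)] h(1) k] linear_maps_add[OF plug_left[OF da] h(1) k] by simp
  have "?S (?T h' \<eta>') = (?S (?T h \<eta>) \<oplus>\<^bsub>\<C> 2 0 (- 1)\<^esub> ?S (?T ?k \<eta>)) \<oplus>\<^bsub>\<C> 2 0 (- 1)\<^esub> (?S (?T h ?da) \<oplus>\<^bsub>\<C> 2 0 (- 1)\<^esub> ?S (?T ?k ?da))"
    unfolding T using tc h(1) k \<eta>(1) da by (simp add: linear_maps_add[OF alternation_linear])
  also have "\<dots> = ?S (?T h \<eta>) \<oplus>\<^bsub>\<C> 2 0 (- 1)\<^esub> (diff P (ix 2 0 0) w1 \<oplus>\<^bsub>\<C> 2 0 (- 1)\<^esub> diff P (ix 2 0 0) w2)"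
    unfolding dw1 2[symmetric] using Sc tc h(1) k \<eta>(1) da by (simp add: V20.a_ac)
  finally have "?S (?T h' \<eta>') = ?S (?T h \<eta>) \<oplus>\<^bsub>\<C> 2 0 (- 1)\<^esub> diff P (ix 2 0 0) (w1 \<oplus>\<^bsub>\<C> 2 0 0\<^esub> w2)"
    using linear_maps_add[OF diff_lin w] by simp
  then show thesis using that[OF M', of "w1 \<oplus>\<^bsub>\<C> 2 0 0\<^esub> w2"] w by simp
qed

end

section \<open>Transport of Massey systems along morphisms\<close>

lemma dg_operad_morphismD:
  assumes "dg_operad_morphism P Q f"
  shows "f s \<in> linear_maps (component P s) (component Q s)"
    "\<sigma> \<in> perms (ar s) \<Longrightarrow> p \<in> carrier (component P s) \<Longrightarrow> f s (act P s \<sigma> p) = act Q s \<sigma> (f s p)"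
    "p \<in> carrier (component P s) \<Longrightarrow> q \<in> carrier (component P t) \<Longrightarrow> i < ar s (out t) \<Longrightarrow>
      f (comp_idx s t) (pcomp P s i t p q) = pcomp Q s i t (f s p) (f t q)"
    "p \<in> carrier (component P s) \<Longrightarrow> f (shift (- 1) s) (diff P s p) = diff Q s (f s p)"
  using assms by (auto simp: dg_operad_morphism_def)

context
  fixes P :: "('k::field, 'a) dg_operad_data" and Q :: "('k, 'b) dg_operad_data" and f
  assumes f: "dg_operad_morphism P Q f" and P: "\<And>n m d. vs (component P (ix n m d))" 
    and Q: "\<And>n m d. vs (component Q (ix n m d))"
begin

lemma morphism_diff:
  "p \<in> carrier (component P (ix n m d)) \<Longrightarrow> f (ix n m (d - 1)) (diff P (ix n m d) p) = diff Q (ix n m d) (f (ix n m d) p)"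
  using dg_operad_morphismD(4)[OF f, of p "ix n m d"] by simp

lemma morphism_cycle:
  "cycle P (ix n m d) p \<Longrightarrow> cycle Q (ix n m d) (f (ix n m d) p)"
  using morphism_diff[of p n m d] linear_maps_zero[OF P Q dg_operad_morphismD(1)[OF f], of n m "d - 1"]
    linear_maps_closed[OF dg_operad_morphismD(1)[OF f]] by (auto simp: cycle_def)

lemma morphism_boundary:
  assumes "p \<in> boundaries P (ix n m d)"
  shows "f (ix n m d) p \<in> boundaries Q (ix n m d)"
proof -
  obtain c where "c \<in> carrier (component P (ix n m (d + 1)))" "p = diff P (ix n m (d + 1)) c"
    using assms by (auto elim: boundariesE)
  then show ?thesis using morphism_diff[of c n m "d + 1"] linear_maps_closed[OF dg_operad_morphismD(1)[OF f], of c]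
    by (auto simp: boundaries_def)
qed

lemma morphism_ins:
  "\<mu> \<in> carrier (component P (ix 0 2 m)) \<Longrightarrow> q \<in> carrier (component P (ix 1 0 d)) \<Longrightarrow> j < 2 \<Longrightarrow>
    f (ix 1 1 (m + d)) (pcomp P (ix 0 2 m) j (ix 1 0 d) \<mu> q) =
    pcomp Q (ix 0 2 m) j (ix 1 0 d) (f (ix 0 2 m) \<mu>) (f (ix 1 0 d) q)"
  using dg_operad_morphismD(3)[OF f, of \<mu> "ix 0 2 m" q "ix 1 0 d" j] by simp

lemma morphism_commdiff:
  assumes "\<mu> \<in> carrier (component P (ix 0 2 m))" "q \<in> carrier (component P (ix 1 0 d))"
    and "\<And>j. j < 2 \<Longrightarrow> pcomp P (ix 0 2 m) j (ix 1 0 d) \<mu> q \<in> carrier (component P (ix 1 1 (m + d)))"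
  shows "f (ix 1 1 (m + d)) (commdiff P m d \<mu> q) = commdiff Q m d (f (ix 0 2 m) \<mu>) (f (ix 1 0 d) q)"
  using linear_maps_minus[OF P Q dg_operad_morphismD(1)[OF f] assms(3)[of 0] assms(3)[of 1]] 
    morphism_ins[OF assms(1,2)] by (simp add: commdiff_def)

lemma morphism_plug:
  "p \<in> carrier (component P (ix 1 1 m)) \<Longrightarrow> q \<in> carrier (component P (ix 1 0 d)) \<Longrightarrow>
    f (ix 2 0 (m + d)) (plug P m d p q) = plug Q m d (f (ix 1 1 m) p) (f (ix 1 0 d) q)"
  using dg_operad_morphismD(3)[OF f, of p "ix 1 1 m" q "ix 1 0 d" 0] by (simp add: plug_def)

lemma morphism_alternation:
  assumes "y \<in> carrier (component P (ix 2 0 d))" "act P (ix 2 0 d) cswap y \<in> carrier (component P (ix 2 0 d))"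
  shows "f (ix 2 0 d) (alternation P d y) = alternation Q d (f (ix 2 0 d) y)"
  using linear_maps_minus[OF P Q dg_operad_morphismD(1)[OF f] assms] dg_operad_morphismD(2)[OF f, of cswap "ix 2 0 d" y] assms
  by (simp add: alternation_def)

end

lemma quasi_isomorphism_morphism: "quasi_isomorphism P Q f \<Longrightarrow> dg_operad_morphism P Q f"
  by (simp add: quasi_isomorphism_def)

lemma dg_operad'I: "dg_operad P \<Longrightarrow> dg_operad' P"
  by (rule dg_operad'.intro)

context dg_operad'
begin

lemma ins_closed:
  "\<mu> \<in> carrier (\<C> 0 2 m) \<Longrightarrow> q \<in> carrier (\<C> 1 0 d) \<Longrightarrow> j < 2 \<Longrightarrow>
    pcomp P (ix 0 2 m) j (ix 1 0 d) \<mu> q \<in> carrier (\<C> 1 1 (m + d))"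
  using linear_maps_closed[OF ins_linear(1)] by blast

lemma plug_closed:
  "p \<in> carrier (\<C> 1 1 m) \<Longrightarrow> q \<in> carrier (\<C> 1 0 d) \<Longrightarrow> plug P m d p q \<in> carrier (\<C> 2 0 (m + d))"
  using linear_maps_closed[OF plug_left] by blast

lemma cswap_closed: "y \<in> carrier (\<C> 2 0 d) \<Longrightarrow> act P (ix 2 0 d) cswap y \<in> carrier (\<C> 2 0 d)"
  using linear_maps_closed[OF act_linear[of cswap "ix 2 0 d"]] by simp

lemma massey_nontrivialI:
  assumes M: "massey_system P \<eta> \<mu> h" 
    and nb: "alternation P (- 1) (plug P 0 (- 1) h \<eta>) \<notin> boundaries P (ix 2 0 (- 1))"
  shows "massey_nontrivial P"
  using assms by (auto simp: massey_nontrivial_def)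

text \<open>Cycles lift through a quasi-isomorphism only up to boundaries. This moves a given triple
  within the homology classes of \<open>\<eta>\<close> and \<open>\<mu>\<close>, to the place where
  lifts exist.\<close>

lemma massey_system_replace:
  assumes M: "massey_system P \<eta> \<mu> h" 
    and nb: "alternation P (- 1) (plug P 0 (- 1) h \<eta>) \<notin> boundaries P (ix 2 0 (- 1))"
    and a: "a \<in> carrier (\<C> 1 0 0)" and b: "b \<in> carrier (\<C> 0 2 1)"
    and \<eta>': "\<eta>' = \<eta> \<oplus>\<^bsub>\<C> 1 0 (- 1)\<^esub> diff P (ix 1 0 0) a"
    and \<mu>': "\<mu>' = \<mu> \<oplus>\<^bsub>\<C> 0 2 0\<^esub> diff P (ix 0 2 1) b"
  obtains h' where "massey_system P \<eta>' \<mu>' h'"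
    "alternation P (- 1) (plug P 0 (- 1) h' \<eta>') \<notin> boundaries P (ix 2 0 (- 1))"
proof -
  let ?V = "\<C> 2 0 (- 1)"
  define h1 where "h1 = h \<oplus>\<^bsub>\<C> 1 1 0\<^esub> commdiff P 1 (- 1) b \<eta>"
  have 1: "massey_system P \<eta> \<mu>' h1" 
    "alternation P (- 1) (plug P 0 (- 1) h1 \<eta>) = alternation P (- 1) (plug P 0 (- 1) h \<eta>)"
    using massey_change_mu[OF M b] by (simp_all add: h1_def \<mu>')
  obtain h2 w where 2: "massey_system P \<eta>' \<mu>' h2" "w \<in> carrier (\<C> 2 0 0)"
    "alternation P (- 1) (plug P 0 (- 1) h2 \<eta>') =
      alternation P (- 1) (plug P 0 (- 1) h1 \<eta>) \<oplus>\<^bsub>?V\<^esub> diff P (ix 2 0 0) w"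
    using massey_change_eta[OF 1(1) a] unfolding \<eta>' by metis
  interpret quotient_space ?V "boundaries P (ix 2 0 (- 1))"
    by (rule quotient_space.intro[OF vspace.intro[OF vsC] quotient_space_axioms.intro[OF boundaries_subspace(1)[OF complex_at_P]]])
  have x: "alternation P (- 1) (plug P 0 (- 1) h \<eta>) \<in> carrier ?V"
    using cycle_alternation_plug[OF M] by (simp add: cycle_def)
  have dw: "diff P (ix 2 0 0) w \<in> boundaries P (ix 2 0 (- 1))" using 2(2) by (auto simp: boundaries_def)
  have dw': "diff P (ix 2 0 0) w \<in> carrier ?V" by (rule subspace_ofD(1)[OF W dw])
  have "alternation P (- 1) (plug P 0 (- 1) h2 \<eta>') \<notin> boundaries P (ix 2 0 (- 1))"
  proof
    assume "alternation P (- 1) (plug P 0 (- 1) h2 \<eta>') \<in> boundaries P (ix 2 0 (- 1))"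
    then have "alternation P (- 1) (plug P 0 (- 1) h2 \<eta>') \<oplus>\<^bsub>?V\<^esub> \<ominus>\<^bsub>?V\<^esub> diff P (ix 2 0 0) w \<in> boundaries P (ix 2 0 (- 1))"
      using subspace_ofD(3)[OF W] W_uminus[OF dw] by blast
    moreover have "alternation P (- 1) (plug P 0 (- 1) h2 \<eta>') \<oplus>\<^bsub>?V\<^esub> \<ominus>\<^bsub>?V\<^esub> diff P (ix 2 0 0) w
       = alternation P (- 1) (plug P 0 (- 1) h \<eta>)"
      unfolding 2(3) 1(2) using x dw' by (simp add: a_assoc r_neg)
    ultimately show False using nb by simp
  qed
  with 2(1) show thesis by (rule that)
qed

text \<open>A bounding element for \<open>c\<close> stays one after composition with the cycle
  \<open>\<eta>\<close> and alternation. Hence the product depends on \<open>h\<close> only modulo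
  boundaries.\<close>

lemma plug_boundary:
  assumes "c \<in> boundaries P (ix 1 1 0)" "cycle P (ix 1 0 (- 1)) \<eta>"
  shows "alternation P (- 1) (plug P 0 (- 1) c \<eta>) \<in> boundaries P (ix 2 0 (- 1))"
proof -
  obtain e where e: "e \<in> carrier (\<C> 1 1 1)" "c = diff P (ix 1 1 1) e" using assms(1) by (auto elim: boundariesE)
  have \<eta>: "\<eta> \<in> carrier (\<C> 1 0 (- 1))" "diff P (ix 1 0 (- 1)) \<eta> = \<zero>\<^bsub>\<C> 1 0 (- 2)\<^esub>" using assms(2) by (auto simp: cycle_def)
  interpret vspace "\<C> 2 0 (- 1)" by (rule vspace.intro[OF vsC])
  have c: "c \<in> carrier (\<C> 1 1 0)" using linear_maps_closed[OF diff_lin e(1)] e(2) by simp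
  have "diff P (ix 2 0 0) (plug P 1 (- 1) e \<eta>) = plug P 0 (- 1) c \<eta>"
    using diff_plug[OF e(1) \<eta>(1)] linear_maps_zero[OF vsC vsC plug_right[OF e(1), of "- 2"]] 
      plug_closed[OF c \<eta>(1)] by (simp add: \<eta> e)
  then have "diff P (ix 2 0 0) (alternation P 0 (plug P 1 (- 1) e \<eta>)) = alternation P (- 1) (plug P 0 (- 1) c \<eta>)"
    using diff_alternation[of _ 0] plug_closed[OF e(1) \<eta>(1)] by simp
  moreover have "alternation P 0 (plug P 1 (- 1) e \<eta>) \<in> carrier (\<C> 2 0 0)"
    using linear_maps_closed[OF alternation_linear] plug_closed[OF e(1) \<eta>(1)] by simp
  ultimately show ?thesis by (force simp: boundaries_def)
qed

lemma cycle_commdiff: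
  assumes \<mu>: "cycle P (ix 0 2 0) \<mu>" and \<eta>: "cycle P (ix 1 0 (- 1)) \<eta>"
  shows "cycle P (ix 1 1 (- 1)) (commdiff P 0 (- 1) \<mu> \<eta>)"
proof -
  have c: "\<mu> \<in> carrier (\<C> 0 2 0)" "\<eta> \<in> carrier (\<C> 1 0 (- 1))" using \<mu> \<eta> by (auto simp: cycle_def)
  interpret vspace "\<C> 1 1 (- 2)" by (rule vspace.intro[OF vsC])
  have "commdiff P (- 1) (- 1) \<zero>\<^bsub>\<C> 0 2 (- 1)\<^esub> \<eta> = \<zero>\<^bsub>\<C> 1 1 (- 2)\<^esub>"
    "commdiff P 0 (- 2) \<mu> \<zero>\<^bsub>\<C> 1 0 (- 2)\<^esub> = \<zero>\<^bsub>\<C> 1 1 (- 2)\<^esub>"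
    using linear_maps_zero[OF vsC vsC commdiff_left[OF c(2), of "- 1"]]
      linear_maps_zero[OF vsC vsC commdiff_right[OF c(1), of "- 2"]] by auto
  then show ?thesis using diff_commdiff[OF c] \<eta> \<mu> linear_maps_closed[OF commdiff_right[OF c(1)] c(2)]
    by (simp add: cycle_def)
qed

lemma alternation_plug_linear:
  assumes "\<eta> \<in> carrier (\<C> 1 0 (- 1))"
  shows "(\<lambda>h. alternation P (- 1) (plug P 0 (- 1) h \<eta>)) \<in> linear_maps (\<C> 1 1 0) (\<C> 2 0 (- 1))"
  using linear_maps_compose[OF plug_left[OF assms, of 0] alternation_linear] by simp

end

locale massey_datum =
  fixes P :: "('k::field, 'a) dg_operad_data" and \<eta> \<mu> h
  assumes vs: "vs (component P (ix n m d))"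
    and complex20: "complex_at P (ix 2 0 (- 1))"
    and massey: "massey_system P \<eta> \<mu> h"
    and ins_closed: "j < 2 \<Longrightarrow> pcomp P (ix 0 2 0) j (ix 1 0 (- 1)) \<mu> \<eta> \<in> carrier (component P (ix 1 1 (- 1)))"
    and plug_closed: "plug P 0 (- 1) h \<eta> \<in> carrier (component P (ix 2 0 (- 1)))"
    and cswap_closed: "act P (ix 2 0 (- 1)) cswap (plug P 0 (- 1) h \<eta>) \<in> carrier (component P (ix 2 0 (- 1)))"
    and cycle: "cycle P (ix 2 0 (- 1)) (alternation P (- 1) (plug P 0 (- 1) h \<eta>))"
    and not_boundary: "alternation P (- 1) (plug P 0 (- 1) h \<eta>) \<notin> boundaries P (ix 2 0 (- 1))"
begin

lemma carriers:
  "\<eta> \<in> carrier (component P (ix 1 0 (- 1)))" "\<mu> \<in> carrier (component P (ix 0 2 0))" "h \<in> carrier (component P (ix 1 1 0))"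
  using massey by (auto simp: massey_system_def cycle_def)

lemma push:
  assumes Y: "dg_operad Y" and qi: "quasi_isomorphism P Y f"
  shows "massey_nontrivial Y"
proof -
  interpret Y: dg_operad' Y by (rule dg_operad'I[OF Y])
  note f = quasi_isomorphism_morphism[OF qi] vs Y.vsC
  have "massey_system Y (f (ix 1 0 (- 1)) \<eta>) (f (ix 0 2 0) \<mu>) (f (ix 1 1 0) h)"
    using massey carriers morphism_cycle[OF f] linear_maps_closed[OF dg_operad_morphismD(1)[OF f(1)]]
      morphism_diff[OF f carriers(3)] morphism_commdiff[OF f carriers(2,1)] ins_closed
    unfolding massey_system_def by simp
  moreover have "f (ix 2 0 (- 1)) (alternation P (- 1) (plug P 0 (- 1) h \<eta>)) =
      alternation Y (- 1) (plug Y 0 (- 1) (f (ix 1 1 0) h) (f (ix 1 0 (- 1)) \<eta>))"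
    using morphism_alternation[OF f plug_closed cswap_closed] morphism_plug[OF f carriers(3,1)] by simp
  moreover interpret quasi_iso_at P Y f "ix 2 0 (- 1)"
    by (rule quasi_iso_at.intro[OF qi complex20 Y.complex_at_P])
  have "f (ix 2 0 (- 1)) (alternation P (- 1) (plug P 0 (- 1) h \<eta>)) \<notin> boundaries Y (ix 2 0 (- 1))"
    using homology_inj[OF cycle] not_boundary by blast
  ultimately show ?thesis using Y.massey_nontrivialI by metis
qed

end

lemma massey_nontrivial_push:
  assumes X: "dg_operad X" and Y: "dg_operad Y" and qi: "quasi_isomorphism X Y f" and M: "massey_nontrivial X"
  shows "massey_nontrivial Y"
proof -
  interpret X: dg_operad' X by (rule dg_operad'I[OF X])
  obtain \<eta> \<mu> h where M: "massey_system X \<eta> \<mu> h" 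
     and nb: "alternation X (- 1) (plug X 0 (- 1) h \<eta>) \<notin> boundaries X (ix 2 0 (- 1))"
    using M by (auto simp: massey_nontrivial_def)
  have c: "\<eta> \<in> carrier (component X (ix 1 0 (- 1)))" "\<mu> \<in> carrier (component X (ix 0 2 0))" "h \<in> carrier (component X (ix 1 1 0))"
    using M by (auto simp: massey_system_def cycle_def)
  have "massey_datum X \<eta> \<mu> h"
    by (rule massey_datum.intro[OF X.vsC X.complex_at_P M _ _ _ X.cycle_alternation_plug[OF M] nb])
      (use X.ins_closed[OF c(2,1)] X.plug_closed[OF c(3,1)] X.cswap_closed[OF X.plug_closed[OF c(3,1)]] in auto)
  then show ?thesis by (rule massey_datum.push[OF _ Y qi])
qed

text \<open>After moving \<open>\<eta>\<close> and \<open>\<mu>\<close> into the image, injectivity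
  on homology provides some bounding element \<open>h1\<close> of the lifted commutator. Its image
  differs from the prescribed one by a cycle, which surjectivity lifts up to a boundary; subtracting
  the lift leaves a discrepancy that does not affect the class.\<close>

lemma massey_nontrivial_pull:
  assumes X: "dg_operad X" and Y: "dg_operad Y" and qi: "quasi_isomorphism X Y f" and M: "massey_nontrivial Y"
  shows "massey_nontrivial X"
proof -
  interpret X: dg_operad' X by (rule dg_operad'I[OF X])
  interpret Y: dg_operad' Y by (rule dg_operad'I[OF Y])
  note f = quasi_isomorphism_morphism[OF qi] X.vsC Y.vsC
  note lin = dg_operad_morphismD(1)[OF f(1)]
  have qat: "quasi_iso_at X Y f s" for s by (rule quasi_iso_at.intro[OF qi X.complex_at_P Y.complex_at_P])
  obtain \<eta>0 \<mu>0 h0 where M0: "massey_system Y \<eta>0 \<mu>0 h0" 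
     and nb0: "alternation Y (- 1) (plug Y 0 (- 1) h0 \<eta>0) \<notin> boundaries Y (ix 2 0 (- 1))"
    using M by (auto simp: massey_nontrivial_def)
  obtain \<eta> a where \<eta>: "cycle X (ix 1 0 (- 1)) \<eta>" and a: "a \<in> carrier (component Y (ix 1 0 0))"
    "f (ix 1 0 (- 1)) \<eta> = \<eta>0 \<oplus>\<^bsub>component Y (ix 1 0 (- 1))\<^esub> diff Y (ix 1 0 0) a"
    using quasi_iso_at.homology_surj[OF qat, of "ix 1 0 (- 1)" \<eta>0] M0 by (auto simp: massey_system_def)
  obtain \<mu> b where \<mu>: "cycle X (ix 0 2 0) \<mu>" and b: "b \<in> carrier (component Y (ix 0 2 1))"
    "f (ix 0 2 0) \<mu> = \<mu>0 \<oplus>\<^bsub>component Y (ix 0 2 0)\<^esub> diff Y (ix 0 2 1) b"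
    using quasi_iso_at.homology_surj[OF qat, of "ix 0 2 0" \<mu>0] M0 by (auto simp: massey_system_def)
  have c: "\<eta> \<in> carrier (component X (ix 1 0 (- 1)))" "\<mu> \<in> carrier (component X (ix 0 2 0))"
    using \<eta> \<mu> by (auto simp: cycle_def)
  obtain h' where M': "massey_system Y (f (ix 1 0 (- 1)) \<eta>) (f (ix 0 2 0) \<mu>) h'"
    and nb': "alternation Y (- 1) (plug Y 0 (- 1) h' (f (ix 1 0 (- 1)) \<eta>)) \<notin> boundaries Y (ix 2 0 (- 1))"
    by (rule Y.massey_system_replace[OF M0 nb0 a(1) b(1) a(2) b(2)])
  have h': "h' \<in> carrier (component Y (ix 1 1 0))" "diff Y (ix 1 1 0) h' = f (ix 1 1 (- 1)) (commdiff X 0 (- 1) \<mu> \<eta>)"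
    using M' morphism_commdiff[OF f c(2,1) X.ins_closed[OF c(2,1)]] by (auto simp: massey_system_def)
  have cc: "commdiff X 0 (- 1) \<mu> \<eta> \<in> carrier (component X (ix 1 1 (- 1)))"
    using linear_maps_closed[OF X.commdiff_right[OF c(2)] c(1)] by simp
  have "cycle X (ix 1 1 (- 1)) (commdiff X 0 (- 1) \<mu> \<eta>)" by (rule X.cycle_commdiff[OF \<mu> \<eta>])
  moreover have "f (ix 1 1 (- 1)) (commdiff X 0 (- 1) \<mu> \<eta>) \<in> boundaries Y (ix 1 1 (- 1))"
    using h' by (force simp: boundaries_def)
  ultimately have "commdiff X 0 (- 1) \<mu> \<eta> \<in> boundaries X (ix 1 1 (- 1))"
    using quasi_iso_at.homology_inj[OF qat] by blast
  then obtain h1 where h1: "h1 \<in> carrier (component X (ix 1 1 0))" "diff X (ix 1 1 0) h1 = commdiff X 0 (- 1) \<mu> \<eta>"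
    by (auto elim: boundariesE)
  interpret X11: vspace "component X (ix 1 1 0)" by (rule vspace.intro[OF X.vsC])
  interpret X11': vspace "component X (ix 1 1 (- 1))" by (rule vspace.intro[OF X.vsC])
  interpret Y11: vspace "component Y (ix 1 1 0)" by (rule vspace.intro[OF Y.vsC])
  interpret Y11': vspace "component Y (ix 1 1 (- 1))" by (rule vspace.intro[OF Y.vsC])
  interpret Y20: quotient_space "component Y (ix 2 0 (- 1))" "boundaries Y (ix 2 0 (- 1))"
    by (rule quotient_space.intro[OF vspace.intro[OF Y.vsC] quotient_space_axioms.intro[OF boundaries_subspace(1)[OF Y.complex_at_P]]])
  let ?f = "f (ix 1 1 0)" and ?A = "\<lambda>h. alternation Y (- 1) (plug Y 0 (- 1) h (f (ix 1 0 (- 1)) \<eta>))"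
  have fh1: "?f h1 \<in> carrier (component Y (ix 1 1 0))" using linear_maps_closed[OF lin h1(1)] .
  have "diff Y (ix 1 1 0) (?f h1) = diff Y (ix 1 1 0) h'"
    using morphism_diff[OF f h1(1)] h1(2) h'(2) by simp
  then have "cycle Y (ix 1 1 0) (?f h1 \<ominus>\<^bsub>component Y (ix 1 1 0)\<^esub> h')"
    using linear_maps_minus[OF Y.vsC Y.vsC Y.diff_lin fh1 h'(1)] fh1 h'(1) linear_maps_closed[OF Y.diff_lin h'(1)] 
    by (simp add: cycle_def a_minus_def Y11'.r_neg)
  then obtain z e where z: "cycle X (ix 1 1 0) z" and e: "e \<in> carrier (component Y (ix 1 1 1))"
    "?f z = (?f h1 \<ominus>\<^bsub>component Y (ix 1 1 0)\<^esub> h') \<oplus>\<^bsub>component Y (ix 1 1 0)\<^esub> diff Y (ix 1 1 1) e"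
    using quasi_iso_at.homology_surj[OF qat, of "ix 1 1 0"] by auto
  have zc: "z \<in> carrier (component X (ix 1 1 0))" "?f z \<in> carrier (component Y (ix 1 1 0))"
    using z linear_maps_closed[OF lin] by (auto simp: cycle_def)
  have de: "diff Y (ix 1 1 1) e \<in> carrier (component Y (ix 1 1 0))" "diff Y (ix 1 1 1) e \<in> boundaries Y (ix 1 1 0)"
    using linear_maps_closed[OF Y.diff_lin e(1)] e(1) by (auto simp: boundaries_def)
  \<comment> \<open>The cycle \<open>z\<close> is subtracted so that the image of \<open>h\<close>
    differs from \<open>h'\<close> by a boundary only.\<close>
  define h where "h = h1 \<ominus>\<^bsub>component X (ix 1 1 0)\<^esub> z"
  have h: "h \<in> carrier (component X (ix 1 1 0))" using h1(1) zc by (simp add: h_def)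
  have "diff X (ix 1 1 0) h = commdiff X 0 (- 1) \<mu> \<eta>"
    unfolding h_def using linear_maps_minus[OF X.vsC X.vsC X.diff_lin h1(1) zc(1)] z cc h1(2)
    by (simp add: cycle_def a_minus_def)
  then have Mh: "massey_system X \<eta> \<mu> h" using \<eta> \<mu> h by (simp add: massey_system_def)
  have fh: "h' = ?f h \<oplus>\<^bsub>component Y (ix 1 1 0)\<^esub> diff Y (ix 1 1 1) e"
  proof -
    have "?f h = ?f h1 \<ominus>\<^bsub>component Y (ix 1 1 0)\<^esub> ((?f h1 \<ominus>\<^bsub>component Y (ix 1 1 0)\<^esub> h') \<oplus>\<^bsub>component Y (ix 1 1 0)\<^esub> diff Y (ix 1 1 1) e)"
      unfolding h_def e(2)[symmetric] by (rule linear_maps_minus[OF X.vsC Y.vsC lin h1(1) zc(1)])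
    then show ?thesis using fh1 h'(1) de(1)
      by (simp add: a_minus_def Y11.minus_add Y11.a_assoc Y11.r_neg2 Y11.l_neg)
  qed
  have f\<eta>: "f (ix 1 0 (- 1)) \<eta> \<in> carrier (component Y (ix 1 0 (- 1)))" using linear_maps_closed[OF lin c(1)] .
  have "alternation X (- 1) (plug X 0 (- 1) h \<eta>) \<notin> boundaries X (ix 2 0 (- 1))"
  proof
    assume "alternation X (- 1) (plug X 0 (- 1) h \<eta>) \<in> boundaries X (ix 2 0 (- 1))"
    then have "f (ix 2 0 (- 1)) (alternation X (- 1) (plug X 0 (- 1) h \<eta>)) \<in> boundaries Y (ix 2 0 (- 1))"
      by (rule morphism_boundary[OF f])
    then have "?A (?f h) \<in> boundaries Y (ix 2 0 (- 1))"
      using morphism_alternation[OF f, of "plug X 0 (- 1) h \<eta>" "- 1"] X.plug_closed[OF h c(1)] 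
      X.cswap_closed[OF X.plug_closed[OF h c(1)]] morphism_plug[OF f h c(1)] by simp
    moreover have "?A (diff Y (ix 1 1 1) e) \<in> boundaries Y (ix 2 0 (- 1))"
      using Y.plug_boundary[OF de(2)] M' by (simp add: massey_system_def)
    ultimately show False
      using linear_maps_add[OF Y.alternation_plug_linear[OF f\<eta>] linear_maps_closed[OF lin h] de(1)] nb' 
        subspace_ofD(3)[OF Y20.W] unfolding fh[symmetric] by metis
  qed
  with Mh show ?thesis by (rule X.massey_nontrivialI)
qed

text \<open>In addition to \<open>massey_datum\<close>: nothing bounds in the places of
  \<open>\<eta>\<close> and \<open>\<mu>\<close>, so lifts of them are exact; and no cycles other
  than zero exist in the place of \<open>h\<close>, so \<open>h\<close> is determined by its
  boundary and homology vanishes there.\<close>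

locale massey_model = massey_datum P \<eta> \<mu> h for P :: "('k::field, 'a) dg_operad_data" and \<eta> \<mu> h +
  assumes complex: "\<And>d. complex_at P (ix 1 0 d)" "\<And>d. complex_at P (ix 0 2 d)"
      "\<And>d. complex_at P (ix 1 1 d)" "\<And>d. complex_at P (ix 2 0 d)"
    and trivial: "carrier (component P (ix 1 0 0)) \<subseteq> {\<zero>\<^bsub>component P (ix 1 0 0)\<^esub>}"
      "carrier (component P (ix 0 2 1)) \<subseteq> {\<zero>\<^bsub>component P (ix 0 2 1)\<^esub>}"
      "carrier (component P (ix 1 1 (- 2))) \<subseteq> {\<zero>\<^bsub>component P (ix 1 1 (- 2))\<^esub>}"
    and acyclic: "y \<in> carrier (component P (ix 1 1 0)) \<Longrightarrow>
      diff P (ix 1 1 0) y = \<zero>\<^bsub>component P (ix 1 1 (- 1))\<^esub> \<Longrightarrow> y = \<zero>\<^bsub>component P (ix 1 1 0)\<^esub>"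
    and ins_closed': "m \<in> carrier (component P (ix 0 2 0)) \<Longrightarrow> n \<in> carrier (component P (ix 1 0 (- 1))) \<Longrightarrow>
      j < 2 \<Longrightarrow> pcomp P (ix 0 2 0) j (ix 1 0 (- 1)) m n \<in> carrier (component P (ix 1 1 (- 1)))"
begin

lemma boundaries_trivial:
  "boundaries P (ix 1 0 (- 1)) = {\<zero>\<^bsub>component P (ix 1 0 (- 1))\<^esub>}"
  "boundaries P (ix 0 2 0) = {\<zero>\<^bsub>component P (ix 0 2 0)\<^esub>}"
proof -
  have "diff P (ix 1 0 0) \<zero>\<^bsub>component P (ix 1 0 0)\<^esub> = \<zero>\<^bsub>component P (ix 1 0 (- 1))\<^esub>"
    using linear_maps_zero[OF vs vs, of "diff P (ix 1 0 0)" 1 0 0 1 0 "- 1"] complex_atD(4)[OF complex(1), of 0] by simp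
  moreover have "\<zero>\<^bsub>component P (ix 1 0 (- 1))\<^esub> \<in> boundaries P (ix 1 0 (- 1))"
    using subspace_ofD(2)[OF boundaries_subspace(1)[OF complex(1)]] .
  ultimately show "boundaries P (ix 1 0 (- 1)) = {\<zero>\<^bsub>component P (ix 1 0 (- 1))\<^esub>}"
    using trivial(1) by (auto simp: boundaries_def) 
  have "diff P (ix 0 2 1) \<zero>\<^bsub>component P (ix 0 2 1)\<^esub> = \<zero>\<^bsub>component P (ix 0 2 0)\<^esub>"
    using linear_maps_zero[OF vs vs, of "diff P (ix 0 2 1)" 0 2 1 0 2 0] complex_atD(4)[OF complex(2), of 1] by simp
  moreover have "\<zero>\<^bsub>component P (ix 0 2 0)\<^esub> \<in> boundaries P (ix 0 2 0)"
    using subspace_ofD(2)[OF boundaries_subspace(1)[OF complex(2)]] .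
  ultimately show "boundaries P (ix 0 2 0) = {\<zero>\<^bsub>component P (ix 0 2 0)\<^esub>}"
    using trivial(2) by (auto simp: boundaries_def)
qed

text \<open>The counterpart of \<open>massey_nontrivial_pull\<close> with a target not known to be a
  dg operad. Lifts of \<open>\<eta>\<close> and \<open>\<mu>\<close> are exact, and any lift of the
  bounding element maps to \<open>h\<close> itself, because both have the same boundary.\<close>

lemma pull:
  assumes X: "dg_operad X" and qi: "quasi_isomorphism X P g"
  shows "massey_nontrivial X"
proof -
  interpret X: dg_operad' X by (rule dg_operad'I[OF X])
  note g = quasi_isomorphism_morphism[OF qi] X.vsC vs
  note lin = dg_operad_morphismD(1)[OF g(1)]
  have qat: "quasi_iso_at X P g s" if "complex_at P s" for s
    by (rule quasi_iso_at.intro[OF qi X.complex_at_P that])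
  interpret P10: vspace "component P (ix 1 0 (- 1))" by (rule vspace.intro[OF vs])
  interpret P02: vspace "component P (ix 0 2 0)" by (rule vspace.intro[OF vs])
  obtain \<eta>' where \<eta>': "cycle X (ix 1 0 (- 1)) \<eta>'" "g (ix 1 0 (- 1)) \<eta>' = \<eta>"
  proof -
    obtain p c where "cycle X (ix 1 0 (- 1)) p" "c \<in> carrier (component P (ix 1 0 0))"
      "g (ix 1 0 (- 1)) p = \<eta> \<oplus>\<^bsub>component P (ix 1 0 (- 1))\<^esub> diff P (ix 1 0 0) c"
      using quasi_iso_at.homology_surj[OF qat[OF complex(1)[of "- 1"]], of \<eta>] massey by (auto simp: massey_system_def)
    moreover have "diff P (ix 1 0 0) c \<in> boundaries P (ix 1 0 (- 1))" 
      using calculation by (auto simp: boundaries_def)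
    ultimately show thesis using that boundaries_trivial(1) carriers(1) by simp
  qed
  obtain \<mu>' where \<mu>': "cycle X (ix 0 2 0) \<mu>'" "g (ix 0 2 0) \<mu>' = \<mu>"
  proof -
    obtain p c where "cycle X (ix 0 2 0) p" "c \<in> carrier (component P (ix 0 2 1))"
      "g (ix 0 2 0) p = \<mu> \<oplus>\<^bsub>component P (ix 0 2 0)\<^esub> diff P (ix 0 2 1) c"
      using quasi_iso_at.homology_surj[OF qat[OF complex(2)[of 0]], of \<mu>] massey by (auto simp: massey_system_def)
    moreover have "diff P (ix 0 2 1) c \<in> boundaries P (ix 0 2 0)" 
      using calculation by (auto simp: boundaries_def)
    ultimately show thesis using that boundaries_trivial(2) carriers(2) by simp
  qed
  have c: "\<eta>' \<in> carrier (component X (ix 1 0 (- 1)))" "\<mu>' \<in> carrier (component X (ix 0 2 0))"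
    using \<eta>' \<mu>' by (auto simp: cycle_def)
  have gc: "g (ix 1 1 (- 1)) (commdiff X 0 (- 1) \<mu>' \<eta>') = diff P (ix 1 1 0) h"
    using morphism_commdiff[OF g c(2,1) X.ins_closed[OF c(2,1)]] massey by (simp add: \<eta>' \<mu>' massey_system_def)
  have cc: "commdiff X 0 (- 1) \<mu>' \<eta>' \<in> carrier (component X (ix 1 1 (- 1)))"
    using linear_maps_closed[OF X.commdiff_right[OF c(2)] c(1)] by simp
  have "cycle X (ix 1 1 (- 1)) (commdiff X 0 (- 1) \<mu>' \<eta>')"
    using X.cycle_commdiff[OF \<mu>'(1) \<eta>'(1)] .
  moreover have "g (ix 1 1 (- 1)) (commdiff X 0 (- 1) \<mu>' \<eta>') \<in> boundaries P (ix 1 1 (- 1))"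
    unfolding gc using carriers(3) by (auto simp: boundaries_def)
  ultimately have "commdiff X 0 (- 1) \<mu>' \<eta>' \<in> boundaries X (ix 1 1 (- 1))"
    using quasi_iso_at.homology_inj[OF qat[OF complex(3)]] by blast
  then obtain h' where h': "h' \<in> carrier (component X (ix 1 1 0))" "diff X (ix 1 1 0) h' = commdiff X 0 (- 1) \<mu>' \<eta>'"
    by (auto elim: boundariesE)
  have M: "massey_system X \<eta>' \<mu>' h'" using \<eta>' \<mu>' h' by (simp add: massey_system_def)
  have gh': "g (ix 1 1 0) h' \<in> carrier (component P (ix 1 1 0))" using linear_maps_closed[OF lin h'(1)] .
  interpret P11: vspace "component P (ix 1 1 0)" by (rule vspace.intro[OF vs])
  interpret P11': vspace "component P (ix 1 1 (- 1))" by (rule vspace.intro[OF vs])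
  have dlin: "diff P (ix 1 1 0) \<in> linear_maps (component P (ix 1 1 0)) (component P (ix 1 1 (- 1)))"
    using complex_atD(4)[OF complex(3), of 0] by simp
  have "diff P (ix 1 1 0) (g (ix 1 1 0) h') = diff P (ix 1 1 0) h"
    using morphism_diff[OF g h'(1)] h'(2) gc by simp
  then have "diff P (ix 1 1 0) (g (ix 1 1 0) h' \<ominus>\<^bsub>component P (ix 1 1 0)\<^esub> h) = \<zero>\<^bsub>component P (ix 1 1 (- 1))\<^esub>"
    using linear_maps_minus[OF vs vs dlin gh' carriers(3)] linear_maps_closed[OF dlin carriers(3)]
    by (simp add: a_minus_def P11'.r_neg)
  then have "g (ix 1 1 0) h' \<ominus>\<^bsub>component P (ix 1 1 0)\<^esub> h = \<zero>\<^bsub>component P (ix 1 1 0)\<^esub>"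
    using acyclic gh' carriers(3) by simp
  moreover have "(g (ix 1 1 0) h' \<ominus>\<^bsub>component P (ix 1 1 0)\<^esub> h) \<oplus>\<^bsub>component P (ix 1 1 0)\<^esub> h = g (ix 1 1 0) h'"
    using gh' carriers(3) by (simp add: a_minus_def P11.a_assoc P11.l_neg)
  ultimately have gh: "g (ix 1 1 0) h' = h" using carriers(3) by simp
  have "alternation X (- 1) (plug X 0 (- 1) h' \<eta>') \<notin> boundaries X (ix 2 0 (- 1))"
  proof
    assume "alternation X (- 1) (plug X 0 (- 1) h' \<eta>') \<in> boundaries X (ix 2 0 (- 1))"
    then have "g (ix 2 0 (- 1)) (alternation X (- 1) (plug X 0 (- 1) h' \<eta>')) \<in> boundaries P (ix 2 0 (- 1))"
      by (rule morphism_boundary[OF g])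
    then show False
      using morphism_alternation[OF g, of "plug X 0 (- 1) h' \<eta>'" "- 1"] X.plug_closed[OF h'(1) c(1)] 
      X.cswap_closed[OF X.plug_closed[OF h'(1) c(1)]] morphism_plug[OF g h'(1) c(1)] not_boundary by (simp add: gh \<eta>')
  qed
  with M show ?thesis by (rule X.massey_nontrivialI)
qed

section \<open>Triviality of the Massey product in the homology operad\<close>

abbreviation H where "H \<equiv> homology_operad P"

lemma complex_H: "complex_at H (ix 1 0 d)" "complex_at H (ix 0 2 d)" "complex_at H (ix 1 1 d)" "complex_at H (ix 2 0 d)"
  by (rule complex_at_homology; simp add: complex)+

lemma zero_H: "\<zero>\<^bsub>component H s\<^esub> = boundaries P s"
  by (simp add: homology_operad_def quotient_module_def)

lemma carrier_H11: "carrier (component H (ix 1 1 0)) \<subseteq> {\<zero>\<^bsub>component H (ix 1 1 0)\<^esub>}"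
proof -
  interpret vspace "component P (ix 1 1 0)" by (rule vspace.intro[OF vs])
  have "p = \<zero>\<^bsub>component P (ix 1 1 0)\<^esub>" if "cycle P (ix 1 1 0) p" for p
    using acyclic[of p] that by (simp add: cycle_def)
  moreover have "hcls P (ix 1 1 0) \<zero>\<^bsub>component P (ix 1 1 0)\<^esub> = boundaries P (ix 1 1 0)"
    using subspace_ofD(1)[OF boundaries_subspace(1)[OF complex(3)[of 0]]] by (auto simp: a_r_coset_alt)
  ultimately show ?thesis unfolding zero_H carrier_homology by auto
qed

text \<open>The component of the homology operad that receives \<open>h'\<close> is zero, so the
  product has the same image as the product formed with \<open>h' = 0\<close>. Injectivity on
  homology makes it a boundary.\<close>

lemma not_nontrivial_push:
  assumes Y: "dg_operad Y" and qi: "quasi_isomorphism Y H f"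
  shows "\<not> massey_nontrivial Y"
proof
  assume "massey_nontrivial Y"
  then obtain \<eta>' \<mu>' h' where M: "massey_system Y \<eta>' \<mu>' h'" 
     and nb: "alternation Y (- 1) (plug Y 0 (- 1) h' \<eta>') \<notin> boundaries Y (ix 2 0 (- 1))"
    by (auto simp: massey_nontrivial_def)
  interpret Y: dg_operad' Y by (rule dg_operad'I[OF Y])
  note f = quasi_isomorphism_morphism[OF qi]
  note lin = dg_operad_morphismD(1)[OF f]
  have c: "\<eta>' \<in> carrier (component Y (ix 1 0 (- 1)))" "h' \<in> carrier (component Y (ix 1 1 0))"
    using M by (auto simp: massey_system_def cycle_def)
  let ?z = "\<zero>\<^bsub>component Y (ix 1 1 0)\<^esub>"
  interpret Y11: vspace "component Y (ix 1 1 0)" by (rule vspace.intro[OF Y.vsC])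
  interpret H20: vspace "component H (ix 2 0 (- 1))" by (rule vspace.intro[OF complex_atD(2)[OF complex_H(4)]])
  have eq: "f (ix 1 1 0) h' = f (ix 1 1 0) ?z"
    using linear_maps_closed[OF lin c(2)] linear_maps_closed[OF lin Y11.zero_closed] carrier_H11 by auto
  have p: "plug Y 0 (- 1) p \<eta>' \<in> carrier (component Y (ix 2 0 (- 1)))" if "p \<in> carrier (component Y (ix 1 1 0))" for p
    using Y.plug_closed[OF that c(1)] by simp
  have fp: "f (ix 2 0 (- 1)) (plug Y 0 (- 1) p \<eta>') = pcomp H (ix 1 1 0) 0 (ix 1 0 (- 1)) (f (ix 1 1 0) p) (f (ix 1 0 (- 1)) \<eta>')"
    if "p \<in> carrier (component Y (ix 1 1 0))" for p
    using dg_operad_morphismD(3)[OF f that c(1), of 0] by (simp add: plug_def)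
  have "f (ix 2 0 (- 1)) (alternation Y (- 1) (plug Y 0 (- 1) h' \<eta>')) = f (ix 2 0 (- 1)) (alternation Y (- 1) (plug Y 0 (- 1) ?z \<eta>'))"
    unfolding alternation_def
    using linear_maps_minus[OF Y.vsC complex_atD(2)[OF complex_H(4)] lin p[OF c(2)] Y.cswap_closed[OF p[OF c(2)]]]
      linear_maps_minus[OF Y.vsC complex_atD(2)[OF complex_H(4)] lin p[OF Y11.zero_closed] Y.cswap_closed[OF p[OF Y11.zero_closed]]]
      dg_operad_morphismD(2)[OF f, of cswap "ix 2 0 (- 1)"] p[OF c(2)] p[OF Y11.zero_closed] fp[OF c(2)] fp[OF Y11.zero_closed] eq
    by simp
  also have "\<dots> = \<zero>\<^bsub>component H (ix 2 0 (- 1))\<^esub>"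
    using linear_maps_zero[OF Y.vsC Y.vsC Y.alternation_plug_linear[OF c(1)]] 
      linear_maps_zero[OF Y.vsC complex_atD(2)[OF complex_H(4)] lin] by simp
  finally have "f (ix 2 0 (- 1)) (alternation Y (- 1) (plug Y 0 (- 1) h' \<eta>')) \<in> boundaries H (ix 2 0 (- 1))"
    using subspace_ofD(2)[OF boundaries_subspace(1)[OF complex_H(4)]] by simp
  then show False
    using quasi_iso_at.homology_inj[OF quasi_iso_at.intro[OF qi Y.complex_at_P complex_H(4)] Y.cycle_alternation_plug[OF M]] nb
    by blast
qed

text \<open>The classes involved are one-element sets, as there are no boundaries in these places,
  so composing classes is composing their elements. The composite is a cycle because the component
  that receives its boundary is zero.\<close>

lemma ins_closed_H:
  assumes X: "X \<in> carrier (component H (ix 0 2 0))" and Y: "Y \<in> carrier (component H (ix 1 0 (- 1)))" and j: "j < 2"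
  shows "pcomp H (ix 0 2 0) j (ix 1 0 (- 1)) X Y \<in> carrier (component H (ix 1 1 (- 1)))"
proof -
  interpret P10: vspace "component P (ix 1 0 (- 1))" by (rule vspace.intro[OF vs])
  interpret P02: vspace "component P (ix 0 2 0)" by (rule vspace.intro[OF vs])
  interpret P11: vspace "component P (ix 1 1 (- 1))" by (rule vspace.intro[OF vs])
  obtain m where m: "m \<in> carrier (component P (ix 0 2 0))" "X = {m}"
    using X unfolding carrier_homology boundaries_trivial by (auto simp: cycle_def a_r_coset_alt)
  obtain n where n: "n \<in> carrier (component P (ix 1 0 (- 1)))" "Y = {n}"
    using Y unfolding carrier_homology boundaries_trivial by (auto simp: cycle_def a_r_coset_alt)
  let ?p = "pcomp P (ix 0 2 0) j (ix 1 0 (- 1)) m n"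
  have p: "?p \<in> carrier (component P (ix 1 1 (- 1)))" by (rule ins_closed'[OF m(1) n(1) j])
  then have "diff P (ix 1 1 (- 1)) ?p \<in> carrier (component P (ix 1 1 (- 2)))"
    using linear_maps_closed[OF complex_atD(4)[OF complex(3)]] by fastforce
  then have "cycle P (ix 1 1 (- 1)) ?p" using trivial(3) p by (auto simp: cycle_def)
  moreover have "pcomp H (ix 0 2 0) j (ix 1 0 (- 1)) X Y = hcls P (ix 1 1 (- 1)) ?p"
    by (simp add: homology_operad_def m n coset_map_def set_add_alt a_r_coset_alt) blast
  ultimately show ?thesis unfolding carrier_homology by blast
qed

text \<open>The commutator of lifted classes maps to a boundary, so it bounds in the homology operad
  and is therefore zero there. This makes \<open>h\<close> a cycle; as the homology in its place
  vanishes, \<open>h\<close> is a boundary and \<open>plug_boundary\<close> applies.\<close>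

lemma not_nontrivial_pull:
  assumes Y: "dg_operad Y" and qi: "quasi_isomorphism H Y g"
  shows "\<not> massey_nontrivial Y"
proof
  assume "massey_nontrivial Y"
  then obtain \<eta>0 \<mu>0 h0 where M0: "massey_system Y \<eta>0 \<mu>0 h0" 
     and nb0: "alternation Y (- 1) (plug Y 0 (- 1) h0 \<eta>0) \<notin> boundaries Y (ix 2 0 (- 1))"
    by (auto simp: massey_nontrivial_def)
  interpret Y: dg_operad' Y by (rule dg_operad'I[OF Y])
  note g = quasi_isomorphism_morphism[OF qi]
  note lin = dg_operad_morphismD(1)[OF g]
  have qat: "quasi_iso_at H Y g s" if "complex_at H s" for s
    by (rule quasi_iso_at.intro[OF qi that Y.complex_at_P])
  obtain n a where n: "cycle H (ix 1 0 (- 1)) n" and a: "a \<in> carrier (component Y (ix 1 0 0))"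
    "g (ix 1 0 (- 1)) n = \<eta>0 \<oplus>\<^bsub>component Y (ix 1 0 (- 1))\<^esub> diff Y (ix 1 0 0) a"
    using quasi_iso_at.homology_surj[OF qat[OF complex_H(1)[of "- 1"]], of \<eta>0] M0 by (auto simp: massey_system_def)
  obtain m b where m: "cycle H (ix 0 2 0) m" and b: "b \<in> carrier (component Y (ix 0 2 1))"
    "g (ix 0 2 0) m = \<mu>0 \<oplus>\<^bsub>component Y (ix 0 2 0)\<^esub> diff Y (ix 0 2 1) b"
    using quasi_iso_at.homology_surj[OF qat[OF complex_H(2)[of 0]], of \<mu>0] M0 by (auto simp: massey_system_def)
  have c: "m \<in> carrier (component H (ix 0 2 0))" "n \<in> carrier (component H (ix 1 0 (- 1)))"
    using n m by (auto simp: cycle_def)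
  obtain h where M: "massey_system Y (g (ix 1 0 (- 1)) n) (g (ix 0 2 0) m) h"
    and nb: "alternation Y (- 1) (plug Y 0 (- 1) h (g (ix 1 0 (- 1)) n)) \<notin> boundaries Y (ix 2 0 (- 1))"
    by (rule Y.massey_system_replace[OF M0 nb0 a(1) b(1) a(2) b(2)])
  interpret H11: vspace "component H (ix 1 1 (- 1))" by (rule vspace.intro[OF complex_atD(2)[OF complex_H(3)]])
  interpret Y11: vspace "component Y (ix 1 1 0)" by (rule vspace.intro[OF Y.vsC])
  let ?p = "\<lambda>j. pcomp H (ix 0 2 0) j (ix 1 0 (- 1)) m n" and ?V = "component H (ix 1 1 (- 1))"
  let ?d = "?p 0 \<ominus>\<^bsub>?V\<^esub> ?p 1"
  have p: "?p j \<in> carrier ?V" if "j < 2" for j by (rule ins_closed_H[OF c that])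
  have "g (ix 1 1 (- 1)) (?p j) = pcomp Y (ix 0 2 0) j (ix 1 0 (- 1)) (g (ix 0 2 0) m) (g (ix 1 0 (- 1)) n)" if "j < 2" for j
    using dg_operad_morphismD(3)[OF g c, of j] that by simp
  then have gd: "g (ix 1 1 (- 1)) ?d = commdiff Y 0 (- 1) (g (ix 0 2 0) m) (g (ix 1 0 (- 1)) n)"
    using linear_maps_minus[OF complex_atD(2)[OF complex_H(3)] Y.vsC lin p p, of 0 1] by (simp add: commdiff_def)
  have h: "h \<in> carrier (component Y (ix 1 1 0))" "diff Y (ix 1 1 0) h = g (ix 1 1 (- 1)) ?d"
    using M gd by (auto simp: massey_system_def)
  have dz: "diff H (ix 1 1 d) y = \<zero>\<^bsub>component H (ix 1 1 (d - 1))\<^esub>" for y d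
    unfolding zero_H by (simp add: homology_operad_def)
  have "cycle H (ix 1 1 (- 1)) ?d" using p[of 0] p[of 1] dz by (simp add: cycle_def)
  moreover have "g (ix 1 1 (- 1)) ?d \<in> boundaries Y (ix 1 1 (- 1))" using h by (force simp: boundaries_def)
  ultimately have "?d \<in> boundaries H (ix 1 1 (- 1))"
    using quasi_iso_at.homology_inj[OF qat[OF complex_H(3)]] by blast
  then have "?d = \<zero>\<^bsub>?V\<^esub>" using dz[of 0] by (auto simp: boundaries_def)
  then have "diff Y (ix 1 1 0) h = \<zero>\<^bsub>component Y (ix 1 1 (- 1))\<^esub>"
    using h(2) linear_maps_zero[OF complex_atD(2)[OF complex_H(3)] Y.vsC lin] by simp
  then have "cycle Y (ix 1 1 0) h" using h by (simp add: cycle_def)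
  then obtain z e where z: "cycle H (ix 1 1 0) z" and e: "e \<in> carrier (component Y (ix 1 1 1))"
    "g (ix 1 1 0) z = h \<oplus>\<^bsub>component Y (ix 1 1 0)\<^esub> diff Y (ix 1 1 1) e"
    using quasi_iso_at.homology_surj[OF qat[OF complex_H(3)[of 0]], of h] by auto
  have "z = \<zero>\<^bsub>component H (ix 1 1 0)\<^esub>" using z carrier_H11 by (auto simp: cycle_def)
  then have eq: "h \<oplus>\<^bsub>component Y (ix 1 1 0)\<^esub> diff Y (ix 1 1 1) e = \<zero>\<^bsub>component Y (ix 1 1 0)\<^esub>"
    using e(2) linear_maps_zero[OF complex_atD(2)[OF complex_H(3)] Y.vsC lin] by simp
  interpret Y20: quotient_space "component Y (ix 1 1 0)" "boundaries Y (ix 1 1 0)"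
    by (rule quotient_space.intro[OF vspace.intro[OF Y.vsC] quotient_space_axioms.intro[OF boundaries_subspace(1)[OF Y.complex_at_P]]])
  have de: "diff Y (ix 1 1 1) e \<in> boundaries Y (ix 1 1 0)" using e(1) by (auto simp: boundaries_def)
  have "h = \<ominus>\<^bsub>component Y (ix 1 1 0)\<^esub> diff Y (ix 1 1 1) e"
    using Y11.minus_equality[OF eq] subspace_ofD(1)[OF Y20.W de] h(1) by simp
  then have "h \<in> boundaries Y (ix 1 1 0)" using Y20.W_uminus[OF de] by simp
  then show False using Y.plug_boundary M nb by (auto simp: massey_system_def)
qed

theorem not_formal: "\<not> formal_via TYPE('x) P"
proof
  assume "formal_via TYPE('x) P"
  then obtain X Y :: "('k, 'x) dg_operad_data" where X: "dg_operad X" and Y: "dg_operad Y" and PX: "quasi_iso_step P X"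
    and XY: "equivclp (\<lambda>X Y. dg_operad X \<and> dg_operad Y \<and> (\<exists>f. quasi_isomorphism X Y f)) X Y"
    and YH: "quasi_iso_step Y H"
    unfolding formal_via_def zigzag_def by blast
  have "massey_nontrivial X"
    using PX push[OF X] pull[OF X] unfolding quasi_iso_step_def by blast
  with XY have "massey_nontrivial Y"
    by (induction rule: equivclp_induct) (use massey_nontrivial_push massey_nontrivial_pull in blast)+
  moreover have "\<not> massey_nontrivial Y"
    using YH not_nontrivial_push[OF Y] not_nontrivial_pull[OF Y] unfolding quasi_iso_step_def by blast
  ultimately show False by contradiction
qed

end

section \<open>Formal linear combinations\<close>

lemma lookup_scal [simp]: "Poly_Mapping.lookup (scal c f) x = c * Poly_Mapping.lookup f x"
  by (auto simp: scal_def Poly_Mapping.map.rep_eq when_def)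

lemma keys_scal: "Poly_Mapping.keys (scal c f) \<subseteq> Poly_Mapping.keys f"
  by (auto simp: in_keys_iff)

global_interpretation scal: Vector_Spaces.vector_space scal
  by unfold_locales (auto intro!: poly_mapping_eqI simp: lookup_add algebra_simps)

text \<open>The linear functional with values \<open>\<phi>\<close> on the basis. Coefficients of a
  linear extension are values of such functionals, which reduces identities between combinations to
  identities of sums.\<close>

definition pair :: "('b \<Rightarrow> 'k::field) \<Rightarrow> ('b \<Rightarrow>\<^sub>0 'k) \<Rightarrow> 'k" where
  "pair \<phi> v = (\<Sum>x\<in>Poly_Mapping.keys v. Poly_Mapping.lookup v x * \<phi> x)"

lemma pair_superset:
  "finite A \<Longrightarrow> Poly_Mapping.keys v \<subseteq> A \<Longrightarrow> pair \<phi> v = (\<Sum>x\<in>A. Poly_Mapping.lookup v x * \<phi> x)"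
  unfolding pair_def by (rule sum.mono_neutral_left) (auto simp: in_keys_iff)

lemma pair_add: "pair \<phi> (v + w) = pair \<phi> v + pair \<phi> w"
proof -
  let ?A = "Poly_Mapping.keys v \<union> Poly_Mapping.keys w"
  have "Poly_Mapping.keys (v + w) \<subseteq> ?A" by (rule Poly_Mapping.keys_add)
  then show ?thesis
    by (simp add: pair_superset[of ?A] lookup_add distrib_right sum.distrib)
qed

lemma pair_scal: "pair \<phi> (scal c v) = c * pair \<phi> v"
  using keys_scal[of c v]
  by (simp add: pair_superset[of "Poly_Mapping.keys v"] sum_distrib_left mult.assoc)

lemma pair_zero [simp]: "pair \<phi> 0 = 0"
  by (simp add: pair_def)

lemma pair_uminus: "pair \<phi> (- v) = - pair \<phi> v"
  using pair_add[of \<phi> v "- v"] by (simp add: eq_neg_iff_add_eq_0 add.commute)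

lemma pair_diff: "pair \<phi> (v - w) = pair \<phi> v - pair \<phi> w"
  using pair_add[of \<phi> v "- w"] by (simp add: pair_uminus)

lemma pair_single [simp]: "pair \<phi> (Poly_Mapping.single x c) = c * \<phi> x"
  by (auto simp: pair_def)

lemma pair_sum: "pair \<phi> (sum f A) = (\<Sum>a\<in>A. pair \<phi> (f a))"
  by (induction A rule: infinite_finite_induct) (auto simp: pair_add)

lemma pair_cong: "(\<And>x. x \<in> Poly_Mapping.keys v \<Longrightarrow> \<phi> x = \<psi> x) \<Longrightarrow> pair \<phi> v = pair \<psi> v"
  by (simp add: pair_def)

lemma pair_mult_left: "pair (\<lambda>x. a * \<phi> x) v = a * pair \<phi> v"
  and pair_mult_right: "pair (\<lambda>x. \<phi> x * a) v = pair \<phi> v * a"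
  and pair_fun_add: "pair (\<lambda>x. \<phi> x + \<psi> x) v = pair \<phi> v + pair \<psi> v"
  and pair_fun_diff: "pair (\<lambda>x. \<phi> x - \<psi> x) v = pair \<phi> v - pair \<psi> v"
  and pair_fun_uminus: "pair (\<lambda>x. - \<phi> x) v = - pair \<phi> v"
  and pair_fun_zero [simp]: "pair (\<lambda>x. 0) v = 0"
  by (simp_all add: pair_def sum.distrib algebra_simps sum_distrib_left sum_subtractf sum_negf)

lemma lookup_lin_ext: "Poly_Mapping.lookup (lin_ext g v) y = pair (\<lambda>x. Poly_Mapping.lookup (g x) y) v"
  by (simp add: lin_ext_def pair_def lookup_sum)

lemma lin_ext_add: "lin_ext g (v + w) = lin_ext g v + lin_ext g w"
  and lin_ext_scal: "lin_ext g (scal c v) = scal c (lin_ext g v)"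
  and lin_ext_zero [simp]: "lin_ext g 0 = 0"
  and lin_ext_diff: "lin_ext g (v - w) = lin_ext g v - lin_ext g w"
  and lin_ext_uminus: "lin_ext g (- v) = - lin_ext g v"
  by (auto intro!: poly_mapping_eqI simp: lookup_lin_ext lookup_add lookup_minus pair_add pair_scal pair_diff pair_uminus)

lemma lin_ext_single: "lin_ext g (Poly_Mapping.single x c) = scal c (g x)"
  by (auto intro!: poly_mapping_eqI simp: lookup_lin_ext)

lemma lin_ext_basis [simp]: "lin_ext g (basis_vec x) = g x"
  by (simp add: lin_ext_single)

lemma lin_ext_sum: "lin_ext g (sum f A) = (\<Sum>a\<in>A. lin_ext g (f a))"
  by (induction A rule: infinite_finite_induct) (auto simp: lin_ext_add)

lemma pair_lin_ext: "pair \<phi> (lin_ext g v) = pair (\<lambda>x. pair \<phi> (g x)) v"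
  by (simp add: lin_ext_def pair_sum pair_scal pair_def[of "\<lambda>x. pair \<phi> (g x)"])

lemma lin_ext_basis_vec [simp]: "lin_ext basis_vec v = v"
proof (rule poly_mapping_eqI)
  fix y
  have "pair (\<lambda>x. Poly_Mapping.lookup (basis_vec x) y) v = (\<Sum>x\<in>insert y (Poly_Mapping.keys v). Poly_Mapping.lookup v x * (if x = y then 1 else 0))"
    by (subst pair_superset[of "insert y (Poly_Mapping.keys v)"]) (auto simp: lookup_single when_def)
  also have "\<dots> = Poly_Mapping.lookup v y" by (subst sum.mono_neutral_right[of _ "{y}"]) auto
  finally show "Poly_Mapping.lookup (lin_ext basis_vec v) y = Poly_Mapping.lookup v y" by (simp add: lookup_lin_ext)
qed

lemma keys_lin_ext: "Poly_Mapping.keys (lin_ext g v) \<subseteq> (\<Union>x\<in>Poly_Mapping.keys v. Poly_Mapping.keys (g x))"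
proof
  fix y assume "y \<in> Poly_Mapping.keys (lin_ext g v)"
  then have "pair (\<lambda>x. Poly_Mapping.lookup (g x) y) v \<noteq> 0" by (simp add: in_keys_iff lookup_lin_ext)
  then obtain x where "x \<in> Poly_Mapping.keys v" "Poly_Mapping.lookup (g x) y \<noteq> 0"
    unfolding pair_def by (metis (no_types, lifting) mult_zero_right sum.neutral)
  then show "y \<in> (\<Union>x\<in>Poly_Mapping.keys v. Poly_Mapping.keys (g x))" by (auto simp: in_keys_iff)
qed

lemma pair_bilin_ext: "pair \<phi> (bilin_ext g (v, w)) = pair (\<lambda>x. pair (\<lambda>y. \<phi> (g x y)) w) v"
  by (simp add: bilin_ext_def pair_lin_ext)

lemma bilin_ext_left: "bilin_ext g (v, w) = lin_ext (\<lambda>x. lin_ext (\<lambda>y. basis_vec (g x y)) w) v"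
  by (simp add: bilin_ext_def)

lemma pair_swap: "pair (\<lambda>x. pair (\<lambda>y. F x y) w) v = pair (\<lambda>y. pair (\<lambda>x. F x y) v) w"
  by (simp add: pair_def sum_distrib_left sum.swap[of _ "Poly_Mapping.keys v"] mult_ac)

lemma bilin_ext_right: "bilin_ext g (v, w) = lin_ext (\<lambda>y. lin_ext (\<lambda>x. basis_vec (g x y)) v) w"
  by (rule poly_mapping_eqI) (simp add: bilin_ext_def lookup_lin_ext, rule pair_swap)

lemma bilin_ext_simps:
  "bilin_ext g (v + v', w) = bilin_ext g (v, w) + bilin_ext g (v', w)"
  "bilin_ext g (v, w + w') = bilin_ext g (v, w) + bilin_ext g (v, w')"
  "bilin_ext g (scal c v, w) = scal c (bilin_ext g (v, w))"
  "bilin_ext g (v, scal c w) = scal c (bilin_ext g (v, w))"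
  unfolding bilin_ext_left[of g "v + v'"] bilin_ext_left[of g v w] bilin_ext_left[of g v' w] bilin_ext_left[of g "scal c v"]
    bilin_ext_right[of g v "w + w'"] bilin_ext_right[of g v w'] bilin_ext_right[of g v "scal c w"]
  using bilin_ext_left[of g v w] bilin_ext_right[of g v w] by (simp_all add: lin_ext_add lin_ext_scal)

lemma bilin_ext_basis [simp]: "bilin_ext g (basis_vec x, basis_vec y) = basis_vec (g x y)"
  by (simp add: bilin_ext_left)

lemma keys_bilin_ext:
  "Poly_Mapping.keys (bilin_ext g (v, w)) \<subseteq> {g x y | x y. x \<in> Poly_Mapping.keys v \<and> y \<in> Poly_Mapping.keys w}"
proof
  fix z assume "z \<in> Poly_Mapping.keys (bilin_ext g (v, w))"
  then obtain x where x: "x \<in> Poly_Mapping.keys v" "z \<in> Poly_Mapping.keys (lin_ext (\<lambda>y. basis_vec (g x y)) w)"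
    unfolding bilin_ext_left by (auto dest: subsetD[OF keys_lin_ext])
  then obtain y where "y \<in> Poly_Mapping.keys w" "z \<in> Poly_Mapping.keys (basis_vec (g x y))" 
    by (auto dest: subsetD[OF keys_lin_ext])
  then show "z \<in> {g x y | x y. x \<in> Poly_Mapping.keys v \<and> y \<in> Poly_Mapping.keys w}" using x by auto
qed

lemma span_of_induct [consumes 1, case_names zero add scal base]:
  assumes "v \<in> span_of S" "P 0" "\<And>x y. P x \<Longrightarrow> P y \<Longrightarrow> P (x + y)" "\<And>c x. P x \<Longrightarrow> P (scal c x)" "\<And>x. x \<in> S \<Longrightarrow> P x"
  shows "P v"
  using assms(1) unfolding span_of_def
proof (induction rule: scal.span_induct_alt)
  case base
  then show ?case by (rule assms(2))
next
  case (step c x y)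
  then show ?case using assms(3-5) by blast
qed

lemma span_of_zero [simp]: "0 \<in> span_of S"
  and span_of_base: "x \<in> S \<Longrightarrow> x \<in> span_of S"
  and span_of_add: "x \<in> span_of S \<Longrightarrow> y \<in> span_of S \<Longrightarrow> x + y \<in> span_of S"
  and span_of_scal: "x \<in> span_of S \<Longrightarrow> scal c x \<in> span_of S"
  and span_of_sum: "(\<And>i. i \<in> I \<Longrightarrow> F i \<in> span_of S) \<Longrightarrow> sum F I \<in> span_of S"
  unfolding span_of_def
  by (auto intro: scal.span_base scal.span_add scal.span_scale scal.span_zero scal.span_sum)

lemma span_of_lin_ext: "(\<And>x. x \<in> Poly_Mapping.keys v \<Longrightarrow> g x \<in> span_of S) \<Longrightarrow> lin_ext g v \<in> span_of S"
  unfolding lin_ext_def by (intro span_of_sum span_of_scal)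

lemma lin_ext_span_of:
  assumes "v \<in> span_of S" "\<And>x. x \<in> S \<Longrightarrow> lin_ext g x \<in> span_of S'"
  shows "lin_ext g v \<in> span_of S'"
  using assms(1) by (induction rule: span_of_induct) (auto simp: lin_ext_add lin_ext_scal span_of_add span_of_scal assms(2))

lemma pair_span_of:
  assumes "v \<in> span_of S" "\<And>x. x \<in> S \<Longrightarrow> pair \<phi> x = 0"
  shows "pair \<phi> v = 0"
  using assms(1) by (induction rule: span_of_induct) (auto simp: pair_add pair_scal assms(2))

section \<open>Free modules and their quotients\<close>

lemma free_module_simps [simp]:
  "carrier (free_module X) = {f. Poly_Mapping.keys f \<subseteq> X}" "\<zero>\<^bsub>free_module X\<^esub> = 0"
  "v \<oplus>\<^bsub>free_module X\<^esub> w = v + w" "c \<odot>\<^bsub>free_module X\<^esub> v = scal c v"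
  by (auto simp: free_module_def)

lemma free_module_closed:
  "Poly_Mapping.keys v \<subseteq> X \<Longrightarrow> Poly_Mapping.keys w \<subseteq> X \<Longrightarrow> Poly_Mapping.keys (v + w) \<subseteq> X"
  "Poly_Mapping.keys v \<subseteq> X \<Longrightarrow> Poly_Mapping.keys (scal c v) \<subseteq> X"
  "Poly_Mapping.keys v \<subseteq> X \<Longrightarrow> Poly_Mapping.keys w \<subseteq> X \<Longrightarrow> Poly_Mapping.keys (v - w) \<subseteq> X"
  using Poly_Mapping.keys_add[of v w] keys_scal[of c v] keys_diff[of v w] by (force, force, force)

lemma keys_span_of:
  assumes "v \<in> span_of S" "\<And>x. x \<in> S \<Longrightarrow> Poly_Mapping.keys x \<subseteq> X"
  shows "Poly_Mapping.keys v \<subseteq> X"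
  using assms(1) by (induction rule: span_of_induct) (simp_all add: assms(2) free_module_closed)

lemma vs_free_module: "vs (free_module X :: ('k::field, 'b \<Rightarrow>\<^sub>0 'k) module)"
proof (intro moduleI cring_field_ring abelian_groupI)
  fix x :: "'b \<Rightarrow>\<^sub>0 'k" assume "x \<in> carrier (free_module X)"
  then have "- x \<in> carrier (free_module X)" by simp
  then show "\<exists>y\<in>carrier (free_module X). y \<oplus>\<^bsub>free_module X\<^esub> x = \<zero>\<^bsub>free_module X\<^esub>"
    by (intro bexI[of _ "- x"]) auto
qed (auto simp: free_module_closed ac_simps scal.scale_left_distrib scal.scale_right_distrib)

lemma free_module_minus [simp]:
  assumes "Poly_Mapping.keys v \<subseteq> X" "Poly_Mapping.keys w \<subseteq> X"
  shows "v \<ominus>\<^bsub>free_module X\<^esub> w = v - w"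
proof -
  interpret vspace "free_module X" by (rule vspace.intro[OF vs_free_module])
  have "\<ominus>\<^bsub>free_module X\<^esub> w = - w" by (rule minus_equality) (use assms in auto)
  then show ?thesis by (simp add: a_minus_def)
qed

lemma lin_ext_linear_maps:
  fixes g :: "'b \<Rightarrow> ('c \<Rightarrow>\<^sub>0 'k::field)"
  assumes "\<And>x. x \<in> X \<Longrightarrow> Poly_Mapping.keys (g x) \<subseteq> Y"
  shows "lin_ext g \<in> linear_maps (free_module X) (free_module Y)"
proof (rule linear_mapsI)
  fix v :: "'b \<Rightarrow>\<^sub>0 'k" assume "v \<in> carrier (free_module X)"
  then show "lin_ext g v \<in> carrier (free_module Y)" using keys_lin_ext[of g v] assms by fastforce
qed (auto simp: lin_ext_add lin_ext_scal)

lemma subspace_of_span: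
  assumes "\<And>x. x \<in> S \<Longrightarrow> Poly_Mapping.keys x \<subseteq> X"
  shows "subspace_of (span_of S) (free_module X)"
  using keys_span_of[OF _ assms] by (auto simp: subspace_of_def span_of_add span_of_scal)

lemma quotient_free:
  assumes "\<And>x. x \<in> S \<Longrightarrow> Poly_Mapping.keys x \<subseteq> X"
  shows "quotient_space (free_module X) (span_of S)"
  by (rule quotient_space.intro[OF vspace.intro[OF vs_free_module] quotient_space_axioms.intro[OF subspace_of_span[OF assms]]])

text \<open>The addition of \<open>free_module X\<close> is the same for every \<open>X\<close>, so
  the basis is dropped from the notation for cosets.\<close>

definition fcl :: "('b \<Rightarrow>\<^sub>0 'k::field) set \<Rightarrow> ('b \<Rightarrow>\<^sub>0 'k) \<Rightarrow> ('b \<Rightarrow>\<^sub>0 'k) set" where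
  "fcl W v = (\<lambda>r. r + v) ` W"

lemma a_r_coset_free: "W +>\<^bsub>free_module X\<^esub> v = fcl W v"
  by (simp add: a_r_coset_alt fcl_def)

lemma fcl_eq_iff: "fcl (span_of S) v = fcl (span_of S) w \<longleftrightarrow> v - w \<in> span_of S"
proof -
  interpret quotient_space "free_module UNIV" "span_of S" by (rule quotient_free) auto
  show ?thesis using cl_eq_iff[of v w] by (simp add: a_r_coset_free)
qed

lemma coset_map_lin_ext:
  assumes "\<And>x. x \<in> S \<Longrightarrow> lin_ext g x \<in> span_of S'"
  shows "coset_map (free_module Y) (span_of S') (lin_ext g) (fcl (span_of S) v) = fcl (span_of S') (lin_ext g v)"
proof -
  interpret quotient_space "free_module UNIV" "span_of S'" by (rule quotient_free) auto
  have eq: "coset_map (free_module Y) = coset_map (free_module UNIV)"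
    by (simp add: fun_eq_iff coset_map_def set_add_alt)
  show ?thesis unfolding eq
    using coset_map_cl[OF vs_free_module[of UNIV] subspace_of_span lin_ext_linear_maps, of S g v] lin_ext_span_of[OF _ assms]
    by (auto simp: a_r_coset_free)
qed

text \<open>The left representative is changed before the right one. Therefore relations on the
  right have to be absorbed for every left argument, whereas those on the left only for the given
  \<open>w\<close>.\<close>

lemma coset_map_bilin_ext:
  assumes "\<And>r. r \<in> S \<Longrightarrow> bilin_ext g (r, w) \<in> span_of S''"
    and "\<And>v r. r \<in> S' \<Longrightarrow> Poly_Mapping.keys v \<subseteq> X \<Longrightarrow> bilin_ext g (v, r) \<in> span_of S''"
    and v: "Poly_Mapping.keys v \<subseteq> X" and S: "\<And>x. x \<in> S \<Longrightarrow> Poly_Mapping.keys x \<subseteq> X"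
  shows "coset_map (free_module Y) (span_of S'') (bilin_ext g) (fcl (span_of S) v \<times> fcl (span_of S') w) =
    fcl (span_of S'') (bilin_ext g (v, w))"
proof -
  have L: "bilin_ext g (r, w) \<in> span_of S''" if "r \<in> span_of S" for r
    using lin_ext_span_of[OF that, of "\<lambda>x. lin_ext (\<lambda>y. basis_vec (g x y)) w" S''] assms(1) by (simp add: bilin_ext_left)
  have R: "bilin_ext g (v, r) \<in> span_of S''" if "r \<in> span_of S'" "Poly_Mapping.keys v \<subseteq> X" for v r
    using lin_ext_span_of[OF that(1), of "\<lambda>y. lin_ext (\<lambda>x. basis_vec (g x y)) v" S''] assms(2)[OF _ that(2)] by (simp add: bilin_ext_right)
  show ?thesis
  proof (intro equalityI subsetI)
    fix z assume "z \<in> coset_map (free_module Y) (span_of S'') (bilin_ext g) (fcl (span_of S) v \<times> fcl (span_of S') w)"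
    then obtain u r r' where u: "u \<in> span_of S''" "r \<in> span_of S" "r' \<in> span_of S'" "z = u + bilin_ext g (r + v, r' + w)"
      by (auto simp: coset_map_def set_add_alt fcl_def)
    have "Poly_Mapping.keys (r + v) \<subseteq> X" using keys_span_of[OF u(2) S] v by (intro free_module_closed) auto
    then have "u + (bilin_ext g (r + v, r') + bilin_ext g (r, w)) \<in> span_of S''"
      using L u R by (intro span_of_add) auto
    moreover have "z = (u + (bilin_ext g (r + v, r') + bilin_ext g (r, w))) + bilin_ext g (v, w)"
      unfolding u(4) by (simp add: bilin_ext_simps)
    ultimately show "z \<in> fcl (span_of S'') (bilin_ext g (v, w))" by (auto simp: fcl_def)
  next
    fix z assume "z \<in> fcl (span_of S'') (bilin_ext g (v, w))"
    then obtain u where u: "u \<in> span_of S''" "z = u + bilin_ext g (v, w)" by (auto simp: fcl_def)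
    have "v \<in> fcl (span_of S) v" "w \<in> fcl (span_of S') w" by (force simp: fcl_def)+
    then show "z \<in> coset_map (free_module Y) (span_of S'') (bilin_ext g) (fcl (span_of S) v \<times> fcl (span_of S') w)"
      using u by (auto simp: coset_map_def set_add_alt)
  qed
qed

section \<open>The operad structure in low arity\<close>

text \<open>
  The truncation to at most two inputs has a basis of trees:
  the units, \<open>Eta = n\<^bsub>1,0\<^esub>\<close>, \<open>Lam = l\<^sub>2\<close>, \<open>Mu = n\<^bsub>0,2\<^esub>\<close>, \<open>Ha = n\<^bsub>1,1\<^esub>\<close>, \<open>Na = n\<^bsub>2,0\<^esub>\<close>, the composites
  \<open>Aa = Mu \<circ>\<^sub>0 Eta\<close>, \<open>Ba = Mu \<circ>\<^sub>1 Eta\<close>, \<open>EL = Eta \<circ> Lam\<close>, \<open>HE = Ha \<circ> Eta\<close>, \<open>Ka = Aa \<circ> Eta\<close>; and a prime denotes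
  the exchange of the two inputs.
\<close>

datatype bas = IdC | IdO | Eta | Lam | Mu | Mu' | Ha | Aa | Ba | Na | EL | HE | HE' | Ka | Ka'

lemma UNIV_bas: "UNIV = {IdC, IdO, Eta, Lam, Mu, Mu', Ha, Aa, Ba, Na, EL, HE, HE', Ka, Ka'}"
  by (auto intro: bas.exhaust)

instance bas :: finite
  by standard (simp only: UNIV_bas finite_insert finite.emptyI)

lemma all_bas: "(\<forall>b. Q b) \<longleftrightarrow> Q IdC \<and> Q IdO \<and> Q Eta \<and> Q Lam \<and> Q Mu \<and> Q Mu' \<and> Q Ha \<and> Q Aa \<and> Q Ba \<and> Q Na \<and> Q EL \<and>
    Q HE \<and> Q HE' \<and> Q Ka \<and> Q Ka'"
  unfolding ball_UNIV[symmetric] UNIV_bas by simp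

lemma bas_fun_eqI:
  assumes "f IdC = g IdC" "f IdO = g IdO" "f Eta = g Eta" "f Lam = g Lam" "f Mu = g Mu" "f Mu' = g Mu'" "f Ha = g Ha"
    "f Aa = g Aa" "f Ba = g Ba" "f Na = g Na" "f EL = g EL" "f HE = g HE" "f HE' = g HE'" "f Ka = g Ka" "f Ka' = g Ka'"
  shows "f = g"
  using assms by (simp add: fun_eq_iff all_bas)

fun bidx :: "bas \<Rightarrow> idx" where
  "bidx IdC = Idx (arr 1 0) Closed 0"
| "bidx IdO = ix 0 1 0"
| "bidx Eta = ix 1 0 (- 1)"
| "bidx Lam = Idx (arr 2 0) Closed 0"
| "bidx Mu = ix 0 2 0"
| "bidx Mu' = ix 0 2 0"
| "bidx Ha = ix 1 1 0"
| "bidx Aa = ix 1 1 (- 1)"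
| "bidx Ba = ix 1 1 (- 1)"
| "bidx Na = ix 2 0 0"
| "bidx EL = ix 2 0 (- 1)"
| "bidx HE = ix 2 0 (- 1)"
| "bidx HE' = ix 2 0 (- 1)"
| "bidx Ka = ix 2 0 (- 2)"
| "bidx Ka' = ix 2 0 (- 2)"

text \<open>Acts on coefficient functions. With at most two inputs of a colour a permutation is
  known from its value at 0. \<open>Lam\<close>, \<open>Na\<close> and \<open>EL\<close> are
  antisymmetric; \<open>Mu\<close>, \<open>HE\<close> and \<open>Ka\<close> are permuted with their
  primed partners.\<close>

fun tact :: "(colour \<Rightarrow> nat \<Rightarrow> nat) \<Rightarrow> (bas \<Rightarrow> 'k::field) \<Rightarrow> bas \<Rightarrow> 'k" where
  "tact \<sigma> f Lam = (if \<sigma> Closed 0 = 0 then f Lam else - f Lam)"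
| "tact \<sigma> f Na = (if \<sigma> Closed 0 = 0 then f Na else - f Na)"
| "tact \<sigma> f EL = (if \<sigma> Closed 0 = 0 then f EL else - f EL)"
| "tact \<sigma> f Mu = (if \<sigma> Open 0 = 0 then f Mu else f Mu')"
| "tact \<sigma> f Mu' = (if \<sigma> Open 0 = 0 then f Mu' else f Mu)"
| "tact \<sigma> f HE = (if \<sigma> Closed 0 = 0 then f HE else f HE')"
| "tact \<sigma> f HE' = (if \<sigma> Closed 0 = 0 then f HE' else f HE)"
| "tact \<sigma> f Ka = (if \<sigma> Closed 0 = 0 then f Ka else f Ka')"
| "tact \<sigma> f Ka' = (if \<sigma> Closed 0 = 0 then f Ka' else f Ka)"
| "tact \<sigma> f b = f b"

text \<open>Most terms are compositions with an identity. The position \<open>i\<close> matters only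
  for insertion into \<open>Mu\<close> or \<open>Mu'\<close>. The minus sign at \<open>Ka'\<close>
  is the Koszul sign from exchanging the two odd vertices \<open>Eta\<close>.\<close>

fun tcomp :: "nat \<Rightarrow> (bas \<Rightarrow> 'k::field) \<Rightarrow> (bas \<Rightarrow> 'k) \<Rightarrow> bas \<Rightarrow> 'k" where
  "tcomp i f g IdC = f IdC * g IdC"
| "tcomp i f g IdO = f IdO * g IdO"
| "tcomp i f g Eta = f Eta * g IdC + f IdO * g Eta"
| "tcomp i f g Lam = f Lam * g IdC + f IdC * g Lam"
| "tcomp i f g Mu = f Mu * g IdO + f IdO * g Mu"
| "tcomp i f g Mu' = f Mu' * g IdO + f IdO * g Mu'"
| "tcomp i f g Ha = f Ha * (g IdC + g IdO) + f IdO * g Ha"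
| "tcomp i f g Aa = f Aa * (g IdC + g IdO) + f IdO * g Aa + (if i = 0 then f Mu else f Mu') * g Eta"
| "tcomp i f g Ba = f Ba * (g IdC + g IdO) + f IdO * g Ba + (if i = 0 then f Mu' else f Mu) * g Eta"
| "tcomp i f g Na = f Na * g IdC + f IdO * g Na"
| "tcomp i f g EL = f EL * g IdC + f IdO * g EL + f Eta * g Lam"
| "tcomp i f g HE = f HE * g IdC + f IdO * g HE + f Ha * g Eta"
| "tcomp i f g HE' = f HE' * g IdC + f IdO * g HE'"
| "tcomp i f g Ka = f Ka * g IdC + f IdO * g Ka + f Aa * g Eta"
| "tcomp i f g Ka' = f Ka' * g IdC + f IdO * g Ka' - f Ba * g Eta"

text \<open>Written on coefficients, hence transposed. On basis trees it reads: \<open>Ha\<close>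
  goes to \<open>Ba - Aa\<close>, \<open>Na\<close> to \<open>EL - HE + HE'\<close>, both
  \<open>HE\<close> and \<open>HE'\<close> to \<open>- Ka - Ka'\<close>, and all others to
  zero.\<close>

fun tdiff :: "(bas \<Rightarrow> 'k::field) \<Rightarrow> bas \<Rightarrow> 'k" where
  "tdiff f Aa = - f Ha"
| "tdiff f Ba = f Ha"
| "tdiff f EL = f Na"
| "tdiff f HE = - f Na"
| "tdiff f HE' = f Na"
| "tdiff f Ka = - f HE - f HE'"
| "tdiff f Ka' = - f HE - f HE'"
| "tdiff f b = 0"

section \<open>The operad axioms for the model\<close>

definition supp :: "idx \<Rightarrow> (bas \<Rightarrow> 'k::field) \<Rightarrow> bool" where
  "supp s f \<longleftrightarrow> (\<forall>b. f b \<noteq> 0 \<longrightarrow> bidx b = s)"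

lemma suppD: "supp s f \<Longrightarrow> f b \<noteq> 0 \<Longrightarrow> s = bidx b"
  by (auto simp: supp_def)

lemma supp_zero: "supp s f \<Longrightarrow> bidx b \<noteq> s \<Longrightarrow> f b = 0"
  by (auto simp: supp_def)

lemma supp_tact: 
  assumes "supp s f"
  shows "supp s (tact \<sigma> f)"
proof -
  have "s = bidx b" if "tact \<sigma> f b \<noteq> 0" for b
    using that by (cases b) (auto split: if_splits dest!: suppD[OF assms])
  then show ?thesis by (auto simp: supp_def)
qed

lemma idx_eq_iff: "s = t \<longleftrightarrow> ar s = ar t \<and> out s = out t \<and> deg s = deg t"
  by (cases s; cases t) simp

lemma ix_eq_iff [simp]: "ix n m d = ix n' m' d' \<longleftrightarrow> n = n' \<and> m = m' \<and> d = d'"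
  by (auto simp: ix_def)

lemma Idx_ix [simp]: "Idx a Closed e \<noteq> ix n m d" "ix n m d \<noteq> Idx a Closed e"
  by (auto simp: ix_def)

lemma comp_ar_arr: "comp_ar (arr n m) Open (arr n' m') = arr (n + n') (m + m' - 1)"
  "comp_ar (arr n m) Closed (arr n' m') = arr (n + n' - 1) (m + m')"
  by (auto simp: comp_ar_def arity_eq_iff)

lemma unit_ar_arr: "unit_ar Closed = arr 1 0" "unit_ar Open = arr 0 1"
  by (auto simp: unit_ar_def arity_eq_iff)

lemma if_mult: "(if c then x else y) * z = (if c then x * z else y * z)"
  by simp

lemma less_two_iff: "n < 2 \<longleftrightarrow> n = 0 \<or> n = (1::nat)"
  by auto

lemma supp_tcomp:
  assumes f: "supp s f" and g: "supp t g" and i: "i < ar s (out t)"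
  shows "supp (comp_idx s t) (tcomp i f g)"
proof -
  have z: "f b = 0 \<or> g c = 0" if "comp_idx (bidx b) (bidx c) \<noteq> comp_idx s t" for b c
    using f g that unfolding supp_def by metis
  have "bidx b = comp_idx s t" if "tcomp i f g b \<noteq> 0" for b
  proof (rule ccontr)
    assume ne: "bidx b \<noteq> comp_idx s t"
    have z': "f c * g d = 0" if "comp_idx (bidx c) (bidx d) = bidx b" for c d
      using z[of c d] ne that by auto
    have "tcomp i f g b = 0"
      by (cases b) (simp_all add: z' comp_idx_def comp_ar_arr ix_def distrib_left One_nat_def if_mult)
    then show False using that by simp
  qed
  then show ?thesis by (auto simp: supp_def)
qed

definition uid :: "colour \<Rightarrow> bas" where
  "uid x = (if x = Closed then IdC else IdO)"

lemma bidx_uid [simp]: "bidx (uid x) = unit_idx x"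
  by (cases x) (auto simp: uid_def unit_idx_def unit_ar_arr ix_def)

lemma unit_idx_eq: "unit_idx Closed = Idx (arr 1 0) Closed 0" "unit_idx Open = ix 0 1 0"
  by (auto simp: unit_idx_def unit_ar_arr ix_def)

lemma tcomp_unit_right:
  assumes f: "supp s f" and g: "supp (unit_idx x) g" and i: "i < ar s x"
  shows "tcomp i f g = (\<lambda>b. g (uid x) * f b)"
proof -
  have z: "f b = 0" if "ar (bidx b) x = 0" for b
    by (rule supp_zero[OF f]) (use i that in auto)
  show ?thesis
    by (rule bas_fun_eqI; cases x) (simp_all add: z supp_zero[OF g] uid_def unit_idx_eq)
qed

lemma tcomp_unit_left:
  assumes f: "supp (unit_idx (out t)) f" and g: "supp t g"
  shows "tcomp i f g = (\<lambda>b. f (uid (out t)) * g b)"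
proof -
  have z: "g b = 0" if "out (bidx b) \<noteq> out t" for b
    by (rule supp_zero[OF g]) (use that in auto)
  show ?thesis
    by (rule bas_fun_eqI; cases "out t") (use z supp_zero[OF f] in \<open>simp_all add: uid_def unit_idx_eq\<close>)
qed

text \<open>Away from the indices of identities the identity coefficients vanish, which leaves the
  products of two genuine vertices.\<close>

lemma tcomp_nonunit:
  assumes f: "supp s f" and g: "supp t g" and s: "\<And>x. s \<noteq> unit_idx x" and t: "\<And>x. t \<noteq> unit_idx x"
  shows "tcomp i f g = (\<lambda>d. case d of 
      Aa \<Rightarrow> (if i = 0 then f Mu else f Mu') * g Eta
    | Ba \<Rightarrow> (if i = 0 then f Mu' else f Mu) * g Eta
    | EL \<Rightarrow> f Eta * g Lam
    | HE \<Rightarrow> f Ha * g Eta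
    | Ka \<Rightarrow> f Aa * g Eta
    | Ka' \<Rightarrow> - f Ba * g Eta
    | _ \<Rightarrow> 0)"
proof -
  have "f IdC = 0" "f IdO = 0" "g IdC = 0" "g IdO = 0"
    using supp_zero[OF f, of IdC] supp_zero[OF f, of IdO] supp_zero[OF g, of IdC] supp_zero[OF g, of IdO]
      s[of Closed] s[of Open] t[of Closed] t[of Open] by (auto simp: unit_idx_eq)
  then show ?thesis by (intro bas_fun_eqI) auto
qed

text \<open>Inserting an index of arity 0 can produce the index of an identity although neither
  factor has one. No tree that is a product of genuine vertices lives at such an index.\<close>

lemma tcomp_nonunit_unit:
  assumes f: "supp s f" and g: "supp t g" and i: "i < ar s (out t)" and n: "\<And>x. s \<noteq> unit_idx x" "\<And>x. t \<noteq> unit_idx x"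
    and u: "comp_idx s t = unit_idx z"
  shows "tcomp i f g = (\<lambda>b. 0)"
proof
  fix b
  show "tcomp i f g b = 0"
  proof (cases "b \<in> {Aa, Ba, EL, HE, Ka, Ka'}")
    case True
    then have "bidx b \<noteq> comp_idx s t" unfolding u by (cases z) (auto simp: unit_idx_eq)
    then show ?thesis by (rule supp_zero[OF supp_tcomp[OF f g i]])
  next
    case False
    then show ?thesis unfolding tcomp_nonunit[OF f g n] by (cases b) auto
  qed
qed

lemma tact_cong:
  assumes f: "supp s f" and eq: "\<And>w l. l < ar s w \<Longrightarrow> \<pi> w l = \<sigma> w l"
  shows "tact \<pi> f = tact \<sigma> f"
proof -
  have C: "\<pi> Closed 0 = \<sigma> Closed 0 \<or> f Lam = 0 \<and> f Na = 0 \<and> f EL = 0 \<and> f HE = 0 \<and> f HE' = 0 \<and> f Ka = 0 \<and> f Ka' = 0"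
    by (cases "ar s Closed = 0") (use eq in \<open>auto intro!: supp_zero[OF f]\<close>)
  have O: "\<pi> Open 0 = \<sigma> Open 0 \<or> f Mu = 0 \<and> f Mu' = 0"
    by (cases "ar s Open = 0") (use eq in \<open>auto intro!: supp_zero[OF f]\<close>)
  show ?thesis by (rule bas_fun_eqI) (use C O in auto)
qed

lemma tact_id: "tact (\<lambda>y. id) f = f"
  by (rule bas_fun_eqI) auto

lemma tact_id_cong:
  assumes f: "supp s f" and eq: "\<And>w l. l < ar s w \<Longrightarrow> \<pi> w l = l"
  shows "tact \<pi> f = f"
  using tact_cong[OF f, of \<pi> "\<lambda>y. id"] eq by (simp add: tact_id)

lemma tact_scale: "tact \<pi> (\<lambda>b. c * f b) = (\<lambda>b. c * tact \<pi> f b)"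
  by (rule bas_fun_eqI) auto

lemma perms_lt: "\<sigma> \<in> perms a \<Longrightarrow> l < a w \<Longrightarrow> \<sigma> w l < a w"
  unfolding perms_def using permutes_in_image[of "\<sigma> w" "{..<a w}" l] by auto

lemma perms_inj: "\<sigma> \<in> perms a \<Longrightarrow> \<sigma> w l = \<sigma> w l' \<longleftrightarrow> l = l'"
  unfolding perms_def using permutes_inj[of "\<sigma> w" "{..<a w}"] by (auto dest: injD)

lemma perms_two:
  assumes "\<sigma> \<in> perms a" "a w = 2"
  shows "(\<sigma> w 0 = 0 \<and> \<sigma> w 1 = 1) \<or> (\<sigma> w 0 = 1 \<and> \<sigma> w 1 = 0)"
  using perms_lt[OF assms(1), of 0 w] perms_lt[OF assms(1), of 1 w] perms_inj[OF assms(1), of w 0 1] assms(2)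
  by (auto simp: less_two_iff)

lemma perms_one:
  assumes "\<sigma> \<in> perms a" "a w = 1"
  shows "\<sigma> w 0 = 0"
  using perms_lt[OF assms(1), of 0 w] assms(2) by auto

lemma tact_tact:
  assumes f: "supp s f" and "\<sigma> \<in> perms (ar s)" "\<tau> \<in> perms (ar s)"
  shows "tact \<sigma> (tact \<tau> f) = tact (\<lambda>y. \<sigma> y \<circ> \<tau> y) f"
proof -
  have P: "(\<sigma> w 0 = 0 \<and> \<tau> w 0 = 0 \<and> \<sigma> w (\<tau> w 0) = 0) \<or> (\<sigma> w 0 = 0 \<and> \<tau> w 0 = 1 \<and> \<sigma> w (\<tau> w 0) = 1) \<or>
    (\<sigma> w 0 = 1 \<and> \<tau> w 0 = 0 \<and> \<sigma> w (\<tau> w 0) = 1) \<or> (\<sigma> w 0 = 1 \<and> \<tau> w 0 = 1 \<and> \<sigma> w (\<tau> w 0) = 0)" 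
    if "ar s w = 2" for w
    using perms_two[of \<sigma> "ar s" w] perms_two[of \<tau> "ar s" w] that assms by auto
  have C: "ar s Closed = 2 \<or> f Lam = 0 \<and> f Na = 0 \<and> f EL = 0 \<and> f HE = 0 \<and> f HE' = 0 \<and> f Ka = 0 \<and> f Ka' = 0"
    by (cases "ar s Closed = 2") (auto intro!: supp_zero[OF f])
  have O: "ar s Open = 2 \<or> f Mu = 0 \<and> f Mu' = 0"
    by (cases "ar s Open = 2") (auto intro!: supp_zero[OF f])
  have "tact \<sigma> (tact \<tau> f) b = tact (\<lambda>y. \<sigma> y \<circ> \<tau> y) f b" for b
  proof (cases "b = Mu \<or> b = Mu'")
    case True
    then show ?thesis using O P[of Open] by auto
  next
    case False
    then show ?thesis using C P[of Closed] by (cases b) auto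
  qed
  then show ?thesis by auto
qed

text \<open>Allows statements about a composite to be checked on the inputs of its factors, both for
  permutations in the model and for glued disks.\<close>

lemma comp_ar_cases:
  assumes "l < comp_ar a x b w" "i < a x"
  obtains (left) l' where "l' < a w" "(w, l') \<noteq> (x, i)" "l = lab_out x i b w l'"
    | (right) l' where "l' < b w" "l = lab_in x i a w l'"
proof (cases "w = x")
  case True
  consider "l < i" | "i \<le> l" "l < i + b x" | "i + b x \<le> l" by linarith
  then show thesis
  proof cases
    case 1
    show thesis by (rule left[of l]) (use True 1 assms in \<open>auto simp: lab_out_def\<close>)
  next
    case 2
    show thesis by (rule right[of "l - i"]) (use True 2 assms in \<open>auto simp: lab_in_def\<close>)
  next
    case 3
    show thesis by (rule left[of "l + 1 - b x"]) (use True 3 assms in \<open>auto simp: lab_out_def comp_ar_def\<close>)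
  qed
next
  case False
  show thesis
  proof (cases "l < a w")
    case True
    show thesis by (rule left[of l]) (use True False in \<open>auto simp: lab_out_def\<close>)
  next
    case l: False
    show thesis by (rule right[of "l - a w"]) (use l False assms in \<open>auto simp: lab_in_def comp_ar_def\<close>)
  qed
qed

lemma unit_ar_self [simp]: "unit_ar x x = 1"
  by (simp add: unit_ar_def)

lemma lab_unit [simp]: "lab_out x i (unit_ar x) y j = j" "lab_in x 0 (unit_ar x) y j = j" "lab_in x i a x 0 = i"
  by (auto simp: lab_out_def lab_in_def unit_ar_def)

lemma comp_ar_unit [simp]: "comp_ar (unit_ar x) x b = b" "0 < a x \<Longrightarrow> comp_ar a x (unit_ar x) = a"
  by (auto simp: comp_ar_def unit_ar_def fun_eq_iff)

lemma unit_ar_less: "l < unit_ar x w \<longleftrightarrow> w = x \<and> l = 0"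
  by (auto simp: unit_ar_def)

lemma unit_idx_simps [simp]: "ar (unit_idx x) = unit_ar x" "out (unit_idx x) = x" "deg (unit_idx x) = 0"
  by (auto simp: unit_idx_def)

lemma comp_idx_simps [simp]: "ar (comp_idx s t) = comp_ar (ar s) (out t) (ar t)" "out (comp_idx s t) = out s"
    "deg (comp_idx s t) = deg s + deg t"
  by (auto simp: comp_idx_def)

lemma tcomp_scale: "tcomp i (\<lambda>b. c * f b) g = (\<lambda>b. c * tcomp i f g b)" "tcomp i f (\<lambda>b. c * g b) = (\<lambda>b. c * tcomp i f g b)"
  by (rule bas_fun_eqI; simp add: algebra_simps)+

lemma tact_uid: "tact \<sigma> f (uid x) = f (uid x)"
  by (cases x) (auto simp: uid_def)

lemma comp_unit_idx [simp]: "comp_idx (unit_idx (out t)) t = t" "0 < ar s x \<Longrightarrow> comp_idx s (unit_idx x) = s"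
  by (auto simp: idx_eq_iff)

text \<open>If one factor has the index of an identity, the permutation of the composite is that of
  the other factor. Otherwise only few products survive, and each pins down the
  permutations.\<close>

lemma tcomp_equivariance:
  fixes f :: "bas \<Rightarrow> 'k::field"
  assumes f: "supp s f" and g: "supp t g" and i: "i < ar s (out t)" and \<sigma>: "\<sigma> \<in> perms (ar s)" and \<tau>: "\<tau> \<in> perms (ar t)"
    and \<pi>: "equivariance_perm (ar s) (out t) i (ar t) \<sigma> \<tau> \<pi>"
  shows "tcomp (\<sigma> (out t) i) (tact \<sigma> f) (tact \<tau> g) = tact \<pi> (tcomp i f g)"
proof -
  let ?x = "out t"
  have p1: "\<pi> y (lab_out ?x i (ar t) y j) = lab_out ?x (\<sigma> ?x i) (ar t) y (\<sigma> y j)" if "j < ar s y" "(y, j) \<noteq> (?x, i)" for y j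
    using \<pi> that by (simp add: equivariance_perm_def)
  have p2: "\<pi> y (lab_in ?x i (ar s) y j) = lab_in ?x (\<sigma> ?x i) (ar s) y (\<tau> y j)" if "j < ar t y" for y j
    using \<pi> that by (simp add: equivariance_perm_def)
  have i': "\<sigma> ?x i < ar s ?x" using perms_lt[OF \<sigma> i] .
  consider (t) "t = unit_idx ?x" | (s) "s = unit_idx ?x" | (n) "\<And>x. s \<noteq> unit_idx x" "\<And>x. t \<noteq> unit_idx x"
    using i unit_ar_less by (metis unit_idx_simps(1,2))
  then show ?thesis
  proof cases
    case t
    then obtain x where x: "t = unit_idx x" "?x = x" by auto
    have "\<pi> w l = \<sigma> w l" if "l < ar s w" for w l
    proof (cases "(w, l) = (x, i)")
      case True
      then show ?thesis using p2[of 0 x] perms_one[OF \<tau>, of x] x by (simp add: unit_ar_less)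
    next
      case False
      then show ?thesis using p1[OF that] x by simp
    qed
    then have "tact \<pi> f = tact \<sigma> f" by (rule tact_cong[OF f])
    then show ?thesis
      using tcomp_unit_right[OF supp_tact[OF f], of x "tact \<tau> g" "\<sigma> x i"] tcomp_unit_right[OF f, of x g i] supp_tact[OF g] g i i' x
      by (simp add: tact_scale tact_uid)
  next
    case s
    then have i0: "i = 0" using i by (simp add: unit_ar_less)
    have "\<pi> w l = \<tau> w l" if "l < ar t w" for w l
      using p2[OF that] perms_one[OF \<sigma>, of ?x] i0 s by simp
    then have "tact \<pi> g = tact \<tau> g" by (rule tact_cong[OF g])
    then show ?thesis
      using tcomp_unit_left[of t "tact \<sigma> f" "tact \<tau> g"] tcomp_unit_left[of t f g] supp_tact[OF f] supp_tact[OF g] f g s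
      by (simp add: tact_scale tact_uid)
  next
    case n
    \<comment> \<open>A nonzero product of coefficients determines both indices, after which the
      permutations can be read off. Hence each of the facts that follow has a vanishing product as
      its alternative.\<close>
    have c1: "f Eta * g Lam = 0 \<or> \<pi> Closed 0 = \<tau> Closed 0"
    proof (cases "f Eta * g Lam = 0")
      case False
      then have st: "s = ix 1 0 (- 1)" "t = Idx (arr 2 0) Closed 0" using suppD[OF f, of Eta] suppD[OF g, of Lam] by auto
      have "i = 0" "\<sigma> Closed i = 0" using i i' st by auto
      then show ?thesis using p2[of 0 Closed] st by (simp add: lab_in_def)
    qed auto
    have c2: "f Mu * g Eta = 0 \<and> f Mu' * g Eta = 0 \<or> (\<sigma> Open 0 = 0 \<and> \<sigma> ?x i = i) \<or> (\<sigma> Open 0 = 1 \<and> \<sigma> ?x i = 1 - i)"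
    proof (cases "f Mu * g Eta = 0 \<and> f Mu' * g Eta = 0")
      case False
      then have st: "s = ix 0 2 0" "t = ix 1 0 (- 1)" using suppD[OF f, of Mu] suppD[OF f, of Mu'] suppD[OF g, of Eta] by auto
      then show ?thesis using perms_two[OF \<sigma>, of Open] i by (auto simp: less_two_iff)
    qed auto
    have c2': "f Mu * g Eta = 0 \<and> f Mu' * g Eta = 0 \<or> i = 0 \<or> i = 1"
    proof (cases "f Mu * g Eta = 0 \<and> f Mu' * g Eta = 0")
      case False
      then have st: "s = ix 0 2 0" "t = ix 1 0 (- 1)" using suppD[OF f, of Mu] suppD[OF f, of Mu'] suppD[OF g, of Eta] by auto
      then show ?thesis using i by (auto simp: less_two_iff)
    qed auto
    have c3: "f b * g Eta = 0 \<or> \<pi> Closed 0 = 0" if b: "b = Ha \<or> b = Aa \<or> b = Ba" for b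
    proof (cases "f b * g Eta = 0")
      case False
      then have st: "ar s = arr 1 1" "t = ix 1 0 (- 1)" using suppD[OF f, of b] suppD[OF g, of Eta] b by auto
      have "\<sigma> Closed 0 = 0" using perms_one[OF \<sigma>, of Closed] st by simp
      then show ?thesis using p1[of 0 Closed] st by (simp add: lab_out_def)
    qed auto
    have u: "tcomp i f g = (\<lambda>d. case d of 
      Aa \<Rightarrow> (if i = 0 then f Mu else f Mu') * g Eta
    | Ba \<Rightarrow> (if i = 0 then f Mu' else f Mu) * g Eta
    | EL \<Rightarrow> f Eta * g Lam | HE \<Rightarrow> f Ha * g Eta | Ka \<Rightarrow> f Aa * g Eta | Ka' \<Rightarrow> - f Ba * g Eta | _ \<Rightarrow> 0)"
      by (rule tcomp_nonunit[OF f g n])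
    show ?thesis
      unfolding tcomp_nonunit[OF supp_tact[OF f] supp_tact[OF g] n] u
    proof (rule ext, goal_cases)
      case (1 b)
      consider "b = Aa \<or> b = Ba" | "b = EL" | "b = HE \<or> b = HE'" | "b = Ka \<or> b = Ka'" 
        | "b \<notin> {Aa, Ba, EL, HE, HE', Ka, Ka'}" by auto
      then show ?case
      proof cases
        case 1
        then show ?thesis using c2 c2' by auto
      next
        case 2
        then show ?thesis using c1 by auto
      next
        case 3
        then show ?thesis using c3[of Ha] by auto
      next
        case 4
        then show ?thesis using c3[of Aa] c3[of Ba] by auto
      next
        case 5
        then show ?thesis by (cases b) auto
      qed
    qed
  qed
qed

text \<open>Without identities both sides are zero: no tree with at most two inputs contains a chain
  of three vertices.\<close>

lemma tcomp_sequential: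
  fixes f :: "bas \<Rightarrow> 'k::field"
  assumes f: "supp s f" and g: "supp t g" and h: "supp u h" and i: "i < ar s (out t)" and j: "j < ar t (out u)"
    and \<pi>: "sequential_perm (ar s) (out t) i (ar t) (out u) j (ar u) \<pi>"
  shows "tcomp (lab_in (out t) i (ar s) (out u) j) (tcomp i f g) h = tact \<pi> (tcomp i f (tcomp j g h))"
proof -
  define x y where xy: "x = out t" "y = out u"
  define a b c where abc: "a = ar s" "b = ar t" "c = ar u"
  define j' where j': "j' = lab_in x i a y j"
  have p1: "\<pi> w (lab_out x i (comp_ar b y c) w l) = lab_out y j' c w (lab_out x i b w l)" if "l < a w" "(w, l) \<noteq> (x, i)" for w l
    using \<pi> that by (simp add: sequential_perm_def Let_def xy abc j')
  have p2: "\<pi> w (lab_in x i a w (lab_out y j c w l)) = lab_out y j' c w (lab_in x i a w l)" if "l < b w" "(w, l) \<noteq> (y, j)" for w l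
    using \<pi> that by (simp add: sequential_perm_def Let_def xy abc j')
  have p3: "\<pi> w (lab_in x i a w (lab_in y j b w l)) = lab_in y j' (comp_ar a x b) w l" if "l < c w" for w l
    using \<pi> that by (simp add: sequential_perm_def Let_def xy abc j')
  have i': "i < a x" and jb: "j < b y" using i j by (auto simp: xy abc)
  have j'lt: "j' < comp_ar a x b y" using i' jb by (auto simp: j' lab_in_def comp_ar_def)
  note sfg = supp_tcomp[OF f g i] and sgh = supp_tcomp[OF g h j]
  have sfgh: "supp (comp_idx s (comp_idx t u)) (tcomp i f (tcomp j g h))" by (rule supp_tcomp[OF f sgh]) (use i in simp)
  consider (s) "s = unit_idx x" | (t) "t = unit_idx x" | (u) "u = unit_idx y" 
    | (n) "\<And>x. s \<noteq> unit_idx x" "\<And>x. t \<noteq> unit_idx x" "\<And>x. u \<noteq> unit_idx x"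
    using i' unit_ar_less by (metis unit_idx_simps(1,2) xy abc(1))
  then show ?thesis
  proof cases
    case s
    then have as: "a = unit_ar x" and i0: "i = 0" using i' by (auto simp: abc unit_ar_less)
    have "\<pi> w l = l" if "l < ar (comp_idx t u) w" for w l
    proof -
      have "l < comp_ar b y c w" using that by (simp add: xy abc)
      then show ?thesis using jb
      proof (cases rule: comp_ar_cases)
        case (left l')
        then show ?thesis using p2[of l' w] by (simp add: as i0 j')
      next
        case (right l')
        then show ?thesis using p3[of l' w] by (simp add: as i0 j')
      qed
    qed
    then have "tact \<pi> (tcomp j g h) = tcomp j g h" by (rule tact_id_cong[OF sgh])
    moreover have "tcomp i f (tcomp j g h) = (\<lambda>b. f (uid x) * tcomp j g h b)"
      using tcomp_unit_left[of "comp_idx t u" f "tcomp j g h"] f sgh s by (simp add: xy)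
    moreover have "tcomp i f g = (\<lambda>b. f (uid x) * g b)"
      using tcomp_unit_left[of t f g] f g s by (simp add: xy)
    ultimately show ?thesis using as i0 by (simp add: tact_scale tcomp_scale flip: xy abc)
  next
    case t
    then have bs: "b = unit_ar x" and j0: "j = 0" "y = x" using jb by (auto simp: abc unit_ar_less)
    have tx: "t = unit_idx (out u)" using t j0 xy by simp
    have "\<pi> w l = l" if "l < ar (comp_idx s u) w" for w l
    proof -
      have "l < comp_ar a x c w" using that j0 by (simp add: abc flip: xy)
      then show ?thesis using i'
      proof (cases rule: comp_ar_cases)
        case (left l')
        then show ?thesis using p1[of l' w] j0 by (simp add: bs j')
      next
        case (right l')
        then show ?thesis using p3[of l' w] j0 i' by (simp add: bs j')
      qed
    qed
    moreover have "supp (comp_idx s u) (tcomp i f h)" by (rule supp_tcomp[OF f h]) (use i j0 xy in simp)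
    ultimately have "tact \<pi> (tcomp i f h) = tcomp i f h" by (intro tact_id_cong[of "comp_idx s u"]) auto
    moreover have "tcomp j g h = (\<lambda>b. g (uid x) * h b)"
      using tcomp_unit_left[of u g h] g h tx j0 by (simp add: xy)
    moreover have "tcomp i f g = (\<lambda>b. g (uid x) * f b)"
      using tcomp_unit_right[OF f, of x g i] g t i' by (simp add: abc)
    ultimately show ?thesis using j0 by (simp add: tact_scale tcomp_scale flip: xy abc)
  next
    case u
    then have cs: "c = unit_ar y" by (auto simp: abc)
    have "\<pi> w l = l" if "l < ar (comp_idx s t) w" for w l
    proof -
      have "l < comp_ar a x b w" using that by (simp add: xy abc)
      then show ?thesis using i'
      proof (cases rule: comp_ar_cases)
        case (left l')
        then show ?thesis using p1[of l' w] jb by (simp add: cs)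
      next
        case (right l')
        show ?thesis
        proof (cases "(w, l') = (y, j)")
          case True
          then show ?thesis using p3[of 0 y] right by (simp add: cs unit_ar_less j')
        next
          case False
          then show ?thesis using p2[of l' w] right by (simp add: cs)
        qed
      qed
    qed
    then have "tact \<pi> (tcomp i f g) = tcomp i f g" by (rule tact_id_cong[OF sfg])
    moreover have hu: "supp (unit_idx y) h" using h u by simp
    have "tcomp j g h = (\<lambda>b. h (uid y) * g b)"
      by (rule tcomp_unit_right[OF g hu]) (use jb abc in simp)
    moreover have "tcomp j' (tcomp i f g) h = (\<lambda>b. h (uid y) * tcomp i f g b)"
      by (rule tcomp_unit_right[OF sfg hu]) (use j'lt abc xy(1) in simp)
    ultimately show ?thesis by (simp add: tact_scale tcomp_scale flip: xy abc j')
  next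
    case n
    have ns: "comp_idx s t \<noteq> unit_idx z \<or> tcomp i f g = (\<lambda>b. 0)" "comp_idx t u \<noteq> unit_idx z \<or> tcomp j g h = (\<lambda>b. 0)" for z
      using tcomp_nonunit_unit[OF f g i n(1,2)] tcomp_nonunit_unit[OF g h j n(2,3)] by blast+
    have gh: "g Eta * h Eta = 0" 
    proof (rule ccontr)
      assume "g Eta * h Eta \<noteq> 0"
      then have "t = ix 1 0 (- 1)" "u = ix 1 0 (- 1)" using suppD[OF g, of Eta] suppD[OF h, of Eta] by auto
      then show False using j by simp
    qed
    have gz: "tcomp j g h Eta = 0" "tcomp j g h Lam = 0" for j
      by (simp_all only: tcomp_nonunit[OF g h n(2,3)] bas.case)
    have fz: "tcomp i f g Aa = (if i = 0 then f Mu else f Mu') * g Eta" "tcomp i f g Ba = (if i = 0 then f Mu' else f Mu) * g Eta"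
      "tcomp i f g Mu = 0" "tcomp i f g Mu' = 0" "tcomp i f g Eta = 0" "tcomp i f g Ha = 0" for i
      by (simp_all only: tcomp_nonunit[OF f g n(1,2)] bas.case)
    have z: "tcomp k (\<lambda>b. 0) h = (\<lambda>b. 0)" "tcomp k f (\<lambda>b. 0) = (\<lambda>b. 0)" "tact \<pi> (\<lambda>b. 0) = (\<lambda>b. 0::'k)" for k
      by (rule bas_fun_eqI; simp)+
    have "tcomp i f (tcomp j g h) = (\<lambda>b. 0)"
    proof (cases "\<exists>z. comp_idx t u = unit_idx z")
      case True
      then show ?thesis using ns(2) z by auto
    next
      case False
      then show ?thesis
        by (subst tcomp_nonunit[OF f sgh n(1)]) (auto simp del: tcomp.simps simp: gz fun_eq_iff split: bas.split)
    qed
    moreover have "tcomp k (tcomp i f g) h = (\<lambda>b. 0)" for k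
    proof (cases "\<exists>z. comp_idx s t = unit_idx z")
      case True
      then show ?thesis using ns(1) z by auto
    next
      case False
      then show ?thesis using gh
        by (subst tcomp_nonunit[OF sfg h _ n(3)], simp) (simp del: tcomp.simps add: fz fun_eq_iff split: bas.split)
    qed
    ultimately show ?thesis using z by simp
  qed
qed

text \<open>Without identities the only case is that both inputs of \<open>Mu\<close> receive
  \<open>Eta\<close>. Both copies of \<open>Eta\<close> are odd, so the Koszul sign is -1, and the
  closed inputs are exchanged; the sign in \<open>Ka'\<close> balances this.\<close>

lemma tcomp_parallel:
  fixes f :: "bas \<Rightarrow> 'k::field"
  assumes f: "supp s f" and g: "supp t g" and h: "supp u h" and i: "i < ar s (out t)" and j: "j < ar s (out u)"
    and ne: "(out t, i) \<noteq> (out u, j)" and \<pi>: "parallel_perm (ar s) (out t) i (ar t) (out u) j (ar u) \<pi>"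
  shows "tcomp (lab_out (out t) i (ar t) (out u) j) (tcomp i f g) h =
    (\<lambda>d. ksign (deg t * deg u) * tact \<pi> (tcomp (lab_out (out u) j (ar u) (out t) i) (tcomp j f h) g) d)"
proof -
  define x y where xy: "x = out t" "y = out u"
  define a b c where abc: "a = ar s" "b = ar t" "c = ar u"
  define j' where j': "j' = lab_out x i b y j"
  define i' where i': "i' = lab_out y j c x i"
  have p1: "\<pi> w (lab_out x i' b w (lab_out y j c w l)) = lab_out y j' c w (lab_out x i b w l)" 
    if "l < a w" "(w, l) \<noteq> (x, i)" "(w, l) \<noteq> (y, j)" for w l
    using \<pi> that by (simp add: parallel_perm_def Let_def xy abc j' i')
  have p2: "\<pi> w (lab_in x i' (comp_ar a y c) w l) = lab_out y j' c w (lab_in x i a w l)" if "l < b w" for w l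
    using \<pi> that by (simp add: parallel_perm_def Let_def xy abc j' i')
  have p3: "\<pi> w (lab_out x i' b w (lab_in y j a w l)) = lab_in y j' (comp_ar a x b) w l" if "l < c w" for w l
    using \<pi> that by (simp add: parallel_perm_def Let_def xy abc j' i')
  have ia: "i < a x" and ja: "j < a y" and ne': "(x, i) \<noteq> (y, j)" using i j ne by (auto simp: xy abc)
  have j'lt: "j' < comp_ar a x b y" and i'lt: "i' < comp_ar a y c x" 
    using ia ja ne' by (auto simp: j' i' lab_out_def comp_ar_def)
  note sfg = supp_tcomp[OF f g i] and sfh = supp_tcomp[OF f h j]
  have s: "s \<noteq> unit_idx z" for z using ia ja ne' by (auto simp: abc unit_ar_less)
  consider (t) "t = unit_idx x" | (u) "u = unit_idx y" | (n) "\<And>x. t \<noteq> unit_idx x" "\<And>x. u \<noteq> unit_idx x"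
    by (metis unit_idx_simps(2) xy)
  then show ?thesis
  proof cases
    case t
    then have bs: "b = unit_ar x" and ks: "ksign (deg t * deg u) = (1::'k)" by (auto simp: abc ksign_def)
    have "\<pi> w l = l" if "l < ar (comp_idx s u) w" for w l
    proof -
      have "l < comp_ar a y c w" using that by (simp add: xy abc)
      then show ?thesis using ja
      proof (cases rule: comp_ar_cases)
        case (left l')
        show ?thesis
        proof (cases "(w, l') = (x, i)")
          case True
          then show ?thesis using p2[of 0 x] left by (simp add: bs unit_ar_less j' i')
        next
          case False
          then show ?thesis using p1[of l' w] left by (simp add: bs j')
        qed
      next
        case (right l')
        then show ?thesis using p3[of l' w] ia by (simp add: bs j')
      qed
    qed
    then have "tact \<pi> (tcomp j f h) = tcomp j f h" by (rule tact_id_cong[OF sfh])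
    moreover have gu: "supp (unit_idx x) g" using g t by simp
    have "tcomp i' (tcomp j f h) g = (\<lambda>b. g (uid x) * tcomp j f h b)"
      by (rule tcomp_unit_right[OF sfh gu]) (use i'lt abc xy(2) in simp)
    moreover have "tcomp i f g = (\<lambda>b. g (uid x) * f b)"
      by (rule tcomp_unit_right[OF f gu]) (use ia abc in simp)
    ultimately show ?thesis unfolding ks using bs by (simp add: tact_scale tcomp_scale flip: xy abc i')
  next
    case u
    then have cs: "c = unit_ar y" and ks: "ksign (deg t * deg u) = (1::'k)" by (auto simp: abc ksign_def)
    have "\<pi> w l = l" if "l < ar (comp_idx s t) w" for w l
    proof -
      have "l < comp_ar a x b w" using that by (simp add: xy abc)
      then show ?thesis using ia
      proof (cases rule: comp_ar_cases)
        case (left l')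
        show ?thesis
        proof (cases "(w, l') = (y, j)")
          case True
          then show ?thesis using p3[of 0 y] left by (simp add: cs unit_ar_less j' i')
        next
          case False
          then show ?thesis using p1[of l' w] left by (simp add: cs i')
        qed
      next
        case (right l')
        then show ?thesis using p2[of l' w] ja by (simp add: cs i')
      qed
    qed
    then have "tact \<pi> (tcomp i f g) = tcomp i f g" by (rule tact_id_cong[OF sfg])
    moreover have hu: "supp (unit_idx y) h" using h u by simp
    have "tcomp j' (tcomp i f g) h = (\<lambda>b. h (uid y) * tcomp i f g b)"
      by (rule tcomp_unit_right[OF sfg hu]) (use j'lt abc xy(1) in simp)
    moreover have "tcomp j f h = (\<lambda>b. h (uid y) * f b)"
      by (rule tcomp_unit_right[OF f hu]) (use ja abc in simp)
    ultimately show ?thesis unfolding ks using cs by (simp add: tact_scale tcomp_scale flip: xy abc j')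
  next
    case n
    have z: "tcomp k (\<lambda>b. 0) h = (\<lambda>b. 0)" "tcomp k (\<lambda>b. 0) g = (\<lambda>b. 0)" "tact \<pi> (\<lambda>b. 0) = (\<lambda>b. 0::'k)" for k
      by (rule bas_fun_eqI; simp)+
    have ns: "comp_idx s t \<noteq> unit_idx z \<or> tcomp i f g = (\<lambda>b. 0)" "comp_idx s u \<noteq> unit_idx z \<or> tcomp j f h = (\<lambda>b. 0)" for z
      using tcomp_nonunit_unit[OF f g i s n(1)] tcomp_nonunit_unit[OF f h j s n(2)] by blast+
    have fz: "tcomp i f g Mu = 0" "tcomp i f g Mu' = 0" "tcomp i f g Eta = 0" "tcomp i f g Ha = 0" for i
      by (simp_all only: tcomp_nonunit[OF f g s n(1)] bas.case)
    have hz: "tcomp j f h Mu = 0" "tcomp j f h Mu' = 0" "tcomp j f h Eta = 0" "tcomp j f h Ha = 0" for j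
      by (simp_all only: tcomp_nonunit[OF f h s n(2)] bas.case)
    have L: "tcomp k (tcomp i f g) h = (\<lambda>d. case d of Ka \<Rightarrow> tcomp i f g Aa * h Eta | Ka' \<Rightarrow> - tcomp i f g Ba * h Eta | _ \<Rightarrow> 0)" for k
    proof (cases "\<exists>z. comp_idx s t = unit_idx z")
      case True
      then have "tcomp i f g = (\<lambda>b. 0)" using ns(1) by auto
      then show ?thesis using z by (simp add: fun_eq_iff all_bas)
    next
      case False
      then show ?thesis
        by (subst tcomp_nonunit[OF sfg h _ n(2)]) (auto simp del: tcomp.simps simp: fz fun_eq_iff split: bas.split)
    qed
    have R: "tcomp k (tcomp j f h) g = (\<lambda>d. case d of Ka \<Rightarrow> tcomp j f h Aa * g Eta | Ka' \<Rightarrow> - tcomp j f h Ba * g Eta | _ \<Rightarrow> 0)" for k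
    proof (cases "\<exists>z. comp_idx s u = unit_idx z")
      case True
      then have "tcomp j f h = (\<lambda>b. 0)" using ns(2) by auto
      then show ?thesis using z by (simp add: fun_eq_iff all_bas)
    next
      case False
      then show ?thesis
        by (subst tcomp_nonunit[OF sfh g _ n(1)]) (auto simp del: tcomp.simps simp: hz fun_eq_iff split: bas.split)
    qed
    \<comment> \<open>A nonzero product forces arity (0,2) for \<open>f\<close> and arity (1,0) for
      \<open>g\<close> and \<open>h\<close>; then \<open>\<pi>\<close> moves the closed input 1 to
      0.\<close>
    have key: "(f Mu * g Eta * h Eta = 0 \<and> f Mu' * g Eta * h Eta = 0) \<or> 
       (\<pi> Closed 0 \<noteq> 0 \<and> ksign (deg t * deg u) = (- 1::'k) \<and> (i = 0 \<and> j = 1 \<or> i = 1 \<and> j = 0))"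
    proof (cases "f Mu * g Eta * h Eta = 0 \<and> f Mu' * g Eta * h Eta = 0")
      case False
      then have st: "s = ix 0 2 0" "t = ix 1 0 (- 1)" "u = ix 1 0 (- 1)" 
        using suppD[OF f, of Mu] suppD[OF f, of Mu'] suppD[OF g, of Eta] suppD[OF h, of Eta] by auto
      have "\<pi> Closed 1 = 0" using p2[of 0 Closed] st by (simp add: abc xy lab_in_def lab_out_def comp_ar_def)
      moreover have "\<pi> Closed 0 \<noteq> \<pi> Closed 1"
      proof -
        have "\<pi> \<in> perms (comp_ar (comp_ar (ar s) (out t) (ar t)) (out u) (ar u))"
          using \<pi> by (simp add: parallel_perm_def Let_def)
        then show ?thesis by (simp add: perms_inj)
      qed
      moreover have "i < 2" "j < 2" "i \<noteq> j" using i j ne unfolding st by auto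
      moreover have "ksign (deg t * deg u) = (- 1::'k)" unfolding st by (simp add: ksign_def)
      ultimately show ?thesis by (auto simp: less_two_iff)
    qed auto
    show ?thesis
      unfolding L R unfolding tcomp_nonunit[OF f g s n(1)] tcomp_nonunit[OF f h s n(2)]
    proof (rule ext, goal_cases)
      case (1 b)
      show ?case
      proof (cases "b = Ka \<or> b = Ka'")
        case True
        consider "f Mu * g Eta * h Eta = 0" "f Mu' * g Eta * h Eta = 0"
          | "\<pi> Closed 0 \<noteq> 0" "ksign (deg t * deg u) = (- 1::'k)" "i = 0" "j = 1" 
          | "\<pi> Closed 0 \<noteq> 0" "ksign (deg t * deg u) = (- 1::'k)" "i = 1" "j = 0" using key by blast
        then show ?thesis by cases (use True in auto)
      next
        case False
        then show ?thesis by (cases b) auto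
      qed
    qed
  qed
qed

text \<open>As \<open>f\<close> is homogeneous, its degree may be replaced by that of each basis
  tree; in this form the identity holds tree by tree for arbitrary coefficients.\<close>

lemma tdiff_tcomp:
  fixes f :: "bas \<Rightarrow> 'k::field"
  assumes f: "supp s f" and g: "supp t g"
  shows "tdiff (tcomp i f g) = (\<lambda>d. tcomp i (tdiff f) g d + ksign (deg s) * tcomp i f (tdiff g) d)"
proof -
  have k: "(\<lambda>b. ksign (deg s) * f b) = (\<lambda>b. ksign (deg (bidx b)) * f b)"
  proof
    fix b show "ksign (deg s) * f b = ksign (deg (bidx b)) * f b"
      using suppD[OF f, of b] by (cases "f b = 0") auto
  qed
  have "tdiff (tcomp i f g) d = tcomp i (tdiff f) g d + tcomp i (\<lambda>b. ksign (deg (bidx b)) * f b) (tdiff g) d" for d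
    by (cases d) (simp_all add: ksign_def algebra_simps)
  then show ?thesis unfolding k[symmetric] tcomp_scale by (rule ext)
qed

lemma tdiff_tact: "tdiff (tact \<sigma> f) = tact \<sigma> (tdiff f)"
  by (rule bas_fun_eqI) auto

lemma tdiff_tdiff: "tdiff (tdiff f) = (\<lambda>b. 0)"
  by (rule bas_fun_eqI) auto

section \<open>Normal forms in the free operad\<close>

lemma permutes_lessThan_one: "p permutes {..<n} \<Longrightarrow> n \<le> 1 \<Longrightarrow> p = id" for n :: nat
proof -
  assume p: "p permutes {..<n}" and n: "n \<le> 1"
  have "p x = x" for x
    using permutes_in_image[OF p, of x] permutes_not_in[OF p, of x] n by (cases "x < n") auto
  then show "p = id" by (simp add: fun_eq_iff)
qed

lemma permutes_lessThan_two:
  assumes p: "p permutes {..<2::nat}"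
  shows "p = id \<or> p = Transposition.transpose 0 1"
proof -
  have "p 0 < 2" "p 1 < 2" "p 0 \<noteq> p 1"
    using permutes_in_image[OF p, of 0] permutes_in_image[OF p, of 1] inj_eq[OF permutes_inj[OF p], of 0 1] by auto
  moreover have big: "p x = x" if "\<not> x < 2" for x using permutes_not_in[OF p, of x] that by auto
  ultimately consider "p 0 = 0" "p 1 = 1" | "p 0 = 1" "p 1 = 0" by (auto simp: less_two_iff)
  then show ?thesis
  proof cases
    case 1
    then have "p x = id x" for x using big[of x] by (cases "x = 0"; cases "x = 1") auto
    then have "p = id" by (rule ext)
    then show ?thesis ..
  next
    case 2
    then have "p x = Transposition.transpose 0 1 x" for x 
      using big[of x] by (cases "x = 0"; cases "x = 1") (auto simp: Transposition.transpose_def)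
    then have "p = Transposition.transpose 0 1" by (rule ext)
    then show ?thesis ..
  qed
qed

definition oswap :: "colour \<Rightarrow> nat \<Rightarrow> nat" where
  "oswap = (\<lambda>y. if y = Open then Transposition.transpose 0 1 else id)"

lemma oswap_simps [simp]: "oswap Closed = id" "oswap Open = Transposition.transpose 0 1"
  by (auto simp: oswap_def)

lemma oswap_perms [simp]: "oswap \<in> perms (arr n 2)"
  using permutes_transpose_01 by (auto simp: perms_def all_colour permutes_id)

lemma id_perms [simp]: "(\<lambda>y. id) \<in> perms a"
  by (auto simp: perms_def permutes_id)

lemma perms_small:
  assumes "\<sigma> \<in> perms a" "a Closed \<le> 1" "a Open \<le> 1"
  shows "\<sigma> = (\<lambda>y. id)"
  using assms permutes_lessThan_one[of "\<sigma> Closed" "a Closed"] permutes_lessThan_one[of "\<sigma> Open" "a Open"]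
  by (simp add: perms_def arity_eq_iff all_colour)

lemma perms_20:
  assumes "\<sigma> \<in> perms (arr 2 0)"
  shows "\<sigma> = (\<lambda>y. id) \<or> \<sigma> = cswap"
  using assms permutes_lessThan_two[of "\<sigma> Closed"] permutes_lessThan_one[of "\<sigma> Open" 0]
  by (auto simp: perms_def arity_eq_iff all_colour)

lemma perms_02:
  assumes "\<sigma> \<in> perms (arr 0 2)"
  shows "\<sigma> = (\<lambda>y. id) \<or> \<sigma> = oswap"
  using assms permutes_lessThan_two[of "\<sigma> Open"] permutes_lessThan_one[of "\<sigma> Closed" 0]
  by (auto simp: perms_def arity_eq_iff all_colour)

lemma oswap_oswap: "(\<lambda>y. oswap y \<circ> oswap y) = (\<lambda>y. id)"
  by (auto simp: oswap_def)

text \<open>\<open>Mu'\<close> is counted as well: generators form vector spaces with an action, and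
  the component containing \<open>Mu\<close> is two-dimensional.\<close>

definition gen :: "bas \<Rightarrow> bool" where
  "gen b \<longleftrightarrow> b \<in> {Eta, Lam, Mu, Mu', Ha, Na}"

text \<open>\<open>\<omega> b\<close> plays the role of the coordinate of a generator along
  \<open>b\<close>; generators whose index carries no such coordinate evaluate to zero.\<close>

definition evgen :: "(bas \<Rightarrow> 'e \<Rightarrow> 'k::field) \<Rightarrow> idx \<Rightarrow> 'e \<Rightarrow> bas \<Rightarrow> 'k" where
  "evgen \<omega> s e b = (if gen b \<and> bidx b = s then \<omega> b e else 0)"

definition delta :: "bas \<Rightarrow> bas \<Rightarrow> 'k::field" where
  "delta b = (\<lambda>c. if c = b then 1 else 0)"

primrec ev :: "(bas \<Rightarrow> 'e \<Rightarrow> 'k::field) \<Rightarrow> 'e expr \<Rightarrow> bas \<Rightarrow> 'k" where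
  "ev \<omega> (Id x) = delta (uid x)"
| "ev \<omega> (Gen s e) = evgen \<omega> s e"
| "ev \<omega> (Act \<sigma> t) = tact \<sigma> (ev \<omega> t)"
| "ev \<omega> (Comp t i u) = tcomp i (ev \<omega> t) (ev \<omega> u)"

definition lev :: "(bas \<Rightarrow> 'e \<Rightarrow> 'k::field) \<Rightarrow> ('e expr \<Rightarrow>\<^sub>0 'k) \<Rightarrow> bas \<Rightarrow> 'k" where
  "lev \<omega> v = (\<lambda>b. pair (\<lambda>t. ev \<omega> t b) v)"

lemma delta_self [simp]: "delta b b = 1"
  by (simp add: delta_def)

lemma supp_delta [simp]: "supp s (delta b) \<longleftrightarrow> bidx b = s"
  by (auto simp: supp_def delta_def)

lemma supp_ev: "wf_expr E t \<Longrightarrow> supp (idx_of t) (ev \<omega> t)"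
proof (induction t)
  case (Gen s e)
  then show ?case by (auto simp: supp_def evgen_def)
qed (auto intro: supp_tact supp_tcomp)

lemma lev_simps:
  "lev \<omega> (v + w) = (\<lambda>b. lev \<omega> v b + lev \<omega> w b)" "lev \<omega> (v - w) = (\<lambda>b. lev \<omega> v b - lev \<omega> w b)"
  "lev \<omega> (- v) = (\<lambda>b. - lev \<omega> v b)" "lev \<omega> (scal c v) = (\<lambda>b. c * lev \<omega> v b)" 
  "lev \<omega> (basis_vec t) = ev \<omega> t" "lev \<omega> 0 = (\<lambda>b. 0)"
  by (auto simp: lev_def pair_add pair_diff pair_scal pair_uminus)

lemma lev_Act: "lev \<omega> (lin_ext (\<lambda>t. basis_vec (Act \<sigma> t)) v) = tact \<sigma> (lev \<omega> v)"
  by (rule bas_fun_eqI) (simp_all add: lev_def pair_lin_ext pair_fun_uminus)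

lemma lev_Comp_left: "lev \<omega> (lin_ext (\<lambda>t. basis_vec (Comp t i u)) v) = tcomp i (lev \<omega> v) (ev \<omega> u)"
  by (rule bas_fun_eqI) (simp_all add: lev_def pair_lin_ext pair_fun_add pair_fun_diff pair_mult_right)

lemma lev_Comp_right: "lev \<omega> (lin_ext (\<lambda>u. basis_vec (Comp t i u)) v) = tcomp i (ev \<omega> t) (lev \<omega> v)"
  by (rule bas_fun_eqI) (simp_all add: lev_def pair_lin_ext pair_fun_add pair_fun_diff pair_mult_left flip: distrib_left)

lemma exprs_simps [simp]:
  "Act \<sigma> t \<in> exprs E s \<longleftrightarrow> t \<in> exprs E s \<and> \<sigma> \<in> perms (ar s)"
  "Gen s' e \<in> exprs E s \<longleftrightarrow> s' = s \<and> e \<in> carrier (component E s)"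
  "Id x \<in> exprs E s \<longleftrightarrow> s = unit_idx x"
  by (auto simp: exprs_def)

lemma Comp_exprs:
  "t \<in> exprs E s \<Longrightarrow> u \<in> exprs E s' \<Longrightarrow> i < ar s (out s') \<Longrightarrow> Comp t i u \<in> exprs E (comp_idx s s')"
  by (auto simp: exprs_def)

lemma keys_basis: "t \<in> X \<Longrightarrow> Poly_Mapping.keys (basis_vec t) \<subseteq> X"
  by auto

lemma keys_lin_ext_le: 
  "Poly_Mapping.keys v \<subseteq> X \<Longrightarrow> (\<And>x. x \<in> X \<Longrightarrow> Poly_Mapping.keys (g x) \<subseteq> Y) \<Longrightarrow> Poly_Mapping.keys (lin_ext g v) \<subseteq> Y"
  using keys_lin_ext[of g v] by blast

lemma comp_ar_lt_left: "i < a x \<Longrightarrow> j < a y \<Longrightarrow> (x, i) \<noteq> (y, j) \<Longrightarrow> lab_out x i b y j < comp_ar a x b y"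
  by (auto simp: lab_out_def comp_ar_def)

lemma comp_ar_lt_right: "i < a x \<Longrightarrow> j < b y \<Longrightarrow> lab_in x i a y j < comp_ar a x b y"
  by (auto simp: lab_in_def comp_ar_def)

lemma comp_idx_assoc:
  assumes "i < ar s (out t)" "j < ar t (out u)"
  shows "comp_idx (comp_idx s t) u = comp_idx s (comp_idx t u)"
  using assms by (auto simp: idx_eq_iff comp_ar_def fun_eq_iff)

lemma comp_idx_comm:
  assumes "i < ar s (out t)" "j < ar s (out u)" "(out t, i) \<noteq> (out u, j)"
  shows "comp_idx (comp_idx s t) u = comp_idx (comp_idx s u) t"
  using assms by (auto simp: idx_eq_iff comp_ar_def fun_eq_iff)

text \<open>Passing to the quotient requires that relations do not leave the free module on the
  well-formed expressions of their index.\<close>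

lemma keys_relator:
  fixes E :: "('k::field, 'e) collection_data"
  assumes vs: "\<And>s. vs (component E s)"
    and act: "\<And>e s \<sigma>. e \<in> carrier (component E s) \<Longrightarrow> \<sigma> \<in> perms (ar s) \<Longrightarrow> act E s \<sigma> e \<in> carrier (component E s)"
  shows "relator E s r \<Longrightarrow> Poly_Mapping.keys r \<subseteq> exprs E s"
proof (induction rule: relator.induct)
  case (gen_add e s e')
  interpret module field_ring "component E s" by (rule vs)
  show ?case using gen_add by (intro free_module_closed keys_basis) auto
next
  case (gen_smult e s c)
  interpret module field_ring "component E s" by (rule vs)
  show ?case using gen_smult smult_closed[of c e] by (intro free_module_closed keys_basis) auto
next
  case (gen_act e s \<sigma>)
  then show ?case using act by (intro free_module_closed keys_basis) auto
next
  case (act_id t s)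
  then show ?case by (intro free_module_closed keys_basis) (auto simp: perms_def permutes_id)
next
  case (act_act t s \<sigma> \<tau>)
  then show ?case by (intro free_module_closed keys_basis) (auto simp: perms_def permutes_compose)
next
  case (unit_left t s)
  then show ?case using Comp_exprs[of "Id (out s)" E "unit_idx (out s)" t s 0] by (intro free_module_closed keys_basis) auto
next
  case (unit_right t s i x)
  then show ?case using Comp_exprs[of t E s "Id x" "unit_idx x" i] by (intro free_module_closed keys_basis) auto
next
  case (equivariance t s u s' i \<sigma> \<tau> \<pi>)
  then have "\<pi> \<in> perms (ar (comp_idx s s'))" by (simp add: equivariance_perm_def)
  moreover have "\<sigma> (out s') i < ar s (out s')" using equivariance perms_lt by blast
  ultimately show ?case using equivariance
    Comp_exprs[of "Act \<sigma> t" E s "Act \<tau> u" s' "\<sigma> (out s') i"] Comp_exprs[of t E s u s' i]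
    by (intro free_module_closed keys_basis) auto
next
  case (sequential_assoc t s u s' v s'' i j \<pi>)
  then have "\<pi> \<in> perms (ar (comp_idx (comp_idx s s') s''))" by (simp add: sequential_perm_def Let_def)
  moreover have "Comp (Comp t i u) (lab_in (out s') i (ar s) (out s'') j) v \<in> exprs E (comp_idx (comp_idx s s') s'')"
    using sequential_assoc by (intro Comp_exprs) (auto intro: comp_ar_lt_right)
  moreover have "Comp t i (Comp u j v) \<in> exprs E (comp_idx (comp_idx s s') s'')"
    unfolding comp_idx_assoc[OF sequential_assoc(4,5)] using sequential_assoc by (intro Comp_exprs) auto
  ultimately show ?case by (intro free_module_closed keys_basis) (auto simp del: comp_idx_simps)
next
  case (parallel_assoc t s u s' v s'' i j \<pi>)
  then have "\<pi> \<in> perms (ar (comp_idx (comp_idx s s') s''))" by (simp add: parallel_perm_def Let_def)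
  moreover have "Comp (Comp t i u) (lab_out (out s') i (ar s') (out s'') j) v \<in> exprs E (comp_idx (comp_idx s s') s'')"
    using parallel_assoc by (intro Comp_exprs) (auto intro!: comp_ar_lt_left)
  moreover have "Comp (Comp t j v) (lab_out (out s'') j (ar s'') (out s') i) u \<in> exprs E (comp_idx (comp_idx s s') s'')"
    unfolding comp_idx_comm[OF parallel_assoc(4-6)] using parallel_assoc by (intro Comp_exprs) (auto intro!: comp_ar_lt_left)
  ultimately show ?case by (intro free_module_closed keys_basis) (auto simp del: comp_idx_simps)
next
  case (cong_act s r \<sigma>)
  then show ?case by (elim keys_lin_ext_le) (intro keys_basis, auto)
next
  case (cong_comp_left s r u s' i)
  then show ?case by (elim keys_lin_ext_le) (intro keys_basis Comp_exprs, auto)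
next
  case (cong_comp_right t s s' r i)
  then show ?case by - (erule keys_lin_ext_le, intro keys_basis Comp_exprs, auto)
qed

definition tot :: "idx \<Rightarrow> nat" where
  "tot s = ar s Closed + ar s Open"

lemma tot_bidx: "1 \<le> tot (bidx b)" "tot (bidx b) \<le> 2"
  by (cases b; simp add: tot_def)+

text \<open>Generators with coordinates \<open>\<omega>\<close> and basis vectors \<open>e1\<close>,
  where \<open>Mu'\<close> arises from \<open>Mu\<close> by the action. Besides uniqueness of
  coordinates, \<open>separation\<close> says that components with at most two inputs and no
  coordinate are zero.\<close>

locale low_generators =
  fixes E :: "('k::field, 'e) collection_data" and \<omega> :: "bas \<Rightarrow> 'e \<Rightarrow> 'k" and e1 :: "bas \<Rightarrow> 'e"
  assumes vs_E: "vs (component E s)"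
    and act_closed: "e \<in> carrier (component E s) \<Longrightarrow> \<sigma> \<in> perms (ar s) \<Longrightarrow> act E s \<sigma> e \<in> carrier (component E s)"
    and \<omega>_add: "gen b \<Longrightarrow> e \<in> carrier (component E (bidx b)) \<Longrightarrow> e' \<in> carrier (component E (bidx b)) \<Longrightarrow>
      \<omega> b (e \<oplus>\<^bsub>component E (bidx b)\<^esub> e') = \<omega> b e + \<omega> b e'"
    and \<omega>_smult: "gen b \<Longrightarrow> e \<in> carrier (component E (bidx b)) \<Longrightarrow> \<omega> b (c \<odot>\<^bsub>component E (bidx b)\<^esub> e) = c * \<omega> b e"
    and \<omega>_act: "gen b \<Longrightarrow> e \<in> carrier (component E (bidx b)) \<Longrightarrow> \<sigma> \<in> perms (ar (bidx b)) \<Longrightarrow>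
      \<omega> b (act E (bidx b) \<sigma> e) = tact \<sigma> (\<lambda>c. \<omega> c e) b"
    and e1_closed: "b \<in> {Eta, Lam, Mu, Ha, Na} \<Longrightarrow> e1 b \<in> carrier (component E (bidx b))"
    and \<omega>_e1: "b \<in> {Eta, Lam, Mu, Ha, Na} \<Longrightarrow> \<omega> b (e1 b) = 1"
    and \<omega>_Mu': "\<omega> Mu' (e1 Mu) = 0"
    and separation: "tot s \<le> 2 \<Longrightarrow> e \<in> carrier (component E s) \<Longrightarrow> e' \<in> carrier (component E s) \<Longrightarrow>
      (\<And>b. gen b \<Longrightarrow> bidx b = s \<Longrightarrow> \<omega> b e = \<omega> b e') \<Longrightarrow> e = e'"
begin

lemma smult_closed: "e \<in> carrier (component E s) \<Longrightarrow> c \<odot>\<^bsub>component E s\<^esub> e \<in> carrier (component E s)"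
  using module.smult_closed[OF vs_E, of c e s] by simp

lemma add_closed: "e \<in> carrier (component E s) \<Longrightarrow> e' \<in> carrier (component E s) \<Longrightarrow> e \<oplus>\<^bsub>component E s\<^esub> e' \<in> carrier (component E s)"
  using abelian_monoid.a_closed[OF abelian_group.axioms(1)[OF vs_abelian_group[OF vs_E]]] .

text \<open>Evaluation is a morphism into the model: each rule for relators is matched by the
  corresponding axiom proved above.\<close>

lemma lev_relator: "relator E s r \<Longrightarrow> lev \<omega> r = (\<lambda>b. 0)"
proof (induction rule: relator.induct)
  case (gen_add e s e')
  then show ?case by (auto simp: lev_simps evgen_def \<omega>_add fun_eq_iff)
next
  case (gen_smult e s c)
  then show ?case by (auto simp: lev_simps evgen_def \<omega>_smult fun_eq_iff)
next
  case (gen_act e s \<sigma>)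
  have "evgen \<omega> s (act E s \<sigma> e) b = tact \<sigma> (evgen \<omega> s e) b" for b
    using gen_act \<omega>_act[of b e \<sigma>] by (cases b) (auto simp: evgen_def gen_def)
  then show ?case by (simp add: lev_simps)
next
  case (act_id t s)
  then show ?case by (simp add: lev_simps tact_id)
next
  case (act_act t s \<sigma> \<tau>)
  then show ?case using supp_ev[of E t \<omega>] by (simp add: lev_simps exprs_def tact_tact)
next
  case (unit_left t s)
  then show ?case using tcomp_unit_left[of s "delta (uid (out s))" "ev \<omega> t" 0] supp_ev[of E t \<omega>]
    by (simp add: lev_simps exprs_def)
next
  case (unit_right t s i x)
  then show ?case using tcomp_unit_right[of s "ev \<omega> t" x "delta (uid x)" i] supp_ev[of E t \<omega>]
    by (simp add: lev_simps exprs_def)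
next
  case (equivariance t s u s' i \<sigma> \<tau> \<pi>)
  then show ?case using supp_ev[of E t \<omega>] supp_ev[of E u \<omega>] tcomp_equivariance[of s "ev \<omega> t" s' "ev \<omega> u" i \<sigma> \<tau> \<pi>]
    by (simp add: lev_simps exprs_def)
next
  case (sequential_assoc t s u s' v s'' i j \<pi>)
  then show ?case using supp_ev[of E t \<omega>] supp_ev[of E u \<omega>] supp_ev[of E v \<omega>]
    tcomp_sequential[of s "ev \<omega> t" s' "ev \<omega> u" s'' "ev \<omega> v" i j \<pi>]
    by (simp add: lev_simps exprs_def)
next
  case (parallel_assoc t s u s' v s'' i j \<pi>)
  then show ?case using supp_ev[of E t \<omega>] supp_ev[of E u \<omega>] supp_ev[of E v \<omega>]
    tcomp_parallel[of s "ev \<omega> t" s' "ev \<omega> u" s'' "ev \<omega> v" i j \<pi>]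
    by (simp add: lev_simps exprs_def)
next
  case (cong_act s r \<sigma>)
  then show ?case by (simp add: lev_Act bas_fun_eqI)
next
  case (cong_comp_left s r u s' i)
  then show ?case by (simp add: lev_Comp_left bas_fun_eqI)
next
  case (cong_comp_right t s s' r i)
  then show ?case by (simp add: lev_Comp_right bas_fun_eqI)
qed

lemma lev_relations: "r \<in> relations E s \<Longrightarrow> lev \<omega> r = (\<lambda>b. 0)"
proof -
  assume r: "r \<in> relations E s"
  have "pair (\<lambda>t. ev \<omega> t b) r = 0" for b
    using r unfolding relations_def
    by (rule pair_span_of) (use lev_relator in \<open>auto simp: lev_def fun_eq_iff\<close>)
  then show ?thesis by (simp add: lev_def)
qed

text \<open>Equality in the free operad, expressed on representatives.\<close>

definition eqr :: "idx \<Rightarrow> ('e expr \<Rightarrow>\<^sub>0 'k) \<Rightarrow> ('e expr \<Rightarrow>\<^sub>0 'k) \<Rightarrow> bool" where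
  "eqr s v w \<longleftrightarrow> v - w \<in> relations E s"

lemma eqr_refl [simp, intro]: "eqr s v v"
  and eqr_trans [trans]: "eqr s u v \<Longrightarrow> eqr s v w \<Longrightarrow> eqr s u w"
  and eqr_sym: "eqr s v w \<Longrightarrow> eqr s w v"
  and eqr_add: "eqr s v w \<Longrightarrow> eqr s v' w' \<Longrightarrow> eqr s (v + v') (w + w')"
  and eqr_scal: "eqr s v w \<Longrightarrow> eqr s (scal c v) (scal c w)"
  and eqr_relator: "relator E s (v - w) \<Longrightarrow> eqr s v w"
proof -
  show "eqr s v v" by (simp add: eqr_def relations_def)
  show "eqr s u v \<Longrightarrow> eqr s v w \<Longrightarrow> eqr s u w"
    using span_of_add[of "u - v" _ "v - w"] by (simp add: eqr_def relations_def)
  show "eqr s v w \<Longrightarrow> eqr s w v"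
    using span_of_scal[of "v - w" _ "- 1"] by (simp add: eqr_def relations_def)
  show "eqr s v w \<Longrightarrow> eqr s v' w' \<Longrightarrow> eqr s (v + v') (w + w')"
    using span_of_add[of "v - w" _ "v' - w'"] by (simp add: eqr_def relations_def algebra_simps)
  show "eqr s v w \<Longrightarrow> eqr s (scal c v) (scal c w)"
    using span_of_scal[of "v - w" _ c] by (simp add: eqr_def relations_def scal.scale_right_diff_distrib)
  show "relator E s (v - w) \<Longrightarrow> eqr s v w" by (simp add: eqr_def relations_def span_of_base)
qed

lemma eqr_sum: "(\<And>i. i \<in> I \<Longrightarrow> eqr s (f i) (g i)) \<Longrightarrow> eqr s (sum f I) (sum g I)"
  by (induction I rule: infinite_finite_induct) (auto intro: eqr_add)

lemma eqr_lin_ext: "(\<And>x. x \<in> Poly_Mapping.keys v \<Longrightarrow> eqr s (f x) (g x)) \<Longrightarrow> eqr s (lin_ext f v) (lin_ext g v)"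
  unfolding lin_ext_def by (intro eqr_sum eqr_scal)

lemma eqr_Act: "eqr s v w \<Longrightarrow> \<sigma> \<in> perms (ar s) \<Longrightarrow>
    eqr s (lin_ext (\<lambda>t. basis_vec (Act \<sigma> t)) v) (lin_ext (\<lambda>t. basis_vec (Act \<sigma> t)) w)"
  unfolding eqr_def lin_ext_diff[symmetric] relations_def
  by (erule lin_ext_span_of) (auto intro: span_of_base relator.cong_act)

lemma eqr_Comp_left: "eqr s v w \<Longrightarrow> u \<in> exprs E s' \<Longrightarrow> i < ar s (out s') \<Longrightarrow>
    eqr (comp_idx s s') (lin_ext (\<lambda>t. basis_vec (Comp t i u)) v) (lin_ext (\<lambda>t. basis_vec (Comp t i u)) w)"
  unfolding eqr_def lin_ext_diff[symmetric] relations_def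
  by (erule lin_ext_span_of) (auto intro: span_of_base relator.cong_comp_left)

lemma eqr_Comp_right: "eqr s' v w \<Longrightarrow> t \<in> exprs E s \<Longrightarrow> i < ar s (out s') \<Longrightarrow>
    eqr (comp_idx s s') (lin_ext (\<lambda>u. basis_vec (Comp t i u)) v) (lin_ext (\<lambda>u. basis_vec (Comp t i u)) w)"
  unfolding eqr_def lin_ext_diff[symmetric] relations_def
  by (erule lin_ext_span_of) (auto intro: span_of_base relator.cong_comp_right)

fun nf :: "bas \<Rightarrow> 'e expr" where
  "nf IdC = Id Closed"
| "nf IdO = Id Open"
| "nf Mu' = Act oswap (Gen (bidx Mu) (e1 Mu))"
| "nf Aa = Comp (Gen (bidx Mu) (e1 Mu)) 0 (Gen (bidx Eta) (e1 Eta))"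
| "nf Ba = Comp (Gen (bidx Mu) (e1 Mu)) 1 (Gen (bidx Eta) (e1 Eta))"
| "nf EL = Comp (Gen (bidx Eta) (e1 Eta)) 0 (Gen (bidx Lam) (e1 Lam))"
| "nf HE = Comp (Gen (bidx Ha) (e1 Ha)) 0 (Gen (bidx Eta) (e1 Eta))"
| "nf HE' = Act cswap (Comp (Gen (bidx Ha) (e1 Ha)) 0 (Gen (bidx Eta) (e1 Eta)))"
| "nf Ka = Comp (Comp (Gen (bidx Mu) (e1 Mu)) 0 (Gen (bidx Eta) (e1 Eta))) 0 (Gen (bidx Eta) (e1 Eta))"
| "nf Ka' = Act cswap (Comp (Comp (Gen (bidx Mu) (e1 Mu)) 0 (Gen (bidx Eta) (e1 Eta))) 0 (Gen (bidx Eta) (e1 Eta)))"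
| "nf b = Gen (bidx b) (e1 b)"

lemma nf_exprs [simp]: "nf b \<in> exprs E (bidx b)"
  using e1_closed[of Eta] e1_closed[of Lam] e1_closed[of Mu] e1_closed[of Ha] e1_closed[of Na]
  by (cases b) (auto simp: exprs_def unit_idx_eq idx_eq_iff comp_ar_arr)

definition N :: "(bas \<Rightarrow> 'k) \<Rightarrow> ('e expr \<Rightarrow>\<^sub>0 'k)" where
  "N f = (\<Sum>b\<in>UNIV. scal (f b) (basis_vec (nf b)))"

lemma N_simps: "N (\<lambda>b. f b + g b) = N f + N g" "N (\<lambda>b. c * f b) = scal c (N f)" "N (\<lambda>b. 0) = 0" "N (\<lambda>b. - f b) = - N f"
  by (simp_all add: N_def scal.scale_left_distrib sum.distrib scal.scale_sum_right sum_negf)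

lemma N_delta: "N (delta b) = basis_vec (nf b)"
  by (simp add: N_def delta_def if_distrib[where f = "\<lambda>c. scal c _"] cong: if_cong)

lemma eqr_Act_id: "t \<in> exprs E s \<Longrightarrow> eqr s (basis_vec (Act (\<lambda>y. id) t)) (basis_vec t)"
  by (rule eqr_relator[OF relator.act_id])

lemma eqr_Act_Act: "t \<in> exprs E s \<Longrightarrow> \<sigma> \<in> perms (ar s) \<Longrightarrow> \<tau> \<in> perms (ar s) \<Longrightarrow>
    eqr s (basis_vec (Act \<sigma> (Act \<tau> t))) (basis_vec (Act (\<lambda>y. \<sigma> y \<circ> \<tau> y) t))"
  by (rule eqr_relator[OF relator.act_act])

lemma eqr_Gen_smult: "e \<in> carrier (component E s) \<Longrightarrow> eqr s (basis_vec (Gen s (c \<odot>\<^bsub>component E s\<^esub> e))) (scal c (basis_vec (Gen s e)))"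
  by (rule eqr_relator[OF relator.gen_smult])

lemma eqr_Gen_add: "e \<in> carrier (component E s) \<Longrightarrow> e' \<in> carrier (component E s) \<Longrightarrow>
    eqr s (basis_vec (Gen s (e \<oplus>\<^bsub>component E s\<^esub> e'))) (basis_vec (Gen s e) + basis_vec (Gen s e'))"
  by (rule eqr_relator[OF relator.gen_add])

lemma eqr_Gen_act: "e \<in> carrier (component E s) \<Longrightarrow> \<sigma> \<in> perms (ar s) \<Longrightarrow>
    eqr s (basis_vec (Gen s (act E s \<sigma> e))) (basis_vec (Act \<sigma> (Gen s e)))"
  by (rule eqr_relator[OF relator.gen_act])

lemma gen_unique:
  assumes "gen b" "gen c" "bidx b = bidx c"
  shows "b = c \<or> b \<in> {Mu, Mu'} \<and> c \<in> {Mu, Mu'}"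
  using assms by (cases b; cases c) (auto simp: gen_def)

text \<open>Antisymmetry holds already among the generators, since both sides have the same
  coordinates; the relators only carry it over.\<close>

lemma eqr_cswap_gen:
  assumes b: "b \<in> {Lam, Na}"
  shows "eqr (bidx b) (basis_vec (Act cswap (nf b))) (- basis_vec (nf b))"
proof -
  have e: "e1 b \<in> carrier (component E (bidx b))" using b by (intro e1_closed) auto
  have p: "cswap \<in> perms (ar (bidx b))" using b by auto
  have "act E (bidx b) cswap (e1 b) = (- 1) \<odot>\<^bsub>component E (bidx b)\<^esub> e1 b"
  proof (rule separation)
    show "act E (bidx b) cswap (e1 b) \<in> carrier (component E (bidx b))" using e p by (rule act_closed)
    show "(- 1) \<odot>\<^bsub>component E (bidx b)\<^esub> e1 b \<in> carrier (component E (bidx b))" using e by (rule smult_closed)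
    fix c assume c: "gen c" "bidx c = bidx b"
    then have cb: "c = b" using gen_unique[of c b] b by (auto simp: gen_def)
    show "\<omega> c (act E (bidx b) cswap (e1 b)) = \<omega> c ((- 1) \<odot>\<^bsub>component E (bidx b)\<^esub> e1 b)"
      unfolding cb using \<omega>_act[of b "e1 b" cswap] \<omega>_smult[of b "e1 b" "- 1"] e p b by (auto simp: gen_def)
  qed (rule tot_bidx)
  then have "eqr (bidx b) (basis_vec (Act cswap (Gen (bidx b) (e1 b)))) (scal (- 1) (basis_vec (Gen (bidx b) (e1 b))))"
    using eqr_trans[OF eqr_sym[OF eqr_Gen_act[OF e p]]] eqr_Gen_smult[OF e, of "- 1"] by simp
  then show ?thesis using b by auto
qed

lemma eqr_Act_nf:
  assumes \<sigma>: "\<sigma> \<in> perms (ar (bidx b))"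
  shows "eqr (bidx b) (basis_vec (Act \<sigma> (nf b))) (N (tact \<sigma> (delta b)))"
proof (cases "\<sigma> = (\<lambda>y. id)")
  case True
  then show ?thesis by (simp add: tact_id N_delta eqr_Act_id)
next
  case False
  then have b: "b \<in> {Mu, Mu'} \<and> \<sigma> = oswap \<or> b \<in> {Lam, Na, EL, HE, HE', Ka, Ka'} \<and> \<sigma> = cswap"
    using \<sigma> perms_small[OF \<sigma>] by (cases b) (auto dest: perms_20 perms_02)
  have t: "tact oswap (delta Mu) = (delta Mu' :: bas \<Rightarrow> 'k)" "tact oswap (delta Mu') = (delta Mu :: bas \<Rightarrow> 'k)"
    "tact cswap (delta HE) = (delta HE' :: bas \<Rightarrow> 'k)" "tact cswap (delta HE') = (delta HE :: bas \<Rightarrow> 'k)"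
    "tact cswap (delta Ka) = (delta Ka' :: bas \<Rightarrow> 'k)" "tact cswap (delta Ka') = (delta Ka :: bas \<Rightarrow> 'k)"
    "tact cswap (delta Lam) = (\<lambda>b. - delta Lam b :: 'k)" "tact cswap (delta Na) = (\<lambda>b. - delta Na b :: 'k)"
    "tact cswap (delta EL) = (\<lambda>b. - delta EL b :: 'k)"
    by (rule bas_fun_eqI; simp add: delta_def)+
  have inv: "eqr (bidx c) (basis_vec (Act \<tau> (Act \<tau> (nf c)))) (basis_vec (nf c))" 
    if "\<tau> \<in> perms (ar (bidx c))" "(\<lambda>y. \<tau> y \<circ> \<tau> y) = (\<lambda>y. id)" for \<tau> c
    using eqr_Act_Act[OF nf_exprs that(1) that(1)] eqr_Act_id[OF nf_exprs] unfolding that(2) by (rule eqr_trans)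
  \<comment> \<open>The antisymmetry of \<open>Lam\<close> passes to the composite \<open>EL\<close>
    by equivariance.\<close>
  have EL: "eqr (bidx EL) (basis_vec (Act cswap (nf EL))) (- basis_vec (nf EL))"
  proof -
    have ep: "equivariance_perm (arr 1 0) Closed 0 (arr 2 0) (\<lambda>y. id) cswap cswap"
      by (auto simp: equivariance_perm_def lab_out_def lab_in_def comp_ar_arr all_colour)
    have ci: "comp_idx (bidx Eta) (bidx Lam) = bidx EL" by (simp add: idx_eq_iff comp_ar_arr)
    have nL: "nf Lam \<in> exprs E (bidx Lam)" and nE: "nf Eta \<in> exprs E (bidx Eta)" by (rule nf_exprs)+
    have AL: "Act cswap (nf Lam) \<in> exprs E (bidx Lam)" using nL by (simp add: exprs_def)
    have "eqr (bidx EL) (basis_vec (Comp (Act (\<lambda>y. id) (nf Eta)) 0 (Act cswap (nf Lam)))) (basis_vec (Act cswap (Comp (nf Eta) 0 (nf Lam))))"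
      using eqr_relator[OF relator.equivariance[OF nE nL, of 0 "\<lambda>y. id" cswap cswap]] ep ci by simp
    moreover have "eqr (bidx EL) (basis_vec (Comp (Act (\<lambda>y. id) (nf Eta)) 0 (Act cswap (nf Lam)))) (basis_vec (Comp (nf Eta) 0 (Act cswap (nf Lam))))"
      using eqr_Comp_left[OF eqr_Act_id[OF nE] AL, of 0] ci by simp
    moreover have "eqr (bidx EL) (basis_vec (Comp (nf Eta) 0 (Act cswap (nf Lam)))) (- basis_vec (Comp (nf Eta) 0 (nf Lam)))"
      using eqr_Comp_right[OF eqr_cswap_gen[of Lam] nE, of 0] ci by (simp add: lin_ext_uminus)
    ultimately have "eqr (bidx EL) (basis_vec (Act cswap (Comp (nf Eta) 0 (nf Lam)))) (- basis_vec (Comp (nf Eta) 0 (nf Lam)))"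
      by (meson eqr_sym eqr_trans)
    then show ?thesis by simp
  qed
  from b consider "b = Mu" "\<sigma> = oswap" | "b = Mu'" "\<sigma> = oswap" | "b = Lam \<or> b = Na" "\<sigma> = cswap" | "b = EL" "\<sigma> = cswap"
    | "b = HE" "\<sigma> = cswap" | "b = HE'" "\<sigma> = cswap" | "b = Ka" "\<sigma> = cswap" | "b = Ka'" "\<sigma> = cswap" by blast
  then show ?thesis
  proof cases
    case 1
    then show ?thesis using N_delta[of Mu'] by (simp add: t)
  next
    case 2
    then show ?thesis using N_delta[of Mu] inv[of oswap Mu] by (simp add: t oswap_oswap)
  next
    case 3
    then show ?thesis using eqr_cswap_gen[of b] N_delta[of b] by (auto simp: t N_simps)
  next
    case 4
    then show ?thesis using EL N_delta[of EL] by (simp add: t N_simps)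
  next
    case 5
    then show ?thesis using N_delta[of HE'] by (simp add: t)
  next
    case 6
    then show ?thesis using N_delta[of HE] inv[of cswap HE] by (simp add: t cswap_cswap)
  next
    case 7
    then show ?thesis using N_delta[of Ka'] by (simp add: t)
  next
    case 8
    then show ?thesis using N_delta[of Ka] inv[of cswap Ka] by (simp add: t cswap_cswap)
  qed
qed

text \<open>The bound on the inputs leaves the identities and a few pairs. Most of these composites
  are normal forms as they stand; \<open>Mu'\<close> with \<open>Eta\<close> needs equivariance, and
  \<open>Ba\<close> with \<open>Eta\<close> needs parallel associativity.\<close>

lemma eqr_Comp_nf:
  assumes i: "i < ar (bidx b) (out (bidx c))" and t: "tot (comp_idx (bidx b) (bidx c)) \<le> 2"
  shows "eqr (comp_idx (bidx b) (bidx c)) (basis_vec (Comp (nf b) i (nf c))) (N (tcomp i (delta b) (delta c)))"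
proof -
  have nE: "nf Eta \<in> exprs E (bidx Eta)" and nM: "nf Mu \<in> exprs E (bidx Mu)" by (rule nf_exprs)+
  consider (r) x where "c = uid x" | (l) x where "b = uid x" | (EL) "b = Eta" "c = Lam" | (Mu) "b = Mu" "c = Eta"
    | (Mu') "b = Mu'" "c = Eta" | (Ha) "b = Ha" "c = Eta" | (Aa) "b = Aa" "c = Eta" | (Ba) "b = Ba" "c = Eta"
  proof -
    have "c \<in> {IdC, IdO} \<or> b \<in> {IdC, IdO} \<or> b = Eta \<and> c = Lam \<or> c = Eta \<and> b \<in> {Mu, Mu', Ha, Aa, Ba}"
      using i t by (cases c; cases b) (simp_all add: tot_def comp_ar_arr)
    then consider "c = uid Closed" | "c = uid Open" | "b = uid Closed" | "b = uid Open" | "b = Eta" "c = Lam" | "b = Mu" "c = Eta"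
      | "b = Mu'" "c = Eta" | "b = Ha" "c = Eta" | "b = Aa" "c = Eta" | "b = Ba" "c = Eta"
      by (auto simp: uid_def)
    then show thesis by cases (use that in blast)+
  qed
  then show ?thesis
  proof cases
    case r
    then have "comp_idx (bidx b) (bidx c) = bidx b" "tcomp i (delta b) (delta c) = (delta b :: bas \<Rightarrow> 'k)"
      using i tcomp_unit_right[of "bidx b" "delta b :: bas \<Rightarrow> 'k" x "delta (uid x)" i] by simp_all
    moreover have "nf c = Id x" using r by (cases x) (auto simp: uid_def)
    ultimately show ?thesis using eqr_relator[OF relator.unit_right[OF nf_exprs[of b], of i x]] i r by (simp add: N_delta)
  next
    case l
    then have x: "x = out (bidx c)" "i = 0" using i by (auto simp: unit_ar_less)
    then have "comp_idx (bidx b) (bidx c) = bidx c" "tcomp i (delta b) (delta c) = (delta c :: bas \<Rightarrow> 'k)"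
      using l tcomp_unit_left[of "bidx c" "delta (uid x) :: bas \<Rightarrow> 'k" "delta c" i] by simp_all
    moreover have "nf b = Id x" using l by (cases x) (auto simp: uid_def)
    ultimately show ?thesis using eqr_relator[OF relator.unit_left[OF nf_exprs[of c]]] x by (simp add: N_delta)
  next
    case EL
    have d: "tcomp i (delta Eta) (delta Lam) = (delta EL :: bas \<Rightarrow> 'k)" by (rule bas_fun_eqI) (simp_all add: delta_def)
    show ?thesis unfolding EL d using i EL by (simp add: N_delta)
  next
    case Mu
    have d: "tcomp 0 (delta Mu) (delta Eta) = (delta Aa :: bas \<Rightarrow> 'k)" "tcomp 1 (delta Mu) (delta Eta) = (delta Ba :: bas \<Rightarrow> 'k)"
      by (rule bas_fun_eqI; simp add: delta_def)+
    have "i = 0 \<or> i = 1" using i Mu by auto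
    then show ?thesis unfolding Mu using d by (auto simp: N_delta)
  next
    case Mu'
    have d: "tcomp 0 (delta Mu') (delta Eta) = (delta Ba :: bas \<Rightarrow> 'k)" "tcomp 1 (delta Mu') (delta Eta) = (delta Aa :: bas \<Rightarrow> 'k)"
      by (rule bas_fun_eqI; simp add: delta_def)+
    have ci: "comp_idx (bidx Mu) (bidx Eta) = bidx Aa" by simp
    have AE: "Act (\<lambda>y. id) (nf Eta) \<in> exprs E (bidx Eta)" using nE by (simp add: exprs_def)
    have AM: "Act oswap (nf Mu) \<in> exprs E (bidx Mu)" using nM by (simp add: exprs_def)
    \<comment> \<open>Equivariance for the exchange of the open inputs of \<open>Mu\<close>. One
      open input remains after insertion, so the permutation of the composite is trivial.\<close>
    have main: "eqr (bidx Aa) (basis_vec (Comp (Act oswap (nf Mu)) (1 - k) (nf Eta))) (basis_vec (Comp (nf Mu) k (nf Eta)))" if k: "k = 0 \<or> k = 1" for k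
    proof -
      have ep: "equivariance_perm (arr 0 2) Open k (arr 1 0) oswap (\<lambda>y. id) (\<lambda>y. id)"
        using k by (auto simp: equivariance_perm_def lab_out_def lab_in_def comp_ar_arr less_two_iff all_colour)
      have ok: "oswap Open k = 1 - k" using k by auto
      have CE: "Comp (nf Mu) k (nf Eta) \<in> exprs E (bidx Aa)" using nE nM k by (auto simp: exprs_def)
      have "eqr (bidx Aa) (basis_vec (Comp (Act oswap (nf Mu)) (1 - k) (Act (\<lambda>y. id) (nf Eta)))) (basis_vec (Act (\<lambda>y. id) (Comp (nf Mu) k (nf Eta))))"
        using eqr_relator[OF relator.equivariance[OF nM nE, of k oswap "\<lambda>y. id" "\<lambda>y. id"]] ep k ok by auto
      moreover have "eqr (bidx Aa) (basis_vec (Comp (Act oswap (nf Mu)) (1 - k) (Act (\<lambda>y. id) (nf Eta)))) (basis_vec (Comp (Act oswap (nf Mu)) (1 - k) (nf Eta)))"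
        using eqr_Comp_right[OF eqr_Act_id[OF nE] AM, of "1 - k"] k by auto
      moreover note eqr_Act_id[OF CE]
      ultimately show ?thesis by (meson eqr_sym eqr_trans)
    qed
    have "i = 0 \<or> i = 1" using i Mu' by auto
    then show ?thesis unfolding Mu' using d main[of 0] main[of 1] by (auto simp: N_delta)
  next
    case Ha
    have d: "tcomp 0 (delta Ha) (delta Eta) = (delta HE :: bas \<Rightarrow> 'k)"
      by (rule bas_fun_eqI; simp add: delta_def)
    have "i = 0" using i Ha by auto
    then show ?thesis unfolding Ha using d by (simp add: N_delta)
  next
    case Aa
    have d: "tcomp 0 (delta Aa) (delta Eta) = (delta Ka :: bas \<Rightarrow> 'k)"
      by (rule bas_fun_eqI; simp add: delta_def)
    have "i = 0" using i Aa by auto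
    then show ?thesis unfolding Aa using d by (simp add: N_delta)
  next
    case Ba
    have d: "tcomp 0 (delta Ba) (delta Eta) = (\<lambda>b. - delta Ka' b :: 'k)"
      by (rule bas_fun_eqI; simp add: delta_def)
    have i0: "i = 0" using i Ba by auto
    have pp: "parallel_perm (arr 0 2) Open 1 (arr 1 0) Open 0 (arr 1 0) cswap"
      by (auto simp: parallel_perm_def Let_def lab_out_def lab_in_def comp_ar_arr less_two_iff all_colour)
    have "eqr (bidx Ka) (basis_vec (Comp (Comp (nf Mu) 1 (nf Eta)) 0 (nf Eta))) (scal (- 1) (basis_vec (Act cswap (Comp (Comp (nf Mu) 0 (nf Eta)) 0 (nf Eta)))))"
      using eqr_relator[OF relator.parallel_assoc[OF nM nE nE, of 1 0 cswap]] pp by (simp add: lab_out_def ksign_def)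
    then show ?thesis unfolding Ba i0 d by (simp add: N_simps N_delta)
  qed
qed

lemma N_sum: "finite A \<Longrightarrow> N (\<lambda>d. \<Sum>a\<in>A. g a * G a d) = (\<Sum>a\<in>A. scal (g a) (N (G a)))"
  by (induction A rule: finite_induct) (auto simp: N_simps)

text \<open>The assumption is restricted to nonzero coefficients because only those tell the index
  of \<open>b\<close>.\<close>

lemma N_expand:
  fixes g :: "bas \<Rightarrow> 'k"
  shows "(\<And>b. g b \<noteq> 0 \<Longrightarrow> eqr s (F b) (N (G b))) \<Longrightarrow>
    eqr s (\<Sum>b\<in>UNIV. scal (g b) (F b)) (N (\<lambda>d. \<Sum>b\<in>UNIV. g b * G b d))"
proof -
  assume "\<And>b. g b \<noteq> 0 \<Longrightarrow> eqr s (F b) (N (G b))"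
  then have "eqr s (scal (g b) (F b)) (scal (g b) (N (G b)))" for b
    by (cases "g b = 0") (auto intro: eqr_scal)
  then have "eqr s (\<Sum>b\<in>UNIV. scal (g b) (F b)) (\<Sum>b\<in>UNIV. scal (g b) (N (G b)))"
    by (intro eqr_sum)
  then show ?thesis using N_sum[of "UNIV :: bas set" g G] by simp
qed

lemma tact_expand: "tact \<sigma> f = (\<lambda>d. \<Sum>b\<in>UNIV. f b * tact \<sigma> (delta b) d)"
  by (rule bas_fun_eqI) (simp_all add: UNIV_bas delta_def)

lemma tcomp_expand_left: "tcomp i f g = (\<lambda>d. \<Sum>b\<in>UNIV. f b * tcomp i (delta b) g d)"
  by (rule bas_fun_eqI) (simp_all add: UNIV_bas delta_def algebra_simps)

lemma tcomp_expand_right: "tcomp i f g = (\<lambda>d. \<Sum>b\<in>UNIV. g b * tcomp i f (delta b) d)"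
  by (rule bas_fun_eqI) (simp_all add: UNIV_bas delta_def algebra_simps)

lemma lin_ext_N: "lin_ext F (N f) = (\<Sum>b\<in>UNIV. scal (f b) (F (nf b)))"
  by (simp add: N_def lin_ext_sum lin_ext_scal)

text \<open>\<open>separation\<close> writes the generator as a combination of the basis vectors
  inside its own component; the relators for linearity and action move this equation into the free
  operad.\<close>

lemma eqr_Gen:
  assumes e: "e \<in> carrier (component E s)" and t: "tot s \<le> 2"
  shows "eqr s (basis_vec (Gen s e)) (N (evgen \<omega> s e))"
proof -
  consider "\<nexists>b. gen b \<and> bidx b = s" | (Mu) "s = bidx Mu" | b where "b \<in> {Eta, Lam, Ha, Na}" "s = bidx b"
  proof (cases "\<exists>b. gen b \<and> bidx b = s")
    case True
    then obtain b where b: "gen b" "s = bidx b" by blast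
    then have "b = Mu \<or> b = Mu' \<or> b \<in> {Eta, Lam, Ha, Na}" by (auto simp: gen_def)
    then show thesis using that(2) that(3)[of b] b by auto
  next
    case False
    then show thesis by (rule that(1))
  qed
  then show ?thesis
  proof cases
    case 1
    \<comment> \<open>No coordinate exists at this index, so all its vectors coincide and
      \<open>e\<close> equals a zero multiple of itself.\<close>
    have "e = 0 \<odot>\<^bsub>component E s\<^esub> e" using 1 by (intro separation[OF t e smult_closed[OF e]]) auto
    then have "eqr s (basis_vec (Gen s e)) (scal 0 (basis_vec (Gen s e)))" using eqr_Gen_smult[OF e, of 0] by simp
    moreover have "evgen \<omega> s e = (\<lambda>b. 0)" using 1 by (auto simp: evgen_def fun_eq_iff)
    ultimately show ?thesis by (simp add: N_simps)
  next
    case Mu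
    let ?V = "component E (bidx Mu)"
    define m' where "m' = act E (bidx Mu) oswap (e1 Mu)"
    have m: "e1 Mu \<in> carrier ?V" by (rule e1_closed) auto
    have m': "m' \<in> carrier ?V" unfolding m'_def using m by (rule act_closed) simp
    have val: "\<omega> Mu (e1 Mu) = 1" "\<omega> Mu' (e1 Mu) = 0" "\<omega> Mu m' = 0" "\<omega> Mu' m' = 1"
      using \<omega>_e1[of Mu] \<omega>_Mu' \<omega>_act[of Mu "e1 Mu" oswap] \<omega>_act[of Mu' "e1 Mu" oswap] m by (auto simp: m'_def gen_def)
    have c: "\<omega> Mu e \<odot>\<^bsub>?V\<^esub> e1 Mu \<in> carrier ?V" "\<omega> Mu' e \<odot>\<^bsub>?V\<^esub> m' \<in> carrier ?V" using m m' by (auto intro: smult_closed)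
    have "e = \<omega> Mu e \<odot>\<^bsub>?V\<^esub> e1 Mu \<oplus>\<^bsub>?V\<^esub> \<omega> Mu' e \<odot>\<^bsub>?V\<^esub> m'"
    proof (rule separation[OF t[unfolded Mu] e[unfolded Mu] add_closed[OF c]])
      fix b assume b: "gen b" "bidx b = bidx Mu"
      then have "b = Mu \<or> b = Mu'" using gen_unique[of b Mu] by (auto simp: gen_def)
      then show "\<omega> b e = \<omega> b (\<omega> Mu e \<odot>\<^bsub>?V\<^esub> e1 Mu \<oplus>\<^bsub>?V\<^esub> \<omega> Mu' e \<odot>\<^bsub>?V\<^esub> m')"
        using \<omega>_add[of b, OF b(1)] \<omega>_smult[of b, OF b(1)] c m m' val by (auto simp: b(2))
    qed
    then have "eqr (bidx Mu) (basis_vec (Gen (bidx Mu) e)) (basis_vec (Gen (bidx Mu) (\<omega> Mu e \<odot>\<^bsub>?V\<^esub> e1 Mu)) + basis_vec (Gen (bidx Mu) (\<omega> Mu' e \<odot>\<^bsub>?V\<^esub> m')))"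
      using eqr_Gen_add[OF c] by simp
    also have "eqr (bidx Mu) \<dots> (scal (\<omega> Mu e) (basis_vec (nf Mu)) + scal (\<omega> Mu' e) (basis_vec (Gen (bidx Mu) m')))"
      using eqr_add[OF eqr_Gen_smult[OF m] eqr_Gen_smult[OF m']] by simp
    also have "eqr (bidx Mu) \<dots> (scal (\<omega> Mu e) (basis_vec (nf Mu)) + scal (\<omega> Mu' e) (basis_vec (nf Mu')))"
      using eqr_add[OF eqr_refl eqr_scal[OF eqr_Gen_act[OF m, of oswap]]] by (simp add: m'_def)
    also have "\<dots> = N (evgen \<omega> s e)"
    proof -
      have "evgen \<omega> s e = (\<lambda>b. \<omega> Mu e * delta Mu b + \<omega> Mu' e * delta Mu' b)"
        unfolding Mu by (rule bas_fun_eqI) (simp_all add: evgen_def gen_def delta_def)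
      then show ?thesis by (simp only: N_simps N_delta)
    qed
    finally show ?thesis unfolding Mu .
  next
    case (3 b)
    have g: "gen b" using 3 by (auto simp: gen_def)
    have m: "e1 b \<in> carrier (component E (bidx b))" using 3 by (intro e1_closed) auto
    have "e = \<omega> b e \<odot>\<^bsub>component E s\<^esub> e1 b"
    proof (rule separation[OF t e])
      show "\<omega> b e \<odot>\<^bsub>component E s\<^esub> e1 b \<in> carrier (component E s)" using m 3 by (auto intro: smult_closed)
      fix c assume c: "gen c" "bidx c = s"
      then have "c = b" using gen_unique[of c b] 3 g by auto
      then show "\<omega> c e = \<omega> c (\<omega> b e \<odot>\<^bsub>component E s\<^esub> e1 b)" using \<omega>_smult[OF g m] \<omega>_e1[of b] 3 by auto
    qed
    then have "eqr s (basis_vec (Gen s e)) (scal (\<omega> b e) (basis_vec (Gen (bidx b) (e1 b))))"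
      using eqr_Gen_smult[OF m, of "\<omega> b e"] 3 by simp
    moreover have "evgen \<omega> s e = (\<lambda>c. \<omega> b e * delta b c)"
    proof
      fix c show "evgen \<omega> s e c = \<omega> b e * delta b c"
        using gen_unique[of c b] 3 g by (auto simp: evgen_def delta_def)
    qed
    moreover have "nf b = Gen (bidx b) (e1 b)" using 3 by auto
    ultimately show ?thesis by (simp add: N_simps N_delta)
  qed
qed

lemma supp_tot_zero: "supp s f \<Longrightarrow> tot s = 0 \<or> 2 < tot s \<Longrightarrow> f = (\<lambda>b. 0)"
  using supp_zero[of s f] tot_bidx by (metis le_zero_eq not_one_le_zero not_le)

lemma tcomp_zero: "tcomp i f (\<lambda>b. 0) = (\<lambda>b. 0)" "tcomp i (\<lambda>b. 0) f = (\<lambda>b. 0)"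
  by (rule bas_fun_eqI; simp)+

theorem normal_form:
  "wf_expr E t \<Longrightarrow> tot (idx_of t) \<le> 2 \<Longrightarrow> eqr (idx_of t) (basis_vec t) (N (ev \<omega> t))"
proof (induction t)
  case (Id x)
  have "nf (uid x) = Id x" by (cases x) (auto simp: uid_def)
  then show ?case by (simp add: N_delta)
next
  case (Gen s e)
  then show ?case using eqr_Gen by simp
next
  case (Act \<sigma> t)
  let ?f = "ev \<omega> t"
  have w: "wf_expr E t" "\<sigma> \<in> perms (ar (idx_of t))" using Act.prems by auto
  have "eqr (idx_of t) (basis_vec (Act \<sigma> t)) (\<Sum>b\<in>UNIV. scal (?f b) (basis_vec (Act \<sigma> (nf b))))"
    using eqr_Act[OF Act.IH w(2)] Act.prems by (simp add: lin_ext_N)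
  also have "eqr (idx_of t) \<dots> (N (\<lambda>d. \<Sum>b\<in>UNIV. ?f b * tact \<sigma> (delta b) d))"
    by (rule N_expand) (use suppD[OF supp_ev[OF w(1)]] w(2) eqr_Act_nf in metis)
  finally show ?case unfolding tact_expand[symmetric] by simp
next
  case (Comp t i u)
  let ?f = "ev \<omega> t" and ?g = "ev \<omega> u" and ?s = "idx_of t" and ?s' = "idx_of u"
  have w: "wf_expr E t" "wf_expr E u" "i < ar ?s (out ?s')" using Comp.prems by auto
  have ex: "t \<in> exprs E ?s" "u \<in> exprs E ?s'" using w by (auto simp: exprs_def)
  have tt: "tot (comp_idx ?s ?s') = tot ?s + tot ?s' - 1" "1 \<le> tot ?s"
    using w(3) by (cases "out ?s'"; simp add: tot_def comp_ar_def)+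
  have tle: "tot (comp_idx ?s ?s') \<le> 2" using Comp.prems by simp
  note sf = supp_ev[OF w(1), of \<omega>] and sg = supp_ev[OF w(2), of \<omega>]
  show ?case
  proof (cases "tot ?s' = 0")
    \<comment> \<open>Here \<open>t\<close> may have three inputs, outside the reach of its
      induction hypothesis. But \<open>u\<close> has no inputs, and since the model has no trees of
      arity 0 it is equivalent to zero.\<close>
    case True
    then have g: "?g = (\<lambda>b. 0)" using supp_tot_zero[OF sg] by simp
    then have "eqr ?s' (basis_vec u) 0" using Comp.IH(2) w True by (simp add: N_simps)
    then have "eqr (comp_idx ?s ?s') (basis_vec (Comp t i u)) 0"
      using eqr_Comp_right[OF _ ex(1) w(3)] by fastforce
    then show ?thesis by (simp add: g tcomp_zero N_simps)
  next
    case False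
    then have le: "tot ?s \<le> 2" "tot ?s' \<le> 2" using tt Comp.prems by auto
    have "eqr (comp_idx ?s ?s') (basis_vec (Comp t i u)) (\<Sum>b\<in>UNIV. scal (?f b) (basis_vec (Comp (nf b) i u)))"
      using eqr_Comp_left[OF Comp.IH(1)[OF w(1) le(1)] ex(2) w(3)] by (simp add: lin_ext_N)
    also have "eqr (comp_idx ?s ?s') \<dots> (N (\<lambda>d. \<Sum>b\<in>UNIV. ?f b * tcomp i (delta b) ?g d))"
    proof (rule N_expand)
      fix b assume "?f b \<noteq> 0"
      then have b: "?s = bidx b" by (rule suppD[OF sf])
      have nb: "nf b \<in> exprs E ?s" using b by simp
      have "eqr (comp_idx ?s ?s') (basis_vec (Comp (nf b) i u)) (\<Sum>c\<in>UNIV. scal (?g c) (basis_vec (Comp (nf b) i (nf c))))"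
        using eqr_Comp_right[OF Comp.IH(2)[OF w(2) le(2)] nb w(3)] by (simp add: lin_ext_N)
      also have "eqr (comp_idx ?s ?s') \<dots> (N (\<lambda>d. \<Sum>c\<in>UNIV. ?g c * tcomp i (delta b) (delta c) d))"
      proof (rule N_expand)
        fix c assume "?g c \<noteq> 0"
        then have c: "?s' = bidx c" by (rule suppD[OF sg])
        show "eqr (comp_idx ?s ?s') (basis_vec (Comp (nf b) i (nf c))) (N (tcomp i (delta b) (delta c)))"
          using eqr_Comp_nf[of i b c] w(3) tle unfolding b c by simp
      qed
      finally show "eqr (comp_idx ?s ?s') (basis_vec (Comp (nf b) i u)) (N (tcomp i (delta b) ?g))"
        unfolding tcomp_expand_right[symmetric] .
    qed
    finally show ?thesis unfolding tcomp_expand_left[symmetric] by simp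
  qed
qed

text \<open>The normal form of a combination has its evaluation as coefficients, so a combination
  that evaluates to zero is equivalent to zero. This makes low arity of the free operad
  computable.\<close>

theorem relations_iff:
  assumes v: "Poly_Mapping.keys v \<subseteq> exprs E s" and t: "tot s \<le> 2"
  shows "v \<in> relations E s \<longleftrightarrow> lev \<omega> v = (\<lambda>b. 0)"
proof
  assume z: "lev \<omega> v = (\<lambda>b. 0)"
  have "eqr s (lin_ext basis_vec v) (lin_ext (\<lambda>x. N (ev \<omega> x)) v)"
    by (rule eqr_lin_ext) (use v t normal_form in \<open>auto simp: exprs_def subset_iff\<close>)
  moreover have "lin_ext (\<lambda>x. N (ev \<omega> x)) v = N (lev \<omega> v)"
    unfolding lin_ext_def lev_def pair_def by (rule N_sum[symmetric]) simp
  ultimately show "v \<in> relations E s" by (simp add: z N_simps eqr_def)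
qed (rule lev_relations)

end

lemma (in quotient_space) minus_quotient:
  assumes "u \<in> carrier V" "v \<in> carrier V"
  shows "cl u \<ominus>\<^bsub>quotient_module V W\<^esub> cl v = cl (u \<ominus>\<^bsub>V\<^esub> v)"
proof -
  interpret Q: vspace "quotient_module V W" by (rule vspace.intro[OF vs_quotient])
  have c: "cl w \<in> carrier (quotient_module V W)" if "w \<in> carrier V" for w
    using that by (auto simp: carrier_quotient)
  have "\<ominus>\<^bsub>quotient_module V W\<^esub> cl v = cl (\<ominus>\<^bsub>V\<^esub> v)"
    using Q.smult_minus_one[OF c[OF assms(2)]] smult_quotient[OF assms(2), of "- 1"] smult_minus_one[OF assms(2)] by simp
  then show ?thesis using add_quotient[OF assms(1), of "\<ominus>\<^bsub>V\<^esub> v"] assms(2) by (simp add: a_minus_def)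
qed

section \<open>The cobar construction in low arity\<close>

text \<open>The two assumptions on \<open>cobar_gen\<close> are what has to be computed for a
  particular cooperad: well-formedness at every index, and agreement with the differential of the
  model.\<close>

locale low_cobar = low_generators E \<omega> e1 
  for E :: "('k::field, 'e) collection_data" and \<omega> e1 +
  fixes C :: "('k, 'e) cooperad_data"
  assumes E_def: "E = desuspend (coaug_coideal C)"
    and cobar_keys: "c \<in> carrier (component E s) \<Longrightarrow> Poly_Mapping.keys (cobar_gen C (shift 1 s) c) \<subseteq> exprs E (shift (- 1) s)"
    and cobar_lev: "c \<in> carrier (component E s) \<Longrightarrow> lev \<omega> (cobar_gen C (shift 1 s) c) = tdiff (evgen \<omega> s c)"
begin

lemma shift_comp: "shift n (comp_idx s t) = comp_idx (shift n s) t" "shift n (comp_idx s t) = comp_idx s (shift n t)"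
  by (auto simp: idx_eq_iff)

lemma keys_lin_ext_Act:
  "Poly_Mapping.keys v \<subseteq> exprs E s \<Longrightarrow> \<sigma> \<in> perms (ar s) \<Longrightarrow> Poly_Mapping.keys (lin_ext (\<lambda>t. basis_vec (Act \<sigma> t)) v) \<subseteq> exprs E s"
  by (erule keys_lin_ext_le) (intro keys_basis, simp)

lemma keys_cobar_diff: "wf_expr E t \<Longrightarrow> Poly_Mapping.keys (cobar_diff C t) \<subseteq> exprs E (shift (- 1) (idx_of t))"
proof (induction t)
  case (Gen s c)
  then show ?case using cobar_keys by simp
next
  case (Act \<sigma> t)
  then have "Poly_Mapping.keys (cobar_diff C t) \<subseteq> exprs E (shift (- 1) (idx_of t))" "\<sigma> \<in> perms (ar (idx_of t))" by auto
  then show ?case using keys_lin_ext_Act[of "cobar_diff C t" "shift (- 1) (idx_of t)" \<sigma>] by simp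
next
  case (Comp t i u)
  then have k: "Poly_Mapping.keys (cobar_diff C t) \<subseteq> exprs E (shift (- 1) (idx_of t))"
    "Poly_Mapping.keys (cobar_diff C u) \<subseteq> exprs E (shift (- 1) (idx_of u))"
    and w: "t \<in> exprs E (idx_of t)" "u \<in> exprs E (idx_of u)" "i < ar (idx_of t) (out (idx_of u))" by (auto simp: exprs_def)
  have "Poly_Mapping.keys (lin_ext (\<lambda>t'. basis_vec (Comp t' i u)) (cobar_diff C t)) \<subseteq> exprs E (shift (- 1) (comp_idx (idx_of t) (idx_of u)))"
    using k(1) by (rule keys_lin_ext_le) (unfold shift_comp(1), intro keys_basis Comp_exprs, use w in auto)
  moreover have "Poly_Mapping.keys (lin_ext (\<lambda>u'. basis_vec (Comp t i u')) (cobar_diff C u)) \<subseteq> exprs E (shift (- 1) (comp_idx (idx_of t) (idx_of u)))"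
    using k(2) by (rule keys_lin_ext_le) (unfold shift_comp(2), intro keys_basis Comp_exprs, use w in auto)
  ultimately show ?case by (simp add: free_module_closed)
qed simp

lemma lev_cobar_diff: "wf_expr E t \<Longrightarrow> lev \<omega> (cobar_diff C t) = tdiff (ev \<omega> t)"
proof (induction t)
  case (Id x)
  then show ?case by (intro bas_fun_eqI) (simp_all add: lev_simps delta_def uid_def)
next
  case (Gen s c)
  then show ?case using cobar_lev by simp
next
  case (Act \<sigma> t)
  then show ?case by (simp add: lev_Act tdiff_tact)
next
  case (Comp t i u)
  then show ?case
    using tdiff_tcomp[OF supp_ev[of E t \<omega>] supp_ev[of E u \<omega>], of i] by (simp add: lev_simps lev_Comp_left lev_Comp_right)
qed

lemma lev_lin_ext_diff:
  assumes "Poly_Mapping.keys v \<subseteq> exprs E s"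
  shows "lev \<omega> (lin_ext (cobar_diff C) v) = tdiff (lev \<omega> v)"
proof -
  have "lev \<omega> (lin_ext (cobar_diff C) v) b = pair (\<lambda>t. tdiff (ev \<omega> t) b) v" for b
    unfolding lev_def pair_lin_ext
    by (rule pair_cong) (use assms lev_cobar_diff in \<open>auto simp: lev_def exprs_def fun_eq_iff subset_iff\<close>)
  then show ?thesis
    by (intro bas_fun_eqI) (simp_all add: lev_def pair_fun_uminus pair_fun_diff)
qed

lemma keys_lin_ext_diff:
  "Poly_Mapping.keys v \<subseteq> exprs E s \<Longrightarrow> Poly_Mapping.keys (lin_ext (cobar_diff C) v) \<subseteq> exprs E (shift (- 1) s)"
  by (erule keys_lin_ext_le) (use keys_cobar_diff in \<open>auto simp: exprs_def\<close>)

abbreviation cl where "cl s v \<equiv> fcl (relations E s) v"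
abbreviation P where "P \<equiv> cobar C"

lemma keys_rel: "relator E s r \<Longrightarrow> Poly_Mapping.keys r \<subseteq> exprs E s"
  by (rule keys_relator[OF vs_E act_closed])

lemma quotient_P: "quotient_space (free_module (exprs E s)) (relations E s)"
  unfolding relations_def by (rule quotient_free) (use keys_rel in auto)

lemma cobar_simps:
  "component P = (\<lambda>s. quotient_module (free_module (exprs E s)) (relations E s))"
  "act P = act (free_operad E)" "pcomp P = pcomp (free_operad E)"
  "diff P = (\<lambda>s. coset_map (free_module (exprs E (shift (- 1) s))) (relations E (shift (- 1) s)) (lin_ext (cobar_diff C)))"
  by (auto simp: cobar_def Let_def free_operad_def E_def)

lemma carrier_P: "carrier (component P s) = cl s ` {v. Poly_Mapping.keys v \<subseteq> exprs E s}"
  using quotient_space.carrier_quotient[OF quotient_P[of s]] by (simp add: cobar_simps a_r_coset_free)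

lemma cl_closed: "Poly_Mapping.keys v \<subseteq> exprs E s \<Longrightarrow> cl s v \<in> carrier (component P s)"
  by (auto simp: carrier_P)

lemma zero_P: "\<zero>\<^bsub>component P s\<^esub> = cl s 0"
  using quotient_space.zero_quotient[OF quotient_P[of s]] by (simp add: cobar_simps a_r_coset_free)

lemma add_P: "Poly_Mapping.keys v \<subseteq> exprs E s \<Longrightarrow> Poly_Mapping.keys w \<subseteq> exprs E s \<Longrightarrow>
    cl s v \<oplus>\<^bsub>component P s\<^esub> cl s w = cl s (v + w)"
  using quotient_space.add_quotient[OF quotient_P[of s], of v w] by (simp add: cobar_simps a_r_coset_free)

lemma minus_P: "Poly_Mapping.keys v \<subseteq> exprs E s \<Longrightarrow> Poly_Mapping.keys w \<subseteq> exprs E s \<Longrightarrow>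
    cl s v \<ominus>\<^bsub>component P s\<^esub> cl s w = cl s (v - w)"
  using quotient_space.minus_quotient[OF quotient_P[of s], of v w] by (simp add: cobar_simps a_r_coset_free)

lemma smult_P: "Poly_Mapping.keys v \<subseteq> exprs E s \<Longrightarrow> c \<odot>\<^bsub>component P s\<^esub> cl s v = cl s (scal c v)"
  using quotient_space.smult_quotient[OF quotient_P[of s], of v c] by (simp add: cobar_simps a_r_coset_free)

lemma vs_P: "vs (component P s)"
  unfolding cobar_simps by (rule quotient_space.vs_quotient[OF quotient_P])

lemma cl_eq_iff:
  assumes "tot s \<le> 2" "Poly_Mapping.keys v \<subseteq> exprs E s" "Poly_Mapping.keys w \<subseteq> exprs E s"
  shows "cl s v = cl s w \<longleftrightarrow> lev \<omega> v = lev \<omega> w"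
proof -
  have "cl s v = cl s w \<longleftrightarrow> v - w \<in> relations E s" unfolding relations_def by (rule fcl_eq_iff)
  also have "\<dots> \<longleftrightarrow> lev \<omega> v = lev \<omega> w"
    using relations_iff[OF free_module_closed(3)[OF assms(2,3)] assms(1)] by (simp add: lev_simps fun_eq_iff)
  finally show ?thesis .
qed

text \<open>Relators need not be differentiated one by one: the differential of a relator evaluates
  to \<open>tdiff\<close> of zero, and \<open>relations_iff\<close> turns this into a
  relation.\<close>

lemma diff_P:
  assumes "tot s \<le> 2"
  shows "diff P s (cl s v) = cl (shift (- 1) s) (lin_ext (cobar_diff C) v)"
proof -
  have "lin_ext (cobar_diff C) r \<in> relations E (shift (- 1) s)" if r: "relator E s r" for r
  proof -
    have "tdiff (lev \<omega> r) = (\<lambda>b. 0)" unfolding lev_relator[OF r] by (rule bas_fun_eqI) auto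
    then show ?thesis
      using relations_iff[OF keys_lin_ext_diff[OF keys_rel[OF r]]] lev_lin_ext_diff[OF keys_rel[OF r]] assms by (simp add: tot_def)
  qed
  then show ?thesis unfolding cobar_simps relations_def by (intro coset_map_lin_ext) auto
qed

lemma act_P: "\<sigma> \<in> perms (ar s) \<Longrightarrow> act P s \<sigma> (cl s v) = cl s (lin_ext (\<lambda>t. basis_vec (Act \<sigma> t)) v)"
  unfolding cobar_simps free_operad_def operad_data.simps collection_data.simps relations_def
  by (rule coset_map_lin_ext) (auto intro: span_of_base relator.cong_act)

lemma pcomp_P:
  assumes "Poly_Mapping.keys v \<subseteq> exprs E s" "Poly_Mapping.keys w \<subseteq> exprs E t" "i < ar s (out t)"
  shows "pcomp P s i t (cl s v) (cl t w) = cl (comp_idx s t) (bilin_ext (\<lambda>p q. Comp p i q) (v, w))"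
  unfolding cobar_simps free_operad_def operad_data.simps collection_data.simps relations_def
proof (rule coset_map_bilin_ext)
  fix r assume "r \<in> {r. relator E s r}"
  then show "bilin_ext (\<lambda>p q. Comp p i q) (r, w) \<in> span_of {r. relator E (comp_idx s t) r}"
    unfolding bilin_ext_right
    by - (rule span_of_lin_ext, use assms relator.cong_comp_left[of E s r _ t i] in \<open>auto intro!: span_of_base\<close>)
next
  fix v r :: "'e expr \<Rightarrow>\<^sub>0 'k" assume "r \<in> {r. relator E t r}" "Poly_Mapping.keys v \<subseteq> exprs E s"
  then show "bilin_ext (\<lambda>p q. Comp p i q) (v, r) \<in> span_of {r. relator E (comp_idx s t) r}"
    unfolding bilin_ext_left
    by - (rule span_of_lin_ext, use assms in \<open>auto intro!: span_of_base relator.cong_comp_right\<close>)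
qed (use assms keys_rel in auto)

lemma keys_bilin_Comp:
  assumes "Poly_Mapping.keys v \<subseteq> exprs E s" "Poly_Mapping.keys w \<subseteq> exprs E t" "i < ar s (out t)"
  shows "Poly_Mapping.keys (bilin_ext (\<lambda>p q. Comp p i q) (v, w)) \<subseteq> exprs E (comp_idx s t)"
  using keys_bilin_ext[of "\<lambda>p q. Comp p i q" v w] Comp_exprs assms by fast

lemma pcomp_closed:
  assumes "p \<in> carrier (component P s)" "q \<in> carrier (component P t)" "i < ar s (out t)"
  shows "pcomp P s i t p q \<in> carrier (component P (comp_idx s t))"
proof -
  obtain v w where "p = cl s v" "Poly_Mapping.keys v \<subseteq> exprs E s" "q = cl t w" "Poly_Mapping.keys w \<subseteq> exprs E t"
    using assms by (auto simp: carrier_P)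
  then show ?thesis using pcomp_P[of v s w t i] cl_closed[OF keys_bilin_Comp[of v s w t i]] assms(3) by simp
qed

text \<open>That the differential squares to zero is read off from \<open>tdiff_tdiff\<close>,
  because classes with at most two inputs are determined by their evaluation.\<close>

lemma complex_at_P:
  assumes t: "tot s \<le> 2"
  shows "complex_at P s"
proof -
  have lin: "diff P s' \<in> linear_maps (component P s') (component P (shift (- 1) s'))" if "tot s' \<le> 2" for s'
    by (rule linear_mapsI)
      (auto simp: carrier_P diff_P[OF that] add_P smult_P keys_lin_ext_diff free_module_closed lin_ext_add lin_ext_scal)
  have ts: "tot (shift n s) \<le> 2" for n using t by (simp add: tot_def)
  have "diff P s (diff P (shift 1 s) p) = \<zero>\<^bsub>component P (shift (- 1) s)\<^esub>" if p: "p \<in> carrier (component P (shift 1 s))" for p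
  proof -
    obtain v where v: "p = cl (shift 1 s) v" "Poly_Mapping.keys v \<subseteq> exprs E (shift 1 s)" using p by (auto simp: carrier_P)
    have k: "Poly_Mapping.keys (lin_ext (cobar_diff C) v) \<subseteq> exprs E s" using keys_lin_ext_diff[OF v(2)] by simp
    have "lev \<omega> (lin_ext (cobar_diff C) (lin_ext (cobar_diff C) v)) = lev \<omega> 0"
      using lev_lin_ext_diff[OF k] lev_lin_ext_diff[OF v(2)] by (simp add: tdiff_tdiff lev_simps)
    then show ?thesis
      using diff_P[OF ts, of 1 v] diff_P[OF t] cl_eq_iff[OF ts keys_lin_ext_diff[OF k], of 0]
      by (simp add: v zero_P)
  qed
  then show ?thesis unfolding complex_at_def using vs_P lin[OF t] lin[OF ts, of 1] by simp
qed

definition p_eta where "p_eta = cl (ix 1 0 (- 1)) (basis_vec (nf Eta))"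
definition p_mu where "p_mu = cl (ix 0 2 0) (basis_vec (nf Mu))"
text \<open>The sign is due to \<open>Ha\<close> having the boundary \<open>Ba - Aa\<close>, whereas
  \<open>commdiff\<close> asks for \<open>Aa - Ba\<close>.\<close>

definition p_h where "p_h = cl (ix 1 1 0) (- basis_vec (nf Ha))"

lemma ev_nf: "ev \<omega> (nf Eta) = delta Eta" "ev \<omega> (nf Mu) = delta Mu" "ev \<omega> (nf Ha) = delta Ha"
  using \<omega>_e1[of Eta] \<omega>_e1[of Mu] \<omega>_e1[of Ha] \<omega>_Mu'
  by (auto intro!: bas_fun_eqI simp: evgen_def gen_def delta_def)

lemma keys_nf: "Poly_Mapping.keys (basis_vec (nf b)) \<subseteq> exprs E (bidx b)"
  by (rule keys_basis) simp

lemma supp_lev: "Poly_Mapping.keys v \<subseteq> exprs E s \<Longrightarrow> supp s (lev \<omega> v)"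
proof -
  assume v: "Poly_Mapping.keys v \<subseteq> exprs E s"
  have "lev \<omega> v b = 0" if "bidx b \<noteq> s" for b
  proof -
    have "pair (\<lambda>t. ev \<omega> t b) v = pair (\<lambda>t. 0) v"
      by (rule pair_cong) (use v supp_ev[of E _ \<omega>] that in \<open>auto simp: exprs_def subset_iff intro: supp_zero\<close>)
    then show ?thesis by (simp add: lev_def)
  qed
  then show ?thesis by (auto simp: supp_def)
qed

lemma massey_model_P: "massey_model P p_eta p_mu p_h"
proof -
  have k: "Poly_Mapping.keys (basis_vec (nf Eta)) \<subseteq> exprs E (ix 1 0 (- 1))" "Poly_Mapping.keys (basis_vec (nf Mu)) \<subseteq> exprs E (ix 0 2 0)"
    "Poly_Mapping.keys (- basis_vec (nf Ha)) \<subseteq> exprs E (ix 1 1 0)"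
    using keys_nf[of Eta] keys_nf[of Mu] keys_nf[of Ha] by auto
  note c = cl_closed[OF k(1), folded p_eta_def] cl_closed[OF k(2), folded p_mu_def] cl_closed[OF k(3), folded p_h_def]
  let ?i = "\<lambda>j. basis_vec (Comp (nf Mu) j (nf Eta))" and ?x = "- basis_vec (Comp (nf Ha) 0 (nf Eta))"
  let ?y = "?x - lin_ext (\<lambda>t. basis_vec (Act cswap t)) ?x"
  have ki: "Poly_Mapping.keys (?i j) \<subseteq> exprs E (ix 1 1 (- 1))" if "j < 2" for j
    by (rule keys_basis) (use Comp_exprs[OF nf_exprs nf_exprs, of j Mu Eta] that in simp)
  have kx: "Poly_Mapping.keys ?x \<subseteq> exprs E (ix 2 0 (- 1))"
    using keys_basis[OF Comp_exprs[OF nf_exprs nf_exprs, of 0 Ha Eta]] by simp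
  have ky: "Poly_Mapping.keys ?y \<subseteq> exprs E (ix 2 0 (- 1))"
    by (intro free_module_closed(3) kx keys_lin_ext_Act) simp
  have tot_ix: "tot (ix n m d) = n + m" for n m d by (simp add: tot_def)
  have ins: "pcomp P (ix 0 2 0) j (ix 1 0 (- 1)) p_mu p_eta = cl (ix 1 1 (- 1)) (?i j)" if "j < 2" for j
    unfolding p_mu_def p_eta_def using pcomp_P[OF k(2,1), of j] that by simp
  have plug: "plug P 0 (- 1) p_h p_eta = cl (ix 2 0 (- 1)) ?x"
    unfolding p_h_def p_eta_def plug_def using pcomp_P[OF k(3,1), of 0] by (simp add: bilin_ext_left lin_ext_uminus)
  have alt: "alternation P (- 1) (plug P 0 (- 1) p_h p_eta) = cl (ix 2 0 (- 1)) ?y"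
    unfolding alternation_def plug using minus_P[OF kx keys_lin_ext_Act[OF kx]] act_P[of cswap "ix 2 0 (- 1)" ?x] by simp
  have levx: "lev \<omega> ?x = (\<lambda>b. - delta HE b)"
    by (rule bas_fun_eqI) (simp_all add: lev_simps ev_nf delta_def del: nf.simps)
  have levy: "lev \<omega> ?y = (\<lambda>b. delta HE' b - delta HE b)"
    unfolding lev_simps(2) lev_Act levx by (rule bas_fun_eqI) (simp_all add: delta_def)
  have d0: "diff P s (cl s v) = \<zero>\<^bsub>component P (shift (- 1) s)\<^esub>"
    if "tot s \<le> 2" "Poly_Mapping.keys v \<subseteq> exprs E s" "tdiff (lev \<omega> v) = (\<lambda>b. 0)" for s v
    unfolding diff_P[OF that(1)] zero_P
    by (subst cl_eq_iff) (use that keys_lin_ext_diff lev_lin_ext_diff[OF that(2)] in \<open>auto simp: tot_def lev_simps\<close>)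
  have td: "tdiff (delta Eta) = (\<lambda>b. 0::'k)" "tdiff (delta Mu) = (\<lambda>b. 0::'k)" "tdiff (lev \<omega> ?y) = (\<lambda>b. 0::'k)"
    unfolding levy by (rule bas_fun_eqI; simp add: delta_def)+
  have ceta: "cycle P (ix 1 0 (- 1)) p_eta" and cmu: "cycle P (ix 0 2 0) p_mu"
    using c d0[OF _ k(1)] d0[OF _ k(2)] td by (simp_all add: cycle_def p_eta_def p_mu_def tot_ix lev_simps ev_nf del: nf.simps)
  have cyc: "cycle P (ix 2 0 (- 1)) (alternation P (- 1) (plug P 0 (- 1) p_h p_eta))"
    unfolding alt using d0[OF _ ky td(3)] cl_closed[OF ky] by (simp add: cycle_def tot_ix)
  have dh: "diff P (ix 1 1 0) p_h = commdiff P 0 (- 1) p_mu p_eta"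
  proof -
    have "tdiff (lev \<omega> (- basis_vec (nf Ha))) = lev \<omega> (?i 0 - ?i 1)"
      by (rule bas_fun_eqI) (simp_all add: lev_simps ev_nf delta_def del: nf.simps)
    then have "cl (ix 1 1 (- 1)) (lin_ext (cobar_diff C) (- basis_vec (nf Ha))) = cl (ix 1 1 (- 1)) (?i 0 - ?i 1)"
      using keys_lin_ext_diff[OF k(3)] lev_lin_ext_diff[OF k(3)] free_module_closed(3)[OF ki[of 0] ki[of 1]]
      by (subst cl_eq_iff) (simp_all add: tot_ix del: nf.simps)
    then show ?thesis
      unfolding commdiff_def using ins[of 0] ins[of 1] minus_P[OF ki[of 0] ki[of 1]] diff_P[of "ix 1 1 0" "- basis_vec (nf Ha)"] 
      by (simp add: p_h_def tot_ix del: nf.simps)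
  qed
  have nb: "alternation P (- 1) (plug P 0 (- 1) p_h p_eta) \<notin> boundaries P (ix 2 0 (- 1))"
  proof
    assume "alternation P (- 1) (plug P 0 (- 1) p_h p_eta) \<in> boundaries P (ix 2 0 (- 1))"
    then obtain v where v: "Poly_Mapping.keys v \<subseteq> exprs E (ix 2 0 0)" "cl (ix 2 0 (- 1)) ?y = diff P (ix 2 0 0) (cl (ix 2 0 0) v)"
      unfolding alt by (auto simp: boundaries_def carrier_P)
    then have "lev \<omega> ?y = tdiff (lev \<omega> v)"
      using diff_P[of "ix 2 0 0" v] keys_lin_ext_diff[OF v(1)] ky lev_lin_ext_diff[OF v(1)] cl_eq_iff[OF _ ky, of "lin_ext (cobar_diff C) v"]
      by (simp add: tot_ix)
    then have "(\<lambda>b. delta HE' b - delta HE b) = tdiff (lev \<omega> v)" unfolding levy .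
    \<comment> \<open>A boundary has equal coefficients at \<open>EL\<close> and \<open>HE'\<close>,
      both being the coefficient of \<open>v\<close> at \<open>Na\<close>. The product has 0 and 1
      there.\<close>
    then have "delta HE' EL - delta HE EL = tdiff (lev \<omega> v) EL" "delta HE' HE' - delta HE HE' = tdiff (lev \<omega> v) HE'"
      by (simp_all only: fun_eq_iff)
    then show False by (simp add: delta_def)
  qed
  have triv: "carrier (component P s) \<subseteq> {\<zero>\<^bsub>component P s\<^esub>}" if "tot s \<le> 2" "\<And>b. bidx b \<noteq> s" for s
  proof -
    have "cl s v = cl s 0" if v: "Poly_Mapping.keys v \<subseteq> exprs E s" for v
      using supp_lev[OF v] \<open>\<And>b. bidx b \<noteq> s\<close> by (subst cl_eq_iff[OF \<open>tot s \<le> 2\<close> v]) (auto simp: lev_simps supp_def)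
    then show ?thesis unfolding carrier_P zero_P by blast
  qed
  have nb': "bidx b \<noteq> ix 1 0 0" "bidx b \<noteq> ix 0 2 1" "bidx b \<noteq> ix 1 1 (- 2)" for b by (cases b; simp)+
  show ?thesis
  proof (intro massey_model.intro massey_datum.intro massey_model_axioms.intro)
    show "massey_system P p_eta p_mu p_h" unfolding massey_system_def using ceta cmu dh c(3) by blast
    show "y = \<zero>\<^bsub>component P (ix 1 1 0)\<^esub>" if y: "y \<in> carrier (component P (ix 1 1 0))" and dy: "diff P (ix 1 1 0) y = \<zero>\<^bsub>component P (ix 1 1 (- 1))\<^esub>" for y
    proof -
      obtain v where v: "Poly_Mapping.keys v \<subseteq> exprs E (ix 1 1 0)" "y = cl (ix 1 1 0) v" using y by (auto simp: carrier_P)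
      have "tdiff (lev \<omega> v) = (\<lambda>b. 0)"
        using dy diff_P[of "ix 1 1 0" v] keys_lin_ext_diff[OF v(1)] lev_lin_ext_diff[OF v(1)] cl_eq_iff[of "ix 1 1 (- 1)" "lin_ext (cobar_diff C) v" 0]
        by (simp add: tot_ix v(2) zero_P lev_simps)
      \<comment> \<open>The coefficient of the boundary at \<open>Ba\<close> is that of
        \<open>v\<close> at \<open>Ha\<close>, the only basis tree with this index.\<close>
      then have "tdiff (lev \<omega> v) Ba = 0" by (simp only:)
      then have "lev \<omega> v Ha = 0" by simp
      moreover have "lev \<omega> v b = 0" if "b \<noteq> Ha" for b
        by (rule supp_zero[OF supp_lev[OF v(1)]]) (use that in \<open>cases b; simp\<close>)
      ultimately have "lev \<omega> v x = lev \<omega> 0 x" for x by (cases "x = Ha") (simp_all add: lev_simps)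
      then have "lev \<omega> v = lev \<omega> 0" by (rule ext)
      then show ?thesis using v by (simp add: zero_P cl_eq_iff tot_ix)
    qed
    show "vs (component P (ix n m d))" for n m d by (rule vs_P)
    show "complex_at P (ix 2 0 (- 1))" "complex_at P (ix 1 0 d)" "complex_at P (ix 0 2 d)" "complex_at P (ix 1 1 d)" "complex_at P (ix 2 0 d)" for d
      by (rule complex_at_P; simp add: tot_ix)+
    show "pcomp P (ix 0 2 0) j (ix 1 0 (- 1)) p_mu p_eta \<in> carrier (component P (ix 1 1 (- 1)))" if "j < 2" for j
      unfolding ins[OF that] by (rule cl_closed[OF ki[OF that]])
    show "plug P 0 (- 1) p_h p_eta \<in> carrier (component P (ix 2 0 (- 1)))"
      unfolding plug by (rule cl_closed[OF kx])
    show "act P (ix 2 0 (- 1)) cswap (plug P 0 (- 1) p_h p_eta) \<in> carrier (component P (ix 2 0 (- 1)))"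
      unfolding plug using act_P[of cswap "ix 2 0 (- 1)" ?x] cl_closed[OF keys_lin_ext_Act[OF kx, of cswap]] by simp
    show "carrier (component P (ix 1 0 0)) \<subseteq> {\<zero>\<^bsub>component P (ix 1 0 0)\<^esub>}"
      "carrier (component P (ix 0 2 1)) \<subseteq> {\<zero>\<^bsub>component P (ix 0 2 1)\<^esub>}"
      "carrier (component P (ix 1 1 (- 2))) \<subseteq> {\<zero>\<^bsub>component P (ix 1 1 (- 2))\<^esub>}"
      by (rule triv; simp add: tot_ix nb')+
    show "pcomp P (ix 0 2 0) j (ix 1 0 (- 1)) m n \<in> carrier (component P (ix 1 1 (- 1)))"
      if "m \<in> carrier (component P (ix 0 2 0))" "n \<in> carrier (component P (ix 1 0 (- 1)))" "j < 2" for m n j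
      using pcomp_closed[OF that(1,2), of j] that(3) by simp
  qed (rule cyc nb)+
qed

lemma not_formal: "\<not> formal_via TYPE('x) P"
  by (rule massey_model.not_formal[OF massey_model_P])

end

section \<open>Configurations of little disks\<close>

abbreviation cen :: "config \<Rightarrow> colour \<Rightarrow> nat \<Rightarrow> complex" where "cen D y j \<equiv> fst (D y j)"
abbreviation rad :: "config \<Rightarrow> colour \<Rightarrow> nat \<Rightarrow> real" where "rad D y j \<equiv> snd (D y j)"

lemma disjoint_balls_iff:
  fixes c d :: "'v::euclidean_space"
  assumes "0 < r" "0 < s"
  shows "ball c r \<inter> ball d s = {} \<longleftrightarrow> r + s \<le> dist c d"
proof
  assume e: "ball c r \<inter> ball d s = {}"
  show "r + s \<le> dist c d"
  proof (rule ccontr)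
    assume "\<not> r + s \<le> dist c d"
    then have lt: "norm (d - c) < r + s" by (simp add: dist_norm norm_minus_commute)
    \<comment> \<open>The point dividing the segment between the centres in the ratio of the radii
      lies in both balls if these are too close.\<close>
    define m where "m = c + (r / (r + s)) *\<^sub>R (d - c)"
    have "dist c m = r / (r + s) * norm (d - c)" using assms by (simp add: m_def dist_norm)
    also have "\<dots> < r / (r + s) * (r + s)" using lt assms by (intro mult_strict_left_mono) auto
    finally have 1: "m \<in> ball c r" using assms by simp
    have "d - m = (1 - r / (r + s)) *\<^sub>R (d - c)" by (simp add: m_def algebra_simps)
    moreover have "1 - r / (r + s) = s / (r + s)" using assms by (simp add: field_simps)
    ultimately have "dist d m = s / (r + s) * norm (d - c)" using assms by (simp add: dist_norm)
    also have "\<dots> < s / (r + s) * (r + s)" using lt assms by (intro mult_strict_left_mono) auto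
    finally have 2: "m \<in> ball d s" using assms by simp
    show False using 1 2 e by blast
  qed
qed (rule disjoint_ballI)

lemma ball_subset_unit_iff:
  fixes c :: "'v::euclidean_space"
  shows "0 < r \<Longrightarrow> ball c r \<subseteq> ball 0 1 \<longleftrightarrow> norm c + r \<le> 1"
  by (auto simp: ball_subset_ball_iff dist_norm)

definition admissible :: "arity \<Rightarrow> colour \<Rightarrow> bool" where
  "admissible a x \<longleftrightarrow> 1 \<le> a Closed + a Open \<and> (x = Closed \<longrightarrow> a Open = 0)"

text \<open>The conditions on single disks. They are convex in centres and radii, in contrast to the
  pairwise distances.\<close>

definition confined :: "arity \<Rightarrow> colour \<Rightarrow> config \<Rightarrow> bool" where
  "confined a x D \<longleftrightarrow> admissible a x \<and>
     (\<forall>y j. j < a y \<longrightarrow> 0 < rad D y j \<and> norm (cen D y j) + rad D y j \<le> 1) \<and>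
     (\<forall>y j. \<not> j < a y \<longrightarrow> D y j = (0, 0)) \<and>
     (x = Open \<longrightarrow> (\<forall>j<a Open. Im (cen D Open j) = 0) \<and> (\<forall>j<a Closed. rad D Closed j \<le> Im (cen D Closed j)))"

text \<open>
  The disks of a conjugate pair are disjoint if and only if the upper one lies in the upper half plane;
  the remaining disjointness conditions on conjugate disks are then automatic.
\<close>

lemma SC_iff:
  "D \<in> SC a x \<longleftrightarrow> confined a x D \<and>
     (\<forall>y j z l. j < a y \<longrightarrow> l < a z \<longrightarrow> (y, j) \<noteq> (z, l) \<longrightarrow> rad D y j + rad D z l \<le> dist (cen D y j) (cen D z l))"
    (is "_ \<longleftrightarrow> _ \<and> ?dist")
proof -
  let ?base = "(\<forall>y j. j < a y \<longrightarrow> 0 < rad D y j \<and> norm (cen D y j) + rad D y j \<le> 1) \<and> (\<forall>y j. \<not> j < a y \<longrightarrow> D y j = (0, 0))"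
  have ld: "D \<in> little_disks a \<longleftrightarrow> ?base \<and> ?dist"
  proof -
    have r: "0 < rad D y j \<and> disk (D y j) \<subseteq> ball 0 1 \<longleftrightarrow> 0 < rad D y j \<and> norm (cen D y j) + rad D y j \<le> 1" for y j
      unfolding disk_def using ball_subset_unit_iff by blast
    have "disk (D y j) \<inter> disk (D z l) = {} \<longleftrightarrow> rad D y j + rad D z l \<le> dist (cen D y j) (cen D z l)"
      if "0 < rad D y j" "0 < rad D z l" for y j z l
      unfolding disk_def using that by (rule disjoint_balls_iff)
    then have e: "(j < a y \<longrightarrow> l < a z \<longrightarrow> (y, j) \<noteq> (z, l) \<longrightarrow> disk (D y j) \<inter> disk (D z l) = {}) \<longleftrightarrow>
        (j < a y \<longrightarrow> l < a z \<longrightarrow> (y, j) \<noteq> (z, l) \<longrightarrow> rad D y j + rad D z l \<le> dist (cen D y j) (cen D z l))"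
      if "\<forall>y j. j < a y \<longrightarrow> 0 < rad D y j" for y j z l
      using that by blast
    show ?thesis
    proof (cases "\<forall>y j. j < a y \<longrightarrow> 0 < rad D y j")
      case True
      show ?thesis unfolding little_disks_def mem_Collect_eq r e[OF True] by (simp only: conj_assoc)
    next
      case False
      then show ?thesis unfolding little_disks_def mem_Collect_eq r by blast
    qed
  qed
  show ?thesis
  proof (cases x)
    case Closed
    show ?thesis unfolding Closed SC.simps mem_Collect_eq ld confined_def admissible_def by auto
  next
    case Open
    have eq: "(\<forall>j<a Open. conj_disk (D Open j) = D Open j) \<and> (\<forall>j<a Closed. Im (cen D Closed j) > 0) \<and>
        (\<forall>j<a Closed. \<forall>y. \<forall>l<a y. disk (conj_disk (D Closed j)) \<inter> disk (D y l) = {}) \<longleftrightarrow>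
      (\<forall>j<a Open. Im (cen D Open j) = 0) \<and> (\<forall>j<a Closed. rad D Closed j \<le> Im (cen D Closed j))"
      if b: ?base and d: ?dist
    proof -
      have r: "0 < rad D y j" if "j < a y" for y j using b that by blast
      have o: "conj_disk (D Open j) = D Open j \<longleftrightarrow> Im (cen D Open j) = 0" for j
        by (auto simp: conj_disk_def prod_eq_iff complex_eq_iff)
      have cc: "disk (conj_disk (D Closed j)) \<inter> disk (D y l) = {} \<longleftrightarrow>
          rad D Closed j + rad D y l \<le> dist (cnj (cen D Closed j)) (cen D y l)" if "j < a Closed" "l < a y" for j y l
        unfolding disk_def conj_disk_def by (subst disjoint_balls_iff) (use r that in auto)
      have self: "dist (cnj c) c = 2 * \<bar>Im c\<bar>" for c
      proof -
        have "dist (cnj c) c = norm (Complex 0 (- 2 * Im c))" by (auto simp: dist_norm complex_eq_iff intro: arg_cong[where f = norm])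
        then show ?thesis by (simp add: cmod_def real_sqrt_mult)
      qed
      have oo: "(\<forall>j<a Open. conj_disk (D Open j) = D Open j) \<longleftrightarrow> (\<forall>j<a Open. Im (cen D Open j) = 0)" by (simp add: o)
      have radI: "rad D Closed j \<le> Im (cen D Closed j)"
        if "j < a Closed" "0 < Im (cen D Closed j)" "disk (conj_disk (D Closed j)) \<inter> disk (D Closed j) = {}" for j
        using cc[of j j Closed] self[of "cen D Closed j"] that by simp
      have disj: "disk (conj_disk (D Closed j)) \<inter> disk (D y l) = {}"
        if j: "j < a Closed" "l < a y" and op: "\<forall>j<a Open. Im (cen D Open j) = 0"
          and cl: "\<forall>j<a Closed. rad D Closed j \<le> Im (cen D Closed j)" for j y l
      proof -
        have pos: "0 < Im (cen D Closed j)" if "j < a Closed" for j using cl r that by fastforce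
        have ge: "0 \<le> Im (cen D y l)" using op pos j by (cases y) (auto intro: less_imp_le)
        show "disk (conj_disk (D Closed j)) \<inter> disk (D y l) = {}"
        proof (cases "(Closed, j) = (y, l)")
          case True
          then show ?thesis unfolding cc[OF j] using self[of "cen D Closed j"] cl j pos[of j] by auto
        next
          case False
          \<comment> \<open>Reflecting one of two points of the closed upper half plane does not
            decrease their distance.\<close>
          have "dist (cen D Closed j) (cen D y l) \<le> dist (cnj (cen D Closed j)) (cen D y l)"
          proof -
            have "(Im (cen D Closed j) - Im (cen D y l))\<^sup>2 \<le> (- Im (cen D Closed j) - Im (cen D y l))\<^sup>2"
              using pos[OF j(1)] ge unfolding abs_le_square_iff[symmetric] by linarith
            then show ?thesis by (simp add: dist_norm cmod_def)
          qed
          then show ?thesis unfolding cc[OF j] using d j False by fastforce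
        qed
      qed
      have pos: "0 < Im (cen D Closed j)" if "j < a Closed" "rad D Closed j \<le> Im (cen D Closed j)" for j
        using r[OF that(1)] that(2) by simp
      show ?thesis
        unfolding oo
      proof (rule iffI, goal_cases)
        case 1
        then show ?case using radI by simp
      next
        case 2
        then show ?case using pos disj by simp
      qed
    qed
    show ?thesis
    proof (cases "?base \<and> ?dist")
      case True
      then show ?thesis unfolding Open SC.simps mem_Collect_eq ld confined_def admissible_def using eq by simp
    next
      case False
      then show ?thesis unfolding Open SC.simps mem_Collect_eq ld confined_def by argo
    qed
  qed
qed


lemma confinedD:
  assumes "confined a x D"
  shows "j < a y \<Longrightarrow> 0 < rad D y j" "j < a y \<Longrightarrow> norm (cen D y j) + rad D y j \<le> 1" "\<not> j < a y \<Longrightarrow> D y j = (0, 0)"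
  using assms by (auto simp: confined_def)

lemma SC_confined: "D \<in> SC a x \<Longrightarrow> confined a x D"
  and SC_dist: "D \<in> SC a x \<Longrightarrow> j < a y \<Longrightarrow> l < a z \<Longrightarrow> (y, j) \<noteq> (z, l) \<Longrightarrow> rad D y j + rad D z l \<le> dist (cen D y j) (cen D z l)"
  unfolding SC_iff by blast+

lemma SC_I:
  "confined a x D \<Longrightarrow> (\<And>y j z l. j < a y \<Longrightarrow> l < a z \<Longrightarrow> (y, j) \<noteq> (z, l) \<Longrightarrow> rad D y j + rad D z l \<le> dist (cen D y j) (cen D z l)) \<Longrightarrow> D \<in> SC a x"
  unfolding SC_iff by blast

section \<open>Paths in the configuration spaces\<close>

lemma path_config_iff: "path g \<longleftrightarrow> (\<forall>y j. continuous_on {0..1} (\<lambda>t. g t y j))" for g :: "real \<Rightarrow> config"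
proof
  assume "path g"
  then have "continuous_on {0..1} g" by (simp add: path_def)
  then have "continuous_on {0..1} (\<lambda>t. g t y)" for y by (rule continuous_on_product_then_coordinatewise)
  then have "continuous_on {0..1} (\<lambda>t. g t y j)" for y j by (rule continuous_on_product_then_coordinatewise)
  then show "\<forall>y j. continuous_on {0..1} (\<lambda>t. g t y j)" by blast
next
  assume "\<forall>y j. continuous_on {0..1} (\<lambda>t. g t y j)"
  then show "path g" unfolding path_def by (intro continuous_on_coordinatewise_then_product) blast
qed

definition config_line :: "config \<Rightarrow> config \<Rightarrow> real \<Rightarrow> config" where
  "config_line D E t = (\<lambda>y j. (1 - t) *\<^sub>R D y j + t *\<^sub>R E y j)"

lemma path_component_line:
  assumes "\<And>t. 0 \<le> t \<Longrightarrow> t \<le> 1 \<Longrightarrow> config_line D E t \<in> X"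
  shows "path_component X D E"
  unfolding path_component_def
proof (intro exI conjI)
  show "path (config_line D E)"
    unfolding path_config_iff config_line_def by (intro allI continuous_intros)
  show "path_image (config_line D E) \<subseteq> X" using assms by (auto simp: path_image_def)
qed (simp_all add: pathstart_def pathfinish_def config_line_def)

lemma config_line_simps:
  "cen (config_line D E t) y j = (1 - t) *\<^sub>R cen D y j + t *\<^sub>R cen E y j"
  "rad (config_line D E t) y j = (1 - t) * rad D y j + t * rad E y j"
  by (simp_all add: config_line_def)

lemma confined_line:
  assumes D: "confined a x D" and E: "confined a x E" and t: "0 \<le> t" "t \<le> 1"
  shows "confined a x (config_line D E t)"
proof -
  have mix: "(1 - t) * p + t * q \<le> (1 - t) * p' + t * q'" if "p \<le> p'" "q \<le> q'" for p q p' q' :: real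
    using that t by (intro add_mono mult_left_mono) auto
  have "norm (cen (config_line D E t) y j) + rad (config_line D E t) y j \<le> 1" if "j < a y" for y j
  proof -
    have "norm (cen (config_line D E t) y j) \<le> (1 - t) * norm (cen D y j) + t * norm (cen E y j)"
      unfolding config_line_simps using t norm_triangle_ineq[of "(1 - t) *\<^sub>R cen D y j" "t *\<^sub>R cen E y j"] by simp
    moreover have "(1 - t) * (norm (cen D y j) + rad D y j) + t * (norm (cen E y j) + rad E y j) \<le> (1 - t) * 1 + t * 1"
      using confinedD(2)[OF D that] confinedD(2)[OF E that] by (rule mix)
    ultimately show ?thesis by (simp add: config_line_simps algebra_simps)
  qed
  moreover have "0 < rad (config_line D E t) y j" if "j < a y" for y j
    unfolding config_line_simps using confinedD(1)[OF D that] confinedD(1)[OF E that] t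
    by (cases "t = 1") (auto intro!: add_pos_nonneg)
  moreover have "config_line D E t y j = (0, 0)" if "\<not> j < a y" for y j
    using confinedD(3)[OF D that] confinedD(3)[OF E that] by (simp add: config_line_def)
  moreover have "rad (config_line D E t) Closed j \<le> Im (cen (config_line D E t) Closed j)" if "j < a Closed" "x = Open" for j
    using D E that by (simp add: config_line_simps confined_def mix)
  ultimately show ?thesis using D E by (auto simp: confined_def config_line_simps)
qed

text \<open>
  Disks separated by their real parts, in the order given by \<open>R\<close>.  Unlike disjointness this is a convex condition.
\<close>

definition sep :: "arity \<Rightarrow> colour \<Rightarrow> ((colour \<times> nat) \<times> (colour \<times> nat)) set \<Rightarrow> config set" where
  "sep a x R = {D. confined a x D \<and> (\<forall>y j z l. j < a y \<longrightarrow> l < a z \<longrightarrow> (y, j) \<noteq> (z, l) \<longrightarrow> rad D y j + rad D z l \<le>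
     (if ((y, j), (z, l)) \<in> R then Re (cen D z l) - Re (cen D y j) else Re (cen D y j) - Re (cen D z l)))}"

lemma abs_Re_le_dist: "\<bar>Re c - Re d\<bar> \<le> dist c d" and abs_Im_le_dist: "\<bar>Im c - Im d\<bar> \<le> dist c d"
  using abs_Re_le_cmod[of "c - d"] abs_Im_le_cmod[of "c - d"] by (simp_all add: dist_norm)

lemma sep_subset: "sep a x R \<subseteq> SC a x"
proof
  fix D assume D: "D \<in> sep a x R"
  show "D \<in> SC a x"
  proof (rule SC_I)
    fix y j z l assume *: "j < a y" "l < a z" "(y, j) \<noteq> (z, l)"
    then have "rad D y j + rad D z l \<le> \<bar>Re (cen D y j) - Re (cen D z l)\<bar>"
      using D unfolding sep_def by (smt (verit) mem_Collect_eq)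
    then show "rad D y j + rad D z l \<le> dist (cen D y j) (cen D z l)" using abs_Re_le_dist order_trans by blast
  qed (use D in \<open>simp add: sep_def\<close>)
qed

lemma path_component_sep:
  assumes D: "D \<in> sep a x R" and E: "E \<in> sep a x R"
  shows "path_component (SC a x) D E"
proof (rule path_component_of_subset[OF sep_subset[of a x R] path_component_line])
  fix t :: real assume t: "0 \<le> t" "t \<le> 1"
  have mix: "(1 - t) * p + t * q \<le> (1 - t) * p' + t * q'" if "p \<le> p'" "q \<le> q'" for p q p' q' :: real
    using that t by (intro add_mono mult_left_mono) auto
  have "rad (config_line D E t) y j + rad (config_line D E t) z l \<le>
      (if ((y, j), (z, l)) \<in> R then Re (cen (config_line D E t) z l) - Re (cen (config_line D E t) y j)
       else Re (cen (config_line D E t) y j) - Re (cen (config_line D E t) z l))"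
    if *: "j < a y" "l < a z" "(y, j) \<noteq> (z, l)" for y j z l
  proof -
    let ?f = "\<lambda>D. if ((y, j), (z, l)) \<in> R then Re (cen D z l) - Re (cen D y j) else Re (cen D y j) - Re (cen D z l)"
    have "rad D y j + rad D z l \<le> ?f D" "rad E y j + rad E z l \<le> ?f E"
      using D E * unfolding sep_def by blast+
    then have "(1 - t) * (rad D y j + rad D z l) + t * (rad E y j + rad E z l) \<le> (1 - t) * ?f D + t * ?f E" by (rule mix)
    then show ?thesis by (simp add: config_line_simps algebra_simps split: if_splits)
  qed
  then show "config_line D E t \<in> sep a x R"
    using confined_line[OF _ _ t] D E unfolding sep_def by blast
qed

definition inputs :: "arity \<Rightarrow> (colour \<times> nat) set" where
  "inputs a = {(y, j). j < a y}"

lemma finite_inputs: "finite (inputs a)"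
proof -
  have "inputs a \<subseteq> Pair Closed ` {..<a Closed} \<union> Pair Open ` {..<a Open}"
  proof
    fix p assume "p \<in> inputs a"
    then show "p \<in> Pair Closed ` {..<a Closed} \<union> Pair Open ` {..<a Open}"
      by (cases "fst p") (auto simp: inputs_def)
  qed
  then show ?thesis by (rule finite_subset) auto
qed

definition order_of :: "arity \<Rightarrow> config \<Rightarrow> ((colour \<times> nat) \<times> (colour \<times> nat)) set" where
  "order_of a D = {((y, j), (z, l)). j < a y \<and> l < a z \<and> Re (cen D y j) < Re (cen D z l)}"

text \<open>Centres move horizontally in proportion to their height: those of open disks stay in
  place, and the heights of closed disks are unchanged. The second parameter rescales the
  radii.\<close>

definition shear :: "real \<Rightarrow> real \<Rightarrow> config \<Rightarrow> config" where
  "shear \<delta> \<epsilon> D = (\<lambda>y j. (cen D y j + of_real (\<delta> * Im (cen D y j)), \<epsilon> * rad D y j))"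

lemma shear_line: "config_line D (shear \<delta> \<epsilon> D) t = shear (t * \<delta>) (1 - t * (1 - \<epsilon>)) D"
  by (auto simp: config_line_def shear_def fun_eq_iff prod_eq_iff complex_eq_iff algebra_simps)

text \<open>
  Shearing by a small amount and then shrinking makes the real parts separate the disks:
  two centres with the same real part have different imaginary parts.
\<close>

lemma shear_SC:
  assumes D: "D \<in> SC a x" and \<delta>: "0 \<le> \<delta>" "0 < \<epsilon>" "\<delta> \<le> 1 - \<epsilon>" "\<And>y j. j < a y \<Longrightarrow> \<delta> \<le> (1 - \<epsilon>) * rad D y j"
  shows "shear \<delta> \<epsilon> D \<in> SC a x"
proof (rule SC_I)
  note c = confinedD[OF SC_confined[OF D]]
  have \<epsilon>: "\<epsilon> \<le> 1" using \<delta> by simp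
  have "norm (cen (shear \<delta> \<epsilon> D) y j) + rad (shear \<delta> \<epsilon> D) y j \<le> 1" if j: "j < a y" for y j
  proof -
    \<comment> \<open>Heights are at most 1, so a centre moves by at most \<open>\<delta>\<close>,
      for which the decrease \<open>(1 - \<epsilon>) * rad D y j\<close> of the radius makes
      up.\<close>
    have "\<bar>Im (cen D y j)\<bar> \<le> 1" using c(1,2)[OF j] abs_Im_le_cmod[of "cen D y j"] by simp
    then have "\<delta> * \<bar>Im (cen D y j)\<bar> \<le> \<delta> * 1" using \<delta>(1) by (rule mult_left_mono)
    then have "norm (cen (shear \<delta> \<epsilon> D) y j) \<le> norm (cen D y j) + \<delta>"
      using norm_triangle_ineq[of "cen D y j" "of_real (\<delta> * Im (cen D y j))"] \<delta>(1)
      by (simp add: shear_def abs_mult norm_of_real del: of_real_mult)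
    then show ?thesis using c(2)[OF j] \<delta>(4)[OF j] by (simp add: shear_def algebra_simps)
  qed
  moreover have "\<epsilon> * rad D Closed j \<le> Im (cen D Closed j)" if "j < a Closed" "x = Open" for j
  proof -
    have "\<epsilon> * rad D Closed j \<le> 1 * rad D Closed j" using \<epsilon> c(1)[OF that(1)] by (intro mult_right_mono) auto
    also have "\<dots> \<le> Im (cen D Closed j)" using SC_confined[OF D] that by (simp add: confined_def)
    finally show ?thesis .
  qed
  ultimately show "confined a x (shear \<delta> \<epsilon> D)"
    using SC_confined[OF D] \<delta>(2) by (auto simp: confined_def shear_def)
  fix y j z l assume *: "j < a y" "l < a z" "(y, j) \<noteq> (z, l)"
  let ?d = "cen D y j - cen D z l"
  have r: "0 < rad D y j + rad D z l" using c(1)[OF *(1)] c(1)[OF *(2)] by simp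
  \<comment> \<open>Shearing changes the difference of two centres by at most
    \<open>\<delta>\<close> times its length, so distances keep at least the proportion
    \<open>1 - \<delta>\<close>, while the radii are scaled by
    \<open>\<epsilon> \<le> 1 - \<delta>\<close>.\<close>
  have "\<epsilon> * (rad D y j + rad D z l) \<le> (1 - \<delta>) * (rad D y j + rad D z l)" using r \<delta>(3) by (intro mult_right_mono) auto
  also have "\<dots> \<le> (1 - \<delta>) * norm ?d" using SC_dist[OF D *] \<delta>(2,3) by (intro mult_left_mono) (auto simp: dist_norm)
  also have "\<dots> \<le> norm ?d - norm (of_real (\<delta> * Im ?d) :: complex)"
    using mult_left_mono[OF abs_Im_le_cmod[of ?d] \<delta>(1)] \<delta>(1) by (simp add: norm_of_real abs_mult algebra_simps del: of_real_mult minus_complex.simps)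
  also have "\<dots> \<le> norm (?d + of_real (\<delta> * Im ?d))" using norm_diff_ineq by blast
  also have "?d + of_real (\<delta> * Im ?d) = cen (shear \<delta> \<epsilon> D) y j - cen (shear \<delta> \<epsilon> D) z l"
    by (simp add: shear_def algebra_simps)
  finally show "rad (shear \<delta> \<epsilon> D) y j + rad (shear \<delta> \<epsilon> D) z l \<le> dist (cen (shear \<delta> \<epsilon> D) y j) (cen (shear \<delta> \<epsilon> D) z l)"
    by (simp add: shear_def dist_norm algebra_simps)
qed

lemma eventually_small: "0 < b \<Longrightarrow> \<forall>\<^sub>F e in at_right 0. e \<le> b" for b :: real
  unfolding eventually_at_right_field by (rule exI[of _ b]) auto

text \<open>For two distinct centres at most one value of \<open>\<delta>\<close> makes the real
  parts collide, so small \<open>\<delta>\<close> avoid all collisions. Then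
  \<open>\<epsilon>\<close> is chosen below half of every gap between real parts.\<close>

lemma shear_separates:
  assumes D: "D \<in> SC a x"
  shows "\<exists>E. E \<in> sep a x (order_of a E) \<and> path_component (SC a x) D E"
proof -
  note c = confinedD[OF SC_confined[OF D]]
  define h where "h \<delta> p = Re (cen D (fst p) (snd p)) + \<delta> * Im (cen D (fst p) (snd p))" for \<delta> p
  have "\<forall>\<^sub>F \<delta> in at_right 0. p \<noteq> q \<longrightarrow> h \<delta> p \<noteq> h \<delta> q" if "p \<in> inputs a" "q \<in> inputs a" for p q
  proof (cases "p = q")
    case False
    obtain y j z l where pq: "p = (y, j)" "q = (z, l)" by (cases p, cases q)
    have "cen D y j \<noteq> cen D z l" using SC_dist[OF D, of j y l z] c(1)[of j y] c(1)[of l z] that False by (auto simp: pq inputs_def)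
    then consider "Im (cen D y j) = Im (cen D z l)" "Re (cen D y j) \<noteq> Re (cen D z l)" | "Im (cen D y j) \<noteq> Im (cen D z l)"
      by (auto simp: complex_eq_iff)
    then show ?thesis
    proof cases
      case 2
      \<comment> \<open>The only parameter for which the two sheared centres have the same real
        part.\<close>
      define s where "s = - (Re (cen D y j) - Re (cen D z l)) / (Im (cen D y j) - Im (cen D z l))"
      have "h \<delta> p = h \<delta> q \<Longrightarrow> \<delta> = s" for \<delta> using 2 by (simp add: h_def pq s_def field_simps)
      moreover have "\<forall>\<^sub>F \<delta> in at_right 0. \<delta> \<noteq> s"
        unfolding eventually_at_right_field by (rule exI[of _ "if 0 < s then s else 1"]) auto
      ultimately show ?thesis by (auto elim!: eventually_mono)
    qed (auto simp: h_def pq)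
  qed simp
  then have "\<forall>\<^sub>F \<delta> in at_right 0. \<forall>p\<in>inputs a. \<forall>q\<in>inputs a. p \<noteq> q \<longrightarrow> h \<delta> p \<noteq> h \<delta> q"
    by (intro eventually_ball_finite finite_inputs ballI)
  moreover have "\<forall>\<^sub>F \<delta> in at_right 0. \<forall>p\<in>inputs a. \<delta> \<le> rad D (fst p) (snd p) / 2"
    by (intro eventually_ball_finite finite_inputs ballI eventually_small) (use c(1) in \<open>auto simp: inputs_def\<close>)
  moreover have "\<forall>\<^sub>F \<delta> in at_right (0::real). \<delta> \<le> 1/2" by (rule eventually_small) simp
  moreover have "\<forall>\<^sub>F \<delta> in at_right (0::real). 0 < \<delta>" by (rule eventually_at_right_less)
  ultimately have "\<forall>\<^sub>F \<delta> in at_right 0. (\<forall>p\<in>inputs a. \<forall>q\<in>inputs a. p \<noteq> q \<longrightarrow> h \<delta> p \<noteq> h \<delta> q) \<and>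
      (\<forall>p\<in>inputs a. \<delta> \<le> rad D (fst p) (snd p) / 2) \<and> \<delta> \<le> 1/2 \<and> 0 < \<delta>"
    by eventually_elim blast
  from eventually_happens'[OF trivial_limit_at_right_real this] obtain \<delta> where
    "(\<forall>p\<in>inputs a. \<forall>q\<in>inputs a. p \<noteq> q \<longrightarrow> h \<delta> p \<noteq> h \<delta> q) \<and> (\<forall>p\<in>inputs a. \<delta> \<le> rad D (fst p) (snd p) / 2) \<and> \<delta> \<le> 1/2 \<and> 0 < \<delta>" ..
  then have \<delta>: "\<And>p q. p \<in> inputs a \<Longrightarrow> q \<in> inputs a \<Longrightarrow> p \<noteq> q \<Longrightarrow> h \<delta> p \<noteq> h \<delta> q"
    "\<And>p. p \<in> inputs a \<Longrightarrow> \<delta> \<le> rad D (fst p) (snd p) / 2" "\<delta> \<le> 1/2" "0 < \<delta>" by blast+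
  have "\<forall>\<^sub>F \<epsilon> in at_right 0. p \<noteq> q \<longrightarrow> \<epsilon> \<le> \<bar>h \<delta> p - h \<delta> q\<bar> / 2" if "p \<in> inputs a" "q \<in> inputs a" for p q
    using eventually_small[of "\<bar>h \<delta> p - h \<delta> q\<bar> / 2"] \<delta>(1)[OF that] by (cases "p = q") (auto elim: eventually_mono)
  then have "\<forall>\<^sub>F \<epsilon> in at_right 0. \<forall>p\<in>inputs a. \<forall>q\<in>inputs a. p \<noteq> q \<longrightarrow> \<epsilon> \<le> \<bar>h \<delta> p - h \<delta> q\<bar> / 2"
    by (intro eventually_ball_finite finite_inputs ballI)
  moreover have "\<forall>\<^sub>F \<epsilon> in at_right (0::real). \<epsilon> \<le> 1/2" by (rule eventually_small) simp
  moreover have "\<forall>\<^sub>F \<epsilon> in at_right (0::real). 0 < \<epsilon>" by (rule eventually_at_right_less)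
  ultimately have "\<forall>\<^sub>F \<epsilon> in at_right 0. (\<forall>p\<in>inputs a. \<forall>q\<in>inputs a. p \<noteq> q \<longrightarrow> \<epsilon> \<le> \<bar>h \<delta> p - h \<delta> q\<bar> / 2) \<and> \<epsilon> \<le> 1/2 \<and> 0 < \<epsilon>"
    by eventually_elim blast
  from eventually_happens'[OF trivial_limit_at_right_real this] obtain \<epsilon> where
    "(\<forall>p\<in>inputs a. \<forall>q\<in>inputs a. p \<noteq> q \<longrightarrow> \<epsilon> \<le> \<bar>h \<delta> p - h \<delta> q\<bar> / 2) \<and> \<epsilon> \<le> 1/2 \<and> 0 < \<epsilon>" ..
  then have \<epsilon>: "\<And>p q. p \<in> inputs a \<Longrightarrow> q \<in> inputs a \<Longrightarrow> p \<noteq> q \<Longrightarrow> \<epsilon> \<le> \<bar>h \<delta> p - h \<delta> q\<bar> / 2" "\<epsilon> \<le> 1/2" "0 < \<epsilon>" by blast+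
  let ?E = "shear \<delta> \<epsilon> D"
  \<comment> \<open>Each configuration on the segment is itself a shear of \<open>D\<close>, with
    interpolated parameters, so \<open>shear_SC\<close> applies throughout.\<close>
  have line: "config_line D ?E t \<in> SC a x" if t: "0 \<le> t" "t \<le> 1" for t
    unfolding shear_line
  proof (rule shear_SC[OF D])
    have "t * (1 - \<epsilon>) \<le> 1 * (1 - \<epsilon>)" using t \<epsilon> by (intro mult_right_mono) auto
    then show "0 < 1 - t * (1 - \<epsilon>)" using \<epsilon>(3) by simp
    show "t * \<delta> \<le> 1 - (1 - t * (1 - \<epsilon>))" using mult_left_mono[of \<delta> "1 - \<epsilon>" t] \<delta>(3) \<epsilon>(2) t by simp
    fix y j assume j: "j < a y"
    have "\<delta> \<le> 1/2 * rad D y j" using \<delta>(2)[of "(y, j)"] j by (simp add: inputs_def)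
    also have "\<dots> \<le> (1 - \<epsilon>) * rad D y j" using \<epsilon>(2) c(1)[OF j] by (intro mult_right_mono) auto
    finally show "t * \<delta> \<le> (1 - (1 - t * (1 - \<epsilon>))) * rad D y j" using mult_left_mono[of \<delta> _ t] t by (simp add: mult.assoc)
  qed (use t \<delta> in auto)
  have E: "?E \<in> SC a x" using line[of 1] by (simp add: config_line_def)
  have "?E \<in> sep a x (order_of a ?E)"
    unfolding sep_def
  proof (intro CollectI conjI allI impI SC_confined[OF E])
    fix y j z l assume *: "j < a y" "l < a z" "(y, j) \<noteq> (z, l)"
    \<comment> \<open>Radii are at most 1, so the shrunken ones add up to at most
      \<open>2 * \<epsilon>\<close>, which no gap between the real parts falls below.\<close>
    have 1: "\<epsilon> * (rad D y j + rad D z l) \<le> \<epsilon> * 2"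
      using c(2)[OF *(1)] c(2)[OF *(2)] \<epsilon>(3) norm_ge_zero[of "cen D y j"] norm_ge_zero[of "cen D z l"] by (intro mult_left_mono) linarith+
    have 2: "\<epsilon> \<le> \<bar>h \<delta> (y, j) - h \<delta> (z, l)\<bar> / 2" using \<epsilon>(1)[of "(y, j)" "(z, l)"] * by (simp add: inputs_def)
    have h: "Re (cen ?E y j) = h \<delta> (y, j)" "Re (cen ?E z l) = h \<delta> (z, l)" by (simp_all add: shear_def h_def)
    have r: "rad ?E y j + rad ?E z l = \<epsilon> * (rad D y j + rad D z l)" by (simp add: shear_def algebra_simps)
    show "rad ?E y j + rad ?E z l \<le> (if ((y, j), (z, l)) \<in> order_of a ?E then Re (cen ?E z l) - Re (cen ?E y j) else Re (cen ?E y j) - Re (cen ?E z l))"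
      unfolding order_of_def h r using 1 2 * h by auto
  qed
  moreover have "path_component (SC a x) D ?E" by (rule path_component_line[OF line])
  ultimately show ?thesis by blast
qed

text \<open>Representatives are chosen for each relation on the finite set of inputs. For relations
  that no configuration realises the choice is arbitrary, which does not harm finiteness.\<close>

lemma finite_path_components:
  "\<exists>B. finite B \<and> (\<forall>D\<in>SC a x. \<exists>E\<in>B. path_component (SC a x) D E)"
proof (intro exI conjI ballI)
  let ?B = "(\<lambda>R. SOME E. E \<in> sep a x R) ` Pow (inputs a \<times> inputs a)"
  show "finite ?B" using finite_inputs[of a] by simp
  fix D assume "D \<in> SC a x"
  then obtain E where E: "E \<in> sep a x (order_of a E)" "path_component (SC a x) D E" using shear_separates by blast
  define F where "F = (SOME F. F \<in> sep a x (order_of a E))"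
  have "F \<in> sep a x (order_of a E)" unfolding F_def using E(1) by (rule someI[where P = "\<lambda>F. F \<in> sep a x (order_of a E)"])
  then have "path_component (SC a x) D F" using E path_component_sep path_component_trans by blast
  moreover have "order_of a E \<in> Pow (inputs a \<times> inputs a)" by (auto simp: order_of_def inputs_def)
  then have "F \<in> ?B" unfolding F_def by (rule imageI)
  ultimately show "\<exists>F\<in>?B. path_component (SC a x) D F" by blast
qed


section \<open>Renumbering and gluing of configurations\<close>

lemma path_component_map:
  assumes "path_component X D E" "\<And>F. F \<in> X \<Longrightarrow> h F \<in> Y" "\<And>g. path g \<Longrightarrow> path (\<lambda>t. h (g t))"
  shows "path_component Y (h D) (h E)"
proof -
  obtain g where g: "path g" "path_image g \<subseteq> X" "pathstart g = D" "pathfinish g = E"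
    using assms(1) by (auto simp: path_component_def)
  have "path_image (\<lambda>t. h (g t)) \<subseteq> Y" using g(2) assms(2) by (force simp: path_image_def)
  moreover have "pathstart (\<lambda>t. h (g t)) = h D" "pathfinish (\<lambda>t. h (g t)) = h E" using g by (auto simp: pathstart_def pathfinish_def)
  ultimately show ?thesis using assms(3)[OF g(1)] unfolding path_component_def by blast
qed

lemma path_SC_act: "path g \<Longrightarrow> path (\<lambda>t. SC_act \<sigma> (g t))"
  unfolding path_config_iff SC_act_def by blast

lemma SC_act_SC:
  assumes \<sigma>: "\<sigma> \<in> perms a" and D: "D \<in> SC a x"
  shows "SC_act \<sigma> D \<in> SC a x"
proof -
  let ?\<tau> = "\<lambda>y. inv_into UNIV (\<sigma> y)"
  have p: "?\<tau> y permutes {..<a y}" for y using \<sigma> by (auto simp: perms_def intro: permutes_inv)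
  have lt: "?\<tau> y j < a y \<longleftrightarrow> j < a y" for y j using permutes_in_image[OF p] by (metis lessThan_iff)
  have inj: "?\<tau> y j = ?\<tau> y l \<longleftrightarrow> j = l" for y j l using permutes_inj[OF p] by (metis injD)
  show ?thesis
  proof (rule SC_I)
    show "confined a x (SC_act \<sigma> D)"
      using SC_confined[OF D] lt unfolding confined_def SC_act_def by simp
    show "rad (SC_act \<sigma> D) y j + rad (SC_act \<sigma> D) z l \<le> dist (cen (SC_act \<sigma> D) y j) (cen (SC_act \<sigma> D) z l)"
      if "j < a y" "l < a z" "(y, j) \<noteq> (z, l)" for y j z l
      using SC_dist[OF D, of "?\<tau> y j" y "?\<tau> z l" z] that lt inj unfolding SC_act_def by auto
  qed
qed

lemma continuous_on_if_const:
  "(c \<Longrightarrow> continuous_on S f) \<Longrightarrow> (\<not> c \<Longrightarrow> continuous_on S g) \<Longrightarrow> continuous_on S (\<lambda>x. if c then f x else g x)"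
  by (cases c) auto

lemma path_SC_glue_left: "path g \<Longrightarrow> path (\<lambda>t. SC_glue a x i b (g t) E)"
  and path_SC_glue_right: "path g \<Longrightarrow> path (\<lambda>t. SC_glue a x i b D (g t))"
  unfolding path_config_iff SC_glue_def rescale_def by (auto intro!: continuous_on_if_const continuous_intros)

lemma SC_glue_outer: "j < a y \<Longrightarrow> (y, j) \<noteq> (x, i) \<Longrightarrow> SC_glue a x i b D E y (lab_out x i b y j) = D y j"
  by (auto simp: SC_glue_def lab_out_def)

lemma SC_glue_inner: "j < b y \<Longrightarrow> SC_glue a x i b D E y (lab_in x i a y j) = rescale (D x i) (E y j)"
  by (auto simp: SC_glue_def lab_in_def)

lemma SC_glue_outside:
  "i < a x \<Longrightarrow> \<not> l < comp_ar a x b y \<Longrightarrow> (\<And>j. \<not> j < a y \<Longrightarrow> D y j = (0, 0)) \<Longrightarrow> SC_glue a x i b D E y l = (0, 0)"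
  by (auto simp: SC_glue_def comp_ar_def)

lemma rescale_simps: "fst (rescale C e) = fst C + of_real (snd C) * fst e" "snd (rescale C e) = snd C * snd e"
  by (auto simp: rescale_def)

text \<open>Everything follows from the fact that a rescaled disk stays inside the disk it is glued
  into: bounds and distances to outer disks are inherited from that disk, and distances among inner
  disks are scaled.\<close>

lemma SC_glue_SC:
  assumes D: "D \<in> SC a z" and E: "E \<in> SC b x" and i: "i < a x"
  shows "SC_glue a x i b D E \<in> SC (comp_ar a x b) z"
proof -
  note cD = confinedD[OF SC_confined[OF D]] and cE = confinedD[OF SC_confined[OF E]]
  note D' = SC_confined[OF D, unfolded confined_def] and E' = SC_confined[OF E, unfolded confined_def]
  let ?G = "SC_glue a x i b D E" and ?C = "D x i"
  have r: "0 < snd ?C" using cD(1)[OF i] .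
  \<comment> \<open>The containment of the rescaled disk in \<open>D x i\<close>, as an estimate
    relative to the centre of the latter.\<close>
  have sub: "norm (of_real (snd ?C) * cen E y j) + snd ?C * rad E y j \<le> snd ?C" if "j < b y" for y j
    using mult_left_mono[OF cE(2)[OF that], of "snd ?C"] r by (simp add: norm_mult algebra_simps)
  have Im: "snd ?C * rad E y j - snd ?C \<le> Im (of_real (snd ?C) * cen E y j)" if "j < b y" for y j
    using sub[OF that] abs_Im_le_cmod[of "of_real (snd ?C) * cen E y j"] by linarith
  have adm: "admissible (comp_ar a x b) z"
    using D' E' i by (cases x; cases z) (auto simp: admissible_def comp_ar_def)
  have "0 < rad ?G y l \<and> norm (cen ?G y l) + rad ?G y l \<le> 1" if l: "l < comp_ar a x b y" for y l
    using l i
  proof (cases rule: comp_ar_cases)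
    case (left j)
    then show ?thesis using cD(1,2) by (simp add: SC_glue_outer)
  next
    case (right j)
    have "norm (fst ?C + of_real (snd ?C) * cen E y j) + snd ?C * rad E y j \<le> 1"
      using sub[OF right(1)] cD(2)[OF i] norm_triangle_ineq[of "fst ?C" "of_real (snd ?C) * cen E y j"] by linarith
    then show ?thesis using right r cE(1) by (simp add: SC_glue_inner rescale_simps)
  qed
  moreover have "?G y l = (0, 0)" if "\<not> l < comp_ar a x b y" for y l
    using SC_glue_outside[OF i that] cD(3) by simp
  moreover have "Im (cen ?G Open l) = 0" if l: "l < comp_ar a x b Open" and z: "z = Open" for l
    using l(1) i
  proof (cases rule: comp_ar_cases)
    case (left j)
    then show ?thesis using D' z by (simp add: SC_glue_outer)
  next
    case (right j)
    then have x: "x = Open" using E' by (cases x) (auto simp: admissible_def)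
    then have "Im (cen E Open j) = 0" "Im (fst ?C) = 0" using E' D' i z right by auto
    then show ?thesis using right by (simp add: SC_glue_inner rescale_simps)
  qed
  moreover have "rad ?G Closed l \<le> Im (cen ?G Closed l)" if l: "l < comp_ar a x b Closed" and z: "z = Open" for l
    using l(1) i
  proof (cases rule: comp_ar_cases)
    case (left j)
    then show ?thesis using D' z by (simp add: SC_glue_outer)
  next
    case (right j)
    show ?thesis
    proof (cases x)
      case Closed
      then have "snd ?C \<le> Im (fst ?C)" using D' i z by auto
      then show ?thesis using Im[OF right(1)] right by (simp add: SC_glue_inner rescale_simps)
    next
      case Open
      then have "rad E Closed j \<le> Im (cen E Closed j)" "Im (fst ?C) = 0" using E' D' i z right by auto
      then show ?thesis using right r by (simp add: SC_glue_inner rescale_simps)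
    qed
  qed
  ultimately have conf: "confined (comp_ar a x b) z ?G" unfolding confined_def using adm by blast
  have io: "rad ?G y l + rad ?G y' l' \<le> dist (cen ?G y l) (cen ?G y' l')"
    if o: "j < a y" "(y, j) \<noteq> (x, i)" "l = lab_out x i b y j" and n: "j' < b y'" "l' = lab_in x i a y' j'" for y l y' l' j j'
  proof -
    have "rad D y j + snd ?C \<le> norm (cen D y j - fst ?C)" using SC_dist[OF D o(1) i o(2)] by (simp add: dist_norm)
    moreover have "norm (cen D y j - fst ?C) \<le> norm (cen D y j - (fst ?C + of_real (snd ?C) * cen E y' j')) + norm (of_real (snd ?C) * cen E y' j')"
      using norm_triangle_ineq[of "cen D y j - (fst ?C + of_real (snd ?C) * cen E y' j')" "of_real (snd ?C) * cen E y' j'"] by simp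
    ultimately show ?thesis using sub[OF n(1)] o n by (simp add: SC_glue_outer SC_glue_inner rescale_simps dist_norm)
  qed
  show ?thesis
  proof (rule SC_I[OF conf])
    fix y l y' l' assume l: "l < comp_ar a x b y" "l' < comp_ar a x b y'" and ne: "(y, l) \<noteq> (y', l')"
    show "rad ?G y l + rad ?G y' l' \<le> dist (cen ?G y l) (cen ?G y' l')"
      using l(1) i
    proof (cases rule: comp_ar_cases)
      case (left j)
      note o = this
      show ?thesis using l(2) i
      proof (cases rule: comp_ar_cases)
        case (left j')
        then have "(y, j) \<noteq> (y', j')" using ne o by auto
        then show ?thesis using SC_dist[OF D o(1) left(1)] o left by (simp add: SC_glue_outer)
      next
        case (right j')
        then show ?thesis using io[OF o] by blast
      qed
    next
      case (right j)
      note n = this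
      show ?thesis using l(2) i
      proof (cases rule: comp_ar_cases)
        case (left j')
        then show ?thesis using io[OF left n] by (simp add: dist_commute add.commute)
      next
        case (right j')
        then have "(y, j) \<noteq> (y', j')" using ne n by auto
        then have "snd ?C * (rad E y j + rad E y' j') \<le> snd ?C * norm (cen E y j - cen E y' j')"
          using SC_dist[OF E n(1) right(1)] r by (intro mult_left_mono) (auto simp: dist_norm)
        also have "\<dots> = norm (of_real (snd ?C) * (cen E y j - cen E y' j'))" using r by (simp add: norm_mult)
        also have "of_real (snd ?C) * (cen E y j - cen E y' j') = (fst ?C + of_real (snd ?C) * cen E y j) - (fst ?C + of_real (snd ?C) * cen E y' j')"
          by (simp add: algebra_simps)
        finally show ?thesis using n right by (simp add: SC_glue_inner rescale_simps dist_norm distrib_left)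
      qed
    qed
  qed
qed

text \<open>
  A point of each configuration space of arity at most two.  For \<open>e\<close> from \<open>1\<close> to \<open>-1\<close> the two disks change
  their horizontal order; this is possible unless both are open.
\<close>

definition cross :: "arity \<Rightarrow> real \<Rightarrow> config" where
  "cross a e = (\<lambda>y j. if j < a y
     then (Complex (e * (real (j + (if y = Open then a Closed else 0)) / 2 - 1/4)) (if y = Closed then 1/4 + real j / 2 else 0), 1/8)
     else (0, 0))"

lemma cross_cases:
  assumes "1 \<le> a Closed + a Open" "a Closed + a Open \<le> 2"
  obtains "a = arr 1 0" | "a = arr 0 1" | "a = arr 2 0" | "a = arr 1 1" | "a = arr 0 2"
proof -
  have "a Closed = 1 \<and> a Open = 0 \<or> a Closed = 0 \<and> a Open = 1 \<or> a Closed = 2 \<and> a Open = 0 \<or> a Closed = 1 \<and> a Open = 1 \<or> a Closed = 0 \<and> a Open = 2"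
    using assms by linarith
  then show thesis using that by (auto simp: arity_eq_iff)
qed

lemma cross_confined:
  assumes a: "admissible a x" "a Closed + a Open \<le> 2" and e: "\<bar>e\<bar> \<le> 1"
  shows "confined a x (cross a e)"
proof -
  \<comment> \<open>The centres of \<open>cross\<close> lie in this rectangle, and the bound 7/8
    leaves room for the radius 1/8.\<close>
  have n: "cmod (Complex u v) \<le> 7/8" if "\<bar>u\<bar> \<le> 1/4" "\<bar>v\<bar> \<le> 3/4" for u v
  proof -
    have "u\<^sup>2 \<le> (1/4)\<^sup>2" "v\<^sup>2 \<le> (3/4)\<^sup>2" using that by (auto simp flip: abs_le_square_iff)
    then show ?thesis unfolding cmod_def by (intro real_le_lsqrt) (auto simp: power2_eq_square)
  qed
  have "cmod (cen (cross a e) y j) \<le> 7/8" if j: "j < a y" for y j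
  proof -
    define k where "k = j + (if y = Open then a Closed else 0)"
    have "k = 0 \<or> k = 1" "j = 0 \<or> j = 1" using a(2) j by (cases y; auto simp: k_def)+
    then have "\<bar>e * (real k / 2 - 1/4)\<bar> \<le> 1/4" "\<bar>if y = Closed then 1/4 + real j / 2 else 0\<bar> \<le> 3/4" using e by (auto simp: abs_mult)
    then show ?thesis using n j by (simp add: cross_def k_def)
  qed
  moreover have "rad (cross a e) y j = 1/8" if "j < a y" for y j using that by (simp add: cross_def)
  moreover have "rad (cross a e) Closed j \<le> Im (cen (cross a e) Closed j)" "Im (cen (cross a e) Open j) = 0" for j
    by (auto simp: cross_def)
  ultimately show ?thesis using a(1) unfolding confined_def by (force simp: cross_def)
qed

text \<open>The radii of two disks add up to 1/4. Heights are 0 for open disks and 1/4, 3/4 for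
  closed ones, so they separate any two disks that are not both open; for \<open>e\<close> of
  modulus 1 the real parts differ by 1/2.\<close>

lemma cross_SC:
  assumes a: "admissible a x" "a Closed + a Open \<le> 2" and e: "\<bar>e\<bar> = 1 \<or> \<bar>e\<bar> \<le> 1 \<and> a Open \<le> 1"
  shows "cross a e \<in> SC a x"
proof (rule SC_I[OF cross_confined[OF a]])
  show "\<bar>e\<bar> \<le> 1" using e by auto
  fix y j z l assume *: "j < a y" "l < a z" "(y, j) \<noteq> (z, l)"
  have "1/4 \<le> \<bar>Re (cen (cross a e) y j) - Re (cen (cross a e) z l)\<bar> \<or> 1/4 \<le> \<bar>Im (cen (cross a e) y j) - Im (cen (cross a e) z l)\<bar>"
  proof -
    consider "a = arr 1 0" | "a = arr 0 1" | "a = arr 2 0" | "a = arr 1 1" | "a = arr 0 2"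
      using cross_cases[of a] a by (auto simp: admissible_def)
    then show ?thesis
      using * e by cases (cases y; cases z; auto simp: cross_def less_two_iff)+
  qed
  then have "1/4 \<le> dist (cen (cross a e) y j) (cen (cross a e) z l)"
    using abs_Re_le_dist abs_Im_le_dist order_trans by blast
  then show "rad (cross a e) y j + rad (cross a e) z l \<le> dist (cen (cross a e) y j) (cen (cross a e) z l)"
    using * by (simp add: cross_def)
qed

lemma cross_line: "config_line (cross a 1) (cross a (- 1)) t = cross a (1 - 2 * t)"
  by (auto simp: config_line_def cross_def fun_eq_iff complex_eq_iff field_simps)

lemma cross_connected:
  assumes "admissible a x" "a Closed + a Open \<le> 2" "a Open \<le> 1"
  shows "path_component (SC a x) (cross a 1) (cross a (- 1))"
  by (rule path_component_line) (use assms in \<open>auto simp: cross_line intro!: cross_SC\<close>)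

text \<open>With at most two disks there are at most two orders of the real parts, and
  \<open>cross\<close> realises both of them.\<close>

lemma path_component_cross:
  assumes D: "D \<in> SC a x" and a: "a Closed + a Open \<le> 2"
  obtains e where "e = 1 \<or> e = - 1" "path_component (SC a x) D (cross a e)"
proof -
  have adm: "admissible a x" using SC_confined[OF D] by (simp add: confined_def)
  obtain E where E: "E \<in> sep a x (order_of a E)" "path_component (SC a x) D E" using shear_separates[OF D] by blast
  have "\<exists>e. (e = 1 \<or> e = - 1) \<and> cross a e \<in> sep a x (order_of a E)"
  proof -
    \<comment> \<open>Compares the first input with the second, closed ones being counted first;
      with a single input either sign will do.\<close>
    define e where "e = (if Re (cen E (if a Closed = 0 then Open else Closed) 0) < Re (cen E (if a Closed = 2 then Closed else Open) (if a Closed = 1 then 0 else 1)) then 1 else - 1 :: real)"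
    have e: "e = 1 \<or> e = - 1" by (simp add: e_def)
    have "confined a x (cross a e)" using cross_confined[OF adm a] e by auto
    moreover have "rad (cross a e) y j + rad (cross a e) z l \<le> (if ((y, j), (z, l)) \<in> order_of a E
        then Re (cen (cross a e) z l) - Re (cen (cross a e) y j) else Re (cen (cross a e) y j) - Re (cen (cross a e) z l))"
      if *: "j < a y" "l < a z" "(y, j) \<noteq> (z, l)" for y j z l
    proof -
      have sep: "0 < (if ((y, j), (z, l)) \<in> order_of a E then Re (cen E z l) - Re (cen E y j) else Re (cen E y j) - Re (cen E z l))"
        if "j < a y" "l < a z" "(y, j) \<noteq> (z, l)" for y j z l
        using E(1) that confinedD(1)[of a x E j y] confinedD(1)[of a x E l z] unfolding sep_def by force
      consider "a = arr 1 0" | "a = arr 0 1" | "a = arr 2 0" | "a = arr 1 1" | "a = arr 0 2"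
        using cross_cases[of a] a adm by (auto simp: admissible_def)
      then show ?thesis
      proof cases
        case 1
        then show ?thesis using * by (cases y; cases z) auto
      next
        case 2
        then show ?thesis using * by (cases y; cases z) auto
      next
        case 3
        then show ?thesis using * sep[of 0 Closed 1 Closed]
          by (cases y; cases z) (auto simp: less_two_iff e_def order_of_def all_colour cross_def split: if_splits)
      next
        case 4
        then show ?thesis using * sep[of 0 Closed 0 Open]
          by (cases y; cases z) (auto simp: less_two_iff e_def order_of_def all_colour cross_def split: if_splits)
      next
        case 5
        then show ?thesis using * sep[of 0 Open 1 Open]
          by (cases y; cases z) (auto simp: less_two_iff e_def order_of_def all_colour cross_def split: if_splits)
      qed
    qed
    ultimately show ?thesis using e unfolding sep_def by blast
  qed
  then obtain e where e: "e = 1 \<or> e = - 1" "cross a e \<in> sep a x (order_of a E)" by blast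
  show thesis by (rule that[OF e(1) path_component_trans[OF E(2) path_component_sep[OF E(1) e(2)]]])
qed


section \<open>Degree zero homology of the Swiss-cheese operad\<close>

lemma vs_dual:
  assumes "vs (V :: ('k::field, 'a) module)"
  shows "vs (dual_module V)"
proof -
  interpret V: vspace V by (rule vspace.intro[OF assms])
  show ?thesis
  proof (intro moduleI cring_field_ring abelian_groupI)
    fix f assume f: "f \<in> carrier (dual_module V)"
    have "(\<lambda>v\<in>carrier V. - f v) \<in> carrier (dual_module V)" using f by (auto simp: dual_module_def)
    moreover have "(\<lambda>v\<in>carrier V. - f v) \<oplus>\<^bsub>dual_module V\<^esub> f = \<zero>\<^bsub>dual_module V\<^esub>"
      by (auto simp: dual_module_def fun_eq_iff restrict_def)
    ultimately show "\<exists>g\<in>carrier (dual_module V). g \<oplus>\<^bsub>dual_module V\<^esub> f = \<zero>\<^bsub>dual_module V\<^esub>" by blast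
  next
    fix f assume "f \<in> carrier (dual_module V)"
    then have "f \<in> extensional (carrier V)" by (auto simp: dual_module_def)
    then show "\<zero>\<^bsub>dual_module V\<^esub> \<oplus>\<^bsub>dual_module V\<^esub> f = f" "\<one>\<^bsub>field_ring\<^esub> \<odot>\<^bsub>dual_module V\<^esub> f = f"
      by (auto simp: dual_module_def fun_eq_iff restrict_def extensional_def)
  qed (auto simp: dual_module_def fun_eq_iff restrict_def extensional_def algebra_simps)
qed

lemma vs_zero_carrier:
  assumes "vs (V :: ('k::field, 'a) module)"
  shows "vs (V\<lparr>carrier := {\<zero>\<^bsub>V\<^esub>}\<rparr>)"
proof -
  interpret V: vspace V by (rule vspace.intro[OF assms])
  show ?thesis by (intro moduleI cring_field_ring abelian_groupI) auto
qed

lemma dual_simps: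
  "f \<in> carrier (dual_module V) \<Longrightarrow> v \<in> carrier V \<Longrightarrow> w \<in> carrier V \<Longrightarrow> f (v \<oplus>\<^bsub>V\<^esub> w) = f v + f w"
  "f \<in> carrier (dual_module V) \<Longrightarrow> v \<in> carrier V \<Longrightarrow> f (c \<odot>\<^bsub>V\<^esub> v) = c * f v"
  "v \<in> carrier V \<Longrightarrow> (f \<oplus>\<^bsub>dual_module V\<^esub> g) v = f v + g v"
  "v \<in> carrier V \<Longrightarrow> (c \<odot>\<^bsub>dual_module V\<^esub> f) v = c * f v"
  "v \<in> carrier V \<Longrightarrow> \<zero>\<^bsub>dual_module V\<^esub> v = 0"
  by (auto simp: dual_module_def)

lemma dual_eqI:
  assumes "f \<in> carrier (dual_module V)" "g \<in> carrier (dual_module V)" "\<And>v. v \<in> carrier V \<Longrightarrow> f v = g v"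
  shows "f = g"
  using assms by (auto simp: dual_module_def intro: extensionalityI)

definition hcl :: "idx \<Rightarrow> (config \<Rightarrow>\<^sub>0 'k::field) \<Rightarrow> (config \<Rightarrow>\<^sub>0 'k) set" where
  "hcl s v = fcl (boundaries0 (SC_points s)) v"

abbreviation ptcl :: "idx \<Rightarrow> config \<Rightarrow> (config \<Rightarrow>\<^sub>0 'k::field) set" where
  "ptcl s D \<equiv> hcl s (basis_vec D)"

abbreviation H0 :: "idx \<Rightarrow> ('k::field, (config \<Rightarrow>\<^sub>0 'k) set) module" where
  "H0 s \<equiv> component H0_SC s"

abbreviation connected_in :: "idx \<Rightarrow> config \<Rightarrow> config \<Rightarrow> bool" where
  "connected_in s \<equiv> path_component (SC_points s)"

definition edges :: "config set \<Rightarrow> (config \<Rightarrow>\<^sub>0 'k::field) set" where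
  "edges X = {basis_vec E - basis_vec D | D E. path_component X D E}"

text \<open>The boundary of a 1-simplex remembers only its endpoints.\<close>

lemma boundaries0_eq: "boundaries0 X = span_of (edges X)"
  by (auto simp: boundaries0_def edges_def path_component_def intro!: arg_cong[where f = span_of])

lemma keys_edges: "r \<in> edges X \<Longrightarrow> Poly_Mapping.keys r \<subseteq> X"
proof -
  assume "r \<in> edges X"
  then obtain D E where r: "r = basis_vec E - basis_vec D" and "path_component X D E" by (auto simp: edges_def)
  then have "D \<in> X" "E \<in> X" by (auto dest: path_component_mem)
  then show ?thesis unfolding r by (intro free_module_closed keys_basis)
qed

lemma quotient_H0: "quotient_space (free_module (SC_points s)) (boundaries0 (SC_points s))"
  unfolding boundaries0_eq by (rule quotient_free[OF keys_edges])

lemma H0_def: "H0 s = quotient_module (free_module (SC_points s)) (boundaries0 (SC_points s))"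
  by (simp add: H0_SC_def)

lemma vs_H0: "vs (H0 s)"
  unfolding H0_def by (rule quotient_space.vs_quotient[OF quotient_H0])

lemma carrier_H0: "carrier (H0 s) = hcl s ` {v. Poly_Mapping.keys v \<subseteq> SC_points s}"
  unfolding H0_def hcl_def using quotient_space.carrier_quotient[OF quotient_H0[of s]] by (simp add: a_r_coset_free)

lemma hcl_closed: "Poly_Mapping.keys v \<subseteq> SC_points s \<Longrightarrow> hcl s v \<in> carrier (H0 s)"
  by (auto simp: carrier_H0)

lemma ptcl_closed: "D \<in> SC_points s \<Longrightarrow> ptcl s D \<in> carrier (H0 s)"
  by (rule hcl_closed) simp

lemma add_H0: "Poly_Mapping.keys v \<subseteq> SC_points s \<Longrightarrow> Poly_Mapping.keys w \<subseteq> SC_points s \<Longrightarrow> hcl s v \<oplus>\<^bsub>H0 s\<^esub> hcl s w = hcl s (v + w)"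
  unfolding H0_def hcl_def using quotient_space.add_quotient[OF quotient_H0[of s], of v w] by (simp add: a_r_coset_free)

lemma smult_H0: "Poly_Mapping.keys v \<subseteq> SC_points s \<Longrightarrow> c \<odot>\<^bsub>H0 s\<^esub> hcl s v = hcl s (scal c v)"
  unfolding H0_def hcl_def using quotient_space.smult_quotient[OF quotient_H0[of s], of v c] by (simp add: a_r_coset_free)

lemma hcl_eq_iff: "hcl s v = hcl s w \<longleftrightarrow> v - w \<in> span_of (edges (SC_points s))"
  unfolding hcl_def boundaries0_eq by (rule fcl_eq_iff)

lemma ptcl_eq: "connected_in s D E \<Longrightarrow> ptcl s D = ptcl s E"
  unfolding hcl_eq_iff by (rule span_of_base) (auto simp: edges_def dest: path_component_sym)

lemma SC_act_points: "\<sigma> \<in> perms (ar s) \<Longrightarrow> D \<in> SC_points s \<Longrightarrow> SC_act \<sigma> D \<in> SC_points s"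
  by (auto simp: SC_points_def SC_act_SC split: if_splits)

lemma SC_glue_points:
  "i < ar s (out t) \<Longrightarrow> D \<in> SC_points s \<Longrightarrow> E \<in> SC_points t \<Longrightarrow> SC_glue (ar s) (out t) i (ar t) D E \<in> SC_points (comp_idx s t)"
  by (auto simp: SC_points_def comp_idx_def SC_glue_SC split: if_splits)

lemma connected_act: "\<sigma> \<in> perms (ar s) \<Longrightarrow> connected_in s D E \<Longrightarrow> connected_in s (SC_act \<sigma> D) (SC_act \<sigma> E)"
  by (erule path_component_map) (auto intro: SC_act_points path_SC_act)

lemma connected_glue_left:
  "i < ar s (out t) \<Longrightarrow> E \<in> SC_points t \<Longrightarrow> connected_in s D D' \<Longrightarrow>
    connected_in (comp_idx s t) (SC_glue (ar s) (out t) i (ar t) D E) (SC_glue (ar s) (out t) i (ar t) D' E)"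
  by (erule path_component_map[where h = "\<lambda>D. SC_glue (ar s) (out t) i (ar t) D E"]) (auto intro: SC_glue_points path_SC_glue_left)

lemma connected_glue_right:
  "i < ar s (out t) \<Longrightarrow> D \<in> SC_points s \<Longrightarrow> connected_in t E E' \<Longrightarrow>
    connected_in (comp_idx s t) (SC_glue (ar s) (out t) i (ar t) D E) (SC_glue (ar s) (out t) i (ar t) D E')"
  by (erule path_component_map) (auto intro: SC_glue_points path_SC_glue_right)

lemma act_H0:
  assumes "\<sigma> \<in> perms (ar s)"
  shows "act H0_SC s \<sigma> (hcl s v) = hcl s (lin_ext (\<lambda>D. basis_vec (SC_act \<sigma> D)) v)"
proof -
  have "coset_map (free_module (SC_points s)) (span_of (edges (SC_points s))) (lin_ext (\<lambda>D. basis_vec (SC_act \<sigma> D))) (fcl (span_of (edges (SC_points s))) v)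
      = fcl (span_of (edges (SC_points s))) (lin_ext (\<lambda>D. basis_vec (SC_act \<sigma> D)) v)"
  proof (rule coset_map_lin_ext)
    fix r :: "config \<Rightarrow>\<^sub>0 'a" assume "r \<in> edges (SC_points s)"
    then obtain D E where "r = basis_vec E - basis_vec D" "connected_in s D E" by (auto simp: edges_def)
    then show "lin_ext (\<lambda>D. basis_vec (SC_act \<sigma> D)) r \<in> span_of (edges (SC_points s))"
      using connected_act[OF assms] by (intro span_of_base) (auto simp: lin_ext_diff edges_def)
  qed
  then show ?thesis by (simp add: H0_SC_def hcl_def boundaries0_eq)
qed

lemma pcomp_H0:
  assumes i: "i < ar s (out t)" and v: "Poly_Mapping.keys v \<subseteq> SC_points s" and w: "Poly_Mapping.keys w \<subseteq> SC_points t"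
  shows "pcomp H0_SC s i t (hcl s v) (hcl t w) = hcl (comp_idx s t) (bilin_ext (SC_glue (ar s) (out t) i (ar t)) (v, w))"
proof -
  let ?st = "comp_idx s t" and ?g = "SC_glue (ar s) (out t) i (ar t)"
  have "coset_map (free_module (SC_points ?st)) (span_of (edges (SC_points ?st))) (bilin_ext ?g) (fcl (span_of (edges (SC_points s))) v \<times> fcl (span_of (edges (SC_points t))) w)
      = fcl (span_of (edges (SC_points ?st))) (bilin_ext ?g (v, w))"
  proof (rule coset_map_bilin_ext[OF _ _ v keys_edges])
    fix r :: "config \<Rightarrow>\<^sub>0 'a" assume "r \<in> edges (SC_points s)"
    then obtain D E where "r = basis_vec E - basis_vec D" "connected_in s D E" by (auto simp: edges_def)
    then show "bilin_ext ?g (r, w) \<in> span_of (edges (SC_points ?st))"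
      unfolding bilin_ext_right using connected_glue_left[OF i _ \<open>connected_in s D E\<close>] w
      by (intro span_of_lin_ext span_of_base) (auto simp: lin_ext_diff edges_def)
  next
    fix v r :: "config \<Rightarrow>\<^sub>0 'a" assume "r \<in> edges (SC_points t)" and v: "Poly_Mapping.keys v \<subseteq> SC_points s"
    then obtain D E where "r = basis_vec E - basis_vec D" "connected_in t D E" by (auto simp: edges_def)
    then show "bilin_ext ?g (v, r) \<in> span_of (edges (SC_points ?st))"
      unfolding bilin_ext_left using connected_glue_right[OF i _ \<open>connected_in t D E\<close>] v
      by (intro span_of_lin_ext span_of_base) (auto simp: lin_ext_diff edges_def)
  qed
  then show ?thesis by (simp add: H0_SC_def hcl_def boundaries0_eq)
qed

lemma dual_H0_pair:
  fixes f :: "(config \<Rightarrow>\<^sub>0 'k::field) set \<Rightarrow> 'k"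
  assumes f: "f \<in> carrier (dual_module (H0 s))" and v: "Poly_Mapping.keys v \<subseteq> SC_points s"
  shows "f (hcl s v) = pair (\<lambda>D. f (ptcl s D)) v"
proof -
  have "Poly_Mapping.keys (\<Sum>x\<in>A. scal (c x) (basis_vec x)) \<subseteq> SC_points s \<and>
      f (hcl s (\<Sum>x\<in>A. scal (c x) (basis_vec x))) = (\<Sum>x\<in>A. c x * f (ptcl s x))"
    if "finite A" "A \<subseteq> SC_points s" for A c
    using that
  proof (induction A)
    case empty
    have "hcl s 0 = 0 \<odot>\<^bsub>H0 s\<^esub> hcl s (0 :: config \<Rightarrow>\<^sub>0 'k)" by (simp add: smult_H0)
    then have "f (hcl s 0) = 0" using dual_simps(2)[OF f hcl_closed, of 0 0] by simp
    then show ?case by simp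
  next
    case (insert x A)
    let ?r = "\<Sum>x\<in>A. scal (c x) (basis_vec x)"
    have r: "Poly_Mapping.keys ?r \<subseteq> SC_points s" and fr: "f (hcl s ?r) = (\<Sum>x\<in>A. c x * f (ptcl s x))" using insert by auto
    have x: "Poly_Mapping.keys (basis_vec x :: config \<Rightarrow>\<^sub>0 'k) \<subseteq> SC_points s" using insert by auto
    then have cx: "Poly_Mapping.keys (scal (c x) (basis_vec x)) \<subseteq> SC_points s" by (rule free_module_closed(2))
    have "f (hcl s (scal (c x) (basis_vec x) + ?r)) = f (hcl s (scal (c x) (basis_vec x))) + f (hcl s ?r)"
      unfolding add_H0[OF cx r, symmetric] by (rule dual_simps(1)[OF f hcl_closed[OF cx] hcl_closed[OF r]])
    also have "f (hcl s (scal (c x) (basis_vec x))) = c x * f (ptcl s x)"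
      unfolding smult_H0[OF x, symmetric] by (rule dual_simps(2)[OF f hcl_closed[OF x]])
    finally show ?case using free_module_closed(1)[OF cx r] fr insert(1,2) by simp
  qed
  from this[of "Poly_Mapping.keys v" "Poly_Mapping.lookup v"] v
  have "f (hcl s (lin_ext basis_vec v)) = pair (\<lambda>D. f (ptcl s D)) v" unfolding lin_ext_def pair_def using finite_keys by blast
  then show ?thesis by simp
qed

lemma dual_H0_eqI:
  fixes f :: "(config \<Rightarrow>\<^sub>0 'k::field) set \<Rightarrow> 'k"
  assumes f: "f \<in> carrier (dual_module (H0 s))" and g: "g \<in> carrier (dual_module (H0 s))"
    and eq: "\<And>D. D \<in> SC_points s \<Longrightarrow> f (ptcl s D) = g (ptcl s D)"
  shows "f = g"
proof (rule dual_eqI[OF f g])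
  fix p :: "(config \<Rightarrow>\<^sub>0 'k) set" assume "p \<in> carrier (H0 s)"
  then obtain v where v: "p = hcl s v" "Poly_Mapping.keys v \<subseteq> SC_points s" by (auto simp: carrier_H0)
  show "f p = g p" unfolding v(1) dual_H0_pair[OF f v(2)] dual_H0_pair[OF g v(2)] by (rule pair_cong) (use v eq in auto)
qed

text \<open>The functional on degree 0 homology induced by a function that is constant on path
  components; this constancy makes the choice of a representative immaterial.\<close>

definition hfun :: "idx \<Rightarrow> (config \<Rightarrow> 'k::field) \<Rightarrow> (config \<Rightarrow>\<^sub>0 'k) set \<Rightarrow> 'k" where
  "hfun s \<phi> = (\<lambda>p\<in>carrier (H0 s). pair \<phi> (SOME v. Poly_Mapping.keys v \<subseteq> SC_points s \<and> hcl s v = p))"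

context
  fixes s and \<phi> :: "config \<Rightarrow> 'k::field"
  assumes inv: "\<And>D E. connected_in s D E \<Longrightarrow> \<phi> D = \<phi> E"
begin

lemma hfun_hcl:
  assumes v: "Poly_Mapping.keys v \<subseteq> SC_points s"
  shows "hfun s \<phi> (hcl s v) = pair \<phi> v"
proof -
  let ?w = "SOME w. Poly_Mapping.keys w \<subseteq> SC_points s \<and> hcl s w = hcl s v"
  have "Poly_Mapping.keys ?w \<subseteq> SC_points s \<and> hcl s ?w = hcl s v" by (rule someI[where x = v]) (simp add: v)
  then have "?w - v \<in> span_of (edges (SC_points s))" by (simp add: hcl_eq_iff)
  then have "pair \<phi> (?w - v) = 0"
    by (rule pair_span_of) (auto simp: edges_def pair_diff dest: inv)
  then show ?thesis using hcl_closed[OF v] by (simp add: hfun_def pair_diff)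
qed

lemma hfun_ptcl: "D \<in> SC_points s \<Longrightarrow> hfun s \<phi> (ptcl s D) = \<phi> D"
  by (subst hfun_hcl) auto

lemma hfun_closed: "hfun s \<phi> \<in> carrier (dual_module (H0 s))"
proof -
  have "hfun s \<phi> (p \<oplus>\<^bsub>H0 s\<^esub> q) = hfun s \<phi> p + hfun s \<phi> q" if "p \<in> carrier (H0 s)" "q \<in> carrier (H0 s)" for p q
    using that by (auto simp: carrier_H0 add_H0 hfun_hcl free_module_closed pair_add)
  moreover have "hfun s \<phi> (c \<odot>\<^bsub>H0 s\<^esub> p) = c * hfun s \<phi> p" if "p \<in> carrier (H0 s)" for c p
    using that by (auto simp: carrier_H0 smult_H0 hfun_hcl free_module_closed pair_scal)
  ultimately show ?thesis by (auto simp: dual_module_def hfun_def)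
qed

end


section \<open>The dual cooperad\<close>

abbreviation CS :: "('k::field, (config \<Rightarrow>\<^sub>0 'k) set \<Rightarrow> 'k) cooperad_data" where
  "CS \<equiv> dual_cooperad (suspension H0_SC)"

text \<open>The index in \<open>H0_SC\<close> underlying an index of the dual cooperad: dualising
  negates the degree and the suspension shifts it.\<close>

definition pidx :: "idx \<Rightarrow> idx" where
  "pidx s = susp_idx (neg_idx s)"

lemma pidx_simps [simp]: "ar (pidx s) = ar s" "out (pidx s) = out s" "deg (pidx s) = total s - 1 - deg s"
  by (auto simp: pidx_def susp_idx_def neg_idx_def total_def)

lemma component_CS: "component CS s = dual_module (H0 (pidx s))"
  by (simp add: dual_cooperad_def suspension_def pidx_def)

abbreviation invp :: "(colour \<Rightarrow> nat \<Rightarrow> nat) \<Rightarrow> colour \<Rightarrow> nat \<Rightarrow> nat" where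
  "invp \<sigma> \<equiv> (\<lambda>y. inv_into UNIV (\<sigma> y))"

lemma invp_perms: "\<sigma> \<in> perms a \<Longrightarrow> invp \<sigma> \<in> perms a"
  by (auto simp: perms_def intro: permutes_inv)

lemma keys_SC_act:
  "\<sigma> \<in> perms (ar s) \<Longrightarrow> Poly_Mapping.keys v \<subseteq> SC_points s \<Longrightarrow> Poly_Mapping.keys (lin_ext (\<lambda>D. basis_vec (SC_act \<sigma> D)) v) \<subseteq> SC_points s"
  by (erule keys_lin_ext_le) (simp add: SC_act_points)

lemma dual_ptcl_eq: "connected_in s D E \<Longrightarrow> f (ptcl s D) = f (ptcl s E)"
  by (simp add: ptcl_eq)

text \<open>In terms of \<open>hfun\<close> both membership in the dual and the values at points
  become immediate.\<close>

lemma act_CS: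
  fixes f :: "(config \<Rightarrow>\<^sub>0 'k::field) set \<Rightarrow> 'k"
  assumes f: "f \<in> carrier (component CS s)" and \<sigma>: "\<sigma> \<in> perms (ar s)"
  shows "act CS s \<sigma> f = hfun (pidx s) (\<lambda>D. of_int (sign (invp \<sigma> Closed) * sign (invp \<sigma> Open)) * f (ptcl (pidx s) (SC_act (invp \<sigma>) D)))"
    (is "_ = hfun _ ?\<phi>")
proof
  fix p :: "(config \<Rightarrow>\<^sub>0 'k) set"
  let ?s = "pidx s" and ?c = "of_int (sign (invp \<sigma> Closed) * sign (invp \<sigma> Open)) :: 'k"
  have \<tau>: "invp \<sigma> \<in> perms (ar ?s)" using invp_perms[OF \<sigma>] by simp
  note f' = f[unfolded component_CS]
  have inv: "connected_in ?s D E \<Longrightarrow> ?\<phi> D = ?\<phi> E" for D E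
    using dual_ptcl_eq[OF connected_act[OF \<tau>], of D E f] by simp
  have a: "act CS s \<sigma> f p = (if p \<in> carrier (H0 ?s) then f (?c \<odot>\<^bsub>H0 ?s\<^esub> act H0_SC ?s (invp \<sigma>) p) else undefined)"
    by (simp add: dual_cooperad_def suspension_def pidx_def restrict_def del: of_int_mult)
  show "act CS s \<sigma> f p = hfun ?s ?\<phi> p"
  proof (cases "p \<in> carrier (H0 ?s)")
    case True
    then obtain v where v: "p = hcl ?s v" "Poly_Mapping.keys v \<subseteq> SC_points ?s" by (auto simp: carrier_H0)
    note k = keys_SC_act[OF \<tau> v(2)]
    have "act CS s \<sigma> f p = f (hcl ?s (scal ?c (lin_ext (\<lambda>D. basis_vec (SC_act (invp \<sigma>) D)) v)))"
      unfolding a if_P[OF True] unfolding v(1) act_H0[OF \<tau>] smult_H0[OF k] by (rule refl)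
    also have "\<dots> = pair ?\<phi> v"
      unfolding dual_H0_pair[OF f' free_module_closed(2)[OF k]] by (simp add: pair_scal pair_lin_ext pair_mult_left del: of_int_mult)
    also have "\<dots> = hfun ?s ?\<phi> p" unfolding v(1) by (rule hfun_hcl[OF inv v(2), symmetric])
    finally show ?thesis .
  next
    case False
    then show ?thesis by (simp add: a hfun_def)
  qed
qed

lemma
  fixes f :: "(config \<Rightarrow>\<^sub>0 'k::field) set \<Rightarrow> 'k"
  assumes f: "f \<in> carrier (component CS s)" and \<sigma>: "\<sigma> \<in> perms (ar s)"
  shows act_CS_closed: "act CS s \<sigma> f \<in> carrier (component CS s)"
    and act_CS_ptcl: "D \<in> SC_points (pidx s) \<Longrightarrow> act CS s \<sigma> f (ptcl (pidx s) D) =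
      of_int (sign (invp \<sigma> Closed) * sign (invp \<sigma> Open)) * f (ptcl (pidx s) (SC_act (invp \<sigma>) D))"
proof -
  let ?\<phi> = "\<lambda>D. of_int (sign (invp \<sigma> Closed) * sign (invp \<sigma> Open)) * f (ptcl (pidx s) (SC_act (invp \<sigma>) D))"
  have \<tau>: "invp \<sigma> \<in> perms (ar (pidx s))" using invp_perms[OF \<sigma>] by simp
  have inv: "connected_in (pidx s) D E \<Longrightarrow> ?\<phi> D = ?\<phi> E" for D E
    using dual_ptcl_eq[OF connected_act[OF \<tau>], of D E f] by simp
  show "act CS s \<sigma> f \<in> carrier (component CS s)" 
    unfolding act_CS[OF f \<sigma>] component_CS by (rule hfun_closed) (rule inv)
  show "act CS s \<sigma> f (ptcl (pidx s) D) = ?\<phi> D" if "D \<in> SC_points (pidx s)"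
    unfolding act_CS[OF f \<sigma>] by (rule hfun_ptcl[OF inv that])
qed

text \<open>The Koszul sign of a tensor product of functionals times the sign with which suspended
  operations compose.\<close>

definition dsign :: "idx \<Rightarrow> nat \<Rightarrow> idx \<Rightarrow> 'k::field" where
  "dsign s i t = ksign (deg t * deg s) * ksign (insertion_parity (ar s) (out t) i (ar t) + deg (pidx s) * (1 - total t))"

lemma ksign_square: "ksign n * ksign n = (1 :: 'k::field)"
  by (simp add: ksign_def)

lemma finite_components: "\<exists>B. finite B \<and> (\<forall>D\<in>SC_points s. \<exists>E\<in>B. connected_in s D E)"
  using finite_path_components[of "ar s" "out s"] by (auto simp: SC_points_def)

text \<open>The sum runs over the path components of the first space, of which there are finitely many.\<close>

lemma decomposition_exists:
  fixes F :: "config \<Rightarrow> config \<Rightarrow> 'k::field"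
  assumes L: "\<And>D D' E. connected_in s D D' \<Longrightarrow> E \<in> SC_points t \<Longrightarrow> F D E = F D' E"
    and R: "\<And>D E E'. D \<in> SC_points s \<Longrightarrow> connected_in t E E' \<Longrightarrow> F D E = F D E'"
  shows "\<exists>w. Poly_Mapping.keys w \<subseteq> carrier (dual_module (H0 s)) \<times> carrier (dual_module (H0 t)) \<and>
    (\<forall>v v'. Poly_Mapping.keys v \<subseteq> SC_points s \<longrightarrow> Poly_Mapping.keys v' \<subseteq> SC_points t \<longrightarrow>
      pair (\<lambda>(g, h). g (hcl s v) * h (hcl t v')) w = pair (\<lambda>D. pair (F D) v') v)"
proof -
  obtain B where B: "finite B" "\<And>D. D \<in> SC_points s \<Longrightarrow> \<exists>E\<in>B. connected_in s D E"
    using finite_components[of s] by blast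
  define rep where "rep D = (SOME E. E \<in> B \<and> connected_in s D E)" for D
  have rep: "rep D \<in> B \<and> connected_in s D (rep D)" if "D \<in> SC_points s" for D
    unfolding rep_def using someI_ex[of "\<lambda>E. E \<in> B \<and> connected_in s D E"] B(2)[OF that] by blast
  have rep_eq: "rep D = rep D'" if "connected_in s D D'" for D D'
  proof -
    have "connected_in s D E \<longleftrightarrow> connected_in s D' E" for E using that path_component_sym path_component_trans by meson
    then show ?thesis by (simp add: rep_def)
  qed
  \<comment> \<open>Members of \<open>B\<close> outside the space are discarded, as
    \<open>F k\<close> is known to be constant on components only for \<open>k\<close> in the
    space.\<close>
  define B' where "B' = B \<inter> SC_points s"
  define g where "g k = hfun s (\<lambda>D. if rep D = k then 1 else 0 :: 'k)" for k
  define h where "h k = hfun t (F k)" for k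
  have g: "g k \<in> carrier (dual_module (H0 s))" "Poly_Mapping.keys v \<subseteq> SC_points s \<Longrightarrow> g k (hcl s v) = pair (\<lambda>D. if rep D = k then 1 else 0) v" for k v
    unfolding g_def by (rule hfun_closed hfun_hcl; simp add: rep_eq)+
  have h: "h k \<in> carrier (dual_module (H0 t))" "Poly_Mapping.keys v \<subseteq> SC_points t \<Longrightarrow> h k (hcl t v) = pair (F k) v" if "k \<in> B'" for k v
    unfolding h_def using that R[of k] by (auto simp: B'_def intro: hfun_closed hfun_hcl)
  let ?w = "\<Sum>k\<in>B'. basis_vec (g k, h k) :: _ \<Rightarrow>\<^sub>0 'k"
  have "Poly_Mapping.keys ?w \<subseteq> carrier (dual_module (H0 s)) \<times> carrier (dual_module (H0 t))"
    by (rule subset_trans[OF keys_sum]) (use g h in auto)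
  moreover have "pair (\<lambda>(g, h). g (hcl s v) * h (hcl t v')) ?w = pair (\<lambda>D. pair (F D) v') v"
    if v: "Poly_Mapping.keys v \<subseteq> SC_points s" and v': "Poly_Mapping.keys v' \<subseteq> SC_points t" for v v'
  proof -
    have "pair (\<lambda>(g, h). g (hcl s v) * h (hcl t v')) ?w = (\<Sum>k\<in>B'. pair (\<lambda>D. if rep D = k then 1 else 0) v * pair (F k) v')"
      unfolding pair_sum by (rule sum.cong) (use g h v v' in auto)
    also have "\<dots> = (\<Sum>x\<in>Poly_Mapping.keys v. \<Sum>k\<in>B'. if rep x = k then Poly_Mapping.lookup v x * pair (F k) v' else 0)"
      unfolding pair_def[of _ v] sum_distrib_right by (subst sum.swap) (auto intro!: sum.cong)
    also have "\<dots> = (\<Sum>x\<in>Poly_Mapping.keys v. Poly_Mapping.lookup v x * pair (F x) v')"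
    proof (rule sum.cong[OF refl])
      fix x assume "x \<in> Poly_Mapping.keys v"
      then have x: "x \<in> SC_points s" using v by blast
      then have "rep x \<in> B'" using rep[OF x] by (auto simp: B'_def dest: path_component_mem)
      moreover have "pair (F (rep x)) v' = pair (F x) v'" 
        by (rule pair_cong) (use L[of x "rep x"] rep[OF x] v' in auto)
      moreover have "finite B'" using B by (simp add: B'_def)
      ultimately show "(\<Sum>k\<in>B'. if rep x = k then Poly_Mapping.lookup v x * pair (F k) v' else 0) = Poly_Mapping.lookup v x * pair (F x) v'"
        by (simp add: sum.delta)
    qed
    finally show ?thesis by (simp add: pair_def[of _ v])
  qed
  ultimately show ?thesis by blast
qed

text \<open>\<open>decomp\<close> is a choice, so only its specification can be used, and that only
  after \<open>decomposition_exists\<close> has supplied a candidate. The values at pairs of points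
  are all that is needed later.\<close>

lemma decomp_CS:
  fixes f :: "(config \<Rightarrow>\<^sub>0 'k::field) set \<Rightarrow> 'k"
  assumes f: "f \<in> carrier (dual_module (H0 (comp_idx (pidx s) (pidx t))))" and i: "i < ar s (out t)"
  shows "Poly_Mapping.keys (decomp CS s i t f) \<subseteq> carrier (component CS s) \<times> carrier (component CS t)"
    and "D \<in> SC_points (pidx s) \<Longrightarrow> E \<in> SC_points (pidx t) \<Longrightarrow>
      pair (\<lambda>(g, h). g (ptcl (pidx s) D) * h (ptcl (pidx t) E)) (decomp CS s i t f) =
      dsign s i t * f (ptcl (comp_idx (pidx s) (pidx t)) (SC_glue (ar s) (out t) i (ar t) D E))"
proof -
  let ?s = "pidx s" and ?t = "pidx t" and ?g = "SC_glue (ar s) (out t) i (ar t)" and ?st = "comp_idx (pidx s) (pidx t)"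
  let ?k = "ksign (deg t * deg s) :: 'k" and ?c = "ksign (insertion_parity (ar s) (out t) i (ar t) + deg (pidx s) * (1 - total t)) :: 'k"
  let ?W = "\<lambda>w. Poly_Mapping.keys w \<subseteq> carrier (component CS s) \<times> carrier (component CS t) \<and>
    (\<forall>p\<in>carrier (H0 ?s). \<forall>q\<in>carrier (H0 ?t). pair (\<lambda>(g, h). ?k * g p * h q) w = f (?c \<odot>\<^bsub>H0 ?st\<^esub> pcomp H0_SC ?s i ?t p q))"
  have total: "total (neg_idx t) = total t" by (simp add: total_def neg_idx_def)
  have d: "decomp CS s i t f = (SOME w. ?W w)"
    by (simp add: component_CS dual_cooperad_def suspension_def pair_def case_prod_unfold pidx_def total del: of_int_mult)
      (simp add: neg_idx_def)
  have i': "i < ar ?s (out ?t)" using i by simp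
  have val: "f (?c \<odot>\<^bsub>H0 ?st\<^esub> pcomp H0_SC ?s i ?t (hcl ?s v) (hcl ?t v')) = ?c * pair (\<lambda>D. pair (\<lambda>E. f (ptcl ?st (?g D E))) v') v"
    if v: "Poly_Mapping.keys v \<subseteq> SC_points ?s" and v': "Poly_Mapping.keys v' \<subseteq> SC_points ?t" for v v'
  proof -
    have k: "Poly_Mapping.keys (bilin_ext ?g (v, v')) \<subseteq> SC_points ?st"
      using keys_bilin_ext[of ?g v v'] SC_glue_points[OF i'] v v' by fastforce
    show ?thesis
      using pcomp_H0[OF i' v v'] dual_simps(2)[OF f hcl_closed[OF k]] dual_H0_pair[OF f k] by (simp add: pair_bilin_ext)
  qed
  have "\<exists>w. ?W w"
  proof -
    obtain w where w: "Poly_Mapping.keys w \<subseteq> carrier (dual_module (H0 ?s)) \<times> carrier (dual_module (H0 ?t))"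
      "\<And>v v'. Poly_Mapping.keys v \<subseteq> SC_points ?s \<Longrightarrow> Poly_Mapping.keys v' \<subseteq> SC_points ?t \<Longrightarrow>
        pair (\<lambda>(g, h). g (hcl ?s v) * h (hcl ?t v')) w = pair (\<lambda>D. pair (\<lambda>E. ?k * ?c * f (ptcl ?st (?g D E))) v') v"
    proof -
      have "\<exists>w. Poly_Mapping.keys w \<subseteq> carrier (dual_module (H0 ?s)) \<times> carrier (dual_module (H0 ?t)) \<and>
        (\<forall>v v'. Poly_Mapping.keys v \<subseteq> SC_points ?s \<longrightarrow> Poly_Mapping.keys v' \<subseteq> SC_points ?t \<longrightarrow>
          pair (\<lambda>(g, h). g (hcl ?s v) * h (hcl ?t v')) w = pair (\<lambda>D. pair (\<lambda>E. ?k * ?c * f (ptcl ?st (?g D E))) v') v)"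
      proof (rule decomposition_exists)
        show "?k * ?c * f (ptcl ?st (?g D E)) = ?k * ?c * f (ptcl ?st (?g D' E))" if "connected_in ?s D D'" "E \<in> SC_points ?t" for D D' E
          using dual_ptcl_eq[OF connected_glue_left[OF i' that(2,1)], of f] by simp
        show "?k * ?c * f (ptcl ?st (?g D E)) = ?k * ?c * f (ptcl ?st (?g D E'))" if "D \<in> SC_points ?s" "connected_in ?t E E'" for D E E'
          using dual_ptcl_eq[OF connected_glue_right[OF i' that], of f] by simp
      qed
      then show thesis using that by blast
    qed
    have "?W w"
    proof (intro conjI ballI)
      fix p q :: "(config \<Rightarrow>\<^sub>0 'k) set" assume "p \<in> carrier (H0 ?s)" "q \<in> carrier (H0 ?t)"
      then obtain v v' where v: "p = hcl ?s v" "Poly_Mapping.keys v \<subseteq> SC_points ?s" and v': "q = hcl ?t v'" "Poly_Mapping.keys v' \<subseteq> SC_points ?t"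
        by (auto simp: carrier_H0)
      have "pair (\<lambda>(g, h). ?k * g p * h q) w = ?k * pair (\<lambda>(g, h). g p * h q) w"
        by (simp add: case_prod_unfold mult.assoc pair_mult_left)
      also have "\<dots> = ?k * (?k * ?c) * pair (\<lambda>D. pair (\<lambda>E. f (ptcl ?st (?g D E))) v') v"
        unfolding v(1) v'(1) w(2)[OF v(2) v'(2)] by (simp add: pair_mult_left mult.assoc)
      also have "?k * (?k * ?c) = ?c" by (simp add: ksign_square flip: mult.assoc)
      finally show "pair (\<lambda>(g, h). ?k * g p * h q) w = f (?c \<odot>\<^bsub>H0 ?st\<^esub> pcomp H0_SC ?s i ?t p q)"
        unfolding v(1) v'(1) val[OF v(2) v'(2)] .
    qed (use w(1) in \<open>simp add: component_CS\<close>)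
    then show ?thesis by blast
  qed
  then have W: "?W (decomp CS s i t f)" unfolding d by (rule someI_ex)
  then show "Poly_Mapping.keys (decomp CS s i t f) \<subseteq> carrier (component CS s) \<times> carrier (component CS t)" by blast
  assume D: "D \<in> SC_points ?s" and E: "E \<in> SC_points ?t"
  have "?k * pair (\<lambda>(g, h). g (ptcl ?s D) * h (ptcl ?t E)) (decomp CS s i t f) = pair (\<lambda>(g, h). ?k * g (ptcl ?s D) * h (ptcl ?t E)) (decomp CS s i t f)"
    by (simp add: case_prod_unfold mult.assoc pair_mult_left)
  also have "\<dots> = ?c * f (ptcl ?st (?g D E))"
    using trans[OF conjunct2[OF W, rule_format, OF ptcl_closed[OF D] ptcl_closed[OF E]] val] D E by simp
  finally have "?k * (?k * pair (\<lambda>(g, h). g (ptcl ?s D) * h (ptcl ?t E)) (decomp CS s i t f)) = ?k * (?c * f (ptcl ?st (?g D E)))" by simp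
  then show "pair (\<lambda>(g, h). g (ptcl ?s D) * h (ptcl ?t E)) (decomp CS s i t f) = dsign s i t * f (ptcl ?st (?g D E))"
    by (simp add: ksign_square dsign_def mult.assoc flip: mult.assoc[of ?k ?k])
qed


section \<open>The generators of low arity\<close>

abbreviation ECS :: "('k::field, (config \<Rightarrow>\<^sub>0 'k) set \<Rightarrow> 'k) collection_data" where
  "ECS \<equiv> desuspend (coaug_coideal CS)"

lemma component_ECS: "component ECS s = (if ar s = unit_ar (out s)
    then (component CS (shift 1 s))\<lparr>carrier := {\<zero>\<^bsub>component CS (shift 1 s)\<^esub>}\<rparr> else component CS (shift 1 s))"
  by (simp add: desuspend_def coaug_coideal_def)

lemma act_ECS: "act ECS s = act CS (shift 1 s)"
  by (simp add: desuspend_def coaug_coideal_def)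

lemma vs_ECS: "vs (component ECS s)"
  unfolding component_ECS component_CS by (cases "ar s = unit_ar (out s)") (auto intro: vs_dual vs_H0 vs_zero_carrier)

lemma zero_CS_closed: "\<zero>\<^bsub>component CS s\<^esub> \<in> carrier (component CS s)"
proof -
  interpret module field_ring "component CS s" unfolding component_CS by (rule vs_dual[OF vs_H0])
  show ?thesis by (rule zero_closed)
qed

lemma carrier_ECS: "c \<in> carrier (component ECS s) \<Longrightarrow> c \<in> carrier (component CS (shift 1 s))"
  by (auto simp: component_ECS zero_CS_closed split: if_splits)

lemma CS_eqI:
  fixes f g :: "(config \<Rightarrow>\<^sub>0 'k::field) set \<Rightarrow> 'k"
  assumes "f \<in> carrier (component CS s)" "g \<in> carrier (component CS s)" "\<And>D. D \<in> SC_points (pidx s) \<Longrightarrow> f (ptcl (pidx s) D) = g (ptcl (pidx s) D)"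
  shows "f = g"
  using assms unfolding component_CS by (rule dual_H0_eqI)

lemma zero_CS_ptcl: "D \<in> SC_points (pidx s) \<Longrightarrow> \<zero>\<^bsub>component CS s\<^esub> (ptcl (pidx s) D) = 0"
  unfolding component_CS by (rule dual_simps(5)[OF ptcl_closed])

lemma act_ECS_closed:
  assumes e: "e \<in> carrier (component ECS s)" and \<sigma>: "\<sigma> \<in> perms (ar s)"
  shows "act ECS s \<sigma> e \<in> carrier (component ECS s)"
proof (cases "ar s = unit_ar (out s)")
  case True
  then have e0: "e = \<zero>\<^bsub>component CS (shift 1 s)\<^esub>" using e by (simp add: component_ECS)
  have p: "\<sigma> \<in> perms (ar (shift 1 s))" using \<sigma> by simp
  have "act CS (shift 1 s) \<sigma> e = \<zero>\<^bsub>component CS (shift 1 s)\<^esub>"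
  proof (rule CS_eqI[OF act_CS_closed[OF carrier_ECS[OF e] p] zero_CS_closed])
    fix D assume D: "D \<in> SC_points (pidx (shift 1 s))"
    have "SC_act (invp \<sigma>) D \<in> SC_points (pidx (shift 1 s))" using D invp_perms[OF \<sigma>] by (intro SC_act_points) auto
    then show "act CS (shift 1 s) \<sigma> e (ptcl (pidx (shift 1 s)) D) = \<zero>\<^bsub>component CS (shift 1 s)\<^esub> (ptcl (pidx (shift 1 s)) D)"
      unfolding act_CS_ptcl[OF carrier_ECS[OF e] p D] zero_CS_ptcl[OF D] unfolding e0 by (simp add: zero_CS_ptcl)
  qed
  then show ?thesis using True by (simp add: component_ECS act_ECS)
next
  case False
  then show ?thesis using act_CS_closed[OF carrier_ECS[OF e], of \<sigma>] \<sigma> by (simp add: component_ECS act_ECS)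
qed

definition gidx :: "bas \<Rightarrow> idx" where
  "gidx b = pidx (shift 1 (bidx b))"

text \<open>The point at which the coordinate along \<open>b\<close> is read off. The points for
  \<open>Mu\<close> and \<open>Mu'\<close> represent the two orders of the open disks.\<close>

definition pt :: "bas \<Rightarrow> config" where
  "pt b = cross (ar (bidx b)) (if b = Mu' then - 1 else 1)"

lemma total_eq: "total s = int (tot s)"
  by (simp add: total_def tot_def)

lemma gen_deg: "gen b \<Longrightarrow> deg (bidx b) = int (tot (bidx b)) - 2"
  and gen_not_unit: "gen b \<Longrightarrow> ar (bidx b) \<noteq> unit_ar (out (bidx b))"
  and gen_admissible: "gen b \<Longrightarrow> admissible (ar (bidx b)) (out (bidx b))"
  by (auto simp: gen_def tot_def unit_ar_arr admissible_def)

lemma gen_points: "gen b \<Longrightarrow> SC_points (gidx b) = SC (ar (bidx b)) (out (bidx b))"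
  using gen_deg[of b] by (simp add: SC_points_def gidx_def total_eq tot_def)

lemma pt_points: "gen b \<Longrightarrow> pt b \<in> SC_points (gidx b)"
  unfolding gen_points pt_def using tot_bidx(2)[of b] by (intro cross_SC gen_admissible) (auto simp: tot_def)

lemma pt_closed: "gen b \<Longrightarrow> ptcl (gidx b) (pt b) \<in> carrier (H0 (gidx b))"
  by (rule ptcl_closed[OF pt_points])

lemma component_gen: "gen b \<Longrightarrow> component ECS (bidx b) = dual_module (H0 (gidx b))"
  by (simp add: component_ECS component_CS gen_not_unit gidx_def)

text \<open>Every configuration is connected to one of the two crossings, and with at most one open
  disk these are connected to each other.\<close>

lemma low_connected:
  assumes D: "D \<in> SC a x" and E: "E \<in> SC a x" and a: "a Closed + a Open \<le> 2" "a Open \<le> 1"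
  shows "path_component (SC a x) D E"
proof -
  have "admissible a x" using SC_confined[OF D] by (simp add: confined_def)
  then have c: "path_component (SC a x) (cross a 1) (cross a (- 1))" using a by (intro cross_connected) auto
  have "path_component (SC a x) F (cross a 1)" if F: "F \<in> SC a x" for F
  proof -
    obtain e where e: "e = 1 \<or> e = - 1" "path_component (SC a x) F (cross a e)" using path_component_cross[OF F a(1)] .
    then show ?thesis using path_component_trans[OF _ path_component_sym[OF c]] by auto
  qed
  then show ?thesis using D E path_component_sym path_component_trans by meson
qed

text \<open>The suspension twists the exchange of open inputs by the signature. The minus sign at
  \<open>Mu'\<close> compensates for this, so that the exchange permutes the coordinates without a
  sign, as in \<open>tact\<close>.\<close>

definition gval :: "bas \<Rightarrow> ((config \<Rightarrow>\<^sub>0 'k::field) set \<Rightarrow> 'k) \<Rightarrow> 'k" where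
  "gval b e = (if b = Mu' then - e (ptcl (gidx b) (pt b)) else e (ptcl (gidx b) (pt b)))"

definition gvec :: "bas \<Rightarrow> (config \<Rightarrow>\<^sub>0 'k::field) set \<Rightarrow> 'k" where
  "gvec b = hfun (gidx b) (if b = Mu then (\<lambda>D. if Re (cen D Open 0) < Re (cen D Open 1) then 1 else 0) else (\<lambda>D. 1))"

text \<open>If the order changed along a path, at some time the real parts would agree; the centres
  of open disks are real, so they would coincide.\<close>

lemma open_order_preserved:
  assumes p: "path_component (SC (arr 0 2) Open) D E" and lt: "Re (cen D Open 0) < Re (cen D Open 1)"
  shows "Re (cen E Open 0) < Re (cen E Open 1)"
proof (rule ccontr)
  assume ge: "\<not> Re (cen E Open 0) < Re (cen E Open 1)"
  obtain g where g: "path g" "path_image g \<subseteq> SC (arr 0 2) Open" "pathstart g = D" "pathfinish g = E"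
    using p by (auto simp: path_component_def)
  let ?f = "\<lambda>t. Re (cen (g t) Open 1) - Re (cen (g t) Open 0)"
  have "continuous_on {0..1} ?f"
    using g(1) unfolding path_config_iff by (intro continuous_intros) auto
  then obtain t where t: "0 \<le> t" "t \<le> 1" "?f t = 0"
    using IVT2'[of ?f 1 0 0] g(3,4) lt ge by (force simp: pathstart_def pathfinish_def)
  then have "g t \<in> path_image g" by (auto simp: path_image_def)
  then have "g t \<in> SC (arr 0 2) Open" using g(2) by blast
  then have "confined (arr 0 2) Open (g t)" "rad (g t) Open 0 + rad (g t) Open 1 \<le> dist (cen (g t) Open 0) (cen (g t) Open 1)"
    using SC_confined SC_dist[of "g t" "arr 0 2" Open 0 Open 1 Open] by auto
  moreover have "cen (g t) Open 0 = cen (g t) Open 1"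
    using \<open>confined (arr 0 2) Open (g t)\<close> t(3) by (auto simp: confined_def complex_eq_iff)
  ultimately show False
    using confinedD(1)[of "arr 0 2" Open "g t" 0 Open] confinedD(1)[of "arr 0 2" Open "g t" 1 Open] by simp
qed

lemma
  assumes "b \<in> {Eta, Lam, Mu, Ha, Na}"
  shows gvec_closed: "gvec b \<in> carrier (component ECS (bidx b))"
    and gvec_ptcl: "D \<in> SC_points (gidx b) \<Longrightarrow> gvec b (ptcl (gidx b) D) = (if b = Mu \<and> \<not> Re (cen D Open 0) < Re (cen D Open 1) then 0 else 1)"
proof -
  have g: "gen b" using assms by (auto simp: gen_def)
  let ?\<phi> = "if b = Mu then (\<lambda>D. if Re (cen D Open 0) < Re (cen D Open 1) then 1 else 0) else (\<lambda>D. 1)"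
  have inv: "?\<phi> D = ?\<phi> E" if "connected_in (gidx b) D E" for D E
    using that open_order_preserved[of D E] open_order_preserved[of E D] path_component_sym[of _ D E] gen_points[OF g] by auto
  show "gvec b \<in> carrier (component ECS (bidx b))"
    unfolding component_gen[OF g] gvec_def by (rule hfun_closed[OF inv])
  show "gvec b (ptcl (gidx b) D) = (if b = Mu \<and> \<not> Re (cen D Open 0) < Re (cen D Open 1) then 0 else 1)" if "D \<in> SC_points (gidx b)"
    unfolding gvec_def by (subst hfun_ptcl[OF inv that]) auto
qed

lemma invp_swap: "invp (\<lambda>y. id) = (\<lambda>y. id)" "invp cswap = cswap" "invp oswap = oswap"
  by (auto simp: fun_eq_iff cswap_def oswap_def)

lemma SC_act_id: "SC_act (\<lambda>y. id) D = D"
  by (simp add: SC_act_def)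

lemma SC_act_oswap: "SC_act oswap (cross (arr 0 2) e) = cross (arr 0 2) (- e)"
proof (intro ext)
  fix y j show "SC_act oswap (cross (arr 0 2) e) y j = cross (arr 0 2) (- e) y j"
    by (cases y) (auto simp: SC_act_def cross_def Transposition.transpose_def less_two_iff field_simps)
qed

lemma act_CS_low:
  fixes f :: "(config \<Rightarrow>\<^sub>0 'k::field) set \<Rightarrow> 'k"
  assumes "f \<in> carrier (component CS s)" "D \<in> SC_points (pidx s)"
  shows "act CS s (\<lambda>y. id) f (ptcl (pidx s) D) = f (ptcl (pidx s) D)"
    and "ar s = arr 2 0 \<Longrightarrow> act CS s cswap f (ptcl (pidx s) D) = - f (ptcl (pidx s) (SC_act cswap D))"
    and "ar s = arr 0 2 \<Longrightarrow> act CS s oswap f (ptcl (pidx s) D) = - f (ptcl (pidx s) (SC_act oswap D))"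
  using act_CS_ptcl[OF assms(1) _ assms(2), of "\<lambda>y. id"] act_CS_ptcl[OF assms(1) _ assms(2), of cswap]
    act_CS_ptcl[OF assms(1) _ assms(2), of oswap]
  by (simp_all add: invp_swap SC_act_id sign_swap_id)

text \<open>Two closed disks can be moved into each other's place, so their exchange acts by the
  signature alone. The exchange of open disks interchanges the points for \<open>Mu\<close> and
  \<open>Mu'\<close>.\<close>

lemma gval_act:
  fixes e :: "(config \<Rightarrow>\<^sub>0 'k::field) set \<Rightarrow> 'k"
  assumes b: "gen b" and e: "e \<in> carrier (component ECS (bidx b))" and \<sigma>: "\<sigma> \<in> perms (ar (bidx b))"
  shows "gval b (act ECS (bidx b) \<sigma> e) = tact \<sigma> (\<lambda>c. gval c e) b"
proof -
  note e' = carrier_ECS[OF e]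
  note low = act_CS_low[OF e', of "pt b", folded gidx_def, OF pt_points[OF b]]
  consider "\<sigma> = (\<lambda>y. id)" | "b = Lam \<or> b = Na" "\<sigma> = cswap" | "b = Mu \<or> b = Mu'" "\<sigma> = oswap"
    using b perms_small[OF \<sigma>] perms_20[of \<sigma>] perms_02[of \<sigma>] \<sigma> unfolding gen_def by auto
  then show ?thesis
  proof cases
    case 1
    then show ?thesis using low(1) by (cases "b = Mu'") (simp_all add: tact_id gval_def act_ECS)
  next
    case 2
    then have a: "ar (bidx b) = arr 2 0" by auto
    have "SC_act cswap (pt b) \<in> SC_points (gidx b)" using \<sigma> pt_points[OF b] 2 by (intro SC_act_points) (auto simp: gidx_def)
    then have "connected_in (gidx b) (SC_act cswap (pt b)) (pt b)"
      using pt_points[OF b] a unfolding gen_points[OF b] by (intro low_connected) auto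
    then have "e (ptcl (gidx b) (SC_act cswap (pt b))) = e (ptcl (gidx b) (pt b))" by (rule dual_ptcl_eq)
    then show ?thesis using low(2) a 2 by (auto simp: gval_def act_ECS)
  next
    case 3
    then have a: "ar (bidx b) = arr 0 2" "gidx Mu = gidx Mu'" by (auto simp: gidx_def)
    have "SC_act oswap (pt Mu) = pt Mu'" "SC_act oswap (pt Mu') = pt Mu" by (simp_all add: pt_def SC_act_oswap)
    then show ?thesis using low(3) a 3 by (auto simp: gval_def act_ECS)
  qed
qed

lemma low_index:
  assumes "admissible (ar s) (out s)" "tot s \<le> 2" "ar s \<noteq> unit_ar (out s)" "deg s = int (tot s) - 2"
  obtains "s = bidx Eta" | "s = bidx Lam" | "s = bidx Mu" | "s = bidx Ha" | "s = bidx Na"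
proof -
  have "1 \<le> ar s Closed + ar s Open" "ar s Closed + ar s Open \<le> 2" using assms by (auto simp: admissible_def tot_def)
  then show thesis
    by (cases rule: cross_cases; cases "out s") (use assms that in \<open>auto simp: idx_eq_iff admissible_def unit_ar_arr tot_def\<close>)
qed

text \<open>A functional is determined by its values at points. Points exist only at the indices of
  generators, and each is connected to a point where a coordinate is taken.\<close>

lemma gval_separates:
  fixes e e' :: "(config \<Rightarrow>\<^sub>0 'k::field) set \<Rightarrow> 'k"
  assumes t: "tot s \<le> 2" and e: "e \<in> carrier (component ECS s)" "e' \<in> carrier (component ECS s)"
    and eq: "\<And>b. gen b \<Longrightarrow> bidx b = s \<Longrightarrow> gval b e = gval b e'"
  shows "e = e'"
proof (cases "ar s = unit_ar (out s)")
  case True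
  then show ?thesis using e by (simp add: component_ECS)
next
  case False
  let ?s = "pidx (shift 1 s)"
  show ?thesis
  proof (rule CS_eqI[OF carrier_ECS[OF e(1)] carrier_ECS[OF e(2)]])
    fix D assume D: "D \<in> SC_points ?s"
    then have "deg ?s = 0" and DS: "D \<in> SC (ar s) (out s)" by (auto simp: SC_points_def split: if_splits)
    then have "deg s = int (tot s) - 2" by (simp add: total_def tot_def)
    moreover have "admissible (ar s) (out s)" using SC_confined[OF DS] by (simp add: confined_def)
    ultimately obtain b where b: "b \<in> {Eta, Lam, Mu, Ha, Na}" "s = bidx b" using low_index[OF _ t False] by (metis insertCI)
    have g: "gen b" using b by (auto simp: gen_def)
    have s: "?s = gidx b" using b by (simp add: gidx_def)
    obtain k where k: "k = 1 \<or> k = - 1" "path_component (SC (ar s) (out s)) D (cross (ar s) k)"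
      using path_component_cross[OF DS] t by (auto simp: tot_def)
    have "\<exists>c. gen c \<and> bidx c = s \<and> connected_in ?s D (pt c)"
    proof (cases "b = Mu")
      case True
      then have "connected_in ?s D (pt (if k = 1 then Mu else Mu'))"
        using k unfolding s gen_points[OF g] pt_def by (auto simp: b(2))
      then show ?thesis using True b by (intro exI[of _ "if k = 1 then Mu else Mu'"]) (auto simp: gen_def)
    next
      case False
      then have "connected_in ?s D (pt b)"
        using DS pt_points[OF g] b t unfolding s gen_points[OF g] by (intro low_connected) (auto simp: tot_def)
      then show ?thesis using g b by blast
    qed
    then obtain c where c: "gen c" "bidx c = s" "connected_in ?s D (pt c)" by blast
    have "e (ptcl ?s (pt c)) = e' (ptcl ?s (pt c))"
      using eq[OF c(1,2)] c(2) by (simp add: gval_def gidx_def split: if_splits)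
    then show "e (ptcl ?s D) = e' (ptcl ?s D)" using dual_ptcl_eq[OF c(3), of e] dual_ptcl_eq[OF c(3), of e'] by simp
  qed
qed

lemma low_generators_ECS: "low_generators (ECS :: ('k::field, (config \<Rightarrow>\<^sub>0 'k) set \<Rightarrow> 'k) collection_data) gval gvec"
proof (rule low_generators.intro, goal_cases)
  case (1 s)
  then show ?case by (rule vs_ECS)
next
  case (2 e s \<sigma>)
  then show ?case by (rule act_ECS_closed)
next
  case (3 b e e')
  then show ?case using 3(1) unfolding component_gen[OF 3(1)] by (cases "b = Mu'") (simp_all add: gval_def dual_simps(3) pt_closed)
next
  case (4 b e c)
  then show ?case using 4(1) unfolding component_gen[OF 4(1)] by (cases "b = Mu'") (simp_all add: gval_def dual_simps(4) pt_closed)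
next
  case (5 b e \<sigma>)
  then show ?case by (rule gval_act)
next
  case (6 b)
  then show ?case by (rule gvec_closed)
next
  case (7 b)
  then have "gen b" "b \<noteq> Mu'" by (auto simp: gen_def)
  moreover have "Re (cen (pt Mu) Open 0) < Re (cen (pt Mu) Open 1)" by (simp add: pt_def cross_def)
  ultimately show ?case by (auto simp: gval_def gvec_ptcl[OF 7] pt_points)
next
  case 8
  have "pt Mu' \<in> SC_points (gidx Mu)" using pt_points[of Mu'] by (simp add: gen_def gidx_def)
  moreover have "gidx Mu' = gidx Mu" by (simp add: gidx_def)
  moreover have "\<not> Re (cen (pt Mu') Open 0) < Re (cen (pt Mu') Open 1)" by (simp add: pt_def cross_def)
  ultimately show ?case by (simp add: gval_def gvec_ptcl)
next
  case (9 s e e')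
  then show ?case by (rule gval_separates)
qed


section \<open>The cobar differential in low arity\<close>

lemma unshuffle_perms:
  assumes "\<And>y. S y \<subseteq> {..<a y}"
  shows "unshuffle a S \<in> perms a"
proof -
  have "unshuffle a S y permutes {..<a y}" for y
  proof (rule bij_imp_permutes)
    let ?L = "sorted_list_of_set ({..<a y} - S y) @ sorted_list_of_set (S y)"
    have fin: "finite (S y)" using assms[of y] finite_subset by auto
    have L: "distinct ?L" "set ?L = {..<a y}" using fin assms[of y] by auto
    then have "length ?L = a y" using distinct_card[of ?L] by simp
    then have "bij_betw ((!) ?L) {..<a y} {..<a y}" using bij_betw_nth[OF L(1)] L(2) by simp
    then show "bij_betw (unshuffle a S y) {..<a y} {..<a y}"
      by (rule bij_betw_cong[THEN iffD1, rotated]) (simp add: unshuffle_def)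
  qed (simp add: unshuffle_def)
  then show ?thesis by (simp add: perms_def)
qed

text \<open>Apart from the identity arities, where the coideal is zero by construction, the
  underlying configuration space is empty.\<close>

lemma coideal_trivial:
  assumes "\<not> (admissible (ar s) (out s) \<and> ar s \<noteq> unit_ar (out s) \<and> deg s = total s - 1)"
  shows "carrier (component (coaug_coideal (CS :: ('k::field, _) cooperad_data)) s) = {\<zero>\<^bsub>component (coaug_coideal CS) s\<^esub>}"
proof (cases "ar s = unit_ar (out s)")
  case True
  then show ?thesis by (simp add: coaug_coideal_def)
next
  case False
  have "D \<notin> SC_points (pidx s)" for D
    using assms False SC_confined[of D "ar s" "out s"] by (auto simp: SC_points_def confined_def simp del: SC.simps)
  then have z: "f = \<zero>\<^bsub>component CS s\<^esub>" if "f \<in> carrier (component CS s)" for f :: "_ \<Rightarrow> 'k"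
    using CS_eqI[OF that zero_CS_closed] by blast
  have eq: "component (coaug_coideal CS) s = component (CS :: ('k, _) cooperad_data) s" using False by (simp add: coaug_coideal_def)
  show ?thesis
    unfolding eq
  proof (intro equalityI subsetI)
    fix f :: "_ \<Rightarrow> 'k" assume "f \<in> carrier (component CS s)"
    then show "f \<in> {\<zero>\<^bsub>component CS s\<^esub>}" using z by simp
  qed (use zero_CS_closed in simp)
qed

text \<open>The constant function 1 is a nonzero functional once there is a configuration.\<close>

lemma coideal_nontrivial:
  assumes "admissible (ar s) (out s)" "ar s \<noteq> unit_ar (out s)" "deg s = total s - 1" "tot s \<le> 2"
  shows "carrier (component (coaug_coideal (CS :: ('k::field, _) cooperad_data)) s) \<noteq> {\<zero>\<^bsub>component (coaug_coideal CS) s\<^esub>}"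
proof -
  have D: "cross (ar s) 1 \<in> SC_points (pidx s)" using assms by (auto simp: SC_points_def tot_def intro!: cross_SC)
  have "hfun (pidx s) (\<lambda>D. 1 :: 'k) \<in> carrier (component CS s)" unfolding component_CS by (rule hfun_closed) simp
  moreover have "hfun (pidx s) (\<lambda>D. 1 :: 'k) \<noteq> \<zero>\<^bsub>component CS s\<^esub>"
  proof
    assume "hfun (pidx s) (\<lambda>D. 1 :: 'k) = \<zero>\<^bsub>component CS s\<^esub>"
    then have "hfun (pidx s) (\<lambda>D. 1 :: 'k) (ptcl (pidx s) (cross (ar s) 1)) = 0" using zero_CS_ptcl[OF D] by simp
    moreover have "hfun (pidx s) (\<lambda>D. 1 :: 'k) (ptcl (pidx s) (cross (ar s) 1)) = 1" by (rule hfun_ptcl[OF _ D]) simp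
    ultimately show False by simp
  qed
  moreover have eq: "component (coaug_coideal CS) s = component (CS :: ('k, _) cooperad_data) s" using assms(2) by (simp add: coaug_coideal_def)
  ultimately show ?thesis unfolding eq by (metis singletonD)
qed

abbreviation trees :: "'k::field itself \<Rightarrow> idx \<Rightarrow> ((colour \<Rightarrow> nat set) \<times> idx \<times> idx) set" where
  "trees K u \<equiv> two_vertex_trees (CS :: ('k, (config \<Rightarrow>\<^sub>0 'k) set \<Rightarrow> 'k) cooperad_data) u"

lemma treeD:
  assumes "(S, s, t) \<in> trees TYPE('k::field) u"
  shows "S y \<subseteq> {..<ar u y}" "ar t = (\<lambda>y. card (S y))" "ar s = (\<lambda>y. ar u y - card (S y) + (if y = out t then 1 else 0))"
    "out s = out u" "admissible (ar s) (out s)" "admissible (ar t) (out t)" "ar s \<noteq> unit_ar (out s)" "ar t \<noteq> unit_ar (out t)"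
    "deg s = total s - 1" "deg t = total t - 1" "deg s + deg t = deg u"
  using assms coideal_trivial[of s, where ?'k = 'k] coideal_trivial[of t, where ?'k = 'k] unfolding two_vertex_trees_def by auto

text \<open>Nonzero decorations have degree one less than their number of inputs, and this quantity
  is additive under grafting.\<close>

lemma tree_shape:
  assumes T: "(S, s, t) \<in> trees TYPE('k::field) u"
  shows "comp_ar (ar s) (out t) (ar t) = ar u" "comp_idx (pidx s) (pidx t) = pidx u" "deg u = total u - 1" "ar s (out t) - 1 < ar s (out t)"
proof -
  have le: "card (S y) \<le> ar u y" for y using card_mono[OF _ treeD(1)[OF T, of y]] by simp
  show a: "comp_ar (ar s) (out t) (ar t) = ar u"
  proof
    fix y show "comp_ar (ar s) (out t) (ar t) y = ar u y"
      using le[of y] by (simp add: comp_ar_def treeD(2,3)[OF T])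
  qed
  show "ar s (out t) - 1 < ar s (out t)" by (simp add: treeD(3)[OF T])
  have "total u = total s + total t - 1"
    unfolding total_def a[symmetric] using \<open>ar s (out t) - 1 < ar s (out t)\<close> by (cases "out t") (auto simp: comp_ar_def)
  then show "deg u = total u - 1" using treeD(9-11)[OF T] by simp
  then show "comp_idx (pidx s) (pidx t) = pidx u"
    using a treeD(4,9,10)[OF T] by (auto simp: idx_eq_iff)
qed

lemma tree_carrier:
  assumes "(S, s, t) \<in> trees TYPE('k::field) u"
  shows "component ECS (shift (- 1) s) = component (CS :: ('k, (config \<Rightarrow>\<^sub>0 'k) set \<Rightarrow> 'k) cooperad_data) s"
    "component ECS (shift (- 1) t) = component (CS :: ('k, (config \<Rightarrow>\<^sub>0 'k) set \<Rightarrow> 'k) cooperad_data) t"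
  using treeD(7,8)[OF assms] by (simp_all add: component_ECS)

abbreviation tree_dual :: "idx \<Rightarrow> (colour \<Rightarrow> nat set) \<Rightarrow> ((config \<Rightarrow>\<^sub>0 'k::field) set \<Rightarrow> 'k) \<Rightarrow> (config \<Rightarrow>\<^sub>0 'k) set \<Rightarrow> 'k" where
  "tree_dual u S c \<equiv> act CS u (invp (unshuffle (ar u) S)) c"

lemma tree_dual_closed:
  assumes "(S, s, t) \<in> trees TYPE('k::field) u" "c \<in> carrier (component (CS :: ('k, (config \<Rightarrow>\<^sub>0 'k) set \<Rightarrow> 'k) cooperad_data) u)"
  shows "tree_dual u S c \<in> carrier (component CS u)"
  using assms treeD(1)[OF assms(1)] by (intro act_CS_closed invp_perms unshuffle_perms) auto

lemma decomp_tree: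
  fixes c :: "(config \<Rightarrow>\<^sub>0 'k::field) set \<Rightarrow> 'k"
  assumes T: "(S, s, t) \<in> trees TYPE('k) u" and c: "c \<in> carrier (component CS u)"
  defines "i \<equiv> ar s (out t) - 1"
  shows "Poly_Mapping.keys (decomp CS s i t (tree_dual u S c)) \<subseteq> carrier (component CS s) \<times> carrier (component CS t)"
    and "D \<in> SC_points (pidx s) \<Longrightarrow> E \<in> SC_points (pidx t) \<Longrightarrow>
      pair (\<lambda>(g, h). g (ptcl (pidx s) D) * h (ptcl (pidx t) E)) (decomp CS s i t (tree_dual u S c)) =
      dsign s i t * tree_dual u S c (ptcl (pidx u) (SC_glue (ar s) (out t) i (ar t) D E))"
  using decomp_CS[of "tree_dual u S c" s t i] tree_dual_closed[OF T c] tree_shape(2,4)[OF T] unfolding component_CS i_def by simp_all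

definition tree_term :: "idx \<Rightarrow> ((config \<Rightarrow>\<^sub>0 'k::field) set \<Rightarrow> 'k) \<Rightarrow> (colour \<Rightarrow> nat set) \<Rightarrow> idx \<Rightarrow> idx \<Rightarrow> (((config \<Rightarrow>\<^sub>0 'k) set \<Rightarrow> 'k) expr \<Rightarrow>\<^sub>0 'k)" where
  "tree_term u c S s t = lin_ext (\<lambda>(c', c''). scal (ksign (deg s))
      (basis_vec (Act (unshuffle (ar u) S) (Comp (Gen (shift (- 1) s) c') (ar s (out t) - 1) (Gen (shift (- 1) t) c'')))))
    (decomp CS s (ar s (out t) - 1) t (tree_dual u S c))"

lemma cobar_gen_CS:
  fixes c :: "(config \<Rightarrow>\<^sub>0 'k::field) set \<Rightarrow> 'k"
  shows "cobar_gen CS u c = (\<Sum>(S, s, t)\<in>trees TYPE('k) u. tree_term u c S s t)"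
  by (simp add: cobar_gen_def tree_term_def Let_def)

lemma keys_tree_term:
  fixes c :: "(config \<Rightarrow>\<^sub>0 'k::field) set \<Rightarrow> 'k"
  assumes T: "(S, s, t) \<in> trees TYPE('k) u" and c: "c \<in> carrier (component CS u)"
  shows "Poly_Mapping.keys (tree_term u c S s t) \<subseteq> exprs ECS (shift (- 2) u)"
  unfolding tree_term_def
proof (rule keys_lin_ext_le[OF decomp_tree(1)[OF T c]], clarsimp simp only: prod.case split: prod.splits, rule free_module_closed(2)[THEN subsetD, rotated], assumption)
  fix c' c'' :: "(config \<Rightarrow>\<^sub>0 'k) set \<Rightarrow> 'k" assume "c' \<in> carrier (component CS s)" "c'' \<in> carrier (component CS t)"
  then have "Gen (shift (- 1) s) c' \<in> exprs ECS (shift (- 1) s)" "Gen (shift (- 1) t) c'' \<in> exprs ECS (shift (- 1) t)"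
    by (simp_all only: exprs_simps tree_carrier[OF T] simp_thms)
  then have "Comp (Gen (shift (- 1) s) c') (ar s (out t) - 1) (Gen (shift (- 1) t) c'') \<in> exprs ECS (comp_idx (shift (- 1) s) (shift (- 1) t))"
    using tree_shape(4)[OF T] by (intro Comp_exprs) auto
  moreover have "comp_idx (shift (- 1) s) (shift (- 1) t) = shift (- 2) u"
    using tree_shape(1)[OF T] treeD(4,11)[OF T] by (auto simp: idx_eq_iff)
  moreover have "unshuffle (ar u) S \<in> perms (ar u)" using treeD(1)[OF T] by (rule unshuffle_perms)
  ultimately show "Poly_Mapping.keys (basis_vec (Act (unshuffle (ar u) S) (Comp (Gen (shift (- 1) s) c') (ar s (out t) - 1) (Gen (shift (- 1) t) c'')))) \<subseteq> exprs ECS (shift (- 2) u)"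
    by (intro keys_basis) simp
qed

text \<open>This is the place where all arities occur: support in well-formed expressions depends on
  the specification of \<open>decomp\<close>, hence on the finiteness of the number of
  components.\<close>

lemma keys_cobar_gen:
  fixes c :: "(config \<Rightarrow>\<^sub>0 'k::field) set \<Rightarrow> 'k"
  assumes c: "c \<in> carrier (component ECS s)"
  shows "Poly_Mapping.keys (cobar_gen CS (shift 1 s) c) \<subseteq> exprs ECS (shift (- 1) s)"
proof -
  have "Poly_Mapping.keys (tree_term (shift 1 s) c S s' t) \<subseteq> exprs ECS (shift (- 1) s)" if "(S, s', t) \<in> trees TYPE('k) (shift 1 s)" for S s' t
    using keys_tree_term[OF that carrier_ECS[OF c]] by simp
  then show ?thesis unfolding cobar_gen_CS by (intro subset_trans[OF keys_sum]) auto
qed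

lemma lev_tree_term:
  "lev \<omega> (tree_term u c S s t) b = ksign (deg s) * pair (\<lambda>(c', c''). tact (unshuffle (ar u) S)
      (tcomp (ar s (out t) - 1) (evgen \<omega> (shift (- 1) s) c') (evgen \<omega> (shift (- 1) t) c'')) b)
    (decomp CS s (ar s (out t) - 1) t (tree_dual u S c))"
  unfolding lev_def tree_term_def pair_lin_ext by (simp add: case_prod_unfold pair_scal pair_mult_left)

section \<open>The trees in the differentials of \<open>Ha\<close> and \<open>Na\<close>\<close>

definition on_closed :: "nat set \<Rightarrow> colour \<Rightarrow> nat set" where
  "on_closed A = (\<lambda>y. if y = Closed then A else {})"

lemma on_closed_simps [simp]: "on_closed A Closed = A" "on_closed A Open = {}"
  by (simp_all add: on_closed_def)

lemma on_closed_eq_iff [simp]: "on_closed A = on_closed B \<longleftrightarrow> A = B"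
  by (metis on_closed_simps(1))

lemma eq_on_closed: "S Open = {} \<Longrightarrow> S = on_closed (S Closed)"
  by (auto simp: fun_eq_iff on_closed_def) (metis colour.exhaust empty_iff)+

lemma tree_I:
  assumes "\<And>y. S y \<subseteq> {..<ar u y}" "ar t = (\<lambda>y. card (S y))" "ar s = (\<lambda>y. ar u y - card (S y) + (if y = out t then 1 else 0))"
    "out s = out u" "admissible (ar s) (out s)" "admissible (ar t) (out t)" "ar s \<noteq> unit_ar (out s)" "ar t \<noteq> unit_ar (out t)"
    "deg s = total s - 1" "deg t = total t - 1" "deg s + deg t = deg u" "tot s \<le> 2" "tot t \<le> 2"
  shows "(S, s, t) \<in> trees TYPE('k::field) u"
  using assms coideal_nontrivial[of s, where ?'k = 'k] coideal_nontrivial[of t, where ?'k = 'k] unfolding two_vertex_trees_def by auto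

lemma tree_cards:
  assumes "(S, s, t) \<in> trees TYPE('k::field) u"
  shows "ar t Closed = card (S Closed)" "ar t Open = card (S Open)"
    "ar s Closed = ar u Closed - card (S Closed) + (if out t = Closed then 1 else 0)"
    "ar s Open = ar u Open - card (S Open) + (if out t = Open then 1 else 0)"
  using treeD(2,3)[OF assms] by auto

lemma unit_ar_iff: "a = unit_ar x \<longleftrightarrow> (if x = Closed then a Closed = 1 \<and> a Open = 0 else a Closed = 0 \<and> a Open = 1)"
  by (cases x) (auto simp: arity_eq_iff unit_ar_def)

text \<open>The upper vertex must carry the closed input alone and have open output. Every other
  distribution makes a vertex an identity, leaves it without inputs, or gives it an open input and
  closed output.\<close>

lemma trees_Ha: "trees TYPE('k::field) (ix 1 1 1) = {(on_closed {0}, ix 0 2 1, ix 1 0 0)}"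
proof (intro equalityI subsetI)
  fix T assume "T \<in> trees TYPE('k) (ix 1 1 1)"
  moreover obtain S s t where T: "T = (S, s, t)" by (cases T)
  ultimately have d: "(S, s, t) \<in> trees TYPE('k) (ix 1 1 1)" by simp
  have "S Closed = {} \<or> S Closed = {0}" "S Open = {} \<or> S Open = {0}"
    using treeD(1)[OF d, of Closed] treeD(1)[OF d, of Open] by auto
  then have S: "S Closed = {0} \<and> S Open = {} \<and> out t = Open"
    using treeD(4-8)[OF d] tree_cards[OF d] unfolding admissible_def unit_ar_iff
    by (elim disjE; cases "out t"; simp)
  then have "s = ix 0 2 1" "t = ix 1 0 0"
    using treeD(4)[OF d] tree_cards[OF d] treeD(9,10)[OF d] by (simp_all add: idx_eq_iff arity_eq_iff total_def)
  then show "T \<in> {(on_closed {0}, ix 0 2 1, ix 1 0 0)}" using S eq_on_closed[of S] by (simp add: T)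
next
  fix T assume "T \<in> {(on_closed {0}, ix 0 2 1, ix 1 0 0)}"
  moreover have "(on_closed {0}, ix 0 2 1, ix 1 0 0) \<in> trees TYPE('k) (ix 1 1 1)"
  proof (rule tree_I)
    fix y show "on_closed {0} y \<subseteq> {..<ar (ix 1 1 1) y}" by (cases y) auto
  qed (auto simp: arity_eq_iff admissible_def unit_ar_arr total_def tot_def)
  ultimately show "T \<in> trees TYPE('k) (ix 1 1 1)" by simp
qed

text \<open>Either one of the closed inputs passes through an upper vertex of the arity of
  \<open>Eta\<close>, or both pass through one of the arity of \<open>Lam\<close>; other
  distributions are excluded as for \<open>Ha\<close>.\<close>

lemma trees_Na: "trees TYPE('k::field) (ix 2 0 1) =
    {(on_closed {0}, ix 1 1 1, ix 1 0 0), (on_closed {1}, ix 1 1 1, ix 1 0 0), (on_closed {0, 1}, ix 1 0 0, Idx (arr 2 0) Closed 1)}"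
  (is "_ = ?R")
proof (intro equalityI subsetI)
  fix T assume "T \<in> trees TYPE('k) (ix 2 0 1)"
  moreover obtain S s t where T: "T = (S, s, t)" by (cases T)
  ultimately have d: "(S, s, t) \<in> trees TYPE('k) (ix 2 0 1)" by simp
  have o: "S Open = {}" and "S Closed \<subseteq> {0, 1}"
    using treeD(1)[OF d, of Closed] treeD(1)[OF d, of Open] by (auto simp: less_two_iff)
  then have "S Closed = {} \<or> S Closed = {0} \<or> S Closed = {1} \<or> S Closed = {0, 1}" by blast
  then have "S Closed = {0} \<and> out t = Open \<or> S Closed = {1} \<and> out t = Open \<or> S Closed = {0, 1} \<and> out t = Closed"
    using treeD(4-8)[OF d] tree_cards[OF d] o unfolding admissible_def unit_ar_iff
    by (elim disjE; cases "out t"; simp)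
  then have "S Closed = {0} \<and> s = ix 1 1 1 \<and> t = ix 1 0 0 \<or> S Closed = {1} \<and> s = ix 1 1 1 \<and> t = ix 1 0 0 \<or>
      S Closed = {0, 1} \<and> s = ix 1 0 0 \<and> t = Idx (arr 2 0) Closed 1"
    using treeD(4)[OF d] tree_cards[OF d] treeD(9,10)[OF d] o
    by (elim disjE conjE) (simp_all add: idx_eq_iff arity_eq_iff total_def)
  then show "T \<in> ?R" using eq_on_closed[of S, OF o] by (elim disjE conjE) (simp_all add: T)
next
  fix T assume "T \<in> ?R"
  moreover have "(on_closed {k}, ix 1 1 1, ix 1 0 0) \<in> trees TYPE('k) (ix 2 0 1)" if "k < 2" for k
  proof (rule tree_I)
    fix y show "on_closed {k} y \<subseteq> {..<ar (ix 2 0 1) y}" using that by (cases y) auto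
  qed (auto simp: arity_eq_iff admissible_def unit_ar_arr total_def tot_def)
  moreover have "(on_closed {0, 1}, ix 1 0 0, Idx (arr 2 0) Closed 1) \<in> trees TYPE('k) (ix 2 0 1)"
  proof (rule tree_I)
    fix y show "on_closed {0, 1} y \<subseteq> {..<ar (ix 2 0 1) y}" by (cases y) auto
  qed (auto simp: arity_eq_iff admissible_def unit_ar_arr total_def tot_def)
  ultimately show "T \<in> trees TYPE('k) (ix 2 0 1)" by auto
qed

lemma less_small: "{..<1::nat} = {0}" "{..<2::nat} = {0, 1}" "{..<Suc 0} = {0}"
  by auto

lemma unshuffle_low:
  "unshuffle (arr 1 1) (on_closed {0}) = (\<lambda>y. id)" "unshuffle (arr 2 0) (on_closed {1}) = (\<lambda>y. id)"
  "unshuffle (arr 2 0) (on_closed {0, 1}) = (\<lambda>y. id)" "unshuffle (arr 2 0) (on_closed {0}) = cswap"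
proof -
  have s: "sorted_list_of_set {0, 1::nat} = [0, 1]" 
  proof -
    have "{0, 1::nat} = {0..<2}" by auto
    then show ?thesis by (simp add: upt_rec)
  qed
  have d: "{0, 1} - {0} = {1::nat}" "{0, 1} - {1} = {0::nat}" by auto
  show "unshuffle (arr 1 1) (on_closed {0}) = (\<lambda>y. id)"
  proof (intro ext)
    fix y j show "unshuffle (arr 1 1) (on_closed {0}) y j = id j" by (cases y) (auto simp: unshuffle_def less_small)
  qed
  show "unshuffle (arr 2 0) (on_closed {1}) = (\<lambda>y. id)"
  proof (intro ext)
    fix y j show "unshuffle (arr 2 0) (on_closed {1}) y j = id j" by (cases y) (auto simp: unshuffle_def less_small d less_two_iff)
  qed
  show "unshuffle (arr 2 0) (on_closed {0, 1}) = (\<lambda>y. id)"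
  proof (intro ext)
    fix y j show "unshuffle (arr 2 0) (on_closed {0, 1}) y j = id j" by (cases y) (auto simp: unshuffle_def less_small s less_two_iff simp del: insert_iff)
  qed
  show "unshuffle (arr 2 0) (on_closed {0}) = cswap"
  proof (intro ext)
    fix y j show "unshuffle (arr 2 0) (on_closed {0}) y j = cswap y j"
      by (cases y) (auto simp: unshuffle_def less_small d less_two_iff cswap_def Transposition.transpose_def)
  qed
qed


lemma ptcl_low:
  assumes d: "gen d" "ar (bidx d) Open \<le> 1" and D: "D \<in> SC_points (gidx d)"
  shows "f (ptcl (gidx d) D) = f (ptcl (gidx d) (pt d))"
proof (rule dual_ptcl_eq)
  show "connected_in (gidx d) D (pt d)"
    using D pt_points[OF d(1)] d(2) tot_bidx(2)[of d] unfolding gen_points[OF d(1)] by (intro low_connected) (auto simp: tot_def)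
qed

text \<open>Coordinates of a decomposition are its values at chosen points, so they are the value of
  the dual element at the glued configuration. That configuration lies in a connected space and can
  be replaced by \<open>pt d\<close>.\<close>

lemma tree_gval:
  fixes c :: "(config \<Rightarrow>\<^sub>0 'k::field) set \<Rightarrow> 'k"
  assumes g: "gen b" "gen b'" "gen d" "b' \<noteq> Mu'" "ar (bidx d) Open \<le> 1"
    and T: "(S, shift 1 (bidx b), shift 1 (bidx b')) \<in> trees TYPE('k) (shift 1 (bidx d))"
    and c: "c \<in> carrier (component CS (shift 1 (bidx d)))"
  defines "i \<equiv> ar (bidx b) (out (bidx b')) - 1"
  shows "pair (\<lambda>(g, h). gval b g * gval b' h) (decomp CS (shift 1 (bidx b)) i (shift 1 (bidx b')) (tree_dual (shift 1 (bidx d)) S c)) =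
    (if b = Mu' then - 1 else 1) * dsign (shift 1 (bidx b)) i (shift 1 (bidx b')) * tree_dual (shift 1 (bidx d)) S c (ptcl (gidx d) (pt d))"
proof -
  note p = pt_points[OF g(1)] pt_points[OF g(2)]
  let ?w = "decomp CS (shift 1 (bidx b)) i (shift 1 (bidx b')) (tree_dual (shift 1 (bidx d)) S c)"
  let ?G = "SC_glue (ar (bidx b)) (out (bidx b')) i (ar (bidx b')) (pt b) (pt b')"
  have i: "i < ar (gidx b) (out (gidx b'))" using tree_shape(4)[OF T] by (simp add: i_def gidx_def)
  have "?G \<in> SC_points (gidx d)"
    using SC_glue_points[OF i p] tree_shape(2)[OF T] by (simp add: gidx_def)
  then have G: "tree_dual (shift 1 (bidx d)) S c (ptcl (gidx d) ?G) = tree_dual (shift 1 (bidx d)) S c (ptcl (gidx d) (pt d))"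
    by (rule ptcl_low[OF g(3,5)])
  have "pair (\<lambda>(g, h). gval b g * gval b' h) ?w =
      (if b = Mu' then - 1 else 1) * pair (\<lambda>(g, h). g (ptcl (gidx b) (pt b)) * h (ptcl (gidx b') (pt b'))) ?w"
    using g(4) by (cases "b = Mu'") (simp_all add: gval_def case_prod_unfold pair_fun_uminus)
  also have "pair (\<lambda>(g, h). g (ptcl (gidx b) (pt b)) * h (ptcl (gidx b') (pt b'))) ?w =
      dsign (shift 1 (bidx b)) i (shift 1 (bidx b')) * tree_dual (shift 1 (bidx d)) S c (ptcl (gidx d) ?G)"
    using decomp_tree(2)[OF T c, of "pt b" "pt b'"] p by (simp add: gidx_def i_def)
  finally show ?thesis unfolding G by (simp add: mult.assoc)
qed

lemma shift_Idx: "shift n (Idx a x d) = Idx a x (d + n)"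
  by (simp add: shift_def)

lemma ix_eq_Idx: "ix n m d = Idx a x e \<longleftrightarrow> arr n m = a \<and> Open = x \<and> d = e" "Idx a x e = ix n m d \<longleftrightarrow> a = arr n m \<and> x = Open \<and> e = d"
  by (auto simp: ix_def)

lemma dsign_low: "dsign (ix 0 2 1) (Suc 0) (ix 1 0 0) = (- 1 :: 'k::field)" "dsign (ix 1 1 1) 0 (ix 1 0 0) = (1 :: 'k)"
  "dsign (ix 1 0 0) 0 (Idx (arr 2 0) Closed 1) = (1 :: 'k)"
  by (simp_all add: dsign_def ksign_def total_def)

text \<open>The single tree yields both terms: its lower vertex has the coordinates
  \<open>Mu\<close> and \<open>Mu'\<close>, and inserting \<open>Eta\<close> at the second input
  gives \<open>Ba\<close> and \<open>Aa\<close>. Their opposite signs come from the sign of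
  \<open>gval\<close> at \<open>Mu'\<close>.\<close>

lemma lev_cobar_Ha:
  fixes c :: "(config \<Rightarrow>\<^sub>0 'k::field) set \<Rightarrow> 'k"
  assumes c: "c \<in> carrier (component CS (ix 1 1 1))"
  shows "lev gval (cobar_gen CS (ix 1 1 1) c) = tdiff (evgen gval (ix 1 1 0) c)"
proof -
  let ?w = "decomp CS (ix 0 2 1) (Suc 0) (ix 1 0 0) (tree_dual (ix 1 1 1) (on_closed {0}) c)"
  have g: "gen Mu" "gen Mu'" "gen Eta" "gen Ha" by (simp_all add: gen_def)
  have p: "pt Ha \<in> SC_points (pidx (ix 1 1 1))" using pt_points[OF g(4)] by (simp add: gidx_def)
  have f: "tree_dual (ix 1 1 1) (on_closed {0}) c (ptcl (gidx Ha) (pt Ha)) = gval Ha c"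
    using act_CS_low(1)[OF c p] by (simp add: unshuffle_low invp_swap gval_def gidx_def)
  have "pair (\<lambda>(g, h). gval Mu g * gval Eta h) ?w = - gval Ha c" "pair (\<lambda>(g, h). gval Mu' g * gval Eta h) ?w = gval Ha c"
    using tree_gval[OF g(1,3,4), of "on_closed {0}" c] tree_gval[OF g(2,3,4), of "on_closed {0}" c] c f
    by (simp_all add: trees_Ha dsign_low)
  then have P: "pair (\<lambda>(g, h). gval Mu g * gval Eta h) ?w = - gval Ha c" "pair (\<lambda>(g, h). gval Mu' g * gval Eta h) ?w = gval Ha c" .
  have lev: "lev gval (cobar_gen CS (ix 1 1 1) c) b = - pair (\<lambda>(c', c''). tcomp (Suc 0) (evgen gval (ix 0 2 0) c') (evgen gval (ix 1 0 (- 1)) c'') b) ?w" for b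
    unfolding cobar_gen_CS trees_Ha using lev_tree_term[of gval "ix 1 1 1" c "on_closed {0}" "ix 0 2 1" "ix 1 0 0" b]
    by (simp add: unshuffle_low tact_id ksign_def)
  show ?thesis
    using P by (intro bas_fun_eqI) (simp_all add: lev evgen_def gen_def case_prod_unfold)
qed

text \<open>Relative to the second tree, the first involves the exchange of the closed inputs twice:
  it changes the sign of the functional and turns \<open>HE\<close> into \<open>HE'\<close>. The
  third tree gives \<open>EL\<close>.\<close>

lemma lev_cobar_Na:
  fixes c :: "(config \<Rightarrow>\<^sub>0 'k::field) set \<Rightarrow> 'k"
  assumes c: "c \<in> carrier (component CS (ix 2 0 1))"
  shows "lev gval (cobar_gen CS (ix 2 0 1) c) = tdiff (evgen gval (ix 2 0 0) c)"
proof -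
  let ?w = "\<lambda>k. decomp CS (ix 1 1 1) 0 (ix 1 0 0) (tree_dual (ix 2 0 1) (on_closed {k}) c)"
  let ?v = "decomp CS (ix 1 0 0) 0 (Idx (arr 2 0) Closed 1) (tree_dual (ix 2 0 1) (on_closed {0, 1}) c)"
  have g: "gen Ha" "gen Eta" "gen Na" "gen Lam" by (simp_all add: gen_def)
  have p: "pt Na \<in> SC_points (pidx (ix 2 0 1))" using pt_points[OF g(3)] by (simp add: gidx_def)
  have "SC_act cswap (pt Na) \<in> SC_points (gidx Na)" using p by (intro SC_act_points) (auto simp: gidx_def)
  then have sw: "c (ptcl (gidx Na) (SC_act cswap (pt Na))) = c (ptcl (gidx Na) (pt Na))"
    by (intro ptcl_low[OF g(3)]) auto
  have f: "tree_dual (ix 2 0 1) (on_closed {1}) c (ptcl (gidx Na) (pt Na)) = gval Na c"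
    "tree_dual (ix 2 0 1) (on_closed {0, 1}) c (ptcl (gidx Na) (pt Na)) = gval Na c"
    "tree_dual (ix 2 0 1) (on_closed {0}) c (ptcl (gidx Na) (pt Na)) = - gval Na c"
    using act_CS_low(1,2)[OF c p] sw by (simp_all add: unshuffle_low invp_swap gval_def gidx_def)
  have P: "pair (\<lambda>(g, h). gval Ha g * gval Eta h) (?w 1) = gval Na c" "pair (\<lambda>(g, h). gval Ha g * gval Eta h) (?w 0) = - gval Na c"
    "pair (\<lambda>(g, h). gval Eta g * gval Lam h) ?v = gval Na c"
    using tree_gval[OF g(1,2,3), of "on_closed {1}" c] tree_gval[OF g(1,2,3), of "on_closed {0}" c] tree_gval[OF g(2,4,3), of "on_closed {0, 1}" c]
      c f
    by (simp_all add: trees_Na shift_Idx dsign_low)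
  have lev: "lev gval (cobar_gen CS (ix 2 0 1) c) b =
      - pair (\<lambda>(c', c''). tact cswap (tcomp 0 (evgen gval (ix 1 1 0) c') (evgen gval (ix 1 0 (- 1)) c'')) b) (?w 0)
      + (- pair (\<lambda>(c', c''). tcomp 0 (evgen gval (ix 1 1 0) c') (evgen gval (ix 1 0 (- 1)) c'') b) (?w 1)
      + pair (\<lambda>(c', c''). tcomp 0 (evgen gval (ix 1 0 (- 1)) c') (evgen gval (Idx (arr 2 0) Closed 0) c'') b) ?v)" for b
  proof -
    have "lev gval (cobar_gen CS (ix 2 0 1) c) b = lev gval (tree_term (ix 2 0 1) c (on_closed {0}) (ix 1 1 1) (ix 1 0 0)) b
      + (lev gval (tree_term (ix 2 0 1) c (on_closed {1}) (ix 1 1 1) (ix 1 0 0)) b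
      + lev gval (tree_term (ix 2 0 1) c (on_closed {0, 1}) (ix 1 0 0) (Idx (arr 2 0) Closed 1)) b)"
      unfolding cobar_gen_CS trees_Na by (simp add: lev_simps)
    then show ?thesis unfolding lev_tree_term by (simp add: unshuffle_low tact_id ksign_def shift_Idx)
  qed
  show ?thesis
    using P by (intro bas_fun_eqI) (simp_all add: lev evgen_def gen_def case_prod_unfold ix_eq_Idx)
qed

lemma lev_cobar_gen:
  fixes c :: "(config \<Rightarrow>\<^sub>0 'k::field) set \<Rightarrow> 'k"
  assumes c: "c \<in> carrier (component ECS s)"
  shows "lev gval (cobar_gen CS (shift 1 s) c) = tdiff (evgen gval s c)"
proof -
  note c' = carrier_ECS[OF c]
  consider "s = bidx Ha" | "s = bidx Na" | "s \<noteq> bidx Ha" "s \<noteq> bidx Na" by blast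
  then show ?thesis
  proof cases
    case 1
    then show ?thesis using lev_cobar_Ha c' by simp
  next
    case 2
    then show ?thesis using lev_cobar_Na c' by simp
  next
    case 3
    have "lev gval (cobar_gen CS (shift 1 s) c) b = 0" for b
    proof (cases "trees TYPE('k) (shift 1 s) = {}")
      case True
      then show ?thesis by (simp add: cobar_gen_CS lev_simps)
    next
      case False
      then obtain S s' t where "(S, s', t) \<in> trees TYPE('k) (shift 1 s)" by auto
      then have deg: "deg s = int (tot s) - 2" using tree_shape(3) by (fastforce simp: total_def tot_def)
      \<comment> \<open>The degree of the differential is the number of inputs minus three. The
        basis trees of this kind share their index with the boundary of \<open>Ha\<close> or of
        \<open>Na\<close>, which are excluded here.\<close>
      have "bidx b \<noteq> shift (- 1) s"
      proof
        assume b: "bidx b = shift (- 1) s"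
        then have "deg (bidx b) = int (tot (bidx b)) - 3" using deg by (simp add: tot_def)
        then have "b \<in> {Aa, Ba, EL, HE, HE'}" by (cases b) (simp_all add: tot_def)
        moreover have "s = shift 1 (bidx b)" by (simp add: b)
        ultimately show False using 3 by auto
      qed
      then have "ev gval x b = 0" if "x \<in> Poly_Mapping.keys (cobar_gen CS (shift 1 s) c)" for x
        using supp_ev[of ECS x gval] subsetD[OF keys_cobar_gen[OF c] that] supp_zero[of "shift (- 1) s" "ev gval x" b] by (simp add: exprs_def)
      then have "pair (\<lambda>t. ev gval t b) (cobar_gen CS (shift 1 s) c) = pair (\<lambda>t. 0) (cobar_gen CS (shift 1 s) c)"
        by (rule pair_cong)
      then show ?thesis by (simp add: lev_def)
    qed
    moreover have "tdiff (evgen gval s c) = (\<lambda>b. 0)"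
      using 3 by (intro bas_fun_eqI) (auto simp: evgen_def gen_def)
    ultimately show ?thesis by auto
  qed
qed

lemma low_cobar_CS: "low_cobar (ECS :: ('k::field, (config \<Rightarrow>\<^sub>0 'k) set \<Rightarrow> 'k) collection_data) gval gvec CS"
  by (intro low_cobar.intro low_generators_ECS low_cobar_axioms.intro refl keys_cobar_gen lev_cobar_gen)

theorem proposition7p2p6:
  shows "\<not> formal_via TYPE('x)
    (OC_infinity ::
      ('k::field_char_0, (((config \<Rightarrow>\<^sub>0 'k) set \<Rightarrow> 'k) expr \<Rightarrow>\<^sub>0 'k) set) dg_operad_data)"
  unfolding OC_infinity_def by (rule low_cobar.not_formal[OF low_cobar_CS])
end
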